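(* Let $A$ be an associative unital algebra over a field $\mathbf{k}$, let $(P,\mu_P)$ be a projective bimodule resolution of $A$, let $\Delta_P:P\to P\otimes_AP$ be a diagonal $2$-approximation for $P$, let $\phi_P:P\otimes_AP\to P[1]$ be such that $\mathbf{d}\phi_P=\mu_P\otimes1_P-1_P\otimes\mu_P$, and let $\epsilon:P\to P[1]$ be such that $\mathbf{d}\epsilon=(\mu_P\otimes1_P-1_P\otimes\mu_P)\Delta_P$. Then the map $$Tr(\phi_P)\sigma_{P,P}Tr(\Delta_P)+Tr(\epsilon):Tr(P)\to Tr(P[1])$$ induces the Connes' differential on the Hochschild homology $\mathrm{HH}_*(A)$.
   Context: Complexes. $A^e=A\otimes_{\mathbf{k}}A^{op}$. An $A^e$-complex is a $\mathbb{Z}$-graded $A$-bimodule $P=\bigoplus_n P_n$ with a bimodule differential $d_P$ of degree $-1$. $P[t]$ is the complex with $P[t]_n=P_{t+n}$ and $d_{P[t]}=(-1)^td_P$. A map of complexes $f:P\to Q$ is a degree-preserving bimodule homomorphism (not necessarily commuting with differentials). Put $\mathbf{d}f=fd_P-d_Qf:P\to Q[-1]$ (so for $f:P\to Q[m]$, $\mathbf{d}f=fd_P-(-1)^md_Qf$); $f$ is a chain map if $\mathbf{d}f=0$. A bimodule is viewed as a complex concentrated in degree $0$. $P\otimes_AQ$ has differential $d(x\otimes y)=d_P(x)\otimes y+(-1)^ix\otimes d_Q(y)$ for $x\in P_i$. $P\otimes_AA$ and $A\otimes_AP$ are identified with $P$. A projective bimodule resolution $(P,\mu_P)$ of $A$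 is an $A^e$-complex $P$ of projective bimodules with $P_n=0$ for $n<0$, $H_n(P)=0$ for $n>0$, and a bimodule map $\mu_P:P_0\to A$ inducing $H_0(P)\cong A$ ($\mu_P$ is extended by zero to $P$). A diagonal $2$-approximation is a chain map $\Delta_P:P\to P\otimes_AP$ with $(\mu_P\otimes\mu_P)\Delta_P=\mu_P$. Trace. $Tr=A\otimes_{A^e}-$, a functor from $A^e$-complexes to $\mathbf{k}$-complexes. $\sigma_{P,Q}:Tr(P\otimes_AQ)\to Tr(Q\otimes_AP)$ is the isomorphism $\sigma_{P,Q}(1\otimes x\otimes y)=(-1)^{ij}\,1\otimes y\otimes x$ for $x\in P_i$, $y\in Q_j$. Hochschild homology. $\mathrm{HH}_*(A)$ is the homology of $Tr(\mathrm{Bar}(A))$, $\mathrm{Bar}(A)$ being the bar resolution ($\mathrm{Bar}_n(A)=A^{\otimes(n+2)}$, $d(a_0\otimes\cdots\otimes a_{n+1})=\sum_{i=0}^n(-1)^ia_0\otimes\cdots\otimes a_ia_{i+1}\otimes\cdots\otimes a_{n+1}$); for any projective bimodule resolution $P$ it is identified with $H_*(Tr(P))$ via the isomorphism induced by comparison chain maps over $A$. With $Tr(\mathrm{Bar}_n(A))\cong A^{\otimes(n+1)}$, the Connes' differential $\mathcal{B}:\mathrm{HH}_n(A)\to\mathrm{HH}_{n+1}(A)$ is induced by $$a_0\otimes\cdots\otimes a_n\mapsto\sum_{i=0}^n(-1)^{in}1\otimes a_i\otimes\cdots\otimes a_n\otimes a_0\otimes\cdots\otimes a_{i-1}+\sum_{i=0}^n(-1)^{in}a_i\otimes1\otimes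 a_{i+1}\otimes\cdots\otimes a_n\otimes a_0\otimes\cdots\otimes a_{i-1}.$$ *)

theory Defs
  imports "HOL-Algebra.Algebra"
begin

section \<open>Algebras and bimodules\<close>

text \<open>The library locale \<open>algebra\<close> is restricted to commutative algebras.\<close>

locale assoc_algebra = field K + module K A + A: ring A
  for K :: "'k ring" and A :: "('k, 'a) module" +
  assumes smult_mult_left:
    "\<lbrakk>c \<in> carrier K; a \<in> carrier A; b \<in> carrier A\<rbrakk>
      \<Longrightarrow> (c \<odot>\<^bsub>A\<^esub> a) \<otimes>\<^bsub>A\<^esub> b = c \<odot>\<^bsub>A\<^esub> (a \<otimes>\<^bsub>A\<^esub> b)"
    and smult_mult_right:
    "\<lbrakk>c \<in> carrier K; a \<in> carrier A; b \<in> carrier A\<rbrakk>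
      \<Longrightarrow> a \<otimes>\<^bsub>A\<^esub> (c \<odot>\<^bsub>A\<^esub> b) = c \<odot>\<^bsub>A\<^esub> (a \<otimes>\<^bsub>A\<^esub> b)"

text \<open>As for \<open>module\<close>, the multiplicative fields of the underlying \<open>ring\<close> record carry no
  information.\<close>

record ('a, 'm) bimodule = "'m ring" +
  lact :: "'a \<Rightarrow> 'm \<Rightarrow> 'm"
  ract :: "'m \<Rightarrow> 'a \<Rightarrow> 'm"

text \<open>The last assumption says that \<open>K\<close> acts centrally, so that bimodules in this sense are exactly
  the modules over \<open>A \<otimes>\<^sub>K A\<^sup>o\<^sup>p\<close>.\<close>

locale is_bimodule = assoc_algebra K A + B: abelian_group M
  for K :: "'k ring" and A :: "('k, 'a) module" and M :: "('a, 'm) bimodule" +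
  assumes lact_closed: "\<lbrakk>a \<in> carrier A; x \<in> carrier M\<rbrakk> \<Longrightarrow> lact M a x \<in> carrier M"
    and ract_closed: "\<lbrakk>x \<in> carrier M; a \<in> carrier A\<rbrakk> \<Longrightarrow> ract M x a \<in> carrier M"
    and lact_add_left: "\<lbrakk>a \<in> carrier A; b \<in> carrier A; x \<in> carrier M\<rbrakk>
      \<Longrightarrow> lact M (a \<oplus>\<^bsub>A\<^esub> b) x = lact M a x \<oplus>\<^bsub>M\<^esub> lact M b x"
    and lact_add_right: "\<lbrakk>a \<in> carrier A; x \<in> carrier M; y \<in> carrier M\<rbrakk>
      \<Longrightarrow> lact M a (x \<oplus>\<^bsub>M\<^esub> y) = lact M a x \<oplus>\<^bsub>M\<^esub> lact M a y"
    and ract_add_left: "\<lbrakk>x \<in> carrier M; y \<in> carrier M; a \<in> carrier A\<rbrakk>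
      \<Longrightarrow> ract M (x \<oplus>\<^bsub>M\<^esub> y) a = ract M x a \<oplus>\<^bsub>M\<^esub> ract M y a"
    and ract_add_right: "\<lbrakk>x \<in> carrier M; a \<in> carrier A; b \<in> carrier A\<rbrakk>
      \<Longrightarrow> ract M x (a \<oplus>\<^bsub>A\<^esub> b) = ract M x a \<oplus>\<^bsub>M\<^esub> ract M x b"
    and lact_mult: "\<lbrakk>a \<in> carrier A; b \<in> carrier A; x \<in> carrier M\<rbrakk>
      \<Longrightarrow> lact M (a \<otimes>\<^bsub>A\<^esub> b) x = lact M a (lact M b x)"
    and ract_mult: "\<lbrakk>x \<in> carrier M; a \<in> carrier A; b \<in> carrier A\<rbrakk>
      \<Longrightarrow> ract M x (a \<otimes>\<^bsub>A\<^esub> b) = ract M (ract M x a) b"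
    and lact_one: "x \<in> carrier M \<Longrightarrow> lact M \<one>\<^bsub>A\<^esub> x = x"
    and ract_one: "x \<in> carrier M \<Longrightarrow> ract M x \<one>\<^bsub>A\<^esub> = x"
    and lact_ract: "\<lbrakk>a \<in> carrier A; x \<in> carrier M; b \<in> carrier A\<rbrakk>
      \<Longrightarrow> ract M (lact M a x) b = lact M a (ract M x b)"
    and central: "\<lbrakk>c \<in> carrier K; x \<in> carrier M\<rbrakk>
      \<Longrightarrow> lact M (c \<odot>\<^bsub>A\<^esub> \<one>\<^bsub>A\<^esub>) x = ract M x (c \<odot>\<^bsub>A\<^esub> \<one>\<^bsub>A\<^esub>)"

definition bimodule_hom ::
  "('k, 'a) module \<Rightarrow> ('a, 'm) bimodule \<Rightarrow> ('a, 'n) bimodule \<Rightarrow> ('m \<Rightarrow> 'n) set" where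
  "bimodule_hom A M N = {f \<in> hom (add_monoid M) (add_monoid N).
     \<forall>a \<in> carrier A. \<forall>x \<in> carrier M.
       f (lact M a x) = lact N a (f x) \<and> f (ract M x a) = ract N (f x) a}"

definition module_hom ::
  "'k ring \<Rightarrow> ('k, 'm) module \<Rightarrow> ('k, 'n) module \<Rightarrow> ('m \<Rightarrow> 'n) set" where
  "module_hom K M N = {f \<in> hom (add_monoid M) (add_monoid N).
     \<forall>c \<in> carrier K. \<forall>x \<in> carrier M. f (c \<odot>\<^bsub>M\<^esub> x) = c \<odot>\<^bsub>N\<^esub> f x}"

definition regular_bimodule :: "('k, 'a) module \<Rightarrow> ('a, 'a) bimodule" where
  "regular_bimodule A = \<lparr>carrier = carrier A, monoid.mult = monoid.mult A, monoid.one = \<one>\<^bsub>A\<^esub>,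
     ring.zero = ring.zero A, ring.add = ring.add A, lact = monoid.mult A, ract = monoid.mult A\<rparr>"

text \<open>\<open>signed M n x\<close> is \<open>(-1)\<^sup>n x\<close>, and \<open>bd P Q f\<close> below is \<open>f d\<^sub>P - d\<^sub>Q f\<close>.\<close>

definition signed :: "('m, 'z) ring_scheme \<Rightarrow> int \<Rightarrow> 'm \<Rightarrow> 'm" where
  "signed M n x = (if even n then x else \<ominus>\<^bsub>M\<^esub> x)"


section \<open>Abelian groups given by generators and relations\<close>

text \<open>All tensor products below are quotients of free abelian groups. The element represented by a
  generator \<open>x\<close> is \<open>gen_class S R x\<close>, and \<open>presented_lift T f\<close> is the homomorphism to \<open>T\<close> that
  sends the class of each generator \<open>x\<close> to \<open>f x\<close>; it is meaningful only if \<open>f\<close> takes values in \<open>T\<close>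
  and respects the relations.\<close>

definition presented :: "'x set \<Rightarrow> ('x \<Rightarrow>\<^sub>0 int) set \<Rightarrow> ('x \<Rightarrow>\<^sub>0 int) set ring" where
  "presented S R =
     (let Q = free_Abelian_group S Mod generate (free_Abelian_group S) R
      in \<lparr>carrier = carrier Q, monoid.mult = undefined, monoid.one = undefined,
          ring.zero = \<one>\<^bsub>Q\<^esub>, ring.add = monoid.mult Q\<rparr>)"

definition gen_class :: "'x set \<Rightarrow> ('x \<Rightarrow>\<^sub>0 int) set \<Rightarrow> 'x \<Rightarrow> ('x \<Rightarrow>\<^sub>0 int) set" where
  "gen_class S R x =
     generate (free_Abelian_group S) R #>\<^bsub>free_Abelian_group S\<^esub> frag_of x"

definition presented_lift ::
  "('t, 'z) ring_scheme \<Rightarrow> ('x \<Rightarrow> 't) \<Rightarrow> ('x \<Rightarrow>\<^sub>0 int) set \<Rightarrow> 't" where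
  "presented_lift T f C = the_elem
     ((\<lambda>c. \<Oplus>\<^bsub>T\<^esub>x \<in> Poly_Mapping.keys c. [Poly_Mapping.lookup c x] \<cdot>\<^bsub>T\<^esub> f x) ` C)"

definition presented_bimodule ::
  "'x set \<Rightarrow> ('x \<Rightarrow>\<^sub>0 int) set \<Rightarrow> ('a \<Rightarrow> 'x \<Rightarrow> 'x) \<Rightarrow> ('x \<Rightarrow> 'a \<Rightarrow> 'x)
    \<Rightarrow> ('a, ('x \<Rightarrow>\<^sub>0 int) set) bimodule" where
  "presented_bimodule S R l r = (let Q = presented S R in
     \<lparr>carrier = carrier Q, monoid.mult = undefined, monoid.one = undefined,
      ring.zero = ring.zero Q, ring.add = ring.add Q,
      lact = (\<lambda>a. presented_lift Q (\<lambda>x. gen_class S R (l a x))),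
      ract = (\<lambda>C a. presented_lift Q (\<lambda>x. gen_class S R (r x a)) C)\<rparr>)"


section \<open>Projective bimodules\<close>

text \<open>The free bimodule on \<open>S\<close> is the direct sum of copies of \<open>A \<otimes>\<^sub>K A\<close> indexed by \<open>S\<close>; the
  generator \<open>(a, s, b)\<close> stands for \<open>a \<otimes> b\<close> in the summand of index \<open>s\<close>.\<close>

definition free_bimodule_gens :: "('k, 'a) module \<Rightarrow> 's set \<Rightarrow> ('a \<times> 's \<times> 'a) set" where
  "free_bimodule_gens A S = carrier A \<times> S \<times> carrier A"

definition free_bimodule_rels ::
  "'k ring \<Rightarrow> ('k, 'a) module \<Rightarrow> 's set \<Rightarrow> ('a \<times> 's \<times> 'a \<Rightarrow>\<^sub>0 int) set" where
  "free_bimodule_rels K A S =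
     {frag_of (a \<oplus>\<^bsub>A\<^esub> a', s, b) - frag_of (a, s, b) - frag_of (a', s, b) | a a' s b.
        a \<in> carrier A \<and> a' \<in> carrier A \<and> s \<in> S \<and> b \<in> carrier A} \<union>
     {frag_of (a, s, b \<oplus>\<^bsub>A\<^esub> b') - frag_of (a, s, b) - frag_of (a, s, b') | a s b b'.
        a \<in> carrier A \<and> s \<in> S \<and> b \<in> carrier A \<and> b' \<in> carrier A} \<union>
     {frag_of (c \<odot>\<^bsub>A\<^esub> a, s, b) - frag_of (a, s, c \<odot>\<^bsub>A\<^esub> b) | c a s b.
        c \<in> carrier K \<and> a \<in> carrier A \<and> s \<in> S \<and> b \<in> carrier A}"

definition free_bimodule ::
  "'k ring \<Rightarrow> ('k, 'a) module \<Rightarrow> 's set \<Rightarrow> ('a, ('a \<times> 's \<times> 'a \<Rightarrow>\<^sub>0 int) set) bimodule" where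
  "free_bimodule K A S =
     presented_bimodule (free_bimodule_gens A S) (free_bimodule_rels K A S)
       (\<lambda>e (a, s, b). (e \<otimes>\<^bsub>A\<^esub> a, s, b)) (\<lambda>(a, s, b) e. (a, s, b \<otimes>\<^bsub>A\<^esub> e))"

text \<open>Projective means: direct summand of a free bimodule. Taking the index set of the free bimodule
  in the element type of \<open>M\<close> is no restriction, since \<open>M\<close> is a quotient of the free bimodule on its
  own carrier.\<close>

definition projective_bimodule :: "'k ring \<Rightarrow> ('k, 'a) module \<Rightarrow> ('a, 'm) bimodule \<Rightarrow> bool" where
  "projective_bimodule K A M \<longleftrightarrow> is_bimodule K A M \<and>
     (\<exists>S :: 'm set. \<exists>i \<in> bimodule_hom A M (free_bimodule K A S).
        \<exists>p \<in> bimodule_hom A (free_bimodule K A S) M. \<forall>x \<in> carrier M. p (i x) = x)"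


section \<open>Complexes\<close>

text \<open>\<open>diff C n\<close> is the differential from degree \<open>n\<close> to degree \<open>n - 1\<close>. Throughout, graded objects
  and maps are families indexed by the degree, and only values on the carriers matter.\<close>

record ('o, 'm) cpx =
  obj :: "int \<Rightarrow> 'o"
  diff :: "int \<Rightarrow> 'm \<Rightarrow> 'm"

type_synonym ('a, 'm) bimodule_cpx = "(('a, 'm) bimodule, 'm) cpx"
type_synonym ('k, 'm) module_cpx = "(('k, 'm) module, 'm) cpx"

definition is_bimodule_cpx :: "'k ring \<Rightarrow> ('k, 'a) module \<Rightarrow> ('a, 'm) bimodule_cpx \<Rightarrow> bool" where
  "is_bimodule_cpx K A P \<longleftrightarrow>
     (\<forall>n. is_bimodule K A (obj P n)) \<and>
     (\<forall>n. diff P n \<in> bimodule_hom A (obj P n) (obj P (n - 1))) \<and>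
     (\<forall>n. \<forall>x \<in> carrier (obj P n). diff P (n - 1) (diff P n x) = \<zero>\<^bsub>obj P (n - 2)\<^esub>)"

definition bimodule_cpx_maps ::
  "('k, 'a) module \<Rightarrow> ('a, 'm) bimodule_cpx \<Rightarrow> ('a, 'n) bimodule_cpx \<Rightarrow> (int \<Rightarrow> 'm \<Rightarrow> 'n) set" where
  "bimodule_cpx_maps A P Q = {f. \<forall>n. f n \<in> bimodule_hom A (obj P n) (obj Q n)}"

definition module_cpx_maps ::
  "'k ring \<Rightarrow> ('k, 'm) module_cpx \<Rightarrow> ('k, 'n) module_cpx \<Rightarrow> (int \<Rightarrow> 'm \<Rightarrow> 'n) set" where
  "module_cpx_maps K C D = {f. \<forall>n. f n \<in> module_hom K (obj C n) (obj D n)}"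

definition shift :: "(('m, 'z) ring_scheme, 'm) cpx \<Rightarrow> int \<Rightarrow> (('m, 'z) ring_scheme, 'm) cpx" where
  "shift P t = \<lparr>obj = (\<lambda>n. obj P (t + n)),
     diff = (\<lambda>n x. signed (obj P (t + n - 1)) t (diff P (t + n) x))\<rparr>"

definition bd :: "(('m, 'y) ring_scheme, 'm) cpx \<Rightarrow> (('n, 'z) ring_scheme, 'n) cpx
    \<Rightarrow> (int \<Rightarrow> 'm \<Rightarrow> 'n) \<Rightarrow> int \<Rightarrow> 'm \<Rightarrow> 'n" where
  "bd P Q f n x = f (n - 1) (diff P n x) \<ominus>\<^bsub>obj Q (n - 1)\<^esub> diff Q n (f n x)"

definition commutes_with_diff :: "(('m, 'y) ring_scheme, 'm) cpx \<Rightarrow> (('n, 'z) ring_scheme, 'n) cpx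
    \<Rightarrow> (int \<Rightarrow> 'm \<Rightarrow> 'n) \<Rightarrow> bool" where
  "commutes_with_diff P Q f \<longleftrightarrow>
     (\<forall>n. \<forall>x \<in> carrier (obj P n). bd P Q f n x = \<zero>\<^bsub>obj Q (n - 1)\<^esub>)"

definition cycles :: "(('m, 'z) ring_scheme, 'm) cpx \<Rightarrow> int \<Rightarrow> 'm set" where
  "cycles C n = {x \<in> carrier (obj C n). diff C n x = \<zero>\<^bsub>obj C (n - 1)\<^esub>}"

definition boundaries :: "(('m, 'z) ring_scheme, 'm) cpx \<Rightarrow> int \<Rightarrow> 'm set" where
  "boundaries C n = diff C (n + 1) ` carrier (obj C (n + 1))"

definition homology :: "(('m, 'z) ring_scheme, 'm) cpx \<Rightarrow> int \<Rightarrow> 'm set monoid" where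
  "homology C n = (obj C n)\<lparr>carrier := cycles C n\<rparr> A_Mod boundaries C n"

text \<open>The map to \<open>homology D n\<close> induced by a map \<open>g\<close> into the degree \<open>n\<close> part of \<open>D\<close> that sends
  cycles to cycles and boundaries to boundaries.\<close>

definition homology_map ::
  "(('n, 'z) ring_scheme, 'n) cpx \<Rightarrow> int \<Rightarrow> ('m \<Rightarrow> 'n) \<Rightarrow> 'm set \<Rightarrow> 'n set" where
  "homology_map D n g C = the_elem ((\<lambda>z. boundaries D n +>\<^bsub>obj D n\<^esub> g z) ` C)"

definition stalk :: "('k, 'a) module \<Rightarrow> ('a, 'a) bimodule_cpx" where
  "stalk A = \<lparr>obj = (\<lambda>n. if n = 0 then regular_bimodule A
                        else (regular_bimodule A)\<lparr>carrier := {\<zero>\<^bsub>A\<^esub>}\<rparr>),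
     diff = (\<lambda>n x. \<zero>\<^bsub>A\<^esub>)\<rparr>"

definition extend_by_zero :: "('k, 'a) module \<Rightarrow> ('p \<Rightarrow> 'a) \<Rightarrow> int \<Rightarrow> 'p \<Rightarrow> 'a" where
  "extend_by_zero A \<mu> n x = (if n = 0 then \<mu> x else \<zero>\<^bsub>A\<^esub>)"

definition projective_resolution ::
  "'k ring \<Rightarrow> ('k, 'a) module \<Rightarrow> ('a, 'p) bimodule_cpx \<Rightarrow> ('p \<Rightarrow> 'a) \<Rightarrow> bool" where
  "projective_resolution K A P \<mu> \<longleftrightarrow>
     is_bimodule_cpx K A P \<and>
     (\<forall>n. projective_bimodule K A (obj P n)) \<and>
     (\<forall>n < 0. carrier (obj P n) = {\<zero>\<^bsub>obj P n\<^esub>}) \<and>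
     (\<forall>n > 0. carrier (homology P n) = {\<one>\<^bsub>homology P n\<^esub>}) \<and>
     \<mu> \<in> bimodule_hom A (obj P 0) (regular_bimodule A) \<and>
     (\<forall>x \<in> carrier (obj P 1). \<mu> (diff P 1 x) = \<zero>\<^bsub>A\<^esub>) \<and>
     bij_betw (\<lambda>C. the_elem (\<mu> ` C)) (carrier (homology P 0)) (carrier A)"


section \<open>Tensor products of complexes over the algebra\<close>

text \<open>The degree \<open>n\<close> part of \<open>P \<otimes>\<^sub>A Q\<close> is the direct sum of the \<open>P\<^sub>i \<otimes>\<^sub>A Q\<^sub>j\<close> with
  \<open>i + j = n\<close>; the generator \<open>((i, x), (j, y))\<close> stands for \<open>x \<otimes> y\<close> in the \<open>(i, j)\<close> summand.\<close>

type_synonym ('p, 'q) tensor_gen = "(int \<times> 'p) \<times> (int \<times> 'q)"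

definition tensor_gens ::
  "('a, 'p) bimodule_cpx \<Rightarrow> ('a, 'q) bimodule_cpx \<Rightarrow> int \<Rightarrow> ('p, 'q) tensor_gen set" where
  "tensor_gens P Q n = {((i, x), (j, y)) | i x j y.
     i + j = n \<and> x \<in> carrier (obj P i) \<and> y \<in> carrier (obj Q j)}"

definition tensor_rels :: "('k, 'a) module \<Rightarrow> ('a, 'p) bimodule_cpx \<Rightarrow> ('a, 'q) bimodule_cpx
    \<Rightarrow> int \<Rightarrow> (('p, 'q) tensor_gen \<Rightarrow>\<^sub>0 int) set" where
  "tensor_rels A P Q n =
     {frag_of ((i, x \<oplus>\<^bsub>obj P i\<^esub> x'), (j, y)) - frag_of ((i, x), (j, y)) - frag_of ((i, x'), (j, y))
        | i x x' j y. i + j = n \<and> x \<in> carrier (obj P i) \<and> x' \<in> carrier (obj P i)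
                      \<and> y \<in> carrier (obj Q j)} \<union>
     {frag_of ((i, x), (j, y \<oplus>\<^bsub>obj Q j\<^esub> y')) - frag_of ((i, x), (j, y)) - frag_of ((i, x), (j, y'))
        | i x j y y'. i + j = n \<and> x \<in> carrier (obj P i) \<and> y \<in> carrier (obj Q j)
                      \<and> y' \<in> carrier (obj Q j)} \<union>
     {frag_of ((i, ract (obj P i) x a), (j, y)) - frag_of ((i, x), (j, lact (obj Q j) a y))
        | i x a j y. i + j = n \<and> x \<in> carrier (obj P i) \<and> a \<in> carrier A \<and> y \<in> carrier (obj Q j)}"

definition tensor_class :: "('k, 'a) module \<Rightarrow> ('a, 'p) bimodule_cpx \<Rightarrow> ('a, 'q) bimodule_cpx
    \<Rightarrow> int \<Rightarrow> ('p, 'q) tensor_gen \<Rightarrow> (('p, 'q) tensor_gen \<Rightarrow>\<^sub>0 int) set" where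
  "tensor_class A P Q n = gen_class (tensor_gens P Q n) (tensor_rels A P Q n)"

definition tensor_obj :: "('k, 'a) module \<Rightarrow> ('a, 'p) bimodule_cpx \<Rightarrow> ('a, 'q) bimodule_cpx
    \<Rightarrow> int \<Rightarrow> ('a, (('p, 'q) tensor_gen \<Rightarrow>\<^sub>0 int) set) bimodule" where
  "tensor_obj A P Q n = presented_bimodule (tensor_gens P Q n) (tensor_rels A P Q n)
     (\<lambda>a ((i, x), (j, y)). ((i, lact (obj P i) a x), (j, y)))
     (\<lambda>((i, x), (j, y)) a. ((i, x), (j, ract (obj Q j) y a)))"

definition tensor :: "('k, 'a) module \<Rightarrow> ('a, 'p) bimodule_cpx \<Rightarrow> ('a, 'q) bimodule_cpx
    \<Rightarrow> ('a, (('p, 'q) tensor_gen \<Rightarrow>\<^sub>0 int) set) bimodule_cpx" where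
  "tensor A P Q = \<lparr>obj = tensor_obj A P Q,
     diff = (\<lambda>n. presented_lift (tensor_obj A P Q (n - 1)) (\<lambda>((i, x), (j, y)).
       tensor_class A P Q (n - 1) ((i - 1, diff P i x), (j, y))
       \<oplus>\<^bsub>tensor_obj A P Q (n - 1)\<^esub>
       signed (tensor_obj A P Q (n - 1)) i
         (tensor_class A P Q (n - 1) ((i, x), (j - 1, diff Q j y)))))\<rparr>"

definition tensor_map :: "('k, 'a) module \<Rightarrow> ('a, 'p) bimodule_cpx \<Rightarrow> ('a, 'q) bimodule_cpx
    \<Rightarrow> (int \<Rightarrow> 'r \<Rightarrow> 'p) \<Rightarrow> (int \<Rightarrow> 's \<Rightarrow> 'q)
    \<Rightarrow> int \<Rightarrow> (('r, 's) tensor_gen \<Rightarrow>\<^sub>0 int) set \<Rightarrow> (('p, 'q) tensor_gen \<Rightarrow>\<^sub>0 int) set" where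
  "tensor_map A P Q f g n = presented_lift (tensor_obj A P Q n)
     (\<lambda>((i, x), (j, y)). tensor_class A P Q n ((i, f i x), (j, g j y)))"

text \<open>The identifications \<open>A \<otimes>\<^sub>A P = P\<close> and \<open>P \<otimes>\<^sub>A A = P\<close>.\<close>

definition left_unit :: "('k, 'a) module \<Rightarrow> ('a, 'p) bimodule_cpx
    \<Rightarrow> int \<Rightarrow> (('a, 'p) tensor_gen \<Rightarrow>\<^sub>0 int) set \<Rightarrow> 'p" where
  "left_unit A P n = presented_lift (obj P n)
     (\<lambda>((i, a), (j, y)). if i = 0 then lact (obj P j) a y else \<zero>\<^bsub>obj P n\<^esub>)"

definition right_unit :: "('k, 'a) module \<Rightarrow> ('a, 'p) bimodule_cpx
    \<Rightarrow> int \<Rightarrow> (('p, 'a) tensor_gen \<Rightarrow>\<^sub>0 int) set \<Rightarrow> 'p" where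
  "right_unit A P n = presented_lift (obj P n)
     (\<lambda>((i, x), (j, a)). if j = 0 then ract (obj P i) x a else \<zero>\<^bsub>obj P n\<^esub>)"

text \<open>The map \<open>\<mu> \<otimes> 1 - 1 \<otimes> \<mu>\<close> from \<open>P \<otimes>\<^sub>A P\<close> to \<open>P\<close>.\<close>

definition counit_difference :: "('k, 'a) module \<Rightarrow> ('a, 'p) bimodule_cpx \<Rightarrow> ('p \<Rightarrow> 'a)
    \<Rightarrow> int \<Rightarrow> (('p, 'p) tensor_gen \<Rightarrow>\<^sub>0 int) set \<Rightarrow> 'p" where
  "counit_difference A P \<mu> n t =
     left_unit A P n (tensor_map A (stalk A) P (extend_by_zero A \<mu>) (\<lambda>i x. x) n t)
     \<ominus>\<^bsub>obj P n\<^esub>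
     right_unit A P n (tensor_map A P (stalk A) (\<lambda>i x. x) (extend_by_zero A \<mu>) n t)"

definition diagonal_2_approximation :: "('k, 'a) module \<Rightarrow> ('a, 'p) bimodule_cpx \<Rightarrow> ('p \<Rightarrow> 'a)
    \<Rightarrow> (int \<Rightarrow> 'p \<Rightarrow> (('p, 'p) tensor_gen \<Rightarrow>\<^sub>0 int) set) \<Rightarrow> bool" where
  "diagonal_2_approximation A P \<mu> \<Delta> \<longleftrightarrow>
     \<Delta> \<in> bimodule_cpx_maps A P (tensor A P P) \<and>
     commutes_with_diff P (tensor A P P) \<Delta> \<and>
     (\<forall>n. \<forall>x \<in> carrier (obj P n).
        left_unit A (stalk A) n (tensor_map A (stalk A) (stalk A)
          (extend_by_zero A \<mu>) (extend_by_zero A \<mu>) n (\<Delta> n x)) = extend_by_zero A \<mu> n x)"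


section \<open>The trace functor\<close>

text \<open>\<open>A \<otimes> M\<close> over \<open>A\<^sup>e = A \<otimes>\<^sub>K A\<^sup>o\<^sup>p\<close>: the element \<open>b \<otimes> c\<close> of \<open>A\<^sup>e\<close> acts from the right on \<open>A\<close>
  by \<open>a \<mapsto> c a b\<close> and from the left on \<open>M\<close> by \<open>x \<mapsto> b x c\<close>.\<close>

definition trace_gens :: "('k, 'a) module \<Rightarrow> ('a, 'm) bimodule \<Rightarrow> ('a \<times> 'm) set" where
  "trace_gens A M = carrier A \<times> carrier M"

definition trace_rels :: "('k, 'a) module \<Rightarrow> ('a, 'm) bimodule \<Rightarrow> ('a \<times> 'm \<Rightarrow>\<^sub>0 int) set" where
  "trace_rels A M =
     {frag_of (a \<oplus>\<^bsub>A\<^esub> a', x) - frag_of (a, x) - frag_of (a', x) | a a' x.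
        a \<in> carrier A \<and> a' \<in> carrier A \<and> x \<in> carrier M} \<union>
     {frag_of (a, x \<oplus>\<^bsub>M\<^esub> x') - frag_of (a, x) - frag_of (a, x') | a x x'.
        a \<in> carrier A \<and> x \<in> carrier M \<and> x' \<in> carrier M} \<union>
     {frag_of (c \<otimes>\<^bsub>A\<^esub> a \<otimes>\<^bsub>A\<^esub> b, x) - frag_of (a, ract M (lact M b x) c) | a b c x.
        a \<in> carrier A \<and> b \<in> carrier A \<and> c \<in> carrier A \<and> x \<in> carrier M}"

definition trace_class ::
  "('k, 'a) module \<Rightarrow> ('a, 'm) bimodule \<Rightarrow> 'a \<times> 'm \<Rightarrow> ('a \<times> 'm \<Rightarrow>\<^sub>0 int) set" where
  "trace_class A M = gen_class (trace_gens A M) (trace_rels A M)"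

definition trace_obj ::
  "('k, 'a) module \<Rightarrow> ('a, 'm) bimodule \<Rightarrow> ('k, ('a \<times> 'm \<Rightarrow>\<^sub>0 int) set) module" where
  "trace_obj A M = (let Q = presented (trace_gens A M) (trace_rels A M) in
     \<lparr>carrier = carrier Q, monoid.mult = undefined, monoid.one = undefined,
      ring.zero = ring.zero Q, ring.add = ring.add Q,
      smult = (\<lambda>c. presented_lift Q (\<lambda>(a, x). trace_class A M (c \<odot>\<^bsub>A\<^esub> a, x)))\<rparr>)"

definition trace_hom :: "('k, 'a) module \<Rightarrow> ('a, 'n) bimodule \<Rightarrow> ('m \<Rightarrow> 'n)
    \<Rightarrow> ('a \<times> 'm \<Rightarrow>\<^sub>0 int) set \<Rightarrow> ('a \<times> 'n \<Rightarrow>\<^sub>0 int) set" where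
  "trace_hom A N f = presented_lift (trace_obj A N) (\<lambda>(a, x). trace_class A N (a, f x))"

definition Tr :: "('k, 'a) module \<Rightarrow> ('a, 'm) bimodule_cpx
    \<Rightarrow> ('k, ('a \<times> 'm \<Rightarrow>\<^sub>0 int) set) module_cpx" where
  "Tr A P = \<lparr>obj = (\<lambda>n. trace_obj A (obj P n)),
     diff = (\<lambda>n. trace_hom A (obj P (n - 1)) (diff P n))\<rparr>"

definition Tr_map :: "('k, 'a) module \<Rightarrow> ('a, 'n) bimodule_cpx \<Rightarrow> (int \<Rightarrow> 'm \<Rightarrow> 'n)
    \<Rightarrow> int \<Rightarrow> ('a \<times> 'm \<Rightarrow>\<^sub>0 int) set \<Rightarrow> ('a \<times> 'n \<Rightarrow>\<^sub>0 int) set" where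
  "Tr_map A Q f n = trace_hom A (obj Q n) (f n)"

text \<open>A general element \<open>a \<otimes> (x \<otimes> y)\<close> of the trace equals \<open>1 \<otimes> (a x \<otimes> y)\<close>, hence the \<open>a x\<close>.\<close>

definition trace_swap :: "('k, 'a) module \<Rightarrow> ('a, 'p) bimodule_cpx \<Rightarrow> ('a, 'q) bimodule_cpx
    \<Rightarrow> int \<Rightarrow> ('a \<times> (('p, 'q) tensor_gen \<Rightarrow>\<^sub>0 int) set \<Rightarrow>\<^sub>0 int) set
    \<Rightarrow> ('a \<times> (('q, 'p) tensor_gen \<Rightarrow>\<^sub>0 int) set \<Rightarrow>\<^sub>0 int) set" where
  "trace_swap A P Q n = (let T = trace_obj A (tensor_obj A Q P n) in
     presented_lift T (\<lambda>(a, t). presented_lift T (\<lambda>((i, x), (j, y)).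
       signed T (i * j) (trace_class A (tensor_obj A Q P n)
         (\<one>\<^bsub>A\<^esub>, tensor_class A Q P n ((j, y), (i, lact (obj P i) a x))))) t))"


section \<open>Bar resolution and Hochschild homology\<close>

text \<open>The tensor power of \<open>m \<ge> 1\<close> copies of \<open>A\<close> over \<open>K\<close>; a list stands for a pure tensor. (For
  \<open>m = 0\<close> these generators and relations would not give \<open>K\<close>.)\<close>

definition tpow_gens :: "('k, 'a) module \<Rightarrow> nat \<Rightarrow> 'a list set" where
  "tpow_gens A m = {as. length as = m \<and> set as \<subseteq> carrier A}"

definition tpow_rels :: "'k ring \<Rightarrow> ('k, 'a) module \<Rightarrow> nat \<Rightarrow> ('a list \<Rightarrow>\<^sub>0 int) set" where
  "tpow_rels K A m =
     {frag_of (as @ (a \<oplus>\<^bsub>A\<^esub> b) # bs) - frag_of (as @ a # bs) - frag_of (as @ b # bs) | as a b bs.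
        length as + length bs + 1 = m \<and> set as \<subseteq> carrier A \<and> set bs \<subseteq> carrier A
        \<and> a \<in> carrier A \<and> b \<in> carrier A} \<union>
     {frag_of (as @ (c \<odot>\<^bsub>A\<^esub> a) # b # bs) - frag_of (as @ a # (c \<odot>\<^bsub>A\<^esub> b) # bs) | as c a b bs.
        length as + length bs + 2 = m \<and> set as \<subseteq> carrier A \<and> set bs \<subseteq> carrier A
        \<and> c \<in> carrier K \<and> a \<in> carrier A \<and> b \<in> carrier A}"

definition tpow :: "'k ring \<Rightarrow> ('k, 'a) module \<Rightarrow> nat \<Rightarrow> ('a list \<Rightarrow>\<^sub>0 int) set ring" where
  "tpow K A m = presented (tpow_gens A m) (tpow_rels K A m)"

definition pure_tensor :: "'k ring \<Rightarrow> ('k, 'a) module \<Rightarrow> 'a list \<Rightarrow> ('a list \<Rightarrow>\<^sub>0 int) set" where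
  "pure_tensor K A as = gen_class (tpow_gens A (length as)) (tpow_rels K A (length as)) as"

text \<open>In negative degrees there are no generators, so the bimodule is zero.\<close>

definition bar_obj :: "'k ring \<Rightarrow> ('k, 'a) module \<Rightarrow> int \<Rightarrow> ('a, ('a list \<Rightarrow>\<^sub>0 int) set) bimodule" where
  "bar_obj K A n = presented_bimodule
     (if n < 0 then {} else tpow_gens A (nat n + 2))
     (if n < 0 then {} else tpow_rels K A (nat n + 2))
     (\<lambda>a as. (a \<otimes>\<^bsub>A\<^esub> hd as) # tl as) (\<lambda>as a. butlast as @ [last as \<otimes>\<^bsub>A\<^esub> a])"

definition bar :: "'k ring \<Rightarrow> ('k, 'a) module \<Rightarrow> ('a, ('a list \<Rightarrow>\<^sub>0 int) set) bimodule_cpx" where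
  "bar K A = \<lparr>obj = bar_obj K A,
     diff = (\<lambda>n. if n \<le> 0 then (\<lambda>_. \<zero>\<^bsub>bar_obj K A (n - 1)\<^esub>)
       else presented_lift (bar_obj K A (n - 1)) (\<lambda>as.
         \<Oplus>\<^bsub>bar_obj K A (n - 1)\<^esub>i \<in> {0..nat n}. signed (bar_obj K A (n - 1)) (int i)
           (pure_tensor K A (take i as @ (as ! i \<otimes>\<^bsub>A\<^esub> as ! (i + 1)) # drop (i + 2) as))))\<rparr>"

definition bar_augmentation :: "('k, 'a) module \<Rightarrow> ('a list \<Rightarrow>\<^sub>0 int) set \<Rightarrow> 'a" where
  "bar_augmentation A = presented_lift (regular_bimodule A) (\<lambda>as. hd as \<otimes>\<^bsub>A\<^esub> last as)"

definition comparison_maps :: "'k ring \<Rightarrow> ('k, 'a) module \<Rightarrow> ('a, 'p) bimodule_cpx \<Rightarrow> ('p \<Rightarrow> 'a)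
    \<Rightarrow> (int \<Rightarrow> ('a list \<Rightarrow>\<^sub>0 int) set \<Rightarrow> 'p) set" where
  "comparison_maps K A P \<mu> = {\<theta> \<in> bimodule_cpx_maps A (bar K A) P.
     commutes_with_diff (bar K A) P \<theta> \<and>
     (\<forall>x \<in> carrier (obj (bar K A) 0). \<mu> (\<theta> 0 x) = bar_augmentation A x)}"

definition HH :: "'k ring \<Rightarrow> ('k, 'a) module \<Rightarrow> int
    \<Rightarrow> ('a \<times> ('a list \<Rightarrow>\<^sub>0 int) set \<Rightarrow>\<^sub>0 int) set set monoid" where
  "HH K A n = homology (Tr A (bar K A)) n"

text \<open>The mutually inverse isomorphisms between the trace of the bar resolution in degree \<open>n\<close> and the
  tensor power of \<open>n + 1\<close> copies of \<open>A\<close>: \<open>a \<otimes> (a\<^sub>0 \<otimes> \<dots> \<otimes> a\<^sub>n\<^sub>+\<^sub>1)\<close> corresponds to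
  \<open>a\<^sub>n\<^sub>+\<^sub>1 a a\<^sub>0 \<otimes> a\<^sub>1 \<otimes> \<dots> \<otimes> a\<^sub>n\<close>.\<close>

definition trace_bar_to_tpow :: "'k ring \<Rightarrow> ('k, 'a) module \<Rightarrow> nat
    \<Rightarrow> ('a \<times> ('a list \<Rightarrow>\<^sub>0 int) set \<Rightarrow>\<^sub>0 int) set \<Rightarrow> ('a list \<Rightarrow>\<^sub>0 int) set" where
  "trace_bar_to_tpow K A n = presented_lift (tpow K A (n + 1))
     (\<lambda>(a, t). presented_lift (tpow K A (n + 1))
        (\<lambda>as. pure_tensor K A ((last as \<otimes>\<^bsub>A\<^esub> a \<otimes>\<^bsub>A\<^esub> hd as) # butlast (tl as))) t)"

definition tpow_to_trace_bar :: "'k ring \<Rightarrow> ('k, 'a) module \<Rightarrow> nat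
    \<Rightarrow> ('a list \<Rightarrow>\<^sub>0 int) set \<Rightarrow> ('a \<times> ('a list \<Rightarrow>\<^sub>0 int) set \<Rightarrow>\<^sub>0 int) set" where
  "tpow_to_trace_bar K A n = presented_lift (trace_obj A (bar_obj K A (int n)))
     (\<lambda>as. trace_class A (bar_obj K A (int n)) (\<one>\<^bsub>A\<^esub>, pure_tensor K A (as @ [\<one>\<^bsub>A\<^esub>])))"

definition connes_tpow :: "'k ring \<Rightarrow> ('k, 'a) module \<Rightarrow> nat
    \<Rightarrow> ('a list \<Rightarrow>\<^sub>0 int) set \<Rightarrow> ('a list \<Rightarrow>\<^sub>0 int) set" where
  "connes_tpow K A n = (let T = tpow K A (n + 2) in presented_lift T (\<lambda>as.
     (\<Oplus>\<^bsub>T\<^esub>i \<in> {0..n}. signed T (int (i * n)) (pure_tensor K A (\<one>\<^bsub>A\<^esub> # rotate i as)))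
     \<oplus>\<^bsub>T\<^esub>
     (\<Oplus>\<^bsub>T\<^esub>i \<in> {0..n}. signed T (int (i * n))
        (pure_tensor K A (hd (rotate i as) # \<one>\<^bsub>A\<^esub> # tl (rotate i as))))))"

definition connes :: "'k ring \<Rightarrow> ('k, 'a) module \<Rightarrow> nat
    \<Rightarrow> ('a \<times> ('a list \<Rightarrow>\<^sub>0 int) set \<Rightarrow>\<^sub>0 int) set set
    \<Rightarrow> ('a \<times> ('a list \<Rightarrow>\<^sub>0 int) set \<Rightarrow>\<^sub>0 int) set set" where
  "connes K A n = homology_map (Tr A (bar K A)) (int (n + 1))
     (\<lambda>z. tpow_to_trace_bar K A (n + 1) (connes_tpow K A n (trace_bar_to_tpow K A n z)))"

text \<open>\<open>F\<close> induces \<open>B\<close> on Hochschild homology: \<open>F\<close> is a chain map, so it acts on homology, and the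
  identification of \<open>HH K A\<close> with the homology of \<open>Tr A P\<close>, which is the isomorphism induced by any
  comparison chain map from the bar resolution, carries \<open>B\<close> to that action. As sets
  \<open>homology (Tr A (shift P 1)) n\<close> and \<open>homology (Tr A P) (n + 1)\<close> have the same elements.\<close>

definition induces_on_HH :: "'k ring \<Rightarrow> ('k, 'a) module \<Rightarrow> ('a, 'p) bimodule_cpx \<Rightarrow> ('p \<Rightarrow> 'a)
    \<Rightarrow> (int \<Rightarrow> ('a \<times> 'p \<Rightarrow>\<^sub>0 int) set \<Rightarrow> ('a \<times> 'p \<Rightarrow>\<^sub>0 int) set)
    \<Rightarrow> (nat \<Rightarrow> ('a \<times> ('a list \<Rightarrow>\<^sub>0 int) set \<Rightarrow>\<^sub>0 int) set set
           \<Rightarrow> ('a \<times> ('a list \<Rightarrow>\<^sub>0 int) set \<Rightarrow>\<^sub>0 int) set set) \<Rightarrow> bool" where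
  "induces_on_HH K A P \<mu> F B \<longleftrightarrow>
     F \<in> module_cpx_maps K (Tr A P) (Tr A (shift P 1)) \<and>
     commutes_with_diff (Tr A P) (Tr A (shift P 1)) F \<and>
     comparison_maps K A P \<mu> \<noteq> {} \<and>
     (\<forall>\<theta> \<in> comparison_maps K A P \<mu>.
        (\<forall>n. bij_betw (homology_map (Tr A P) n (Tr_map A P \<theta> n))
               (carrier (HH K A n)) (carrier (homology (Tr A P) n))) \<and>
        (\<forall>n. \<forall>z \<in> carrier (HH K A (int n)).
           homology_map (Tr A (shift P 1)) (int n) (F (int n))
             (homology_map (Tr A P) (int n) (Tr_map A P \<theta> (int n)) z)
           = homology_map (Tr A P) (int (n + 1)) (Tr_map A P \<theta> (int (n + 1))) (B n z)))"

end

theory Submission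
  imports Defs
begin

text \<open>
  The operator of the statement is compared with the one of the bar resolution $B$. There
  $\Delta_B$ has the terms $a_0 \ldots a_i \otimes 1 \otimes a_{i+1} \ldots a_{n+1}$, it commutes strictly with
  the counits, so that $\epsilon_B = 0$ is allowed, and multiplying the inner factors gives a $\phi_B$ for
  which the operator is the cyclic formula for the differential of Connes up to a boundary. For a
  comparison map $\theta : B \rightarrow P$ the operators of $P$ and $B$ differ on the trace by a null-homotopic
  map: homomorphisms from $B$ and from $B \otimes_A B$ lift along exact sequences of bimodules, so
  $\Delta_P \theta$ and $(\theta \otimes \theta) \Delta_B$, as well as $\phi_P (\theta \otimes \theta)$ and $\theta \phi_B$,
  differ by homotopies, and the homotopies cancel against the change of $\epsilon$ because
  $\sigma_{P,P}$ exchanges $\mu_P \otimes 1$ and $1 \otimes \mu_P$.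
\<close>

text \<open>Neither \<phi> nor \<epsilon> is a chain map: each has a difference of counits as its
  defect, evaluated on P \<otimes> P for \<phi> and along \<Delta> for \<epsilon>. In the trace the
  swap reverses the sign of the first defect, so it is their sum that commutes with the
  differentials. To compare P with the bar resolution, the maps are corrected by a homotopy between
  the two diagonals until the defects cancel. The corrected maps send degree 0 to degree 1, where P
  is exact, hence they are null-homotopic without any condition in degree 0.

  The obstacle is the supply of lifts. A bar module is free only over a basis of a tensor power, and
  B \<otimes> B is a sum of bar modules only up to isomorphism. So lifting is treated as a property
  \<open>lifts\<close> of three bimodules, and linear sections over the field take the place of
  bases. Homotopies into P \<otimes> P need its exactness in positive degrees, which comes from a
  contraction of P that is linear on one side. The first half of the formula of Connes is exactly
  the operator of B on the trace; the second half is shown to be a boundary on cycles, by inserting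
  two units.\<close>

type_synonym 'x fab = "('x \<Rightarrow>\<^sub>0 int) set"

abbreviation (input) in_carrier (infix ":>" 50) where "x :> M \<equiv> x \<in> carrier M"
abbreviation (input) add_in ("_ +[_] _" [65, 0, 66] 65) where "x +[M] y \<equiv> x \<oplus>\<^bsub>M\<^esub> y"
abbreviation (input) minus_in ("_ -[_] _" [65, 0, 66] 65) where "x -[M] y \<equiv> x \<ominus>\<^bsub>M\<^esub> y"
abbreviation (input) neg_in ("-[_] _" [0, 81] 80) where "-[M] x \<equiv> \<ominus>\<^bsub>M\<^esub> x"
abbreviation (input) mult_in ("_ *[_] _" [70, 0, 71] 70) where "x *[M] y \<equiv> x \<otimes>\<^bsub>M\<^esub> y"
abbreviation (input) smult_in ("_ .*[_] _" [70, 0, 71] 70) where "c .*[M] x \<equiv> c \<odot>\<^bsub>M\<^esub> x"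
abbreviation (input) zero_in ("0[_]") where "0[M] \<equiv> \<zero>\<^bsub>M\<^esub>"
abbreviation (input) one_in ("1[_]") where "1[M] \<equiv> \<one>\<^bsub>M\<^esub>"
abbreviation (input) "bhom \<equiv> bimodule_hom"
abbreviation (input) "Tg \<equiv> tpow_gens"
abbreviation (input) "plift \<equiv> presented_lift"
abbreviation (input) "Ba \<equiv> bar_augmentation"
abbreviation (input) "reg_bim \<equiv> regular_bimodule"
abbreviation (input) "trob \<equiv> trace_obj"
abbreviation (input) "pkeys \<equiv> Poly_Mapping.keys"

section \<open>Homomorphisms of abelian groups\<close>

lemma (in abelian_group) a_inv_zero [simp]: "\<ominus> \<zero> = \<zero>"
 by(rule minus_equality) simp_all

text \<open>Registered with the method \<open>algebra\<close>, these rules let it normalise additive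
  expressions in any interpreted abelian group, the groups of bimodules and of traces
  included.\<close>

lemmas (in abelian_group) abelian_group_simprules
 [algebra abelian_group "ring.zero G" "ring.add G" "a_inv G" "a_minus G"] =
 a_closed zero_closed a_inv_closed minus_closed a_assoc l_zero l_neg a_comm minus_eq
 r_zero r_neg r_neg2 r_neg1 minus_add minus_minus a_inv_zero a_lcomm

lemma (in abelian_group) a_minus_zero [simp]: "x :> G ==> x \<ominus> \<zero> = x"
 by(simp add: minus_eq)

lemma (in abelian_group) a_minus_self [simp]: "x :> G ==> x \<ominus> x = \<zero>"
 by(simp add: minus_eq r_neg)

abbreviation ahom :: "('m, 'y) ring_scheme => ('n, 'z) ring_scheme => ('m => 'n) set" where
 "ahom M N \<equiv> hom (add_monoid M) (add_monoid N)"

lemma ahomI: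
 assumes "!!x. x :> M ==> f x :> N"
 and "!!x y. x :> M ==> y :> M ==> f (x +[M] y) = f x +[N] f y"
 shows "f : ahom M N"
 using assms by(auto simp: hom_def)

lemma ahom_closed: "f : ahom M N ==> x :> M ==> f x :> N"
 by(auto simp: hom_def)

lemma ahom_add:
 "f : ahom M N ==> x :> M ==> y :> M ==> f (x +[M] y) = f x +[N] f y"
 by(auto simp: hom_def)

lemma ahom_comp: "f : ahom L M ==> g : ahom M N ==> (%x. g (f x)) : ahom L N"
 by(auto simp: hom_def Pi_def)

context abelian_group
begin

lemma signed_closed [simp, intro]: "x :> G ==> signed G n x :> G"
 by(simp add: signed_def)

lemma signed_add:
 "x :> G ==> y :> G ==> signed G n (x \<oplus> y) = signed G n x \<oplus> signed G n y"
 by(simp add: signed_def minus_add a_comm)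

lemma signed_zero [simp]: "signed G n \<zero> = \<zero>"
 by(simp add: signed_def)

lemma signed_signed: "x :> G ==> signed G m (signed G n x) = signed G (m+n) x"
 by(simp add: signed_def)

lemma signed_ahom: "signed G n : ahom G G"
 by(rule ahomI) (simp_all add: signed_add)

lemma eq_iff_diff_zero: "x :> G ==> y :> G ==> x = y \<longleftrightarrow> x \<ominus> y = \<zero>"
 by(metis add.inv_closed a_minus_def add.inv_inv add.inv_equality r_neg)

lemma diff_zeroD: "x \<ominus> y = \<zero> ==> x :> G ==> y :> G ==> x = y"
 by(simp only: eq_iff_diff_zero)

lemma finsum_ahom:
 assumes "abelian_group H" "f : ahom G H" "u : I \<rightarrow> carrier G"
 shows "f (finsum G u I) = finsum H (%i. f (u i)) I"
proof -
 interpret H: abelian_group H by fact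
 have f: "f : carrier G \<rightarrow> carrier H" using assms(2) by(auto simp: hom_def)
 have z: "f \<zero> = 0[H]"
 using hom_one[OF assms(2)] a_group H.a_group by simp
 show ?thesis using assms(3)
 proof (induction I rule: infinite_finite_induct)
 case (insert i I)
 hence "u : I \<rightarrow> carrier G" "u i :> G" by auto
 moreover have "(%i. f (u i)) : I \<rightarrow> carrier H" "f (u i) :> H"
 using insert f by auto
 ultimately show ?case using insert
 by(simp add: ahom_add[OF assms(2)] finsum_closed)
 qed (simp_all add: z)
qed

end

text \<open>Bundled so that a single \<open>OF\<close> instantiation per homomorphism yields a
  complete set of rewrite rules.\<close>

lemma ahom_rules:
 assumes "abelian_group M" "abelian_group N" "f : ahom M N"
 shows "x :> M ==> f x :> N"
 and "x :> M ==> y :> M ==> f (x +[M] y) = f x +[N] f y"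
 and "f 0[M] = 0[N]"
 and "x :> M ==> f (-[M] x) = -[N] f x"
 and "x :> M ==> y :> M ==> f (x -[M] y) = f x -[N] f y"
 and "x :> M ==> f (signed M n x) = signed N n (f x)"
proof -
 interpret M: abelian_group M by fact
 interpret N: abelian_group N by fact
 show 1: "f x :> N" if "x :> M" for x
 using assms(3) that by(rule ahom_closed)
 show 2: "f (x +[M] y) = f x +[N] f y" if "x :> M" "y :> M" for x y
 using assms(3) that by(rule ahom_add)
 show 3: "f 0[M] = 0[N]"
 using hom_one[OF assms(3)] M.a_group N.a_group by simp
 show 4: "f (-[M] x) = -[N] f x" if x: "x :> M" for x
 proof -
 have "f (-[M] x) +[N] f x = 0[N]"
 using x 2[of "-[M] x" x] 3 by(simp add: M.l_neg)
 thus ?thesis using x 1 by(simp add: N.minus_equality)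
 qed
 show "f (x -[M] y) = f x -[N] f y" if "x :> M" "y :> M" for x y
 using that by(simp add: M.minus_eq N.minus_eq 2 4)
 show "f (signed M n x) = signed N n (f x)" if "x :> M"
 using that by(simp add: signed_def 4)
qed

lemma abelian_group_cong:
 assumes "abelian_group G" "carrier H = carrier G" "0[H] = 0[G]" "ring.add H = ring.add G"
 shows "abelian_group H"
proof -
 interpret abelian_group G by fact
 have "EX y:carrier H. y +[H] x = 0[H]" if "x :> H" for x
 using that assms by(intro bexI[of _ "-[G] x"]) (simp_all add: l_neg)
 thus ?thesis
 using assms by(intro abelian_groupI) (simp_all add: a_ac)
qed

lemma ahom_plus:
 assumes "abelian_group N" "f : ahom M N" "g : ahom M N"
 shows "(%x. f x +[N] g x) : ahom M N"
proof -
 interpret abelian_group N by fact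
 show ?thesis
 proof (rule ahomI)
 fix x y assume "x :> M" "y :> M"
 thus "f (x +[M] y) +[N] g (x +[M] y) = f x +[N] g x +[N] (f y +[N] g y)"
 using assms by(simp add: ahom_add a_ac ahom_closed[OF assms(2)] ahom_closed[OF assms(3)])
 qed (simp add: ahom_closed[OF assms(2)] ahom_closed[OF assms(3)])
qed

lemma ahom_uminus:
 assumes "abelian_group N" "f : ahom M N"
 shows "(%x. -[N] f x) : ahom M N"
proof -
 interpret abelian_group N by fact
 show ?thesis
 by(rule ahomI) (simp_all add: ahom_add[OF assms(2)] ahom_closed[OF assms(2)] minus_add a_comm)
qed

lemma ahom_minus:
 assumes "abelian_group N" "f : ahom M N" "g : ahom M N"
 shows "(%x. f x -[N] g x) : ahom M N"
 unfolding a_minus_def by(intro ahom_plus ahom_uminus assms)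

lemma ahom_const_zero: "abelian_group N ==> (%x. 0[N]) : ahom M N"
 by(rule ahomI) (simp_all add: abelian_group.axioms abelian_monoid.zero_closed abelian_monoid.l_zero)

lemma ahom_id: "(%x. x) : ahom M M"
 by(auto simp: hom_def)

section \<open>Abelian groups given by generators and relations\<close>

text \<open>Evaluation of a formal sum before passing to the quotient; \<open>presented_lift\<close>
  returns the common value of \<open>frag_eval\<close> on a coset.\<close>

definition frag_eval :: "('t, 'z) ring_scheme => ('x => 't) => ('x \<Rightarrow>\<^sub>0 int) => 't" where
 "frag_eval T f c = (\<Oplus>\<^bsub>T\<^esub>x \<in> pkeys c. [Poly_Mapping.lookup c x] \<cdot>\<^bsub>T\<^esub> f x)"

context abelian_group
begin

lemma add_pow_int_closed: "x :> G ==> add_pow G (k::int) x :> G"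
 using add.int_pow_closed by simp

text \<open>Cancellation can make the support of a sum smaller than the union of the supports; a
  common finite index set is what makes additivity provable term by term.\<close>

lemma frag_eval_superset:
 assumes "finite I" "pkeys c <= I" "f : I \<rightarrow> carrier G"
 shows "frag_eval G f c = (\<Oplus>x \<in> I. [Poly_Mapping.lookup c x] \<cdot>\<^bsub>G\<^esub> f x)"
 unfolding frag_eval_def
proof (rule add.finprod_mono_neutral_cong_left)
 show "!!i. i : I - pkeys c ==> [Poly_Mapping.lookup c i] \<cdot>\<^bsub>G\<^esub> f i = \<zero>"
 by(simp add: in_keys_iff add_pow_def)
qed (use assms in \<open>auto intro!: add_pow_int_closed\<close>)

lemma frag_eval_closed:
 "f : S \<rightarrow> carrier G ==> pkeys c <= S ==> frag_eval G f c :> G"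
 unfolding frag_eval_def by(intro finsum_closed) (auto intro!: add_pow_int_closed)

lemma frag_eval_add:
 assumes f: "f : S \<rightarrow> carrier G" and c: "pkeys c <= S" and d: "pkeys d <= S"
 shows "frag_eval G f (c + d) = frag_eval G f c \<oplus> frag_eval G f d"
proof -
 let ?I = "pkeys c \<union> pkeys d"
 have I: "finite ?I" "f : ?I \<rightarrow> carrier G" using assms by auto
 have "frag_eval G f (c + d) = (\<Oplus>x \<in> ?I. [Poly_Mapping.lookup (c + d) x] \<cdot>\<^bsub>G\<^esub> f x)"
 using I by(intro frag_eval_superset) (auto dest!: subsetD[OF keys_add])
 also have "... = (\<Oplus>x \<in> ?I. [Poly_Mapping.lookup c x] \<cdot>\<^bsub>G\<^esub> f x \<oplus> [Poly_Mapping.lookup d x] \<cdot>\<^bsub>G\<^esub> f x)"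
 using I by(intro finsum_cong')
 (auto simp: lookup_add Pi_iff intro!: add.int_pow_mult add_pow_int_closed a_closed)
 also have "... = frag_eval G f c \<oplus> frag_eval G f d"
 using I by(subst finsum_addf)
 (auto simp: frag_eval_superset[of ?I] intro!: add_pow_int_closed)
 finally show ?thesis .
qed

lemma frag_eval_0 [simp]: "frag_eval G f 0 = \<zero>"
 by(simp add: frag_eval_def)

lemma frag_eval_of [simp]: "f x :> G ==> frag_eval G f (frag_of x) = f x"
 by(simp add: frag_eval_def)

lemma frag_eval_uminus:
 assumes f: "f : S \<rightarrow> carrier G" and c: "pkeys c <= S"
 shows "frag_eval G f (- c) = \<ominus> frag_eval G f c"
proof -
 have "frag_eval G f (- c) \<oplus> frag_eval G f c = \<zero>"
 using frag_eval_add[OF f, of "- c" c] c by simp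
 thus ?thesis using f c by(simp add: minus_equality frag_eval_closed)
qed

lemma frag_eval_diff:
 assumes f: "f : S \<rightarrow> carrier G" and c: "pkeys c <= S" and d: "pkeys d <= S"
 shows "frag_eval G f (c - d) = frag_eval G f c \<ominus> frag_eval G f d"
 using frag_eval_add[OF f, of c "- d"] frag_eval_uminus[OF f d] c d by(simp add: minus_eq)

end

lemma presented_lift_frag_eval: "plift T f C = the_elem (frag_eval T f ` C)"
 by(simp add: presented_lift_def frag_eval_def[abs_def])

text \<open>\<open>gen_class\<close> covers single generators; cosets of arbitrary formal sums are
  needed to argue by induction on formal sums.\<close>

definition frag_class :: "'x set => 'x fab => ('x \<Rightarrow>\<^sub>0 int) => 'x fab" where
 "frag_class S R c = generate (free_Abelian_group S) R #>\<^bsub>free_Abelian_group S\<^esub> c"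

lemma gen_class_eq: "gen_class S R x = frag_class S R (frag_of x)"
 by(simp add: gen_class_def frag_class_def)

text \<open>The record type of \<open>Q\<close> is left open because tensor products and traces extend the underlying
 presented group by further operations.\<close>

locale presented_group =
 fixes S :: "'x set" and R :: "'x fab" and Q :: "('x fab, 'z) ring_scheme"
 assumes rels: "!!r. r : R ==> pkeys r <= S"
 and carrier_presented: "carrier Q = carrier (presented S R)"
 and zero_presented: "0[Q] = 0[presented S R]"
 and add_presented: "ring.add Q = ring.add (presented S R)"
begin

abbreviation "cls \<equiv> frag_class S R"

lemma normal_rels: "generate (free_Abelian_group S) R \<lhd> free_Abelian_group S"
proof -
 interpret F: comm_group "free_Abelian_group S" by(rule abelian_free_Abelian_group)
 show ?thesis
 by(rule F.normal_iff_subgroup[THEN iffD2], rule F.generate_is_subgroup) (use rels in auto)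
qed

lemma carrier_eq: "carrier Q = {cls c | c. pkeys c <= S}"
 by(auto simp: carrier_presented presented_def Let_def FactGroup_def RCOSETS_def frag_class_def)

lemma cls_closed [simp]: "pkeys c <= S ==> cls c :> Q"
 by(auto simp: carrier_eq)

lemma gen_closed: "x : S ==> gen_class S R x :> Q"
 by(simp add: gen_class_eq)

lemma cls_add:
 assumes "pkeys c <= S" "pkeys d <= S"
 shows "cls c +[Q] cls d = cls (c + d)"
 using normal.rcos_sum[OF normal_rels, of c d] assms
 by(simp add: add_presented presented_def Let_def FactGroup_def frag_class_def)

lemma zero_eq: "0[Q] = cls 0"
proof -
 interpret F: group "free_Abelian_group S" by simp
 have "generate (free_Abelian_group S) R <= carrier (free_Abelian_group S)"
 using normal_rels by(meson normal_imp_subgroup subgroup.subset)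
 thus ?thesis
 using F.coset_mult_one[of "generate (free_Abelian_group S) R"]
 by(simp add: zero_presented presented_def Let_def FactGroup_def frag_class_def)
qed

lemma abelian_group_presented: "abelian_group Q"
proof -
 interpret F: comm_group "free_Abelian_group S" by(rule abelian_free_Abelian_group)
 have sub: "generate (free_Abelian_group S) R <= carrier (free_Abelian_group S)"
 using normal_rels by(meson normal_imp_subgroup subgroup.subset)
 have "comm_group (free_Abelian_group S Mod generate (free_Abelian_group S) R)"
 using F.abelian_FactGroup normal_rels normal_imp_subgroup by blast
 moreover have "add_monoid (presented S R) = free_Abelian_group S Mod generate (free_Abelian_group S) R"
 by(simp add: presented_def Let_def)
 ultimately have "abelian_group (presented S R)" by(intro comm_group_abelian_groupI) simp
 thus ?thesis
 by(rule abelian_group_cong) (simp_all add: carrier_presented zero_presented add_presented)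
qed

sublocale Q: abelian_group Q by(rule abelian_group_presented)

lemma cls_uminus: "pkeys c <= S ==> cls (- c) = -[Q] cls c"
 using cls_add[of "- c" c] Q.minus_equality[of "cls (- c)" "cls c"] by(simp add: zero_eq)

lemma cls_diff:
 "pkeys c <= S ==> pkeys d <= S ==> cls (c - d) = cls c -[Q] cls d"
 using cls_add[of c "- d"] by(simp add: cls_uminus Q.minus_eq)

lemma cls_rel: "r : R ==> cls r = 0[Q]"
proof -
 assume r: "r : R"
 interpret F: group "free_Abelian_group S" by simp
 interpret N: subgroup "generate (free_Abelian_group S) R" "free_Abelian_group S"
 using normal_rels normal_imp_subgroup by blast
 have "cls r = generate (free_Abelian_group S) R"
 unfolding frag_class_def using r rels
 by(intro F.coset_join2 N.subgroup_axioms) (auto intro: generate.incl)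
 thus ?thesis
 by(simp add: zero_presented presented_def Let_def FactGroup_def)
qed

text \<open>The relations of free bimodules, tensor products, traces and tensor powers all have the
  form x - y or x - y - z with generators x, y, z. This lemma and the next turn such relations into
  equations between classes.\<close>

lemma gen_diff2:
 assumes "frag_of x - frag_of y : R" "x : S" "y : S"
 shows "gen_class S R x = gen_class S R y"
 unfolding gen_class_eq
 by(rule Q.diff_zeroD) (use cls_rel[OF assms(1)] assms(2,3) in \<open>simp_all add: cls_diff\<close>)

lemma gen_diff3:
 assumes "frag_of x - frag_of y - frag_of z : R" "x : S" "y : S" "z : S"
 shows "gen_class S R x = gen_class S R y +[Q] gen_class S R z"
proof -
 have k: "pkeys (frag_of y + frag_of z) <= S" "pkeys (frag_of x) <= S"
 using assms keys_add[of "frag_of y" "frag_of z"] by auto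
 have "cls (frag_of x) -[Q] cls (frag_of y + frag_of z) = 0[Q]"
 unfolding cls_diff[OF k(2,1), symmetric] diff_diff_add[symmetric] by(rule cls_rel) (rule assms(1))
 hence "cls (frag_of x) = cls (frag_of y + frag_of z)"
 by(rule Q.diff_zeroD) (use k in simp_all)
 thus ?thesis using assms by(simp add: gen_class_eq cls_add)
qed

lemma presented_induct [consumes 1, case_names gen zero add uminus]:
 assumes "z :> Q"
 and "!!x. x : S ==> P (gen_class S R x)"
 and "P 0[Q]"
 and "!!z w. z :> Q ==> w :> Q ==> P z ==> P w ==> P (z +[Q] w)"
 and "!!z. z :> Q ==> P z ==> P (-[Q] z)"
 shows "P z"
proof -
 obtain c where c: "z = cls c" "pkeys c <= S" using assms(1) by(auto simp: carrier_eq)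
 have "pkeys c <= S & P (cls c)" using c(2)
 proof (induction c rule: frag_induction)
 case (diff a b)
 thus ?case
 using assms(4)[of "cls a" "cls (- b)"] assms(5)[of "cls b"] keys_diff[of a b]
 by(auto simp: cls_add cls_uminus[symmetric])
 qed (use assms in \<open>auto simp: zero_eq gen_class_eq\<close>)
 thus ?thesis using c by simp
qed

lemma hom_ext:
 assumes "abelian_group T" "f : ahom Q T" "g : ahom Q T"
 and "!!x. x : S ==> f (gen_class S R x) = g (gen_class S R x)"
 and "z :> Q"
 shows "f z = g z"
 using assms(5)
 by(induction rule: presented_induct)
 (simp_all add: assms ahom_rules[OF abelian_group_presented assms(1,2)]
 ahom_rules[OF abelian_group_presented assms(1,3)])

text \<open>An evaluation that kills the relations is constant on every coset of the subgroup they
  generate, so the image formed by \<open>presented_lift\<close> is a singleton and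
  \<open>the_elem\<close> returns its value.\<close>

lemma lift_hom:
 assumes T: "abelian_group T" and f: "!!x. x : S ==> f x :> T"
 and R: "!!r. r : R ==> frag_eval T f r = 0[T]"
 shows "plift T f : ahom Q T"
 and "!!x. x : S ==> plift T f (gen_class S R x) = f x"
proof -
 interpret T: abelian_group T by(rule T)
 have f': "f : S \<rightarrow> carrier T" using f by auto
 have N: "pkeys n <= S & frag_eval T f n = 0[T]"
 if "n : generate (free_Abelian_group S) R" for n
 using that
 proof (induction rule: generate.induct)
 case (eng n m)
 thus ?case using keys_add[of n m] by(auto simp: T.frag_eval_add[OF f'])
 next
 case (inv n)
 hence "inv\<^bsub>free_Abelian_group S\<^esub> n = - n" using rels by simp
 thus ?case using inv rels R by(simp add: T.frag_eval_uminus[OF f'])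
 qed (use rels R in simp_all)
 have ev: "plift T f (cls c) = frag_eval T f c" if c: "pkeys c <= S" for c
 proof -
 have "frag_eval T f ` cls c = {frag_eval T f c}"
 proof (intro equalityI subsetI)
 fix y assume "y : frag_eval T f ` cls c"
 then obtain n where n: "n : generate (free_Abelian_group S) R" "y = frag_eval T f (n + c)"
 by(auto simp: frag_class_def r_coset_def)
 thus "y : {frag_eval T f c}"
 using N[OF n(1)] c f' by(simp add: T.frag_eval_add[OF f'] T.frag_eval_closed)
 next
 fix y assume y: "y : {frag_eval T f c}"
 have "0 : generate (free_Abelian_group S) R"
 using generate.one[of "free_Abelian_group S" R] by simp
 hence "c : cls c" by(force simp: frag_class_def r_coset_def)
 thus "y : frag_eval T f ` cls c" using y by blast
 qed
 thus ?thesis by(simp add: presented_lift_frag_eval)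
 qed
 show "plift T f : ahom Q T"
 proof (rule ahomI)
 fix x y assume "x :> Q" "y :> Q"
 then obtain c d where cd: "x = cls c" "y = cls d" "pkeys c <= S" "pkeys d <= S"
 by(auto simp: carrier_eq)
 moreover have "pkeys (c + d) <= S" using cd keys_add[of c d] by auto
 ultimately show "plift T f (x +[Q] y) = plift T f x +[T] plift T f y"
 by(simp add: cls_add ev T.frag_eval_add[OF f'])
 qed (auto simp: carrier_eq ev T.frag_eval_closed[OF f'])
 show "plift T f (gen_class S R x) = f x" if "x : S" for x
 using that f by(simp add: gen_class_eq ev)
qed

lemma frag_eval_diff2:
 assumes "abelian_group T" "!!x. x : S ==> f x :> T" "x : S" "y : S" "f x = f y"
 shows "frag_eval T f (frag_of x - frag_of y) = 0[T]"
proof -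
 interpret T: abelian_group T by fact
 show ?thesis
 using assms T.frag_eval_diff[of f S "frag_of x" "frag_of y"]
 by(simp add: T.r_neg T.minus_eq)
qed

lemma frag_eval_diff3:
 assumes "abelian_group T" "!!x. x : S ==> f x :> T" "x : S" "y : S" "z : S"
 and "f x = f y +[T] f z"
 shows "frag_eval T f (frag_of x - frag_of y - frag_of z) = 0[T]"
proof -
 interpret T: abelian_group T by fact
 have f: "f : S \<rightarrow> carrier T" and k: "pkeys (frag_of x - frag_of y) <= S"
 using assms keys_diff[of "frag_of x" "frag_of y"] by auto
 have "f x :> T" "f y :> T" "f z :> T" using assms by auto
 moreover from this have "f y +[T] f z -[T] f y -[T] f z = 0[T]" by algebra
 ultimately show ?thesis
 using assms k by(simp add: T.frag_eval_diff[OF f])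
qed

end

lemma presented_groupI:
 assumes "!!r. r : R ==> pkeys r <= S"
 shows "presented_group S R (presented S R)"
 using assms by unfold_locales auto

lemma presented_bimodule_group:
 assumes "!!r. r : R ==> pkeys r <= S"
 shows "presented_group S R (presented_bimodule S R l r)"
 using assms by unfold_locales (auto simp: presented_bimodule_def Let_def)

section \<open>Bimodules\<close>

text \<open>The bimodule record has no scalar multiplication, so the field acts through the
  multiples of the unit of A; by \<open>central\<close> the left and the right action of these
  agree.\<close>

abbreviation scal :: "('k, 'a) module => ('a, 'm) bimodule => 'k => 'm => 'm" where
 "scal A M c \<equiv> lact M (c .*[A] 1[A])"

lemma bimodule_homI:
 assumes "f : ahom M N"
 and "!!a x. a :> A ==> x :> M ==> f (lact M a x) = lact N a (f x)"
 and "!!a x. a :> A ==> x :> M ==> f (ract M x a) = ract N (f x) a"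
 shows "f : bhom A M N"
 using assms by(simp add: bimodule_hom_def)

lemma bhom_ahom: "f : bhom A M N ==> f : ahom M N"
 by(simp add: bimodule_hom_def)

lemma bhom_lact:
 "f : bhom A M N ==> a :> A ==> x :> M ==> f (lact M a x) = lact N a (f x)"
 by(simp add: bimodule_hom_def)

lemma bhom_ract:
 "f : bhom A M N ==> a :> A ==> x :> M ==> f (ract M x a) = ract N (f x) a"
 by(simp add: bimodule_hom_def)

lemma bhom_cl: "f : bhom A M N ==> x :> M ==> f x :> N"
 by(auto dest: bhom_ahom ahom_closed)

lemma bhom_comp:
 assumes "f : bhom A L M" "g : bhom A M N"
 shows "(%x. g (f x)) : bhom A L N"
 using assms by(intro bimodule_homI ahom_comp[of f L M g N])
 (auto simp: bhom_ahom bhom_lact bhom_ract bhom_cl)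

lemma bhom_id: "(%x. x) : bhom A M M"
 by(intro bimodule_homI ahom_id) auto

context assoc_algebra
begin

lemma K_unit: "c :> K ==> c ~= 0[K] ==> EX d:carrier K. d *[K] c = 1[K]"
 using field_Units by(auto simp: Units_def)

lemma scalar_closed: "c :> K ==> c .*[A] 1[A] :> A"
 by(simp add: smult_closed)

end

context is_bimodule
begin

lemma lact_ahom: "a :> A ==> lact M a : ahom M M"
 by(rule ahomI) (simp_all add: lact_closed lact_add_right)

lemma ract_ahom: "a :> A ==> (%x. ract M x a) : ahom M M"
 by(rule ahomI) (simp_all add: ract_closed ract_add_left)

lemmas lact_rules = ahom_rules[OF B.abelian_group_axioms B.abelian_group_axioms lact_ahom]
lemmas ract_rules = ahom_rules[OF B.abelian_group_axioms B.abelian_group_axioms ract_ahom]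

lemma lact_ahom': "x :> M ==> (%a. lact M a x) : ahom A M"
 by(rule ahomI) (simp_all add: lact_closed lact_add_left)

lemma ract_ahom': "x :> M ==> (%a. ract M x a) : ahom A M"
 by(rule ahomI) (simp_all add: ract_closed ract_add_right)

lemmas lact_rules' = ahom_rules[OF A.is_abelian_group B.abelian_group_axioms lact_ahom']
lemmas ract_rules' = ahom_rules[OF A.is_abelian_group B.abelian_group_axioms ract_ahom']

lemma scal_closed: "c :> K ==> x :> M ==> scal A M c x :> M"
 by(simp add: lact_closed scalar_closed)

lemma lact_smult:
 assumes "c :> K" "a :> A" "x :> M"
 shows "lact M (c .*[A] a) x = scal A M c (lact M a x)"
 and "lact M a (scal A M c x) = scal A M c (lact M a x)"
proof -
 have "(c .*[A] 1[A]) *[A] a = c .*[A] a" "a *[A] (c .*[A] 1[A]) = c .*[A] a"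
 using assms by(simp_all add: smult_mult_left smult_mult_right)
 thus "lact M (c .*[A] a) x = scal A M c (lact M a x)"
 "lact M a (scal A M c x) = scal A M c (lact M a x)"
 using assms by(metis lact_mult scalar_closed)+
qed

lemma ract_smult:
 assumes "c :> K" "a :> A" "x :> M"
 shows "ract M x (c .*[A] a) = scal A M c (ract M x a)"
 and "ract M (scal A M c x) a = scal A M c (ract M x a)"
proof -
 have "a *[A] (c .*[A] 1[A]) = c .*[A] a"
 using assms by(simp_all add: smult_mult_left smult_mult_right)
 thus "ract M x (c .*[A] a) = scal A M c (ract M x a)"
 using assms by(metis central ract_closed ract_mult scalar_closed)
 show "ract M (scal A M c x) a = scal A M c (ract M x a)"
 using assms by(simp add: lact_ract scalar_closed)
qed

lemma scal_mult:
 "c :> K ==> d :> K ==> x :> M ==>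
 scal A M (c *[K] d) x = scal A M c (scal A M d x)"
 by(simp add: smult_assoc1 lact_smult scalar_closed)

lemma scal_zero: "x :> M ==> scal A M 0[K] x = 0[M]"
 by(simp add: lact_rules')

lemma scal_add_left:
 "c :> K ==> d :> K ==> x :> M ==>
 scal A M (c +[K] d) x = scal A M c x +[M] scal A M d x"
 by(simp add: smult_l_distr lact_add_left scalar_closed)

lemma scal_uminus:
 "x :> M ==> scal A M (-[K] 1[K]) x = -[M] x"
 by(simp add: smult_l_minus lact_rules' lact_one)

end

lemma bhom_rules:
 assumes "is_bimodule K A M" "is_bimodule K A N" "f : bhom A M N"
 shows "x :> M ==> f x :> N"
 and "x :> M ==> y :> M ==> f (x +[M] y) = f x +[N] f y"
 and "f 0[M] = 0[N]"
 and "x :> M ==> f (-[M] x) = -[N] f x"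
 and "x :> M ==> y :> M ==> f (x -[M] y) = f x -[N] f y"
 and "x :> M ==> f (signed M n x) = signed N n (f x)"
 and "a :> A ==> x :> M ==> f (lact M a x) = lact N a (f x)"
 and "a :> A ==> x :> M ==> f (ract M x a) = ract N (f x) a"
proof -
 interpret M: is_bimodule K A M by fact
 interpret N: is_bimodule K A N by fact
 note * = ahom_rules[OF M.B.abelian_group_axioms N.B.abelian_group_axioms bhom_ahom[OF assms(3)]]
 show "x :> M ==> f x :> N"
 and "x :> M ==> y :> M ==> f (x +[M] y) = f x +[N] f y"
 and "f 0[M] = 0[N]"
 and "x :> M ==> f (-[M] x) = -[N] f x"
 and "x :> M ==> y :> M ==> f (x -[M] y) = f x -[N] f y"
 and "x :> M ==> f (signed M n x) = signed N n (f x)"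
 by(simp_all add: *)
 show "a :> A ==> x :> M ==> f (lact M a x) = lact N a (f x)"
 and "a :> A ==> x :> M ==> f (ract M x a) = ract N (f x) a"
 by(simp_all add: bhom_lact[OF assms(3)] bhom_ract[OF assms(3)])
qed

lemma bhom_plus:
 assumes "is_bimodule K A N" "f : bhom A M N" "g : bhom A M N"
 shows "(%x. f x +[N] g x) : bhom A M N"
proof -
 interpret N: is_bimodule K A N by fact
 show ?thesis
 using assms(2,3)
 by(intro bimodule_homI ahom_plus N.B.abelian_group_axioms)
 (auto simp: bhom_ahom bhom_lact bhom_ract bhom_cl
 N.lact_rules N.ract_rules)
qed

lemma bhom_uminus:
 assumes "is_bimodule K A N" "f : bhom A M N"
 shows "(%x. -[N] f x) : bhom A M N"
proof -
 interpret N: is_bimodule K A N by fact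
 show ?thesis
 using assms(2)
 by(intro bimodule_homI ahom_uminus N.B.abelian_group_axioms)
 (auto simp: bhom_ahom bhom_lact bhom_ract bhom_cl
 N.lact_rules N.ract_rules)
qed

lemma bhom_minus:
 assumes "is_bimodule K A N" "f : bhom A M N" "g : bhom A M N"
 shows "(%x. f x -[N] g x) : bhom A M N"
 unfolding a_minus_def by(intro bhom_plus[OF assms(1)] bhom_uminus[OF assms(1)] assms)

lemma bhom_signed:
 assumes "is_bimodule K A N" "f : bhom A M N"
 shows "(%x. signed N n (f x)) : bhom A M N"
 using assms bhom_uminus[OF assms] by(cases "even n") (simp_all add: signed_def)

lemma bhom_zero:
 assumes "is_bimodule K A N"
 shows "(%x. 0[N]) : bhom A M N"
proof -
 interpret N: is_bimodule K A N by fact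
 show ?thesis
 by(intro bimodule_homI ahom_const_zero N.B.abelian_group_axioms) (simp_all add: N.lact_rules N.ract_rules)
qed

text \<open>By the lemma of Zorn there is a maximal subspace of N that meets the kernel of p in
  zero. It is mapped onto the whole image of p, and the inverse of p on it is linear over the field.
  A section compatible with the actions of A need not exist.\<close>

lemma (in assoc_algebra) linear_section:
 assumes N: "is_bimodule K A N" and Q: "is_bimodule K A Q" and p: "p : bhom A N Q"
 obtains s where "!!q. q : p ` carrier N ==> s q :> N"
 and "!!q. q : p ` carrier N ==> p (s q) = q"
 and "!!q r. q : p ` carrier N ==> r : p ` carrier N ==> s (q +[Q] r) = s q +[N] s r"
 and "!!c q. c :> K ==> q : p ` carrier N ==> s (scal A Q c q) = scal A N c (s q)"
proof -
 interpret N: is_bimodule K A N by fact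
 interpret Q: is_bimodule K A Q by fact
 note [simp] = bhom_rules[OF N Q p] scalar_closed N.scal_closed Q.scal_closed
 define subsp where "subsp U \<longleftrightarrow> U <= carrier N & 0[N] : U & (ALL u:U. ALL v:U. u +[N] v : U) &
 (ALL c:carrier K. ALL u:U. scal A N c u : U)" for U
 define F where "F = {U. subsp U & (ALL u:U. p u = 0[Q] --> u = 0[N])}"
 have "{0[N]} : F" by(auto simp: F_def subsp_def N.lact_rules)
 hence "F ~= {}" by blast
 hence "EX U:F. ALL V:F. U <= V --> V = U"
 proof (rule subset_Zorn_nonempty)
 fix C assume C: "C ~= {}" "subset.chain F C"
 hence sub: "subsp U" "ALL u:U. p u = 0[Q] --> u = 0[N]" if "U : C" for U
 using that by(auto simp: F_def subset.chain_def)
 have tot: "U <= V | V <= U" if "U : C" "V : C" for U V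
 using C that by(auto simp: subset.chain_def)
 have "u +[N] v : \<Union>C" if uv: "u : \<Union>C" "v : \<Union>C" for u v
 proof -
 obtain U V where UV: "U : C" "V : C" "u : U" "v : V" using uv by blast
 then consider "u : V" | "v : U" using tot[of U V] by blast
 thus ?thesis using UV sub unfolding subsp_def by cases blast+
 qed
 hence "subsp (\<Union>C)"
 using sub C(1) unfolding subsp_def by blast
 thus "\<Union>C \<in> F" using sub by(auto simp: F_def)
 qed
 then obtain U where U: "U : F" and max: "!!V. V : F ==> U <= V ==> V = U" by blast
 have UN: "u :> N" if "u : U" for u using U that by(auto simp: F_def subsp_def)
 have U0: "0[N] : U" using U by(auto simp: F_def subsp_def)
 have Ua: "u +[N] v : U" if "u : U" "v : U" for u v using U that by(auto simp: F_def subsp_def)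
 have Us: "scal A N c u : U" if "c :> K" "u : U" for c u
 using U that by(auto simp: F_def subsp_def)
 have Uk: "u = 0[N]" if "u : U" "p u = 0[Q]" for u using U that by(auto simp: F_def)
 have Um: "-[N] u : U" if "u : U" for u
 using Us[of "-[K] 1[K]" u] that UN by(simp add: N.scal_uminus)
 \<comment> \<open>If p v were missed, U could be enlarged by the line through v: an element u + c v
   of the kernel with c nonzero would exhibit p v as the image of - u / c, which lies in U.\<close>
 have onto: "EX u:U. p u = p v" if v: "v :> N" for v
 proof (rule ccontr)
 assume no: "\<not> (EX u:U. p u = p v)"
 define V where "V = {u +[N] scal A N c v | u c. u : U & c :> K}"
 have VI: "u +[N] scal A N c v : V" if "u : U" "c :> K" for u c
 using that by(auto simp: V_def)
 have "w +[N] w' : V" if hw: "w : V" "w' : V" for w w'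
 proof -
 obtain u c u' c' where w: "w = u +[N] scal A N c v" "w' = u' +[N] scal A N c' v"
 "u : U" "c :> K" "u' : U" "c' :> K" using hw unfolding V_def by blast
 moreover from this have "w +[N] w' = (u +[N] u') +[N] scal A N (c +[K] c') v"
 using v by(simp add: UN N.scal_add_left N.B.a_ac)
 ultimately show ?thesis using VI Ua by simp
 qed
 moreover have "scal A N d w : V" if hw: "w : V" "d :> K" for w d
 proof -
 obtain u c where w: "w = u +[N] scal A N c v" "u : U" "c :> K"
 using hw unfolding V_def by blast
 moreover from this have "scal A N d w = scal A N d u +[N] scal A N (d *[K] c) v"
 using v that by(simp add: UN N.lact_rules N.scal_mult)
 ultimately show ?thesis using VI Us that by simp
 qed
 moreover have "0[N] : V" using VI[OF U0, of "0[K]"] v by(simp add: N.scal_zero del: smult_l_null)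
 moreover have "w = 0[N]" if hw: "w : V" "p w = 0[Q]" for w
 proof -
 obtain u c where w: "w = u +[N] scal A N c v" "u : U" "c :> K"
 using hw unfolding V_def by blast
 have "c = 0[K]"
 proof (rule ccontr)
 assume "c ~= 0[K]"
 then obtain d where d: "d :> K" "d *[K] c = 1[K]" using K_unit w(3) by blast
 have "p u +[Q] scal A Q c (p v) = 0[Q]" using that w v UN by simp
 hence "-[Q] p u = scal A Q c (p v)"
 using w v UN by(metis Q.B.minus_equality Q.B.a_comm Q.scal_closed bhom_cl[OF p]
 Q.B.minus_minus Q.B.a_inv_closed)
 hence "scal A Q d (-[Q] p u) = scal A Q (d *[K] c) (p v)"
 by(simp only: Q.scal_mult[OF d(1) w(3) bhom_cl[OF p v]])
 hence "p (scal A N d (-[N] u)) = p v"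
 using d w v UN by(simp add: Q.lact_one)
 thus False using no Us[OF d(1) Um[OF w(2)]] by blast
 qed
 thus ?thesis using w that v UN Uk by(simp add: N.lact_rules')
 qed
 moreover have "V <= carrier N" using v UN by(auto simp: V_def)
 ultimately have "V : F" unfolding F_def subsp_def by blast
 moreover have "U <= V"
 proof
 fix u assume "u : U"
 thus "u : V" using VI[of u "0[K]"] v UN by(simp add: N.lact_rules')
 qed
 ultimately have "V = U" by(rule max)
 moreover have "v : V" using VI[OF U0, of "1[K]"] v by(simp add: N.lact_one)
 ultimately show False using no by blast
 qed
 have uniq: "u = u'" if "u : U" "u' : U" "p u = p u'" for u u'
 proof -
 have "u -[N] u' : U" using Ua[OF that(1) Um[OF that(2)]] by(simp add: N.B.minus_eq)
 moreover have "p (u -[N] u') = 0[Q]" by(simp only: bhom_rules(5)[OF N Q p UN[OF that(1)] UN[OF that(2)]] that(3))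
 (simp add: Q.B.minus_eq Q.B.r_neg UN that(2))
 ultimately have "u -[N] u' = 0[N]" by(rule Uk)
 thus ?thesis using N.B.eq_iff_diff_zero[OF UN[OF that(1)] UN[OF that(2)]] by simp
 qed
 define s where "s q = (SOME u. u : U & p u = q)" for q
 have s: "s q : U & p (s q) = q" if "q : p ` carrier N" for q
 unfolding s_def by(rule someI_ex) (use onto that in blast)
 have s': "s q : U" "p (s q) = q" "s q :> N" if "q : p ` carrier N" for q
 using s[OF that] UN by auto
 have add: "q +[Q] r : p ` carrier N" if "q : p ` carrier N" "r : p ` carrier N" for q r
 using that by(auto simp flip: bhom_rules(2)[OF N Q p])
 have sc: "scal A Q c q : p ` carrier N" if "q : p ` carrier N" "c :> K" for q c
 using that by(auto simp: scalar_closed N.lact_closed simp flip: bhom_rules(7)[OF N Q p])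
 show thesis
 proof (rule that)
 show "s (q +[Q] r) = s q +[N] s r" if "q : p ` carrier N" "r : p ` carrier N" for q r
 using that add by(intro uniq) (simp_all add: s' Ua)
 show "s (scal A Q c q) = scal A N c (s q)" if "c :> K" "q : p ` carrier N" for c q
 using that sc by(intro uniq) (simp_all add: s' Us)
 qed (simp_all add: s')
qed

section \<open>Bimodules given by generators and relations\<close>

text \<open>The conditions under which actions of the algebra on generators turn the presented group into
 a bimodule.\<close>

locale presented_bimod = assoc_algebra K A
 for K :: "'k ring" and A :: "('k, 'a) module" +
 fixes S :: "'x set" and R :: "'x fab" and l :: "'a => 'x => 'x" and r :: "'x => 'a => 'x"
 assumes relsS: "!!u. u : R ==> pkeys u <= S"
 and l_closed: "!!a x. a :> A ==> x : S ==> l a x : S"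
 and r_closed: "!!a x. a :> A ==> x : S ==> r x a : S"
 and l_rels: "!!a u. a :> A ==> u : R ==>
 frag_eval (presented S R) (%x. gen_class S R (l a x)) u = 0[presented S R]"
 and r_rels: "!!a u. a :> A ==> u : R ==>
 frag_eval (presented S R) (%x. gen_class S R (r x a)) u = 0[presented S R]"
 and l_add: "!!a b x. a :> A ==> b :> A ==> x : S ==> gen_class S R (l (a +[A] b) x)
 = gen_class S R (l a x) +[presented S R] gen_class S R (l b x)"
 and r_add: "!!a b x. a :> A ==> b :> A ==> x : S ==> gen_class S R (r x (a +[A] b))
 = gen_class S R (r x a) +[presented S R] gen_class S R (r x b)"
 and l_mult: "!!a b x. a :> A ==> b :> A ==> x : S ==>
 gen_class S R (l (a *[A] b) x) = gen_class S R (l a (l b x))"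
 and r_mult: "!!a b x. a :> A ==> b :> A ==> x : S ==>
 gen_class S R (r x (a *[A] b)) = gen_class S R (r (r x a) b)"
 and l_one: "!!x. x : S ==> gen_class S R (l 1[A] x) = gen_class S R x"
 and r_one: "!!x. x : S ==> gen_class S R (r x 1[A]) = gen_class S R x"
 and l_r: "!!a b x. a :> A ==> b :> A ==> x : S ==>
 gen_class S R (r (l a x) b) = gen_class S R (l a (r x b))"
 and lr_central: "!!c x. c :> K ==> x : S ==>
 gen_class S R (l (c .*[A] 1[A]) x) = gen_class S R (r x (c .*[A] 1[A]))"
begin

abbreviation "M \<equiv> presented_bimodule S R l r"

sublocale Q: presented_group S R "presented S R"
 by(rule presented_groupI) (rule relsS)

sublocale M: presented_group S R M
 by(rule presented_bimodule_group) (rule relsS)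

lemma M_simps: "carrier M = carrier (presented S R)" "0[M] = 0[presented S R]" "ring.add M = ring.add (presented S R)"
 by(simp_all add: presented_bimodule_def Let_def)

lemma ahom_M: "ahom (presented S R) (presented S R) = ahom M M"
 by(simp add: hom_def M_simps)

lemma lact_M: assumes "a :> A"
 shows "lact M a : ahom M M" "!!x. x : S ==> lact M a (gen_class S R x) = gen_class S R (l a x)"
proof -
 have l: "lact M a = plift (presented S R) (%x. gen_class S R (l a x))"
 by(simp add: presented_bimodule_def Let_def)
 note L = Q.lift_hom[OF Q.abelian_group_presented, of "%x. gen_class S R (l a x)"]
 show "lact M a : ahom M M" unfolding l ahom_M[symmetric]
 by(rule L) (simp_all add: assms Q.gen_closed l_closed l_rels)
 show "!!x. x : S ==> lact M a (gen_class S R x) = gen_class S R (l a x)" unfolding l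
 by(rule L) (simp_all add: assms Q.gen_closed l_closed l_rels)
qed

lemma ract_M: assumes "a :> A"
 shows "(%x. ract M x a) : ahom M M" "!!x. x : S ==> ract M (gen_class S R x) a = gen_class S R (r x a)"
proof -
 have l: "(%x. ract M x a) = plift (presented S R) (%x. gen_class S R (r x a))"
 by(simp add: presented_bimodule_def Let_def)
 note L = Q.lift_hom[OF Q.abelian_group_presented, of "%x. gen_class S R (r x a)"]
 show "(%x. ract M x a) : ahom M M" unfolding l ahom_M[symmetric]
 by(rule L) (simp_all add: assms Q.gen_closed r_closed r_rels)
 show "ract M (gen_class S R x) a = gen_class S R (r x a)" if "x : S" for x
 unfolding fun_cong[OF l]
 by(rule L) (simp_all add: assms that Q.gen_closed r_closed r_rels)
qed

lemma bimodule_M: "is_bimodule K A M"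
proof -
 note lc = ahom_closed[OF lact_M(1)] ahom_closed[OF ract_M(1)]
 note la = ahom_add[OF lact_M(1)] ahom_add[OF ract_M(1)]
 note G = M.abelian_group_presented
 note [simp] = lact_M(2) ract_M(2) l_closed r_closed scalar_closed M.gen_closed
 have e: "lact M (a +[A] b) x = lact M a x +[M] lact M b x"
 if "a :> A" "b :> A" "x :> M" for a b x
 using that(3) by(rule M.hom_ext[OF G _ _ _, rotated 3])
 (use that in \<open>auto intro!: ahom_plus G lact_M simp: l_add[folded M_simps(3)]\<close>)
 have f: "ract M x (a +[A] b) = ract M x a +[M] ract M x b"
 if "a :> A" "b :> A" "x :> M" for a b x
 using that(3) by(rule M.hom_ext[OF G _ _ _, rotated 3])
 (use that in \<open>auto intro!: ahom_plus G ract_M simp: r_add[folded M_simps(3)]\<close>)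
 have g: "lact M (a *[A] b) x = lact M a (lact M b x)"
 if "a :> A" "b :> A" "x :> M" for a b x
 using that(3) by(rule M.hom_ext[OF G _ _ _, rotated 3])
 (use that in \<open>auto intro!: ahom_comp[OF lact_M(1) lact_M(1)] lact_M simp: l_mult\<close>)
 have h: "ract M x (a *[A] b) = ract M (ract M x a) b"
 if "a :> A" "b :> A" "x :> M" for a b x
 using that(3) by(rule M.hom_ext[OF G _ _ _, rotated 3])
 (use that in \<open>auto intro!: ahom_comp[OF ract_M(1) ract_M(1)] ract_M simp: r_mult\<close>)
 have i: "lact M 1[A] x = x" if "x :> M" for x
 using that by(rule M.hom_ext[OF G _ ahom_id _, rotated 2]) (auto intro!: lact_M simp: l_one)
 have j: "ract M x 1[A] = x" if "x :> M" for x
 using that by(rule M.hom_ext[OF G _ ahom_id _, rotated 2]) (auto intro!: ract_M simp: r_one)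
 have k: "ract M (lact M a x) b = lact M a (ract M x b)"
 if "a :> A" "b :> A" "x :> M" for a b x
 using that(3) by(rule M.hom_ext[OF G _ _ _, rotated 3])
 (use that in \<open>auto intro!: ahom_comp[OF lact_M(1) ract_M(1)] ahom_comp[OF ract_M(1) lact_M(1)] simp: l_r\<close>)
 have m: "lact M (c .*[A] 1[A]) x = ract M x (c .*[A] 1[A])"
 if "c :> K" "x :> M" for c x
 using that(2) by(rule M.hom_ext[OF G _ _ _, rotated 3])
 (use that in \<open>auto intro!: lact_M ract_M simp: lr_central\<close>)
 show ?thesis
 by(intro is_bimodule.intro is_bimodule_axioms.intro assoc_algebra_axioms G)
 (simp_all add: e f g h i j k m lc la)
qed

end

lemma keys_frag_diff2: "pkeys (frag_of x - frag_of y) <= {x, y}"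
 using keys_diff[of "frag_of x" "frag_of y"] by auto

lemma keys_frag_diff3: "pkeys (frag_of x - frag_of y - frag_of z) <= {x, y, z}"
 using keys_diff[of "frag_of x - frag_of y" "frag_of z"] keys_frag_diff2[of x y] by auto

section \<open>Lifting homomorphisms out of projective bimodules\<close>

text \<open>A relative lifting property, stated for three bimodules because it is proved by
  different means for projective bimodules, for bar modules and for the tensor square of the bar
  resolution. Inclusion of images in place of surjectivity allows p to be a differential.\<close>

definition lifts ::
 "('k, 'a) module => ('a, 'm) bimodule => ('a, 'n) bimodule => ('a, 'q) bimodule => bool" where
 "lifts A M N Q \<longleftrightarrow> (ALL f:bhom A M Q. ALL p:bhom A N Q.
 f ` carrier M <= p ` carrier N -->
 (EX g:bhom A M N. ALL x:carrier M. p (g x) = f x))"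

lemma liftsD:
 assumes "lifts A M N Q" "f : bhom A M Q" "p : bhom A N Q"
 and "!!x. x :> M ==> f x : p ` carrier N"
 obtains g where "g : bhom A M N" "!!x. x :> M ==> p (g x) = f x"
 using assms unfolding lifts_def by(meson image_subsetI)

lemma (in is_bimodule) lact_ract_smult:
 assumes "c :> K" "a :> A" "x :> M" "b :> A"
 shows "lact M (c .*[A] a) (ract M x b) = lact M a (ract M x (c .*[A] b))"
 using lact_smult[of c a "ract M x b"] assms by(simp add: ract_closed ract_smult(1))

text \<open>Names for the actions that \<open>free_bimodule\<close> gives as anonymous abstractions,
  so that \<open>presented_bimod\<close> and simp rules can refer to them;
  \<open>tensor_lact\<close> and \<open>bar_lact\<close> serve the same end.\<close>

definition free_lact :: "('k, 'a) module => 'a => 'a \<times> 's \<times> 'a => 'a \<times> 's \<times> 'a" where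
 "free_lact A = (%e (a, s, b). (e *[A] a, s, b))"

definition free_ract :: "('k, 'a) module => 'a \<times> 's \<times> 'a => 'a => 'a \<times> 's \<times> 'a" where
 "free_ract A = (%(a, s, b) e. (a, s, b *[A] e))"

lemma free_act_simps [simp]:
 "free_lact A e (a, s, b) = (e *[A] a, s, b)" "free_ract A (a, s, b) e = (a, s, b *[A] e)"
 by(simp_all add: free_lact_def free_ract_def)

lemma free_bimodule_eq:
 "free_bimodule K A S = presented_bimodule (free_bimodule_gens A S) (free_bimodule_rels K A S)
 (free_lact A) (free_ract A)"
 by(simp add: free_bimodule_def free_lact_def free_ract_def)

context assoc_algebra
begin

lemma free_bimodule_presented:
 "presented_bimod K A (free_bimodule_gens A S) (free_bimodule_rels K A S)
 (free_lact A) (free_ract A)"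
proof -
 let ?S = "free_bimodule_gens A S" and ?R = "free_bimodule_rels K A S"
 have rels: "pkeys u <= ?S" if "u : ?R" for u
 using that unfolding free_bimodule_rels_def free_bimodule_gens_def
 by(auto dest!: subsetD[OF keys_frag_diff2] subsetD[OF keys_frag_diff3])
 interpret Q: presented_group ?S ?R "presented ?S ?R"
 by(rule presented_groupI) (rule rels)
 note T = Q.abelian_group_presented
 have add1: "gen_class ?S ?R (a +[A] a', s, b)
 = gen_class ?S ?R (a, s, b) +[presented ?S ?R] gen_class ?S ?R (a', s, b)"
 if "a :> A" "a' :> A" "b :> A" "s : S" for a a' s b
 by(rule Q.gen_diff3)
 (use that in \<open>auto simp: free_bimodule_gens_def free_bimodule_rels_def\<close>)
 have add2: "gen_class ?S ?R (a, s, b +[A] b')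
 = gen_class ?S ?R (a, s, b) +[presented ?S ?R] gen_class ?S ?R (a, s, b')"
 if "a :> A" "b' :> A" "b :> A" "s : S" for a b' s b
 by(rule Q.gen_diff3)
 (use that in \<open>auto simp: free_bimodule_gens_def free_bimodule_rels_def\<close>)
 have bal: "gen_class ?S ?R (c .*[A] a, s, b) = gen_class ?S ?R (a, s, c .*[A] b)"
 if "a :> A" "c :> K" "b :> A" "s : S" for a c s b
 by(rule Q.gen_diff2)
 (use that in \<open>auto simp: free_bimodule_gens_def free_bimodule_rels_def smult_closed\<close>)
 have mem: "(a, s, b) : ?S \<longleftrightarrow> a :> A & s : S & b :> A" for a s b
 by(simp add: free_bimodule_gens_def)
 have cases: "(\<exists>a a' s b. u = frag_of (a +[A] a', s, b) - frag_of (a, s, b) - frag_of (a', s, b) &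
 a :> A & a' :> A & s : S & b :> A) |
 (\<exists>a s b b'. u = frag_of (a, s, b +[A] b') - frag_of (a, s, b) - frag_of (a, s, b') &
 a :> A & s : S & b :> A & b' :> A) |
 (\<exists>c a s b. u = frag_of (c .*[A] a, s, b) - frag_of (a, s, c .*[A] b) &
 c :> K & a :> A & s : S & b :> A)"
 if "u : ?R" for u
 using that unfolding free_bimodule_rels_def by blast
 show ?thesis
 proof
 fix e u assume eu: "e :> A" "u : ?R"
 have *: "gen_class ?S ?R (free_lact A e x) :> (presented ?S ?R)"
 "gen_class ?S ?R (free_ract A x e) :> (presented ?S ?R)"
 if "x : ?S" for x
 using that eu by(cases x; auto intro!: Q.gen_closed simp: mem)+
 show "frag_eval (presented ?S ?R)
 (%x. gen_class ?S ?R (free_lact A e x)) u = 0[presented ?S ?R]"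
 by(insert cases[OF eu(2)] eu(1)) (elim disjE exE conjE; hypsubst; (rule Q.frag_eval_diff2[OF T *(1)] | rule Q.frag_eval_diff3[OF T *(1)]);
 simp add: smult_closed mem add1 add2 bal A.r_distr smult_mult_right)
 show "frag_eval (presented ?S ?R)
 (%x. gen_class ?S ?R (free_ract A x e)) u = 0[presented ?S ?R]"
 by(insert cases[OF eu(2)] eu(1)) (elim disjE exE conjE; hypsubst; (rule Q.frag_eval_diff2[OF T *(2)] | rule Q.frag_eval_diff3[OF T *(2)]);
 simp add: smult_closed mem add1 add2 bal A.l_distr smult_mult_left)
 next
 fix c x assume "c :> K" "x : ?S"
 thus "gen_class ?S ?R (free_lact A (c .*[A] 1[A]) x)
 = gen_class ?S ?R (free_ract A x (c .*[A] 1[A]))"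
 by(cases x) (auto simp: mem smult_mult_left smult_mult_right bal)
 qed (use rels in \<open>auto simp: mem add1 add2 A.m_assoc A.l_distr A.r_distr split: prod.splits del: equalityI\<close>)
qed

lemma free_bimodule_hom:
 assumes N: "is_bimodule K A N" and g: "!!s. s : S ==> g s :> N"
 obtains G where "G : bhom A (free_bimodule K A S) N"
 and "!!s. s : S ==> G (gen_class (free_bimodule_gens A S) (free_bimodule_rels K A S) (1[A], s, 1[A])) = g s"
proof -
 let ?S = "free_bimodule_gens A S" and ?R = "free_bimodule_rels K A S"
 interpret F: presented_bimod K A ?S ?R "free_lact A" "free_ract A"
 by(rule free_bimodule_presented)
 interpret N: is_bimodule K A N by(rule N)
 note [simp] = N.lact_closed N.ract_closed g
 note NG = N.B.abelian_group_axioms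
 define f where "f = (%(a, s, b). lact N a (ract N (g s) b))"
 have f: "f x :> N" if "x : ?S" for x
 using that by(auto simp: f_def free_bimodule_gens_def)
 have fs: "f (a, s, b) = lact N a (ract N (g s) b)" for a s b by(simp add: f_def)
 have mem: "(a, s, b) : ?S \<longleftrightarrow> a :> A & s : S & b :> A" for a s b
 by(simp add: free_bimodule_gens_def)
 have R: "frag_eval N f u = 0[N]" if "u : ?R" for u
 using that unfolding free_bimodule_rels_def
 by(auto intro!: F.M.frag_eval_diff2[OF NG f] F.M.frag_eval_diff3[OF NG f]
 simp: mem fs N.lact_add_left N.ract_add_right N.lact_add_right N.lact_ract_smult)
 note L = F.M.lift_hom[OF NG f R]
 have *: "plift N f : bhom A F.M N"
 proof (rule bimodule_homI)
 show "plift N f (lact F.M e x) = lact N e (plift N f x)"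
 if "e :> A" "x :> F.M" for e x
 using that(2)
 proof (rule F.M.hom_ext[OF NG, rotated 3])
 fix x assume "x : ?S"
 thus "plift N f (lact F.M e (gen_class ?S ?R x)) = lact N e (plift N f (gen_class ?S ?R x))"
 using that F.l_closed[OF that(1), of x]
 by(cases x) (simp add: F.lact_M L mem fs N.lact_mult)
 qed (auto intro!: that ahom_comp[OF F.lact_M(1) L(1)] ahom_comp[OF L(1) N.lact_ahom])
 show "plift N f (ract F.M x e) = ract N (plift N f x) e"
 if "e :> A" "x :> F.M" for e x
 using that(2)
 proof (rule F.M.hom_ext[OF NG, rotated 3])
 fix x assume "x : ?S"
 thus "plift N f (ract F.M (gen_class ?S ?R x) e) = ract N (plift N f (gen_class ?S ?R x)) e"
 using that F.r_closed[OF that(1), of x]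
 by(cases x) (simp add: F.ract_M L mem fs N.ract_mult N.lact_ract)
 qed (auto intro!: that ahom_comp[OF F.ract_M(1) L(1)] ahom_comp[OF L(1) N.ract_ahom])
 qed (rule L)
 show thesis
 proof (rule that)
 show "plift N f : bhom A (free_bimodule K A S) N"
 using * by(simp add: free_bimodule_eq)
 show "plift N f (gen_class ?S ?R (1[A], s, 1[A])) = g s" if "s : S" for s
 using that by(simp add: L mem fs N.lact_one N.ract_one)
 qed
qed

text \<open>The generator \<open>(a, s, b)\<close> is obtained from \<open>(1, s, 1)\<close> by
  acting with a and b, so the elements attached to the indices generate the bimodule.\<close>

lemma free_bhom_ext:
 assumes N: "is_bimodule K A N"
 and f: "f : bhom A (free_bimodule K A S) N" and g: "g : bhom A (free_bimodule K A S) N"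
 and eq: "!!s. s : S ==> f (gen_class (free_bimodule_gens A S) (free_bimodule_rels K A S) (1[A], s, 1[A]))
 = g (gen_class (free_bimodule_gens A S) (free_bimodule_rels K A S) (1[A], s, 1[A]))"
 and x: "x :> free_bimodule K A S"
 shows "f x = g x"
proof -
 let ?S = "free_bimodule_gens A S" and ?R = "free_bimodule_rels K A S"
 interpret F: presented_bimod K A ?S ?R "free_lact A" "free_ract A"
 by(rule free_bimodule_presented)
 interpret N: is_bimodule K A N by(rule N)
 have F: "free_bimodule K A S = F.M" by(simp add: free_bimodule_eq)
 have "f x = g x" if "x :> F.M"
 using that
 proof (rule F.M.hom_ext[OF N.B.abelian_group_axioms, rotated 3])
 fix x assume "x : ?S"
 then obtain a s b where x: "x = (a, s, b)" "a :> A" "s : S" "b :> A"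
 by(auto simp: free_bimodule_gens_def)
 let ?u = "gen_class ?S ?R (1[A], s, 1[A])"
 have u: "(1[A], s, 1[A]) : ?S" "(1[A], s, b) : ?S" using x by(auto simp: free_bimodule_gens_def)
 have "gen_class ?S ?R x = lact F.M a (ract F.M ?u b)"
 using x u F.ract_M(2)[OF x(4) u(1)] F.lact_M(2)[OF x(2) u(2)] by simp
 moreover have "?u :> F.M" by(rule F.M.gen_closed) (rule u(1))
 moreover from this have "ract F.M ?u b :> F.M" using x F.ract_M(1) ahom_closed by metis
 ultimately show "f (gen_class ?S ?R x) = g (gen_class ?S ?R x)"
 using f g eq[OF x(3)] x unfolding F by(simp add: bhom_lact bhom_ract)
 qed (use f g in \<open>auto simp: F intro: bhom_ahom\<close>)
 thus ?thesis using x by(simp add: F)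
qed

text \<open>Preimages chosen for the basis elements extend to the free bimodule that contains M as a
  summand; restricting along the inclusion \<open>i\<close> gives the lift, since
  \<open>r (i x) = x\<close>.\<close>

lemma projective_lifts:
 assumes P: "projective_bimodule K A M" and N: "is_bimodule K A N" and Q: "is_bimodule K A Q"
 shows "lifts A M N Q"
 unfolding lifts_def
proof (intro ballI impI)
 fix f p assume f: "f : bhom A M Q" and p: "p : bhom A N Q"
 and sub: "f ` carrier M <= p ` carrier N"
 obtain S :: "'b set" and i r where i: "i : bhom A M (free_bimodule K A S)"
 and r: "r : bhom A (free_bimodule K A S) M" and ri: "!!x. x :> M ==> r (i x) = x"
 using P unfolding projective_bimodule_def by blast
 let ?S = "free_bimodule_gens A S" and ?R = "free_bimodule_rels K A S"
 interpret F: presented_bimod K A ?S ?R "free_lact A" "free_ract A"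
 by(rule free_bimodule_presented)
 let ?u = "%s. gen_class ?S ?R (1[A], s, 1[A])"
 have u: "?u s :> free_bimodule K A S" if "s : S" for s
 using that unfolding free_bimodule_eq by(intro F.M.gen_closed) (simp add: free_bimodule_gens_def)
 define g where "g s = (SOME n. n :> N & p n = f (r (?u s)))" for s
 have "g s :> N & p (g s) = f (r (?u s))" if "s : S" for s
 proof -
 have "f (r (?u s)) : p ` carrier N" using sub bhom_cl[OF r u[OF that]] by blast
 thus ?thesis unfolding g_def by(intro someI_ex[of "%n. n :> N & p n = f (r (?u s))"]) auto
 qed
 hence g: "!!s. s : S ==> g s :> N" "!!s. s : S ==> p (g s) = f (r (?u s))"
 by auto
 obtain G where G: "G : bhom A (free_bimodule K A S) N" "!!s. s : S ==> G (?u s) = g s"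
 by(rule free_bimodule_hom[OF N, where g = g and S = S]) (use g(1) in blast)+
 have "p (G x) = f (r x)" if "x :> free_bimodule K A S" for x
 by(rule free_bhom_ext[OF Q bhom_comp[OF G(1) p] bhom_comp[OF r f] _ that])
 (simp add: G g)
 hence "p (G (i x)) = f x" if "x :> M" for x
 using that ri bhom_cl[OF i] by simp
 thus "EX g:bhom A M N. ALL x:carrier M. p (g x) = f x"
 by(intro bexI[of _ "%x. G (i x)"] ballI bhom_comp[OF i G(1)])
qed

text \<open>Chain maps over the augmentation and null-homotopies both arise by solving
 \<open>e h\<^sub>n = f\<^sub>n - h\<^sub>n\<^sub>-\<^sub>1 \<delta>\<close> degree by degree.\<close>

lemma extend_homs:
 fixes M :: "int => ('a, 'm) bimodule" and N :: "int => ('a, 'n) bimodule"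
 assumes M: "!!n. is_bimodule K A (M n)" and N: "!!n. is_bimodule K A (N n)"
 and d: "!!n. \<delta> n : bhom A (M n) (M (n-1))"
 and dd: "!!n x. x :> M n ==> \<delta> (n-1) (\<delta> n x) = 0[M (n-2)]"
 and e: "!!n. n >= 1 ==> e n : bhom A (N n) (N (n-1))"
 and f: "!!n. n >= 1 ==> f n : bhom A (M n) (N (n-1))"
 and lift: "!!n. n >= 1 ==> lifts A (M n) (N n) (N (n-1))"
 and exact: "!!n y. n >= 1 ==> y :> N n ==> e n y = 0[N (n-1)] ==>
 y : e (n+1) ` carrier (N (n+1))"
 and comm: "!!n x. n >= 2 ==> x :> M n ==> e (n-1) (f n x) = f (n-1) (\<delta> n x)"
 and h0: "h0 : bhom A (M 0) (N 0)"
 and start: "!!x. x :> M 1 ==> f 1 x -[N 0] h0 (\<delta> 1 x) : e 1 ` carrier (N 1)"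
 obtains h where "h 0 = h0" "!!n. n < 0 ==> h n = (%_. 0[N n])"
 and "!!n. h n : bhom A (M n) (N n)"
 and "!!n x. n >= 1 ==> x :> M n ==>
 e n (h n x) = f n x -[N (n-1)] h (n-1) (\<delta> n x)"
proof -
 \<comment> \<open>Besides the map in degree n, \<open>Pr\<close> records that the residual in
   degree n + 1 lies in the image of \<open>e\<close>. This solvability condition for the next step
   has to be carried through the recursion.\<close>
 define Pr where "Pr n h \<longleftrightarrow> h : bhom A (M (int n)) (N (int n)) & (n = 0 --> h = h0) &
 (ALL x:carrier (M (int n + 1)). f (int n + 1) x -[N (int n)] h (\<delta> (int n + 1) x)
 : e (int n + 1) ` carrier (N (int n + 1)))" for n h
 define Qr where "Qr n h h' \<longleftrightarrow> (ALL x:carrier (M (int n + 1)). e (int n + 1) (h' x)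
 = f (int n + 1) x -[N (int n)] h (\<delta> (int n + 1) x))" for n and h h' :: "'m => 'n"
 have "\<exists>H. \<forall>n. Pr n (H n) & Qr n (H n) (H (Suc n))"
 proof (rule dependent_nat_choice)
 show "\<exists>h. Pr 0 h" using h0 start by(auto simp: Pr_def)
 next
 fix h n assume h: "Pr n h"
 let ?n = "int n + 1"
 interpret N0: is_bimodule K A "N (int n)" by(rule N)
 have hh: "h : bhom A (M (int n)) (N (int n))" using h by(simp add: Pr_def)
 have dn: "\<delta> ?n : bhom A (M ?n) (M (int n))" using d[of ?n] by simp
 have fn: "f ?n : bhom A (M ?n) (N (int n))" using f[of ?n] by simp
 have en: "e ?n : bhom A (N ?n) (N (int n))" using e[of ?n] by simp
 have w: "(%x. f ?n x -[N (int n)] h (\<delta> ?n x)) : bhom A (M ?n) (N (int n))"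
 using bhom_minus[OF N fn bhom_comp[OF dn hh]] .
 obtain g where g: "g : bhom A (M ?n) (N ?n)"
 and eg: "!!x. x :> (M ?n) ==> e ?n (g x) = f ?n x -[N (int n)] h (\<delta> ?n x)"
 using lift[of ?n] w en h by(auto simp: Pr_def elim!: liftsD)
 \<comment> \<open>The new residual is killed by \<open>e\<close>: by \<open>comm\<close>, the
   equation for g and the vanishing square of \<delta>, its image is f \<delta> - f \<delta>.
   Exactness then puts it into the next image.\<close>
 have "f (?n + 1) x -[N ?n] g (\<delta> (?n + 1) x) : e (?n + 1) ` carrier (N (?n + 1))"
 if x: "x :> M (?n + 1)" for x
 proof (rule exact)
 interpret N1: is_bimodule K A "N ?n" by(rule N)
 have fx: "f (?n + 1) x :> (N ?n)" using bhom_cl[OF f[of "?n + 1"], of x] x by(simp add: ac_simps)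
 have dx: "\<delta> (?n + 1) x :> (M ?n)" using bhom_cl[OF d[of "?n + 1"], of x] x by(simp add: ac_simps)
 have gx: "g (\<delta> (?n + 1) x) :> (N ?n)" using bhom_cl[OF g dx] .
 show "f (?n + 1) x -[N ?n] g (\<delta> (?n + 1) x) :> (N ?n)" using fx gx by simp
 have z: "\<delta> ?n (\<delta> (?n + 1) x) = 0[M (int n)]" using dd[OF x] by(simp add: ac_simps)
 have fd: "f ?n (\<delta> (?n + 1) x) :> N (int n)" using bhom_cl[OF fn dx] .
 have cm: "e ?n (f (?n + 1) x) = f ?n (\<delta> (?n + 1) x)"
 using comm[of "?n + 1" x] x by(simp add: ac_simps)
 have "e ?n (f (?n + 1) x -[N ?n] g (\<delta> (?n + 1) x))
 = f ?n (\<delta> (?n + 1) x) -[N (int n)] (f ?n (\<delta> (?n + 1) x) -[N (int n)] 0[N (int n)])"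
 using fx gx eg[OF dx] cm z
 by(simp add: bhom_rules[OF N N en] bhom_rules(3)[OF M N hh])
 also have "... = 0[N (int n)]" using fd by algebra
 finally show "e ?n (f (?n + 1) x -[N ?n] g (\<delta> (?n + 1) x)) = 0[N (?n - 1)]"
 by simp
 qed simp
 hence "Pr (Suc n) g" using g by(simp add: Pr_def add.commute add.left_commute)
 moreover have "Qr n h g" using eg by(simp add: Qr_def)
 ultimately show "\<exists>g. Pr (Suc n) g & Qr n h g" by blast
 qed
 then obtain H where H: "!!n. Pr n (H n)" "!!n. Qr n (H n) (H (Suc n))" by blast
 define h where "h n = (if n < 0 then (%_. 0[N n]) else H (nat n))" for n
 show thesis
 proof (rule that[of h])
 show "h 0 = h0" using H(1)[of 0] by(simp add: h_def Pr_def)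
 show "h n : bhom A (M n) (N n)" for n
 using H(1)[of "nat n"] bhom_zero[OF N, of n "M n"] by(auto simp: h_def Pr_def)
 show "e n (h n x) = f n x -[N (n-1)] h (n-1) (\<delta> n x)" if n: "n >= 1" and x: "x :> M n" for n x
 proof -
 obtain m where "n - 1 = int m" using n nonneg_int_cases[of "n - 1"] by auto
 hence m: "n = int m + 1" by simp
 hence "nat n = Suc m" "nat (n-1) = m" by auto
 thus ?thesis using H(2)[of m] x m by(simp add: h_def Qr_def)
 qed
 qed (simp add: h_def)
qed

end

section \<open>Resolutions and homotopies\<close>

lemma cpx_bim: "is_bimodule_cpx K A P ==> is_bimodule K A (obj P n)"
 by(simp add: is_bimodule_cpx_def)

lemma cpx_diff: "is_bimodule_cpx K A P ==> diff P n : bhom A (obj P n) (obj P (n-1))"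
 by(simp add: is_bimodule_cpx_def)

lemma cpx_diff_diff: "is_bimodule_cpx K A P ==> x :> obj P n ==>
 diff P (n-1) (diff P n x) = 0[obj P (n-2)]"
 by(simp add: is_bimodule_cpx_def)

text \<open>Exactness of the augmented complex, phrased with elements instead of homology groups.
  Both P and the bar resolution are treated in this form, while their lifting properties enter
  through \<open>lifts\<close>.\<close>

definition resolution ::
 "'k ring => ('k, 'a) module => ('a, 'p) bimodule_cpx => ('p => 'a) => bool" where
 "resolution K A P \<mu> \<longleftrightarrow> is_bimodule_cpx K A P &
 (\<forall>n < 0. carrier (obj P n) = {0[obj P n]}) &
 (\<forall>n > 0. ALL x:carrier (obj P n). diff P n x = 0[obj P (n-1)] -->
 x : diff P (n+1) ` carrier (obj P (n+1))) &
 \<mu> : bhom A (obj P 0) (reg_bim A) &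
 (ALL x:carrier (obj P 1). \<mu> (diff P 1 x) = 0[A]) &
 (ALL x:carrier (obj P 0). \<mu> x = 0[A] --> x : diff P 1 ` carrier (obj P 1)) &
 \<mu> ` carrier (obj P 0) = carrier A"

lemma cpx_maps_hom: "f : bimodule_cpx_maps A P Q ==> f n : bhom A (obj P n) (obj Q n)"
 by(simp add: bimodule_cpx_maps_def)

lemma commutes_with_diffD:
 assumes "commutes_with_diff P Q f" "x :> obj P n" "abelian_group (obj Q (n-1))"
 and "f (n-1) (diff P n x) :> obj Q (n-1)" "diff Q n (f n x) :> obj Q (n-1)"
 shows "diff Q n (f n x) = f (n-1) (diff P n x)"
proof -
 interpret abelian_group "obj Q (n-1)" by fact
 show ?thesis
 using assms eq_iff_diff_zero[OF assms(4,5)] by(auto simp: commutes_with_diff_def bd_def)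
qed

lemma chain_mapD:
 assumes P: "is_bimodule_cpx K A P" and Q: "is_bimodule_cpx K A Q"
 and f: "f : bimodule_cpx_maps A P Q" "commutes_with_diff P Q f" and x: "x :> obj P n"
 shows "diff Q n (f n x) = f (n-1) (diff P n x)"
proof (rule commutes_with_diffD[OF f(2) x])
 interpret Q: is_bimodule K A "obj Q (n-1)" by(rule cpx_bim[OF Q])
 show "abelian_group (obj Q (n-1))" by(rule Q.B.abelian_group_axioms)
qed (use x in \<open>auto intro!: bhom_cl[OF cpx_maps_hom[OF f(1)]] bhom_cl[OF cpx_diff[OF P]]
 bhom_cl[OF cpx_diff[OF Q]]\<close>)

context assoc_algebra
begin

lemma reg_bim: "is_bimodule K A (reg_bim A)"
proof -
 interpret R: abelian_group "reg_bim A"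
 by(rule abelian_group_cong[OF A.is_abelian_group]) (simp_all add: regular_bimodule_def)
 show ?thesis
 by(intro is_bimodule.intro is_bimodule_axioms.intro assoc_algebra_axioms R.abelian_group_axioms)
 (simp_all add: regular_bimodule_def A.l_distr A.r_distr A.m_assoc smult_mult_left smult_mult_right)
qed

lemma comparison_exists:
 assumes C: "is_bimodule_cpx K A C" and D: "resolution K A D \<mu>"
 and \<nu>: "\<nu> : bhom A (obj C 0) (reg_bim A)"
 and \<nu>d: "!!x. x :> obj C 1 ==> \<nu> (diff C 1 x) = 0[A]"
 and neg: "!!n. n < 0 ==> carrier (obj C n) = {0[obj C n]}"
 and lift0: "lifts A (obj C 0) (obj D 0) (reg_bim A)"
 and lift: "!!n. lifts A (obj C n) (obj D n) (obj D (n-1))"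
 obtains th where "th : bimodule_cpx_maps A C D" "commutes_with_diff C D th"
 "!!x. x :> obj C 0 ==> \<mu> (th 0 x) = \<nu> x"
proof -
 note D' = D[unfolded resolution_def]
 have Dc: "is_bimodule_cpx K A D" and \<mu>: "\<mu> : bhom A (obj D 0) (reg_bim A)"
 and onto: "\<mu> ` carrier (obj D 0) = carrier A"
 using D' by auto
 note Cb = cpx_bim[OF C] and Db = cpx_bim[OF Dc]
 have "\<nu> x : \<mu> ` carrier (obj D 0)" if "x :> obj C 0" for x
 using bhom_cl[OF \<nu> that] onto by(simp add: regular_bimodule_def)
 then obtain h0 where h0: "h0 : bhom A (obj C 0) (obj D 0)"
 and \<mu>h0: "!!x. x :> obj C 0 ==> \<mu> (h0 x) = \<nu> x"
 using liftsD[OF lift0 \<nu> \<mu>] by metis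
 interpret D0: is_bimodule K A "obj D 0" by(rule Db)
 have start: "0[obj D 0] -[obj D 0] h0 (-[obj C (1-1)] diff C 1 x) : diff D 1 ` carrier (obj D 1)"
 if x: "x :> obj C 1" for x
 proof -
 have dx: "diff C 1 x :> obj C 0" using bhom_cl[OF cpx_diff[OF C] x] by simp
 have hd: "h0 (diff C 1 x) :> obj D 0" using bhom_cl[OF h0 dx] .
 have "\<mu> (h0 (diff C 1 x)) = 0[A]" using \<nu>d[OF x] \<mu>h0[OF dx] by simp
 hence "h0 (diff C 1 x) : diff D 1 ` carrier (obj D 1)" using D' hd by blast
 thus ?thesis using dx hd by(simp add: bhom_rules[OF Cb Db h0] D0.B.minus_eq)
 qed
 \<comment> \<open>In the scheme of \<open>extend_homs\<close>, zero is taken for \<open>f\<close>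
   and the negated differential for \<delta>, so that the equation solved there becomes d h = h
   d.\<close>
 have neg_hom: "(%x. -[obj C (n-1)] diff C n x) : bhom A (obj C n) (obj C (n-1))" for n
 by(rule bhom_uminus[OF Cb cpx_diff[OF C]])
 obtain h where h: "h 0 = h0" "!!n. n < 0 ==> h n = (%_. 0[obj D n])"
 "!!n. h n : bhom A (obj C n) (obj D n)"
 "!!n x. n >= 1 ==> x :> obj C n ==>
 diff D n (h n x) = 0[obj D (n-1)] -[obj D (n-1)] h (n-1) (-[obj C (n-1)] diff C n x)"
 proof (rule extend_homs[where M = "obj C" and N = "obj D" and e = "diff D" and ?h0.0 = h0
 and \<delta> = "%n x. -[obj C (n-1)] diff C n x" and f = "%n x. 0[obj D (n-1)]", OF Cb Db neg_hom])
 show "-[obj C (n - 1 - 1)] diff C (n-1) (-[obj C (n-1)] diff C n x) = 0[obj C (n-2)]"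
 if x: "x :> obj C n" for n x
 proof -
 interpret Z: is_bimodule K A "obj C (n-2)" by(rule Cb)
 have "diff C n x :> obj C (n-1)" using bhom_cl[OF cpx_diff[OF C] x] .
 thus ?thesis
 using cpx_diff_diff[OF C x] bhom_rules[OF Cb Cb cpx_diff[OF C, of "n - 1"]] by simp
 qed
 show "y : diff D (n+1) ` carrier (obj D (n+1))"
 if "1 <= n" "y :> obj D n" "diff D n y = 0[obj D (n-1)]" for n y
 using that D' by auto
 show "diff D (n-1) 0[obj D (n-1)] = 0[obj D (n - 1 - 1)]" for n
 using bhom_rules(3)[OF Db Db cpx_diff[OF Dc]] .
 qed (use h0 start lift in \<open>auto intro: bhom_zero[OF Db] cpx_diff[OF Dc]\<close>)
 have comm: "diff D n (h n x) = h (n-1) (diff C n x)" if x: "x :> obj C n" for n x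
 proof -
 interpret Z: is_bimodule K A "obj D (n-1)" by(rule Db)
 have dx: "diff C n x :> obj C (n-1)" using bhom_cl[OF cpx_diff[OF C] x] .
 show ?thesis
 proof (cases "n >= 1")
 case True
 thus ?thesis
 using h(4)[OF True x] dx by(simp add: bhom_rules[OF Cb Db h(3)] Z.B.minus_eq)
 next
 case False
 have "diff D n (h n x) = 0[obj D (n-1)]"
 using D' False bhom_cl[OF cpx_diff[OF Dc] bhom_cl[OF h(3) x]] by auto
 moreover have "h (n-1) (diff C n x) = 0[obj D (n-1)]" using False h(2) by simp
 ultimately show ?thesis by simp
 qed
 qed
 show thesis
 proof (rule that)
 show "h : bimodule_cpx_maps A C D" using h(3) by(simp add: bimodule_cpx_maps_def)
 show "commutes_with_diff C D h"
 unfolding commutes_with_diff_def bd_def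
 proof (intro allI ballI)
 fix n x assume x: "x :> obj C n"
 interpret Z: is_bimodule K A "obj D (n-1)" by(rule Db)
 have "h (n-1) (diff C n x) :> obj D (n-1)"
 using x bhom_cl[OF h(3)] bhom_cl[OF cpx_diff[OF C]] by blast
 thus "h (n-1) (diff C n x) -[obj D (n-1)] diff D n (h n x) = 0[obj D (n-1)]"
 using comm[OF x] by(simp add: Z.B.minus_eq Z.B.r_neg)
 qed
 show "\<mu> (h 0 x) = \<nu> x" if "x :> obj C 0" for x using that h(1) \<mu>h0 by simp
 qed
qed

text \<open>For \<open>k = 1\<close> the sign makes \<open>f\<close> a chain map into the shifted complex.\<close>

lemma null_homotopy:
 assumes C: "is_bimodule_cpx K A C" and D: "is_bimodule_cpx K A D"
 and exact: "!!n x. n > k ==> x :> obj D n ==> diff D n x = 0[obj D (n-1)] ==>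
 x : diff D (n+1) ` carrier (obj D (n+1))"
 and neg: "!!n. n < 0 ==> carrier (obj C n) = {0[obj C n]}"
 and lift: "!!n. lifts A (obj C n) (obj D (n + k + 1)) (obj D (n+k))"
 and f: "!!n. f n : bhom A (obj C n) (obj D (n+k))"
 and comm: "!!n x. n >= 1 ==> x :> obj C n ==>
 diff D (n+k) (f n x) = f (n-1) (signed (obj C (n-1)) k (diff C n x))"
 and start: "!!x. x :> obj C 0 ==> f 0 x : diff D (k+1) ` carrier (obj D (k+1))"
 obtains h where "!!n. h n : bhom A (obj C n) (obj D (n + k + 1))"
 and "!!n x. x :> obj C n ==> diff D (n + k + 1) (h n x)
 = f n x -[obj D (n+k)] h (n-1) (signed (obj C (n-1)) k (diff C n x))"
proof -
 note Cb = cpx_bim[OF C] and Db = cpx_bim[OF D]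
 \<comment> \<open>The homotopy raises degrees by k + 1, so D is re-indexed by this amount and its
   differential plays the part of \<open>e\<close>.\<close>
 let ?N = "%n. obj D (n + k + 1)"
 let ?\<delta> = "%n x. signed (obj C (n-1)) k (diff C n x)"
 have \<delta>: "?\<delta> n : bhom A (obj C n) (obj C (n-1))" for n
 by(rule bhom_signed[OF Cb cpx_diff[OF C]])
 have e: "diff D (n + k + 1) : bhom A (?N n) (?N (n-1))" for n
 using cpx_diff[OF D, of "n + k + 1"] by(simp add: algebra_simps)
 have Neq: "?N (n-1) = obj D (n+k)" for n by(simp add: algebra_simps)
 have \<delta>\<delta>: "?\<delta> (n-1) (?\<delta> n x) = 0[obj C (n-2)]" if x: "x :> obj C n" for n x
 proof -
 interpret Z: is_bimodule K A "obj C (n-2)" by(rule Cb)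
 have "diff C n x :> obj C (n-1)" using bhom_cl[OF cpx_diff[OF C] x] .
 thus ?thesis
 using cpx_diff_diff[OF C x] bhom_rules[OF Cb Cb cpx_diff[OF C, of "n - 1"]] by simp
 qed
 have e0: "diff D (k+1) : bhom A (obj D (k+1)) (obj D k)" using e[of 0] by(simp add: add.commute)
 obtain h0 where h0: "h0 : bhom A (obj C 0) (obj D (k+1))"
 and dh0: "!!x. x :> obj C 0 ==> diff D (k+1) (h0 x) = f 0 x"
 using lift[of 0] f[of 0] e0 start by(auto elim!: liftsD)
 obtain h where h: "h 0 = h0" "!!n. n < 0 ==> h n = (%_. 0[?N n])"
 "!!n. h n : bhom A (obj C n) (?N n)"
 "!!n x. n >= 1 ==> x :> obj C n ==>
 diff D (n + k + 1) (h n x) = f n x -[?N (n-1)] h (n-1) (?\<delta> n x)"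
 proof (rule extend_homs[where M = "obj C" and N = ?N and \<delta> = ?\<delta> and e = "%n. diff D (n + k + 1)"
 and f = f and ?h0.0 = h0, OF Cb Db \<delta> \<delta>\<delta> e])
 show "f n : bhom A (obj C n) (?N (n-1))" for n
 using f[of n] by(simp add: Neq)
 show "lifts A (obj C n) (?N n) (?N (n-1))" for n
 using lift[of n] by(simp add: Neq)
 show "y : diff D (n + 1 + k + 1) ` carrier (obj D (n + 1 + k + 1))"
 if "1 <= n" "y :> (?N n)" "diff D (n + k + 1) y = 0[?N (n-1)]" for n y
 using exact[of "n + k + 1" y] that by(simp add: Neq algebra_simps)
 show "diff D (n - 1 + k + 1) (f n x) = f (n-1) (?\<delta> n x)"
 if "2 <= n" "x :> obj C n" for n x
 using comm[of n x] that by(simp add: algebra_simps)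
 show "f 1 x -[obj D (0 + k + 1)] h0 (?\<delta> 1 x) : diff D (1 + k + 1) ` carrier (obj D (1 + k + 1))"
 if x: "x :> obj C 1" for x
 proof -
 interpret Z: is_bimodule K A "obj D k" by(rule Db)
 interpret Z1: is_bimodule K A "obj D (k+1)" by(rule Db)
 have dx: "?\<delta> 1 x :> obj C 0" using bhom_cl[OF \<delta> x] by simp
 have fx: "f 1 x :> obj D (k+1)" using bhom_cl[OF f x] by(simp add: add.commute)
 have hx: "h0 (?\<delta> 1 x) :> obj D (k+1)" using bhom_cl[OF h0 dx] .
 have f0: "f 0 (?\<delta> 1 x) :> obj D k" using bhom_cl[OF f dx] by simp
 have cm: "diff D (k+1) (f 1 x) = f 0 (?\<delta> 1 x)"
 using comm[of 1 x] x by(simp add: add.commute)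
 have "diff D (k+1) (f 1 x -[obj D (k+1)] h0 (?\<delta> 1 x)) = 0[obj D k]"
 using fx hx dh0[OF dx] f0
 by(simp add: bhom_rules[OF Db Db e0] cm Z.B.minus_eq Z.B.r_neg)
 thus ?thesis
 using exact[of "k + 1" "f 1 x -[obj D (k+1)] h0 (?\<delta> 1 x)"] Z1.B.minus_closed[OF fx hx]
 by(simp add: ac_simps)
 qed
 show "h0 : bhom A (obj C 0) (obj D (0 + k + 1))" using h0 by simp
 qed (assumption, rule that, assumption+)
 show thesis
 proof (rule that[OF h(3)])
 fix n x assume x: "x :> obj C n"
 interpret Z: is_bimodule K A "obj D (n+k)" by(rule Db)
 interpret Z0: is_bimodule K A "obj D k" by(rule Db)
 have fx: "f n x :> obj D (n+k)" using bhom_cl[OF f x] .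
 \<comment> \<open>\<open>extend_homs\<close> provides the equation in positive degrees only. In
   degree 0 it is the choice of \<open>h0\<close> together with the zero value in degree -1; in
   negative degrees C vanishes.\<close>
 consider "n >= 1" | "n = 0" | "n < 0" by linarith
 thus "diff D (n + k + 1) (h n x)
 = f n x -[obj D (n+k)] h (n-1) (signed (obj C (n-1)) k (diff C n x))"
 proof cases
 case 1 thus ?thesis using h(4)[OF 1 x] by(simp add: Neq)
 next
 case 2 thus ?thesis using h(1) h(2)[of "- 1"] dh0 x fx by simp
 next
 case 3
 hence "x = 0[obj C n]" using neg x by blast
 hence "f n x = 0[obj D (n+k)]" using bhom_rules(3)[OF Cb Db f] by simp
 moreover have "diff D (n + k + 1) 0[obj D (n + k + 1)] = 0[obj D (n+k)]"
 using bhom_rules(3)[OF Db Db e, of n] by(simp add: Neq)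
 ultimately show ?thesis using 3 h(2)[OF 3] h(2)[of "n - 1"] by(simp add: Neq)
 qed
 qed
qed

end

section \<open>Tensor products of complexes\<close>

definition tensor_lact ::
 "('a, 'p) bimodule_cpx => 'a => ('p, 'q) tensor_gen => ('p, 'q) tensor_gen" where
 "tensor_lact P = (%a ((i, x), (j, y)). ((i, lact (obj P i) a x), (j, y)))"

definition tensor_ract ::
 "('a, 'q) bimodule_cpx => ('p, 'q) tensor_gen => 'a => ('p, 'q) tensor_gen" where
 "tensor_ract Q = (%((i, x), (j, y)) a. ((i, x), (j, ract (obj Q j) y a)))"

lemma tensor_act_simps [simp]:
 "tensor_lact P a ((i, x), (j, y)) = ((i, lact (obj P i) a x), (j, y))"
 "tensor_ract Q ((i, x), (j, y)) a = ((i, x), (j, ract (obj Q j) y a))"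
 by(simp_all add: tensor_lact_def tensor_ract_def)

lemma tensor_obj_eq:
 "tensor_obj A P Q n = presented_bimodule (tensor_gens P Q n) (tensor_rels A P Q n)
 (tensor_lact P) (tensor_ract Q)"
 by(simp add: tensor_obj_def tensor_lact_def tensor_ract_def)

lemma tensor_gens_iff:
 "((i, x), (j, y)) : tensor_gens P Q n \<longleftrightarrow> i + j = n & x :> obj P i & y :> obj Q j"
 by(auto simp: tensor_gens_def)

lemma tensor_gens_cases:
 assumes "u : tensor_gens P Q n"
 obtains i x j y where "u = ((i, x), (j, y))" "i + j = n" "x :> obj P i" "y :> obj Q j"
 using assms by(auto simp: tensor_gens_def)

lemma tensor_rels_cases:
 assumes "u : tensor_rels A P Q n"
 obtains i x x' j y where "u = frag_of ((i, x +[obj P i] x'), (j, y)) - frag_of ((i, x), (j, y)) - frag_of ((i, x'), (j, y))"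
 "i + j = n" "x :> obj P i" "x' :> obj P i" "y :> obj Q j"
 | i x j y y' where "u = frag_of ((i, x), (j, y +[obj Q j] y')) - frag_of ((i, x), (j, y)) - frag_of ((i, x), (j, y'))"
 "i + j = n" "x :> obj P i" "y :> obj Q j" "y' :> obj Q j"
 | i x a j y where "u = frag_of ((i, ract (obj P i) x a), (j, y)) - frag_of ((i, x), (j, lact (obj Q j) a y))"
 "i + j = n" "x :> obj P i" "a :> A" "y :> obj Q j"
 using assms unfolding tensor_rels_def by blast

locale tensor_product = assoc_algebra K A
 for K :: "'k ring" and A :: "('k, 'a) module" +
 fixes P :: "('a, 'p) bimodule_cpx" and Q :: "('a, 'q) bimodule_cpx"
 assumes P: "is_bimodule_cpx K A P" and Q: "is_bimodule_cpx K A Q"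
begin

abbreviation "T n \<equiv> tensor_obj A P Q n"

abbreviation "tc n i x j y \<equiv> tensor_class A P Q n ((i, x), (j, y))"

lemmas PB = cpx_bim[OF P] and QB = cpx_bim[OF Q]

lemma presented: "presented_bimod K A (tensor_gens P Q n) (tensor_rels A P Q n) (tensor_lact P) (tensor_ract Q)"
proof -
 let ?S = "tensor_gens P Q n" and ?R = "tensor_rels A P Q n"
 note closed = is_bimodule.lact_closed[OF PB] is_bimodule.lact_closed[OF QB]
 is_bimodule.ract_closed[OF PB] is_bimodule.ract_closed[OF QB]
 have Pa: "x +[obj P i] x' :> obj P i" if "x :> obj P i" "x' :> obj P i" for x x' i
 proof -
 interpret is_bimodule K A "obj P i" by(rule PB)
 show ?thesis using that by simp
 qed
 have Qa: "x +[obj Q i] x' :> obj Q i" if "x :> obj Q i" "x' :> obj Q i" for x x' i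
 proof -
 interpret is_bimodule K A "obj Q i" by(rule QB)
 show ?thesis using that by simp
 qed
 have rels: "pkeys u <= ?S" if "u : ?R" for u
 using that
 by(cases rule: tensor_rels_cases)
 (auto simp: tensor_gens_iff Pa Qa closed dest!: subsetD[OF keys_frag_diff2] subsetD[OF keys_frag_diff3])
 interpret X: presented_group ?S ?R "presented ?S ?R"
 by(rule presented_groupI) (rule rels)
 note XG = X.abelian_group_presented
 have add1: "gen_class ?S ?R ((i, x +[obj P i] x'), (j, y))
 = gen_class ?S ?R ((i, x), (j, y)) +[presented ?S ?R] gen_class ?S ?R ((i, x'), (j, y))"
 if "i + j = n" "x :> obj P i" "x' :> obj P i" "y :> obj Q j" for i x x' j y
 by(rule X.gen_diff3) (use that Pa in \<open>auto simp: tensor_gens_iff tensor_rels_def\<close>)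
 have add2: "gen_class ?S ?R ((i, x), (j, y +[obj Q j] y'))
 = gen_class ?S ?R ((i, x), (j, y)) +[presented ?S ?R] gen_class ?S ?R ((i, x), (j, y'))"
 if "i + j = n" "x :> obj P i" "y' :> obj Q j" "y :> obj Q j" for i x j y y'
 by(rule X.gen_diff3) (use that Qa in \<open>auto simp: tensor_gens_iff tensor_rels_def\<close>)
 have bal: "gen_class ?S ?R ((i, ract (obj P i) x a), (j, y)) = gen_class ?S ?R ((i, x), (j, lact (obj Q j) a y))"
 if "i + j = n" "x :> obj P i" "a :> A" "y :> obj Q j" for i x j y a
 by(rule X.gen_diff2) (use that closed in \<open>auto simp: tensor_gens_iff tensor_rels_def\<close>)
 show ?thesis
 proof
 fix a u assume a: "a :> A" and u: "u : ?R"
 have l: "gen_class ?S ?R (tensor_lact P a x) :> (presented ?S ?R)"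
 and r: "gen_class ?S ?R (tensor_ract Q x a) :> (presented ?S ?R)" if "x : ?S" for x
 by(rule X.gen_closed; use that a in \<open>auto simp: tensor_gens_iff closed elim!: tensor_gens_cases\<close>)+
 show "frag_eval (presented ?S ?R) (%x. gen_class ?S ?R (tensor_lact P a x)) u = 0[presented ?S ?R]"
 using u
 proof (cases rule: tensor_rels_cases)
 case (1 i x x' j y)
 show ?thesis unfolding 1(1)
 by(rule X.frag_eval_diff3[OF XG l])
 (use 1 a in \<open>simp_all add: tensor_gens_iff Pa closed add1 is_bimodule.lact_add_right[OF PB]\<close>)
 next
 case (2 i x j y y')
 show ?thesis unfolding 2(1)
 by(rule X.frag_eval_diff3[OF XG l]) (use 2 a in \<open>simp_all add: tensor_gens_iff Qa closed add2\<close>)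
 next
 case (3 i x b j y)
 show ?thesis unfolding 3(1)
 by(rule X.frag_eval_diff2[OF XG l])
 (use 3 a in \<open>simp_all add: tensor_gens_iff closed bal is_bimodule.lact_ract[OF PB, symmetric]\<close>)
 qed
 show "frag_eval (presented ?S ?R) (%x. gen_class ?S ?R (tensor_ract Q x a)) u = 0[presented ?S ?R]"
 using u
 proof (cases rule: tensor_rels_cases)
 case (1 i x x' j y)
 show ?thesis unfolding 1(1)
 by(rule X.frag_eval_diff3[OF XG r])
 (use 1 a in \<open>simp_all add: tensor_gens_iff Pa closed add1\<close>)
 next
 case (2 i x j y y')
 show ?thesis unfolding 2(1)
 by(rule X.frag_eval_diff3[OF XG r])
 (use 2 a in \<open>simp_all add: tensor_gens_iff Qa closed add2 is_bimodule.ract_add_left[OF QB]\<close>)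
 next
 case (3 i x b j y)
 show ?thesis unfolding 3(1)
 by(rule X.frag_eval_diff2[OF XG r])
 (use 3 a in \<open>simp_all add: tensor_gens_iff closed bal is_bimodule.lact_ract[OF QB]\<close>)
 qed
 next
 fix c u assume c: "c :> K" and u: "u : ?S"
 from u obtain i x j y where u: "u = ((i, x), (j, y))" "i + j = n" "x :> obj P i" "y :> obj Q j"
 by(rule tensor_gens_cases)
 thus "gen_class ?S ?R (tensor_lact P (c .*[A] 1[A]) u) = gen_class ?S ?R (tensor_ract Q u (c .*[A] 1[A]))"
 using c by(simp add: bal is_bimodule.central[OF PB] scalar_closed) (simp add: is_bimodule.central[OF QB])
 qed (erule rels | elim tensor_gens_cases; simp add: tensor_gens_iff closed add1 add2
 is_bimodule.lact_add_left[OF PB] is_bimodule.ract_add_right[OF QB] is_bimodule.lact_mult[OF PB]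
 is_bimodule.ract_mult[OF QB] is_bimodule.lact_one[OF PB] is_bimodule.ract_one[OF QB])+
qed

lemma tensor_bim: "is_bimodule K A (T n)"
proof -
 interpret X: presented_bimod K A "tensor_gens P Q n" "tensor_rels A P Q n" "tensor_lact P" "tensor_ract Q"
 by(rule presented)
 show ?thesis using X.bimodule_M by(simp add: tensor_obj_eq)
qed

lemmas TG = is_bimodule.axioms(2)[OF tensor_bim] and PG = is_bimodule.axioms(2)[OF PB]
 and QG = is_bimodule.axioms(2)[OF QB]

lemma tc_closed:
 assumes "i + j = n" "x :> obj P i" "y :> obj Q j"
 shows "tc n i x j y :> T n"
proof -
 interpret X: presented_bimod K A "tensor_gens P Q n" "tensor_rels A P Q n" "tensor_lact P" "tensor_ract Q"
 by(rule presented)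
 show ?thesis
 unfolding tensor_class_def tensor_obj_eq by(rule X.M.gen_closed) (simp add: tensor_gens_iff assms)
qed

lemma tc_ahom1: assumes "i + j = n" "y :> obj Q j"
 shows "(%x. tc n i x j y) : ahom (obj P i) (T n)"
proof (rule ahomI)
 interpret is_bimodule K A "obj P i" by(rule PB)
 interpret X: presented_bimod K A "tensor_gens P Q n" "tensor_rels A P Q n" "tensor_lact P" "tensor_ract Q"
 by(rule presented)
 fix x x' assume x: "x :> obj P i" "x' :> obj P i"
 show "tc n i (x +[obj P i] x') j y = tc n i x j y +[T n] tc n i x' j y"
 unfolding tensor_class_def tensor_obj_eq
 by(rule X.M.gen_diff3) (use assms x in \<open>auto simp: tensor_gens_iff tensor_rels_def\<close>)
qed (simp add: assms tc_closed)

lemma tc_ahom2: assumes "i + j = n" "x :> obj P i"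
 shows "(%y. tc n i x j y) : ahom (obj Q j) (T n)"
proof (rule ahomI)
 interpret is_bimodule K A "obj Q j" by(rule QB)
 interpret X: presented_bimod K A "tensor_gens P Q n" "tensor_rels A P Q n" "tensor_lact P" "tensor_ract Q"
 by(rule presented)
 fix y y' assume y: "y :> obj Q j" "y' :> obj Q j"
 show "tc n i x j (y +[obj Q j] y') = tc n i x j y +[T n] tc n i x j y'"
 unfolding tensor_class_def tensor_obj_eq
 by(rule X.M.gen_diff3) (use assms y in \<open>auto simp: tensor_gens_iff tensor_rels_def\<close>)
qed (simp add: assms tc_closed)

lemmas tc_rules1 = ahom_rules[OF PG TG tc_ahom1] and tc_rules2 = ahom_rules[OF QG TG tc_ahom2]

lemma tc_bal:
 assumes "i + j = n" "x :> obj P i" "a :> A" "y :> obj Q j"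
 shows "tc n i (ract (obj P i) x a) j y = tc n i x j (lact (obj Q j) a y)"
proof -
 interpret X: presented_bimod K A "tensor_gens P Q n" "tensor_rels A P Q n" "tensor_lact P" "tensor_ract Q"
 by(rule presented)
 show ?thesis
 unfolding tensor_class_def
 by(rule X.M.gen_diff2)
 (use assms is_bimodule.ract_closed[OF PB] is_bimodule.lact_closed[OF QB] in
 \<open>auto simp: tensor_gens_iff tensor_rels_def\<close>)
qed

lemma lact_tc:
 assumes "i + j = n" "x :> obj P i" "a :> A" "y :> obj Q j"
 shows "lact (T n) a (tc n i x j y) = tc n i (lact (obj P i) a x) j y"
proof -
 interpret X: presented_bimod K A "tensor_gens P Q n" "tensor_rels A P Q n" "tensor_lact P" "tensor_ract Q"
 by(rule presented)
 show ?thesis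
 unfolding tensor_class_def tensor_obj_eq using assms by(simp add: X.lact_M tensor_gens_iff)
qed

lemma ract_tc:
 assumes "i + j = n" "x :> obj P i" "a :> A" "y :> obj Q j"
 shows "ract (T n) (tc n i x j y) a = tc n i x j (ract (obj Q j) y a)"
proof -
 interpret X: presented_bimod K A "tensor_gens P Q n" "tensor_rels A P Q n" "tensor_lact P" "tensor_ract Q"
 by(rule presented)
 show ?thesis
 unfolding tensor_class_def tensor_obj_eq using assms by(simp add: X.ract_M tensor_gens_iff)
qed

lemma tensor_ext:
 assumes "abelian_group Z" "f : ahom (T n) Z" "g : ahom (T n) Z" "t :> T n"
 and eq: "!!i x j y. i + j = n ==> x :> obj P i ==> y :> obj Q j ==>
 f (tc n i x j y) = g (tc n i x j y)"
 shows "f t = g t"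
proof -
 interpret X: presented_bimod K A "tensor_gens P Q n" "tensor_rels A P Q n" "tensor_lact P" "tensor_ract Q"
 by(rule presented)
 show ?thesis
 by(rule X.M.hom_ext[OF assms(1) assms(2,3)[unfolded tensor_obj_eq] _ assms(4)[unfolded tensor_obj_eq]])
 (elim tensor_gens_cases, simp add: eq[unfolded tensor_class_def])
qed

lemma tensor_lift:
 assumes Z: "abelian_group Z"
 and closed: "!!i x j y. i + j = n ==> x :> obj P i ==> y :> obj Q j ==> G i x j y :> Z"
 and add1: "!!i x x' j y. i + j = n ==> x :> obj P i ==> x' :> obj P i ==> y :> obj Q j ==>
 G i (x +[obj P i] x') j y = G i x j y +[Z] G i x' j y"
 and add2: "!!i x j y y'. i + j = n ==> x :> obj P i ==> y :> obj Q j ==> y' :> obj Q j ==>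
 G i x j (y +[obj Q j] y') = G i x j y +[Z] G i x j y'"
 and bal: "!!i x j y a. i + j = n ==> x :> obj P i ==> y :> obj Q j ==> a :> A ==>
 G i (ract (obj P i) x a) j y = G i x j (lact (obj Q j) a y)"
 shows "plift Z (%((i, x), (j, y)). G i x j y) : ahom (T n) Z"
 and "!!i x j y. i + j = n ==> x :> obj P i ==> y :> obj Q j ==>
 plift Z (%((i, x), (j, y)). G i x j y) (tc n i x j y) = G i x j y"
proof -
 interpret X: presented_bimod K A "tensor_gens P Q n" "tensor_rels A P Q n" "tensor_lact P" "tensor_ract Q"
 by(rule presented)
 let ?f = "%((i, x), (j, y)). G i x j y"
 have f: "?f u :> Z" if "u : tensor_gens P Q n" for u
 using that by(auto elim!: tensor_gens_cases intro: closed)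
 have Pa: "x +[obj P i] x' :> obj P i" if "x :> obj P i" "x' :> obj P i" for x x' i
 using PG that by(simp add: abelian_group_def abelian_monoid.a_closed)
 have Qa: "x +[obj Q i] x' :> obj Q i" if "x :> obj Q i" "x' :> obj Q i" for x x' i
 using QG that by(simp add: abelian_group_def abelian_monoid.a_closed)
 have R: "frag_eval Z ?f u = 0[Z]" if "u : tensor_rels A P Q n" for u
 using that
 proof (cases rule: tensor_rels_cases)
 case (1 i x x' j y)
 show ?thesis unfolding 1(1)
 by(rule X.M.frag_eval_diff3[OF Z f]) (use 1 in \<open>simp_all add: tensor_gens_iff add1 Pa\<close>)
 next
 case (2 i x j y y')
 show ?thesis unfolding 2(1)
 by(rule X.M.frag_eval_diff3[OF Z f]) (use 2 in \<open>simp_all add: tensor_gens_iff add2 Qa\<close>)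
 next
 case (3 i x b j y)
 show ?thesis unfolding 3(1)
 by(rule X.M.frag_eval_diff2[OF Z f])
 (use 3 in \<open>simp_all add: tensor_gens_iff bal is_bimodule.ract_closed[OF PB] is_bimodule.lact_closed[OF QB]\<close>)
 qed
 show "plift Z ?f : ahom (T n) Z"
 unfolding tensor_obj_eq by(rule X.M.lift_hom[OF Z f R])
 show "plift Z ?f (tc n i x j y) = G i x j y"
 if "i + j = n" "x :> obj P i" "y :> obj Q j" for i x j y
 unfolding tensor_class_def
 using X.M.lift_hom(2)[OF Z f R, of "((i, x), (j, y))"] that by(simp add: tensor_gens_iff)
qed

lemma tensor_bim_homI:
 assumes Z: "is_bimodule K A Z" and f: "f : ahom (T n) Z"
 and l: "!!i x j y a. i + j = n ==> x :> obj P i ==> y :> obj Q j ==> a :> A ==>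
 f (tc n i (lact (obj P i) a x) j y) = lact Z a (f (tc n i x j y))"
 and r: "!!i x j y a. i + j = n ==> x :> obj P i ==> y :> obj Q j ==> a :> A ==>
 f (tc n i x j (ract (obj Q j) y a)) = ract Z (f (tc n i x j y)) a"
 shows "f : bhom A (T n) Z"
proof (rule bimodule_homI[OF f])
 interpret Z: is_bimodule K A Z by(rule Z)
 interpret T: is_bimodule K A "T n" by(rule tensor_bim)
 fix a t assume a: "a :> A" and t: "t :> T n"
 show "f (lact (T n) a t) = lact Z a (f t)"
 by(rule tensor_ext[OF Z.B.abelian_group_axioms ahom_comp[OF T.lact_ahom[OF a] f] ahom_comp[OF f Z.lact_ahom[OF a]] t])
 (simp add: lact_tc l a)
 show "f (ract (T n) t a) = ract Z (f t) a"
 by(rule tensor_ext[OF Z.B.abelian_group_axioms ahom_comp[OF T.ract_ahom[OF a] f] ahom_comp[OF f Z.ract_ahom[OF a]] t])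
 (simp add: ract_tc r a)
qed

lemma obj_tensor [simp]: "obj (tensor A P Q) = tensor_obj A P Q"
 by(simp add: tensor_def)

lemma tensor_diff:
 shows "diff (tensor A P Q) n : bhom A (T n) (T (n-1))"
 and "!!i x j y. i + j = n ==> x :> obj P i ==> y :> obj Q j ==>
 diff (tensor A P Q) n (tc n i x j y) = tc (n-1) (i-1) (diff P i x) j y +[T (n-1)]
 signed (T (n-1)) i (tc (n-1) i x (j-1) (diff Q j y))"
proof -
 let ?m = "n - 1"
 interpret T: is_bimodule K A "T ?m" by(rule tensor_bim)
 define G where "G = (%i x j y. tc ?m (i-1) (diff P i x) j y +[T ?m] signed (T ?m) i (tc ?m i x (j-1) (diff Q j y)))"
 have D: "diff (tensor A P Q) n = plift (T ?m) (%((i, x), (j, y)). G i x j y)"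
 by(simp add: tensor_def G_def)
 note dP = bhom_rules[OF PB PB cpx_diff[OF P]] and dQ = bhom_rules[OF QB QB cpx_diff[OF Q]]
 have ac: "a +[T ?m] b +[T ?m] (c +[T ?m] d) = a +[T ?m] c +[T ?m] (b +[T ?m] d)"
 if "a :> (T ?m)" "b :> (T ?m)" "c :> (T ?m)" "d :> (T ?m)" for a b c d
 using that by(simp add: T.B.a_ac)
 note sgl = ahom_rules(6)[OF TG TG T.lact_ahom] and sgr = ahom_rules(6)[OF TG TG T.ract_ahom]
 have L: "plift (T ?m) (%((i, x), (j, y)). G i x j y) : ahom (T n) (T ?m)"
 and v: "!!i x j y. i + j = n ==> x :> obj P i ==> y :> obj Q j ==>
 plift (T ?m) (%((i, x), (j, y)). G i x j y) (tc n i x j y) = G i x j y"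
 by(rule tensor_lift; simp add: G_def TG tc_closed dP dQ tc_rules1 tc_rules2 ac T.B.signed_add tc_bal
 is_bimodule.lact_closed[OF QB] is_bimodule.ract_closed[OF PB])+
 show "diff (tensor A P Q) n : bhom A (T n) (T ?m)" unfolding D
 by(rule tensor_bim_homI[OF tensor_bim L])
 (simp_all add: v is_bimodule.lact_closed[OF PB] is_bimodule.ract_closed[OF QB],
 simp_all add: G_def dP dQ tc_closed T.lact_add_right T.ract_add_left lact_tc ract_tc sgl sgr)
 show "diff (tensor A P Q) n (tc n i x j y) = tc ?m (i-1) (diff P i x) j y +[T ?m]
 signed (T ?m) i (tc ?m i x (j-1) (diff Q j y))"
 if "i + j = n" "x :> obj P i" "y :> obj Q j" for i x j y
 using that by(simp add: D v) (simp add: G_def)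
qed

lemma tensor_is_cpx: "is_bimodule_cpx K A (tensor A P Q)"
 unfolding is_bimodule_cpx_def obj_tensor
proof (intro conjI allI ballI)
 fix n t assume t: "t :> T n"
 let ?m = "n - 1" and ?k = "n - 2"
 let ?d = "diff (tensor A P Q)"
 interpret T: is_bimodule K A "T ?k" by(rule tensor_bim)
 note dP = bhom_rules[OF PB PB cpx_diff[OF P]] and dQ = bhom_rules[OF QB QB cpx_diff[OF Q]]
 have d1: "?d n : ahom (T n) (T ?m)" by(rule bhom_ahom[OF tensor_diff(1)])
 have d2: "?d ?m : ahom (T ?m) (T ?k)" using bhom_ahom[OF tensor_diff(1)[of ?m]] by simp
 note d2r = ahom_rules[OF TG TG d2]
 have v: "?d ?m (tc ?m i x j y) = tc ?k (i-1) (diff P i x) j y +[T ?k]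
 signed (T ?k) i (tc ?k i x (j-1) (diff Q j y))"
 if "i + j = ?m" "x :> obj P i" "y :> obj Q j" for i x j y
 using tensor_diff(2)[of i j ?m x y] that by simp
 show "?d ?m (?d n t) = 0[T ?k]"
 proof (rule tensor_ext[OF TG ahom_comp[OF d1 d2] ahom_const_zero[OF TG] t])
 fix i x j y assume ij: "i + j = n" and x: "x :> obj P i" and y: "y :> obj Q j"
 have xx: "diff P (i-1) (diff P i x) = 0[obj P (i-2)]" using cpx_diff_diff[OF P x] by simp
 have yy: "diff Q (j-1) (diff Q j y) = 0[obj Q (j-2)]" using cpx_diff_diff[OF Q y] by simp
 have dx: "diff P i x :> obj P (i-1)" and dy: "diff Q j y :> obj Q (j-1)"
 using x y by(simp_all add: dP dQ)
 let ?w = "tc ?k (i-1) (diff P i x) (j-1) (diff Q j y)"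
 have w: "?w :> (T ?k)" using dx dy ij by(simp add: tc_closed)
 have z1: "tc ?k (i-2) 0[obj P (i-2)] j y = 0[T ?k]"
 using ij y by(intro tc_rules1(3)) simp_all
 have z2: "tc ?k i x (j-2) 0[obj Q (j-2)] = 0[T ?k]"
 using ij x by(intro tc_rules2(3)) simp_all
 \<comment> \<open>The two terms with a double differential vanish; the mixed term d x \<otimes> d y
   occurs once with sign exponent i - 1 and once with i.\<close>
 have "?d ?m (?d n (tc n i x j y)) = 0[T ?k] +[T ?k] signed (T ?k) (i-1) ?w
 +[T ?k] signed (T ?k) i (?w +[T ?k] signed (T ?k) i 0[T ?k])"
 using ij x y dx dy
 by(simp add: tensor_diff(2) d2r tc_closed v xx yy z1 z2 abelian_group.signed_closed[OF TG])
 also have "... = 0[T ?k]"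
 using w by(simp add: signed_def T.B.l_neg T.B.r_neg)
 finally show "?d ?m (?d n (tc n i x j y)) = 0[T ?k]" .
 qed
qed (simp_all add: tensor_bim tensor_diff(1))

lemma tensor_neg:
 assumes "!!i. i < 0 ==> carrier (obj P i) = {0[obj P i]}" "!!j. j < 0 ==> carrier (obj Q j) = {0[obj Q j]}"
 and n: "n < 0"
 shows "carrier (T n) = {0[T n]}"
proof -
 interpret T: is_bimodule K A "T n" by(rule tensor_bim)
 have "t = 0[T n]" if t: "t :> T n" for t
 proof (rule tensor_ext[OF TG ahom_id ahom_const_zero[OF TG] t])
 fix i x j y assume ij: "i + j = n" and x: "x :> obj P i" and y: "y :> obj Q j"
 then consider "i < 0" | "j < 0" using n by linarith
 thus "tc n i x j y = 0[T n]"
 proof cases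
 case 1
 hence "x = 0[obj P i]" using assms x by blast
 thus ?thesis using tc_rules1(3)[OF ij y] by simp
 next
 case 2
 hence "y = 0[obj Q j]" using assms y by blast
 thus ?thesis using tc_rules2(3)[OF ij x] by simp
 qed
 qed
 thus ?thesis by auto
qed

end

lemma tensor_map_hom:
 assumes "tensor_product K A R S" "tensor_product K A P Q"
 and f: "f : bimodule_cpx_maps A R P" and g: "g : bimodule_cpx_maps A S Q"
 shows "tensor_map A P Q f g n : bhom A (tensor_obj A R S n) (tensor_obj A P Q n)"
 and "!!i x j y. i + j = n ==> x :> obj R i ==> y :> obj S j ==>
 tensor_map A P Q f g n (tensor_class A R S n ((i, x), (j, y))) = tensor_class A P Q n ((i, f i x), (j, g j y))"
proof -
 interpret R: tensor_product K A R S by fact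
 interpret P: tensor_product K A P Q by fact
 note fr = bhom_rules[OF R.PB P.PB cpx_maps_hom[OF f]] and gr = bhom_rules[OF R.QB P.QB cpx_maps_hom[OF g]]
 have L: "tensor_map A P Q f g n : ahom (R.T n) (P.T n)"
 and v: "!!i x j y. i + j = n ==> x :> obj R i ==> y :> obj S j ==>
 tensor_map A P Q f g n (R.tc n i x j y) = P.tc n i (f i x) j (g j y)"
 unfolding tensor_map_def
 by(rule R.tensor_lift[where G = "%i x j y. P.tc n i (f i x) j (g j y)"];
 simp add: P.TG fr gr P.tc_closed P.tc_rules1 P.tc_rules2 P.tc_bal)+
 show "tensor_map A P Q f g n : bhom A (R.T n) (P.T n)"
 by(rule R.tensor_bim_homI[OF P.tensor_bim L])
 (simp_all add: v fr gr P.lact_tc P.ract_tc is_bimodule.lact_closed[OF R.PB] is_bimodule.ract_closed[OF R.QB])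
 show "!!i x j y. i + j = n ==> x :> obj R i ==> y :> obj S j ==>
 tensor_map A P Q f g n (R.tc n i x j y) = P.tc n i (f i x) j (g j y)"
 by(rule v)
qed

lemma tensor_map_chain:
 assumes "tensor_product K A R S" "tensor_product K A P Q"
 and f: "f : bimodule_cpx_maps A R P" "commutes_with_diff R P f"
 and g: "g : bimodule_cpx_maps A S Q" "commutes_with_diff S Q g"
 and t: "t :> tensor_obj A R S n"
 shows "diff (tensor A P Q) n (tensor_map A P Q f g n t) = tensor_map A P Q f g (n-1) (diff (tensor A R S) n t)"
proof -
 interpret R: tensor_product K A R S by fact
 interpret P: tensor_product K A P Q by fact
 note m = tensor_map_hom[OF assms(1,2) f(1) g(1)]
 note fr = bhom_rules[OF R.PB P.PB cpx_maps_hom[OF f(1)]] and gr = bhom_rules[OF R.QB P.QB cpx_maps_hom[OF g(1)]]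
 note dR = bhom_cl[OF cpx_diff[OF R.P]] and dS = bhom_cl[OF cpx_diff[OF R.Q]]
 show ?thesis
 proof (rule R.tensor_ext[OF P.TG _ _ t])
 show "(%t. diff (tensor A P Q) n (tensor_map A P Q f g n t)) : ahom (R.T n) (P.T (n-1))"
 using bhom_ahom[OF bhom_comp[OF m(1) P.tensor_diff(1)]] .
 show "(%t. tensor_map A P Q f g (n-1) (diff (tensor A R S) n t)) : ahom (R.T n) (P.T (n-1))"
 using bhom_ahom[OF bhom_comp[OF R.tensor_diff(1) m(1)]] .
 fix i x j y assume "i + j = n" "x :> obj R i" "y :> obj S j"
 thus "diff (tensor A P Q) n (tensor_map A P Q f g n (R.tc n i x j y))
 = tensor_map A P Q f g (n-1) (diff (tensor A R S) n (R.tc n i x j y))"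
 by(simp add: m(2) P.tensor_diff(2) R.tensor_diff(2) fr gr R.tc_closed dR dS
 ahom_rules[OF R.TG P.TG bhom_ahom[OF m(1)]] is_bimodule.axioms(2)[OF R.tensor_bim]
 abelian_group.signed_closed[OF R.TG] chain_mapD[OF R.P P.P f] chain_mapD[OF R.Q P.Q g])
 qed
qed

section \<open>Augmentations and counits\<close>

context assoc_algebra
begin

lemma tensor_productI: "is_bimodule_cpx K A P ==> is_bimodule_cpx K A Q ==> tensor_product K A P Q"
 by(rule tensor_product.intro[OF assoc_algebra_axioms tensor_product_axioms.intro])

lemma stalk_is_cpx: "is_bimodule_cpx K A (stalk A)"
proof -
 interpret R: is_bimodule K A "reg_bim A" by(rule reg_bim)
 let ?Z = "(reg_bim A)\<lparr>carrier := {0[A]}\<rparr>"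
 have zero: "0[reg_bim A] = 0[A]" "carrier (reg_bim A) = carrier A"
 "ring.add (reg_bim A) = ring.add A" "lact (reg_bim A) = monoid.mult A"
 "ract (reg_bim A) = monoid.mult A"
 by(simp_all add: regular_bimodule_def)
 have Z: "abelian_group ?Z"
 by(rule abelian_groupI) (simp_all add: zero)
 have Zb: "is_bimodule K A ?Z"
 by(intro is_bimodule.intro is_bimodule_axioms.intro assoc_algebra_axioms Z) (simp_all add: zero scalar_closed)
 have o: "obj (stalk A) n = (if n = 0 then reg_bim A else ?Z)" for n
 by(simp add: stalk_def)
 have b: "is_bimodule K A (obj (stalk A) n)" for n
 by(simp add: o Zb reg_bim)
 have z: "0[obj (stalk A) n] = 0[A]" for n by(simp add: o zero)
 have d: "diff (stalk A) n = (%x. 0[A])" for n by(simp add: stalk_def)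
 have "(%x. 0[A]) : bhom A (obj (stalk A) n) (obj (stalk A) m)" for n m
 using bhom_zero[OF b, of m] unfolding z .
 thus ?thesis unfolding is_bimodule_cpx_def d z using b by simp
qed

lemma stalk_obj_0: "obj (stalk A) 0 = reg_bim A"
 by(simp add: stalk_def)

lemma stalk_zero: "0[obj (stalk A) n] = 0[A]"
 by(simp add: stalk_def regular_bimodule_def)

lemma regular_simps:
 "carrier (reg_bim A) = carrier A" "0[reg_bim A] = 0[A]"
 "ring.add (reg_bim A) = ring.add A" "lact (reg_bim A) = monoid.mult A"
 "ract (reg_bim A) = monoid.mult A"
 by(simp_all add: regular_bimodule_def)

lemma extend_by_zero_map:
 assumes "\<mu> : bhom A (obj P 0) (reg_bim A)"
 shows "extend_by_zero A \<mu> : bimodule_cpx_maps A P (stalk A)"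
 unfolding bimodule_cpx_maps_def
proof (intro CollectI allI)
 fix n
 show "extend_by_zero A \<mu> n : bhom A (obj P n) (obj (stalk A) n)"
 proof (cases "n = 0")
 case True
 have "extend_by_zero A \<mu> 0 = \<mu>" by(simp add: extend_by_zero_def fun_eq_iff)
 thus ?thesis using assms True by(simp add: stalk_obj_0)
 next
 case False
 have "extend_by_zero A \<mu> n = (%x. 0[obj (stalk A) n])"
 using False by(simp add: extend_by_zero_def fun_eq_iff stalk_zero)
 thus ?thesis using bhom_zero[OF cpx_bim[OF stalk_is_cpx]] by simp
 qed
qed

lemma left_unit_hom:
 assumes P: "is_bimodule_cpx K A P"
 shows "left_unit A P n : bhom A (tensor_obj A (stalk A) P n) (obj P n)"
 and "!!i a j y. i + j = n ==> a :> obj (stalk A) i ==> y :> obj P j ==>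
 left_unit A P n (tensor_class A (stalk A) P n ((i, a), (j, y)))
 = (if i = 0 then lact (obj P j) a y else 0[obj P n])"
proof -
 interpret T: tensor_product K A "stalk A" P
 by(rule tensor_productI[OF stalk_is_cpx P])
 interpret N: is_bimodule K A "obj P n" by(rule cpx_bim[OF P])
 have L: "left_unit A P n : ahom (T.T n) (obj P n)"
 and v: "!!i a j y. i + j = n ==> a :> obj (stalk A) i ==> y :> obj P j ==>
 left_unit A P n (tensor_class A (stalk A) P n ((i, a), (j, y)))
 = (if i = 0 then lact (obj P j) a y else 0[obj P n])"
 unfolding left_unit_def
 by(rule T.tensor_lift[where G = "%i a j y. if i = 0 then lact (obj P j) a y else 0[obj P n]"];
 auto simp: N.B.abelian_group_axioms stalk_obj_0 regular_simps is_bimodule.lact_closed[OF T.QB]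
 is_bimodule.lact_add_left[OF T.QB] is_bimodule.lact_add_right[OF T.QB] is_bimodule.lact_mult[OF T.QB])+
 show "left_unit A P n : bhom A (T.T n) (obj P n)"
 by(rule T.tensor_bim_homI[OF cpx_bim[OF P] L])
 (auto simp: v stalk_obj_0 regular_simps N.lact_mult N.lact_rules N.ract_rules N.lact_ract
 is_bimodule.lact_closed[OF T.PB] is_bimodule.ract_closed[OF T.QB])
 show "!!i a j y. i + j = n ==> a :> obj (stalk A) i ==> y :> obj P j ==>
 left_unit A P n (tensor_class A (stalk A) P n ((i, a), (j, y)))
 = (if i = 0 then lact (obj P j) a y else 0[obj P n])" by(rule v)
qed

lemma right_unit_hom:
 assumes P: "is_bimodule_cpx K A P"
 shows "right_unit A P n : bhom A (tensor_obj A P (stalk A) n) (obj P n)"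
 and "!!i x j a. i + j = n ==> x :> obj P i ==> a :> obj (stalk A) j ==>
 right_unit A P n (tensor_class A P (stalk A) n ((i, x), (j, a)))
 = (if j = 0 then ract (obj P i) x a else 0[obj P n])"
proof -
 interpret T: tensor_product K A P "stalk A"
 by(rule tensor_productI[OF P stalk_is_cpx])
 interpret N: is_bimodule K A "obj P n" by(rule cpx_bim[OF P])
 have L: "right_unit A P n : ahom (T.T n) (obj P n)"
 and v: "!!i x j a. i + j = n ==> x :> obj P i ==> a :> obj (stalk A) j ==>
 right_unit A P n (tensor_class A P (stalk A) n ((i, x), (j, a)))
 = (if j = 0 then ract (obj P i) x a else 0[obj P n])"
 unfolding right_unit_def
 by(rule T.tensor_lift[where G = "%i x j a. if j = 0 then ract (obj P i) x a else 0[obj P n]"];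
 auto simp: N.B.abelian_group_axioms stalk_obj_0 regular_simps is_bimodule.ract_closed[OF T.PB]
 is_bimodule.ract_add_left[OF T.PB] is_bimodule.ract_add_right[OF T.PB] is_bimodule.ract_mult[OF T.PB])+
 show "right_unit A P n : bhom A (T.T n) (obj P n)"
 by(rule T.tensor_bim_homI[OF cpx_bim[OF P] L])
 (auto simp: v stalk_obj_0 regular_simps N.ract_mult N.lact_rules N.ract_rules N.lact_ract
 is_bimodule.lact_closed[OF T.PB] is_bimodule.ract_closed[OF T.QB])
 show "!!i x j a. i + j = n ==> x :> obj P i ==> a :> obj (stalk A) j ==>
 right_unit A P n (tensor_class A P (stalk A) n ((i, x), (j, a)))
 = (if j = 0 then ract (obj P i) x a else 0[obj P n])" by(rule v)
qed

end

lemma bimodule_cpx_maps_id: "(%i x. x) : bimodule_cpx_maps A P P"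
 by(simp add: bimodule_cpx_maps_def bhom_id)

locale augmented_cpx = assoc_algebra K A
 for K :: "'k ring" and A :: "('k, 'a) module" +
 fixes P :: "('a, 'p) bimodule_cpx" and \<mu> :: "'p => 'a"
 assumes P: "is_bimodule_cpx K A P"
 and \<mu>: "\<mu> : bhom A (obj P 0) (reg_bim A)"
 and \<mu>_d: "!!x. x :> obj P 1 ==> \<mu> (diff P 1 x) = 0[A]"
begin

sublocale PP: tensor_product K A P P
 by(rule tensor_productI[OF P P])

text \<open>\<open>cl\<close> is \<mu> \<otimes> 1 and \<open>cr\<close> is 1 \<otimes> \<mu>, with
  values read in P. The two halves of \<open>counit_difference\<close> are kept apart because the
  swap on the trace exchanges them.\<close>

definition cl :: "int => ('p, 'p) tensor_gen fab => 'p" where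
 "cl n t = left_unit A P n (tensor_map A (stalk A) P (extend_by_zero A \<mu>) (%i x. x) n t)"

definition cr :: "int => ('p, 'p) tensor_gen fab => 'p" where
 "cr n t = right_unit A P n (tensor_map A P (stalk A) (%i x. x) (extend_by_zero A \<mu>) n t)"

lemma counit_difference_eq: "counit_difference A P \<mu> n t = cl n t -[obj P n] cr n t"
 by(simp add: counit_difference_def cl_def cr_def)

lemma \<mu>_rules:
 "x :> obj P 0 ==> \<mu> x :> A"
 "a :> A ==> x :> obj P 0 ==> \<mu> (lact (obj P 0) a x) = a *[A] \<mu> x"
 "a :> A ==> x :> obj P 0 ==> \<mu> (ract (obj P 0) x a) = \<mu> x *[A] a"
 "x :> obj P 0 ==> y :> obj P 0 ==> \<mu> (x +[obj P 0] y) = \<mu> x +[A] \<mu> y"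
 "\<mu> 0[obj P 0] = 0[A]"
 using bhom_rules[OF PP.PB reg_bim \<mu>] by(simp_all add: regular_simps)

lemma stalk_products:
 "tensor_product K A (stalk A) P" "tensor_product K A P (stalk A)" "tensor_product K A (stalk A) (stalk A)"
 by(rule tensor_productI[OF stalk_is_cpx P] tensor_productI[OF P stalk_is_cpx] tensor_productI[OF stalk_is_cpx stalk_is_cpx])+

lemma cl_hom: "cl n : bhom A (PP.T n) (obj P n)"
 unfolding cl_def
 using bhom_comp[OF tensor_map_hom(1)[OF PP.tensor_product_axioms stalk_products(1)
 extend_by_zero_map[OF \<mu>] bimodule_cpx_maps_id] left_unit_hom(1)[OF P]] .

lemma cr_hom: "cr n : bhom A (PP.T n) (obj P n)"
 unfolding cr_def
 using bhom_comp[OF tensor_map_hom(1)[OF PP.tensor_product_axioms stalk_products(2)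
 bimodule_cpx_maps_id extend_by_zero_map[OF \<mu>]] right_unit_hom(1)[OF P]] .

lemma cl_tc:
 assumes "i + j = n" "x :> obj P i" "y :> obj P j"
 shows "cl n (PP.tc n i x j y) = (if i = 0 then lact (obj P j) (\<mu> x) y else 0[obj P n])"
proof -
 have "extend_by_zero A \<mu> i x :> obj (stalk A) i"
 using bhom_cl[OF cpx_maps_hom[OF extend_by_zero_map[OF \<mu>]] assms(2)] .
 moreover have "cl n (PP.tc n i x j y)
 = left_unit A P n (tensor_class A (stalk A) P n ((i, extend_by_zero A \<mu> i x), (j, y)))"
 unfolding cl_def using tensor_map_hom(2)[OF PP.tensor_product_axioms stalk_products(1)
 extend_by_zero_map[OF \<mu>] bimodule_cpx_maps_id assms] by simp
 ultimately show ?thesis using assms by(simp add: left_unit_hom(2)[OF P]) (simp add: extend_by_zero_def)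
qed

lemma cr_tc:
 assumes "i + j = n" "x :> obj P i" "y :> obj P j"
 shows "cr n (PP.tc n i x j y) = (if j = 0 then ract (obj P i) x (\<mu> y) else 0[obj P n])"
proof -
 have "extend_by_zero A \<mu> j y :> obj (stalk A) j"
 using bhom_cl[OF cpx_maps_hom[OF extend_by_zero_map[OF \<mu>]] assms(3)] .
 moreover have "cr n (PP.tc n i x j y)
 = right_unit A P n (tensor_class A P (stalk A) n ((i, x), (j, extend_by_zero A \<mu> j y)))"
 unfolding cr_def using tensor_map_hom(2)[OF PP.tensor_product_axioms stalk_products(2)
 bimodule_cpx_maps_id extend_by_zero_map[OF \<mu>] assms] by simp
 ultimately show ?thesis using assms by(simp add: right_unit_hom(2)[OF P]) (simp add: extend_by_zero_def)
qed

lemma cl_diff: assumes t: "t :> PP.T n"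
 shows "diff P n (cl n t) = cl (n-1) (diff (tensor A P P) n t)"
proof (rule PP.tensor_ext[OF PP.PG _ _ t])
 show "(%t. diff P n (cl n t)) : ahom (PP.T n) (obj P (n-1))"
 using bhom_ahom[OF bhom_comp[OF cl_hom cpx_diff[OF P]]] .
 show "(%t. cl (n-1) (diff (tensor A P P) n t)) : ahom (PP.T n) (obj P (n-1))"
 using bhom_ahom[OF bhom_comp[OF PP.tensor_diff(1) cl_hom]] .
 interpret N: is_bimodule K A "obj P (n-1)" by(rule PP.PB)
 note d = bhom_rules[OF PP.PB PP.PB cpx_diff[OF P]] and c = ahom_rules[OF PP.TG PP.PG bhom_ahom[OF cl_hom]]
 fix i x j y assume ij: "i + j = n" and x: "x :> obj P i" and y: "y :> obj P j"
 hence dx: "diff P i x :> obj P (i-1)" and dy: "diff P j y :> obj P (j-1)" by(simp_all add: d)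
 have E: "cl (n-1) (diff (tensor A P P) n (PP.tc n i x j y))
 = cl (n-1) (PP.tc (n-1) (i-1) (diff P i x) j y)
 +[obj P (n-1)] signed (obj P (n-1)) i (cl (n-1) (PP.tc (n-1) i x (j-1) (diff P j y)))"
 using ij x y dx dy
 by(simp add: PP.tensor_diff(2) PP.tc_closed c abelian_group.signed_closed[OF PP.TG])
 have c0: "cl n (PP.tc n i x j y) = (if i = 0 then lact (obj P j) (\<mu> x) y else 0[obj P n])"
 using ij x y by(rule cl_tc)
 have c1: "cl (n-1) (PP.tc (n-1) (i-1) (diff P i x) j y)
 = (if i - 1 = 0 then lact (obj P j) (\<mu> (diff P i x)) y else 0[obj P (n-1)])"
 using ij dx y by(intro cl_tc) simp_all
 have c2: "cl (n-1) (PP.tc (n-1) i x (j-1) (diff P j y))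
 = (if i = 0 then lact (obj P (j-1)) (\<mu> x) (diff P j y) else 0[obj P (n-1)])"
 using ij x dy by(intro cl_tc) simp_all
 \<comment> \<open>For i = 1 the counit of the tensor is zero, although its differential has a
   component with left degree 0; that component is killed because \<mu> vanishes on
   boundaries.\<close>
 consider "i = 0" "j = n" | "i = 1" "j = n - 1" | "i ~= 0" "i ~= 1" using ij by linarith
 thus "diff P n (cl n (PP.tc n i x j y)) = cl (n-1) (diff (tensor A P P) n (PP.tc n i x j y))"
 proof cases
 case 1 thus ?thesis unfolding E c1 c2 c0 using x y dy by(simp add: d \<mu>_rules N.lact_closed signed_def)
 next
 case 2 thus ?thesis unfolding E c1 c2 c0 using x y by(simp add: d \<mu>_d N.lact_rules')
 next
 case 3 thus ?thesis unfolding E c1 c2 c0 by(simp add: d)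
 qed
qed

lemma cr_diff: assumes t: "t :> PP.T n"
 shows "diff P n (cr n t) = cr (n-1) (diff (tensor A P P) n t)"
proof (rule PP.tensor_ext[OF PP.PG _ _ t])
 show "(%t. diff P n (cr n t)) : ahom (PP.T n) (obj P (n-1))"
 using bhom_ahom[OF bhom_comp[OF cr_hom cpx_diff[OF P]]] .
 show "(%t. cr (n-1) (diff (tensor A P P) n t)) : ahom (PP.T n) (obj P (n-1))"
 using bhom_ahom[OF bhom_comp[OF PP.tensor_diff(1) cr_hom]] .
 interpret N: is_bimodule K A "obj P (n-1)" by(rule PP.PB)
 note d = bhom_rules[OF PP.PB PP.PB cpx_diff[OF P]] and c = ahom_rules[OF PP.TG PP.PG bhom_ahom[OF cr_hom]]
 fix i x j y assume ij: "i + j = n" and x: "x :> obj P i" and y: "y :> obj P j"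
 hence dx: "diff P i x :> obj P (i-1)" and dy: "diff P j y :> obj P (j-1)" by(simp_all add: d)
 have E: "cr (n-1) (diff (tensor A P P) n (PP.tc n i x j y))
 = cr (n-1) (PP.tc (n-1) (i-1) (diff P i x) j y)
 +[obj P (n-1)] signed (obj P (n-1)) i (cr (n-1) (PP.tc (n-1) i x (j-1) (diff P j y)))"
 using ij x y dx dy
 by(simp add: PP.tensor_diff(2) PP.tc_closed c abelian_group.signed_closed[OF PP.TG])
 have c0: "cr n (PP.tc n i x j y) = (if j = 0 then ract (obj P i) x (\<mu> y) else 0[obj P n])"
 using ij x y by(rule cr_tc)
 have c1: "cr (n-1) (PP.tc (n-1) (i-1) (diff P i x) j y)
 = (if j = 0 then ract (obj P (i-1)) (diff P i x) (\<mu> y) else 0[obj P (n-1)])"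
 using ij dx y by(intro cr_tc) simp_all
 have c2: "cr (n-1) (PP.tc (n-1) i x (j-1) (diff P j y))
 = (if j - 1 = 0 then ract (obj P i) x (\<mu> (diff P j y)) else 0[obj P (n-1)])"
 using ij x dy by(intro cr_tc) simp_all
 consider "j = 0" "i = n" | "j = 1" "i = n - 1" | "j ~= 0" "j ~= 1" using ij by linarith
 thus "diff P n (cr n (PP.tc n i x j y)) = cr (n-1) (diff (tensor A P P) n (PP.tc n i x j y))"
 proof cases
 case 1 thus ?thesis unfolding E c1 c2 c0 using x y dx by(simp add: d \<mu>_rules N.ract_closed)
 next
 case 2 thus ?thesis unfolding E c1 c2 c0 using x y by(simp add: d \<mu>_d N.ract_rules')
 next
 case 3 thus ?thesis unfolding E c1 c2 c0 by(simp add: d)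
 qed
qed

text \<open>Since \<mu> is left linear, \<mu> \<otimes> \<mu> factors as \<mu> after \<mu> \<otimes>
  1. This turns the normalisation of a diagonal into a condition on \<open>cl\<close>.\<close>

lemma augmentation_tensor: assumes t: "t :> PP.T 0"
 shows "left_unit A (stalk A) 0 (tensor_map A (stalk A) (stalk A) (extend_by_zero A \<mu>) (extend_by_zero A \<mu>) 0 t)
 = \<mu> (cl 0 t)"
proof (rule PP.tensor_ext[OF _ _ _ t])
 interpret R: is_bimodule K A "reg_bim A" by(rule reg_bim)
 show "abelian_group (reg_bim A)" by(rule R.B.abelian_group_axioms)
 note m = tensor_map_hom[OF PP.tensor_product_axioms stalk_products(3) extend_by_zero_map[OF \<mu>] extend_by_zero_map[OF \<mu>]]
 show "(%t. \<mu> (cl 0 t)) : ahom (PP.T 0) (reg_bim A)"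
 using bhom_ahom[OF bhom_comp[OF cl_hom \<mu>]] .
 show "(%t. left_unit A (stalk A) 0 (tensor_map A (stalk A) (stalk A) (extend_by_zero A \<mu>) (extend_by_zero A \<mu>) 0 t))
 : ahom (PP.T 0) (reg_bim A)"
 using bhom_ahom[OF bhom_comp[OF m(1) left_unit_hom(1)[OF stalk_is_cpx], of 0]] by(simp add: stalk_obj_0)
 fix i x j y assume ij: "i + j = 0" and x: "x :> obj P i" and y: "y :> obj P j"
 have e: "extend_by_zero A \<mu> i x :> obj (stalk A) i" "extend_by_zero A \<mu> j y :> obj (stalk A) j"
 using bhom_cl[OF cpx_maps_hom[OF extend_by_zero_map[OF \<mu>]]] x y by blast+
 show "left_unit A (stalk A) 0 (tensor_map A (stalk A) (stalk A) (extend_by_zero A \<mu>) (extend_by_zero A \<mu>) 0 (PP.tc 0 i x j y))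
 = \<mu> (cl 0 (PP.tc 0 i x j y))"
 using ij x y by(simp add: m(2) left_unit_hom(2)[OF stalk_is_cpx] e cl_tc)
 (auto simp: extend_by_zero_def stalk_obj_0 regular_simps \<mu>_rules stalk_zero)
qed

end

lemma counit_natural:
 assumes "augmented_cpx K A C \<nu>" "augmented_cpx K A P \<mu>"
 and f: "f : bimodule_cpx_maps A C P" and \<mu>f: "!!x. x :> obj C 0 ==> \<mu> (f 0 x) = \<nu> x"
 and t: "t :> tensor_obj A C C n"
 shows "augmented_cpx.cl A P \<mu> n (tensor_map A P P f f n t) = f n (augmented_cpx.cl A C \<nu> n t)"
 and "augmented_cpx.cr A P \<mu> n (tensor_map A P P f f n t) = f n (augmented_cpx.cr A C \<nu> n t)"
proof -
 interpret C: augmented_cpx K A C \<nu> by fact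
 interpret P: augmented_cpx K A P \<mu> by fact
 note m = tensor_map_hom[OF C.PP.tensor_product_axioms P.PP.tensor_product_axioms f f]
 note fr = bhom_rules[OF C.PP.PB P.PP.PB cpx_maps_hom[OF f]]
 show "P.cl n (tensor_map A P P f f n t) = f n (C.cl n t)"
 by(rule C.PP.tensor_ext[OF P.PP.PG bhom_ahom[OF bhom_comp[OF m(1) P.cl_hom]]
 bhom_ahom[OF bhom_comp[OF C.cl_hom cpx_maps_hom[OF f]]] t])
 (auto simp: m(2) fr P.cl_tc C.cl_tc \<mu>f C.\<mu>_rules)
 show "P.cr n (tensor_map A P P f f n t) = f n (C.cr n t)"
 by(rule C.PP.tensor_ext[OF P.PP.PG bhom_ahom[OF bhom_comp[OF m(1) P.cr_hom]]
 bhom_ahom[OF bhom_comp[OF C.cr_hom cpx_maps_hom[OF f]]] t])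
 (auto simp: m(2) fr P.cr_tc C.cr_tc \<mu>f C.\<mu>_rules)
qed

section \<open>The trace functor\<close>

definition tr :: "('k, 'a) module => ('a, 'm) bimodule => 'm => ('a \<times> 'm) fab" where
 "tr A M x = trace_class A M (1[A], x)"

lemma trace_rels_cases:
 assumes "u : trace_rels A M"
 obtains a a' x where "u = frag_of (a +[A] a', x) - frag_of (a, x) - frag_of (a', x)"
 "a :> A" "a' :> A" "x :> M"
 | a x x' where "u = frag_of (a, x +[M] x') - frag_of (a, x) - frag_of (a, x')"
 "a :> A" "x :> M" "x' :> M"
 | a b c x where "u = frag_of (c *[A] a *[A] b, x) - frag_of (a, ract M (lact M b x) c)"
 "a :> A" "b :> A" "c :> A" "x :> M"
 using assms unfolding trace_rels_def by blast

context is_bimodule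
begin

lemma trace_presented: "presented_group (trace_gens A M) (trace_rels A M) (trob A M)"
proof -
 have "pkeys u <= trace_gens A M" if "u : trace_rels A M" for u
 using that
 by(cases rule: trace_rels_cases)
 (auto simp: trace_gens_def lact_closed ract_closed dest!: subsetD[OF keys_frag_diff2] subsetD[OF keys_frag_diff3])
 thus ?thesis by unfold_locales (auto simp: trace_obj_def Let_def)
qed

lemmas TrG = presented_group.abelian_group_presented[OF trace_presented]

lemma trace_class_eq:
 assumes "a :> A" "x :> M"
 shows "trace_class A M (a, x) = tr A M (lact M a x)" "trace_class A M (a, x) = tr A M (ract M x a)"
proof -
 interpret tr: presented_group "trace_gens A M" "trace_rels A M" "trob A M" by(rule trace_presented)
 have *: "trace_class A M (c *[A] 1[A] *[A] b, x) = trace_class A M (1[A], ract M (lact M b x) c)"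
 if "b :> A" "c :> A" for b c
 unfolding trace_class_def
 proof (rule tr.gen_diff2)
 show "frag_of (c *[A] 1[A] *[A] b, x) - frag_of (1[A], ract M (lact M b x) c) : trace_rels A M"
 unfolding trace_rels_def using assms that A.one_closed by blast
 qed (use assms that in \<open>simp_all add: trace_gens_def lact_closed ract_closed\<close>)
 show "trace_class A M (a, x) = tr A M (lact M a x)"
 using *[of a "1[A]"] assms by(simp add: tr_def ract_one lact_closed)
 show "trace_class A M (a, x) = tr A M (ract M x a)"
 using *[of "1[A]" a] assms by(simp add: tr_def lact_one)
qed

lemma tr_comm: "a :> A ==> x :> M ==> tr A M (lact M a x) = tr A M (ract M x a)"
 using trace_class_eq by metis

lemma tr_ahom: "tr A M : ahom M (trob A M)"
proof (rule ahomI)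
 interpret tr: presented_group "trace_gens A M" "trace_rels A M" "trob A M" by(rule trace_presented)
 show "tr A M x :> trob A M" if "x :> M" for x
 unfolding tr_def trace_class_def by(rule tr.gen_closed) (simp add: trace_gens_def that)
 show "tr A M (x +[M] y) = tr A M x +[trob A M] tr A M y"
 if "x :> M" "y :> M" for x y
 unfolding tr_def trace_class_def
 by(rule tr.gen_diff3) (use that A.one_closed in \<open>auto simp: trace_gens_def trace_rels_def\<close>)
qed

lemmas tr_rules = ahom_rules[OF B.abelian_group_axioms TrG tr_ahom]

text \<open>A generator a \<otimes> x equals 1 \<otimes> a x, and \<open>tr\<close> is additive, so
  sums collapse to one representative. Identities on traces are proved below by choosing such
  representatives.\<close>

lemma tr_surj: assumes "z :> trob A M"
 obtains x where "x :> M" "z = tr A M x"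
proof -
 interpret tr: presented_group "trace_gens A M" "trace_rels A M" "trob A M" by(rule trace_presented)
 have "EX x:carrier M. z = tr A M x"
 using assms
 proof (induction rule: tr.presented_induct)
 case (gen u)
 thus ?case
 using trace_class_eq by(auto simp: trace_gens_def trace_class_def intro!: bexI[of _ "lact M _ _"] lact_closed)
 next
 case zero
 thus ?case using tr_rules(3) by(intro bexI[of _ "0[M]"]) simp_all
 next
 case (add z w)
 then obtain x y where "x :> M" "y :> M" "z = tr A M x" "w = tr A M y" by auto
 thus ?case by(intro bexI[of _ "x +[M] y"]) (simp_all add: tr_rules)
 next
 case (uminus z)
 then obtain x where "x :> M" "z = tr A M x" by auto
 thus ?case by(intro bexI[of _ "-[M] x"]) (simp_all add: tr_rules)
 qed
 thus thesis using that by blast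
qed

text \<open>The trace is M modulo the differences a x - x a, so an additive map that does not
  distinguish the two actions descends to it. The map \<open>f\<close> on pairs is kept separate
  from \<open>g\<close> to match the shape of the definitions on generators.\<close>

lemma trace_lift:
 assumes T: "abelian_group T" and g: "g : ahom M T"
 and comm: "!!a x. a :> A ==> x :> M ==> g (lact M a x) = g (ract M x a)"
 and f: "!!a x. a :> A ==> x :> M ==> f (a, x) = g (lact M a x)"
 shows "plift T f : ahom (trob A M) T"
 and "!!x. x :> M ==> plift T f (tr A M x) = g x"
proof -
 interpret tr: presented_group "trace_gens A M" "trace_rels A M" "trob A M" by(rule trace_presented)
 note gr = ahom_rules[OF B.abelian_group_axioms T g]
 have fc: "f u :> T" if "u : trace_gens A M" for u
 using that by(auto simp: trace_gens_def f gr lact_closed)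
 have R: "frag_eval T f u = 0[T]" if "u : trace_rels A M" for u
 using that
 proof (cases rule: trace_rels_cases)
 case (1 a a' x)
 show ?thesis unfolding 1(1)
 by(rule tr.frag_eval_diff3[OF T fc]) (use 1 in \<open>simp_all add: trace_gens_def f lact_add_left gr lact_closed\<close>)
 next
 case (2 a x x')
 show ?thesis unfolding 2(1)
 by(rule tr.frag_eval_diff3[OF T fc]) (use 2 in \<open>simp_all add: trace_gens_def f lact_add_right gr lact_closed\<close>)
 next
 case (3 a b c x)
 have "g (lact M (c *[A] a *[A] b) x) = g (lact M a (ract M (lact M b x) c))"
 proof -
 have "lact M (c *[A] a *[A] b) x = lact M c (lact M a (lact M b x))"
 using 3 by(simp add: lact_mult lact_closed)
 thus ?thesis
 using comm[of c "lact M a (lact M b x)"] lact_ract[of a "lact M b x" c] 3 by(simp add: lact_closed)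
 qed
 thus ?thesis unfolding 3(1)
 by(intro tr.frag_eval_diff2[OF T fc]) (use 3 in \<open>simp_all add: trace_gens_def f lact_closed ract_closed\<close>)
 qed
 show "plift T f : ahom (trob A M) T" by(rule tr.lift_hom[OF T fc R])
 show "plift T f (tr A M x) = g x" if "x :> M" for x
 using tr.lift_hom(2)[OF T fc R, of "(1[A], x)"] that
 by(simp add: tr_def trace_class_def trace_gens_def f lact_one)
qed

lemma smult_tr:
 assumes c: "c :> K"
 shows "smult (trob A M) c : ahom (trob A M) (trob A M)"
 and "x :> M ==> c .*[trob A M] tr A M x = tr A M (scal A M c x)"
proof -
 interpret tr: presented_group "trace_gens A M" "trace_rels A M" "trob A M" by(rule trace_presented)
 let ?Q = "presented (trace_gens A M) (trace_rels A M)"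
 interpret Q: presented_group "trace_gens A M" "trace_rels A M" ?Q
 by(rule presented_groupI) (rule tr.rels)
 let ?f = "%(a, x). trace_class A M (c .*[A] a, x)"
 have eq: "smult (trob A M) c = plift ?Q ?f"
 by(simp add: trace_obj_def Let_def)
 have h: "ahom N ?Q = ahom N (trob A M)" for N :: "('e, 'f) ring_scheme"
 by(simp add: hom_def trace_obj_def Let_def)
 have g: "(%x. tr A M (scal A M c x)) : ahom M ?Q"
 unfolding h using ahom_comp[OF lact_ahom tr_ahom] c scalar_closed by blast
 have comm: "tr A M (scal A M c (lact M a x)) = tr A M (scal A M c (ract M x a))"
 if "a :> A" "x :> M" for a x
 using tr_comm[of a "scal A M c x"] lact_smult(2)[of c a x] ract_smult(2)[of c a x] that c
 by(simp add: scal_closed)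
 have f: "?f (a, x) = tr A M (scal A M c (lact M a x))" if "a :> A" "x :> M" for a x
 using that c trace_class_eq(1)[of "c .*[A] a" x] lact_smult(1)[of c a x] by(simp add: smult_closed)
 note L = trace_lift[OF Q.abelian_group_presented g comm f]
 show "smult (trob A M) c : ahom (trob A M) (trob A M)"
 using L(1) unfolding eq h .
 show "x :> M ==> c .*[trob A M] tr A M x = tr A M (scal A M c x)"
 using L(2) unfolding eq by simp
qed

end

lemma trace_hom_tr:
 assumes M: "is_bimodule K A M" and N: "is_bimodule K A N" and f: "f : bhom A M N"
 shows "trace_hom A N f : ahom (trob A M) (trob A N)"
 and "!!x. x :> M ==> trace_hom A N f (tr A M x) = tr A N (f x)"
proof -
 interpret M: is_bimodule K A M by(rule M)
 interpret N: is_bimodule K A N by(rule N)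
 note fr = bhom_rules[OF M N f]
 have L: "trace_hom A N f : ahom (trob A M) (trob A N) &
 (ALL x:carrier M. trace_hom A N f (tr A M x) = tr A N (f x))"
 unfolding trace_hom_def
 using M.trace_lift[OF N.TrG ahom_comp[OF bhom_ahom[OF f] N.tr_ahom],
 of "%(a, x). trace_class A N (a, f x)"]
 by(simp add: fr N.trace_class_eq(1) N.tr_comm)
 thus "trace_hom A N f : ahom (trob A M) (trob A N)"
 "!!x. x :> M ==> trace_hom A N f (tr A M x) = tr A N (f x)" by simp_all
qed

lemma trace_hom_scal:
 assumes M: "is_bimodule K A M" and N: "is_bimodule K A N" and f: "f : bhom A M N"
 and c: "c :> K" and z: "z :> trob A M"
 shows "trace_hom A N f (c .*[trob A M] z) = c .*[trob A N] trace_hom A N f z"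
proof -
 interpret M: is_bimodule K A M by(rule M)
 interpret N: is_bimodule K A N by(rule N)
 from z obtain x where "x :> M" "z = tr A M x" by(rule M.tr_surj)
 thus ?thesis
 using c by(simp add: M.smult_tr N.smult_tr trace_hom_tr[OF M N f] M.scal_closed bhom_rules[OF M N f] M.scalar_closed)
qed

section \<open>The cyclic swap of tensor factors on the trace\<close>

definition swap_tr :: "('k, 'a) module => ('a, 'p) bimodule_cpx => ('a, 'q) bimodule_cpx => int
 => ('p, 'q) tensor_gen fab => ('a \<times> ('q, 'p) tensor_gen fab) fab" where
 "swap_tr A P Q n = (let T = trob A (tensor_obj A Q P n) in
 plift T (%((i, x), (j, y)).
 signed T (i * j) (tr A (tensor_obj A Q P n) (tensor_class A Q P n ((j, y), (i, x))))))"

context tensor_product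
begin

lemma opposite: "tensor_product K A Q P"
 by(rule tensor_productI[OF Q P])

text \<open>Defining the swap on P \<otimes> Q itself and passing to the trace only in the target
  avoids the coefficient a that \<open>trace_swap\<close> carries along. Balancing holds because the
  trace moves a across the outer ends of y \<otimes> x.\<close>

lemma swap_tr_hom:
 shows "swap_tr A P Q n : ahom (T n) (trob A (tensor_obj A Q P n))"
 and "!!i x j y. i + j = n ==> x :> obj P i ==> y :> obj Q j ==>
 swap_tr A P Q n (tc n i x j y) = signed (trob A (tensor_obj A Q P n)) (i * j)
 (tr A (tensor_obj A Q P n) (tensor_class A Q P n ((j, y), (i, x))))"
proof -
 interpret O: tensor_product K A Q P by(rule opposite)
 interpret N: is_bimodule K A "O.T n" by(rule O.tensor_bim)
 interpret TN: abelian_group "trob A (O.T n)" by(rule N.TrG)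
 let ?G = "%i x j y. signed (trob A (O.T n)) (i * j) (tr A (O.T n) (O.tc n j y i x))"
 have bal: "tr A (O.T n) (O.tc n j y i (ract (obj P i) x a)) = tr A (O.T n) (O.tc n j (lact (obj Q j) a y) i x)"
 if "i + j = n" "x :> obj P i" "y :> obj Q j" "a :> A" for i x j y a
 using that by(simp add: O.ract_tc[symmetric] O.lact_tc[symmetric] N.tr_comm O.tc_closed)
 have "plift (trob A (O.T n)) (%((i, x), (j, y)). ?G i x j y) : ahom (T n) (trob A (O.T n)) &
 (\<forall>i x j y. i + j = n --> x :> obj P i --> y :> obj Q j -->
 plift (trob A (O.T n)) (%((i, x), (j, y)). ?G i x j y) (tc n i x j y) = ?G i x j y)"
 using tensor_lift[OF N.TrG, of n ?G]
 by(simp add: N.tr_rules O.tc_closed O.tc_rules1 O.tc_rules2 TN.signed_add bal)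
 thus "swap_tr A P Q n : ahom (T n) (trob A (O.T n))"
 "!!i x j y. i + j = n ==> x :> obj P i ==> y :> obj Q j ==>
 swap_tr A P Q n (tc n i x j y) = ?G i x j y"
 by(simp_all add: swap_tr_def Let_def)
qed

text \<open>On pure tensors the two sides are the classes of y \<otimes> a x and y a \<otimes> x,
  which the balancing relation of the opposite tensor product identifies.\<close>

lemma swap_tr_comm:
 assumes a: "a :> A" and t: "t :> T n"
 shows "swap_tr A P Q n (lact (T n) a t) = swap_tr A P Q n (ract (T n) t a)"
proof -
 interpret O: tensor_product K A Q P by(rule opposite)
 interpret N: is_bimodule K A "O.T n" by(rule O.tensor_bim)
 interpret M: is_bimodule K A "T n" by(rule tensor_bim)
 show ?thesis
 by(rule tensor_ext[OF N.TrG ahom_comp[OF M.lact_ahom[OF a] swap_tr_hom(1)] ahom_comp[OF M.ract_ahom[OF a] swap_tr_hom(1)] t])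
 (simp add: lact_tc ract_tc a swap_tr_hom(2) is_bimodule.lact_closed[OF PB] is_bimodule.ract_closed[OF QB] O.tc_bal)
qed

lemma trace_swap_tr: 
 shows "trace_swap A P Q n : ahom (trob A (T n)) (trob A (tensor_obj A Q P n))"
 and "!!t. t :> T n ==> trace_swap A P Q n (tr A (T n) t) = swap_tr A P Q n t"
proof -
 interpret O: tensor_product K A Q P by(rule opposite)
 interpret N: is_bimodule K A "O.T n" by(rule O.tensor_bim)
 interpret M: is_bimodule K A "T n" by(rule tensor_bim)
 interpret TN: abelian_group "trob A (O.T n)" by(rule N.TrG)
 let ?TN = "trob A (O.T n)"
 let ?f = "%(a, t). plift ?TN (%((i, x), (j, y)). signed ?TN (i * j)
 (trace_class A (O.T n) (1[A], O.tc n j y i (lact (obj P i) a x)))) t"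
 have f: "?f (a, t) = swap_tr A P Q n (lact (T n) a t)" if a: "a :> A" and t: "t :> T n" for a t
 proof -
 let ?G = "%i x j y. signed ?TN (i * j) (tr A (O.T n) (O.tc n j y i (lact (obj P i) a x)))"
 have bal: "tr A (O.T n) (O.tc n j y i (lact (obj P i) a (ract (obj P i) x b))) = tr A (O.T n) (O.tc n j (lact (obj Q j) b y) i (lact (obj P i) a x))"
 if "i + j = n" "x :> obj P i" "y :> obj Q j" "b :> A" for i x j y b
 using that a by(simp add: is_bimodule.lact_ract[OF PB, symmetric] is_bimodule.lact_closed[OF PB] O.ract_tc[symmetric] O.lact_tc[symmetric] N.tr_comm O.tc_closed)
 have L: "plift ?TN (%((i, x), (j, y)). ?G i x j y) : ahom (T n) ?TN &
 (\<forall>i x j y. i + j = n --> x :> obj P i --> y :> obj Q j -->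
 plift ?TN (%((i, x), (j, y)). ?G i x j y) (tc n i x j y) = ?G i x j y)"
 using tensor_lift[OF N.TrG, of n ?G] a
 by(simp add: N.tr_rules O.tc_closed O.tc_rules1 O.tc_rules2 TN.signed_add bal is_bimodule.lact_closed[OF PB] is_bimodule.lact_add_right[OF PB])
 have "plift ?TN (%((i, x), (j, y)). ?G i x j y) t = swap_tr A P Q n (lact (T n) a t)"
 by(rule tensor_ext[OF N.TrG _ ahom_comp[OF M.lact_ahom[OF a] swap_tr_hom(1)] t])
 (use L in \<open>simp_all add: lact_tc a swap_tr_hom(2) is_bimodule.lact_closed[OF PB]\<close>)
 thus ?thesis by(simp add: tr_def)
 qed
 have "trace_swap A P Q n = plift ?TN ?f" by(simp add: trace_swap_def Let_def)
 thus "trace_swap A P Q n : ahom (trob A (T n)) ?TN"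
 and "!!t. t :> T n ==> trace_swap A P Q n (tr A (T n) t) = swap_tr A P Q n t"
 using M.trace_lift[OF N.TrG swap_tr_hom(1) swap_tr_comm f] by simp_all
qed

lemma swap_tr_scal:
 assumes c: "c :> K" and t: "t :> T n"
 shows "swap_tr A P Q n (scal A (T n) c t) = c .*[trob A (tensor_obj A Q P n)] swap_tr A P Q n t"
proof -
 interpret O: tensor_product K A Q P by(rule opposite)
 interpret N: is_bimodule K A "O.T n" by(rule O.tensor_bim)
 interpret M: is_bimodule K A "T n" by(rule tensor_bim)
 note sm = ahom_rules[OF N.TrG N.TrG N.smult_tr(1)[OF c]]
 show ?thesis
 proof (rule tensor_ext[OF N.TrG ahom_comp[OF M.lact_ahom swap_tr_hom(1)] ahom_comp[OF swap_tr_hom(1) N.smult_tr(1)[OF c]] t])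
 show "c .*[A] 1[A] :> A" using c by(rule scalar_closed)
 fix i x j y assume ij: "i + j = n" and x: "x :> obj P i" and y: "y :> obj Q j"
 have "tr A (O.T n) (O.tc n j y i (scal A (obj P i) c x)) = tr A (O.T n) (scal A (O.T n) c (O.tc n j y i x))"
 using ij x y c by(simp add: is_bimodule.central[OF PB] scalar_closed N.central O.tc_closed O.ract_tc)
 thus "swap_tr A P Q n (scal A (T n) c (tc n i x j y)) = c .*[trob A (O.T n)] swap_tr A P Q n (tc n i x j y)"
 using ij x y c
 by(simp add: lact_tc scalar_closed swap_tr_hom(2) is_bimodule.lact_closed[OF PB] sm N.tr_rules O.tc_closed N.smult_tr(2))
 qed
qed

lemma swap_tr_diff:
 assumes t: "t :> T n"
 shows "swap_tr A P Q (n-1) (diff (tensor A P Q) n t)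
 = trace_hom A (tensor_obj A Q P (n-1)) (diff (tensor A Q P) n) (swap_tr A P Q n t)"
proof -
 interpret O: tensor_product K A Q P by(rule opposite)
 interpret N: is_bimodule K A "O.T n" by(rule O.tensor_bim)
 interpret N': is_bimodule K A "O.T (n-1)" by(rule O.tensor_bim)
 interpret TN: abelian_group "trob A (O.T (n-1))" by(rule N'.TrG)
 note d = trace_hom_tr[OF O.tensor_bim O.tensor_bim O.tensor_diff(1)]
 note dr = ahom_rules[OF N.TrG N'.TrG d(1)]
 note sr = ahom_rules[OF TG N'.TrG swap_tr_hom(1)]
 note dP = bhom_cl[OF cpx_diff[OF P]] and dQ = bhom_cl[OF cpx_diff[OF Q]]
 show ?thesis
 proof (rule tensor_ext[OF N'.TrG ahom_comp[OF bhom_ahom[OF tensor_diff(1)] swap_tr_hom(1)] ahom_comp[OF swap_tr_hom(1) d(1)] t])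
 fix i x j y assume ij: "i + j = n" and x: "x :> obj P i" and y: "y :> obj Q j"
 \<comment> \<open>The differential lowers one of the two degrees and thereby changes the sign of
   the swap; these parities match it with the signs of the differential on the opposite
   product.\<close>
 have par: "even ((i-1) * j) = even (i * j + j)" "even (i + i * (j-1)) = even (i * j)" by auto
 have sg: "signed (trob A (O.T (n-1))) ((i-1) * j) u = signed (trob A (O.T (n-1))) (i * j + j) u"
 "signed (trob A (O.T (n-1))) (i + i * (j-1)) u = signed (trob A (O.T (n-1))) (i * j) u" for u
 by(simp_all only: signed_def par)
 have "swap_tr A P Q (n-1) (diff (tensor A P Q) n (tc n i x j y))
 = signed (trob A (O.T (n-1))) ((i-1) * j) (tr A (O.T (n-1)) (O.tc (n-1) j y (i-1) (diff P i x)))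
 +[trob A (O.T (n-1))] signed (trob A (O.T (n-1))) (i + i * (j-1)) (tr A (O.T (n-1)) (O.tc (n-1) (j-1) (diff Q j y) i x))"
 using ij x y
 by(simp add: tensor_diff(2) sr tc_closed dP dQ swap_tr_hom(2) abelian_group.signed_closed[OF TG]
 TN.signed_signed N'.tr_rules O.tc_closed)
 also have "... = trace_hom A (O.T (n-1)) (diff (tensor A Q P) n) (swap_tr A P Q n (tc n i x j y))"
 unfolding sg using ij x y
 by(simp add: swap_tr_hom(2) dr N.tr_rules O.tc_closed d(2) O.tensor_diff(2) dP dQ N'.tr_rules
 abelian_group.signed_closed[OF O.TG] TN.signed_add TN.signed_signed TN.a_comm)
 finally show "swap_tr A P Q (n-1) (diff (tensor A P Q) n (tc n i x j y))
 = trace_hom A (O.T (n-1)) (diff (tensor A Q P) n) (swap_tr A P Q n (tc n i x j y))" .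
 qed
qed

end

lemma swap_tr_natural:
 assumes "tensor_product K A R S" "tensor_product K A P Q"
 and f: "f : bimodule_cpx_maps A R P" and g: "g : bimodule_cpx_maps A S Q"
 and t: "t :> tensor_obj A R S n"
 shows "swap_tr A P Q n (tensor_map A P Q f g n t)
 = trace_hom A (tensor_obj A Q P n) (tensor_map A Q P g f n) (swap_tr A R S n t)"
proof -
 interpret R: tensor_product K A R S by fact
 interpret P: tensor_product K A P Q by fact
 interpret R': tensor_product K A S R by(rule R.opposite)
 interpret P': tensor_product K A Q P by(rule P.opposite)
 interpret N: is_bimodule K A "P'.T n" by(rule P'.tensor_bim)
 interpret M: is_bimodule K A "R'.T n" by(rule R'.tensor_bim)
 note m = tensor_map_hom[OF assms(1,2) f g] and m' = tensor_map_hom[OF R.opposite P.opposite g f]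
 note h = trace_hom_tr[OF R'.tensor_bim P'.tensor_bim m'(1)]
 note hr = ahom_rules[OF M.TrG N.TrG h(1)]
 note fr = bhom_cl[OF cpx_maps_hom[OF f]] and gr = bhom_cl[OF cpx_maps_hom[OF g]]
 show ?thesis
 by(rule R.tensor_ext[OF N.TrG ahom_comp[OF bhom_ahom[OF m(1)] P.swap_tr_hom(1)] ahom_comp[OF R.swap_tr_hom(1) h(1)] t])
 (simp add: m(2) fr gr P.swap_tr_hom(2) R.swap_tr_hom(2) hr M.tr_rules R'.tc_closed h(2) m'(2))
qed

text \<open>A counit is nonzero only where the factor it evaluates has degree 0, and there the swap
  has no sign. What remains is that \<mu>(y) x and x \<mu>(y) agree in the trace.\<close>

lemma (in augmented_cpx) trace_counit_swap:
 assumes t: "t :> PP.T n"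
 shows "trace_hom A (obj P n) (cl n) (swap_tr A P P n t) = tr A (obj P n) (cr n t)"
 and "trace_hom A (obj P n) (cr n) (swap_tr A P P n t) = tr A (obj P n) (cl n t)"
proof -
 interpret N: is_bimodule K A "obj P n" by(rule PP.PB)
 interpret M: is_bimodule K A "PP.T n" by(rule PP.tensor_bim)
 note hl = trace_hom_tr[OF PP.tensor_bim PP.PB cl_hom] and hr = trace_hom_tr[OF PP.tensor_bim PP.PB cr_hom]
 note hlr = ahom_rules[OF M.TrG N.TrG hl(1)] and hrr = ahom_rules[OF M.TrG N.TrG hr(1)]
 interpret TN: abelian_group "trob A (obj P n)" by(rule N.TrG)
 show "trace_hom A (obj P n) (cl n) (swap_tr A P P n t) = tr A (obj P n) (cr n t)"
 proof (rule PP.tensor_ext[OF N.TrG ahom_comp[OF PP.swap_tr_hom(1) hl(1)] ahom_comp[OF bhom_ahom[OF cr_hom] N.tr_ahom] t])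
 fix i x j y assume "i + j = n" "x :> obj P i" "y :> obj P j"
 thus "trace_hom A (obj P n) (cl n) (swap_tr A P P n (PP.tc n i x j y)) = tr A (obj P n) (cr n (PP.tc n i x j y))"
 by(cases "j = 0") (simp_all add: PP.swap_tr_hom(2) hlr M.tr_rules PP.tc_closed hl(2) cl_tc cr_tc
 N.tr_rules N.tr_comm \<mu>_rules signed_def)
 qed
 show "trace_hom A (obj P n) (cr n) (swap_tr A P P n t) = tr A (obj P n) (cl n t)"
 proof (rule PP.tensor_ext[OF N.TrG ahom_comp[OF PP.swap_tr_hom(1) hr(1)] ahom_comp[OF bhom_ahom[OF cl_hom] N.tr_ahom] t])
 fix i x j y assume "i + j = n" "x :> obj P i" "y :> obj P j"
 thus "trace_hom A (obj P n) (cr n) (swap_tr A P P n (PP.tc n i x j y)) = tr A (obj P n) (cl n (PP.tc n i x j y))"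
 by(cases "i = 0") (simp_all add: PP.swap_tr_hom(2) hrr M.tr_rules PP.tc_closed hr(2) cl_tc cr_tc
 N.tr_rules N.tr_comm \<mu>_rules signed_def)
 qed
qed

section \<open>Homology\<close>

text \<open>Only the additive structure of the objects matters for homology, so bimodule complexes and
 their traces are treated uniformly.\<close>

locale group_cpx =
 fixes C :: "(('m, 'z) ring_scheme, 'm) cpx"
 assumes G: "!!n. abelian_group (obj C n)"
 and d: "!!n. diff C n : ahom (obj C n) (obj C (n-1))"
 and dd: "!!n x. x :> obj C n ==> diff C (n-1) (diff C n x) = 0[obj C (n-2)]"
begin

abbreviation "hcls n z \<equiv> boundaries C n +>\<^bsub>obj C n\<^esub> z"

lemmas d_rules = ahom_rules[OF G G d]

lemma boundariesE:
 assumes "b : boundaries C n"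
 obtains y where "y :> obj C (n+1)" "b = diff C (n+1) y"
 using assms by(auto simp: boundaries_def)

lemma boundariesI: "y :> obj C (n+1) ==> diff C (n+1) y : boundaries C n"
 by(simp add: boundaries_def)

lemma boundaries_cycles: "b : boundaries C n ==> b : cycles C n"
 using d_rules(1)[of _ "n + 1"] dd[of _ "n + 1"] by(auto simp: boundaries_def cycles_def)

lemma boundaries_closed: "b : boundaries C n ==> b :> obj C n"
 using boundaries_cycles by(auto simp: cycles_def)

lemma boundaries_subgroup:
 "0[obj C n] : boundaries C n"
 "b : boundaries C n ==> c : boundaries C n ==> b +[obj C n] c : boundaries C n"
 "b : boundaries C n ==> -[obj C n] b : boundaries C n"
proof -
 interpret N: abelian_group "obj C (n+1)" by(rule G)
 show "0[obj C n] : boundaries C n"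
 using boundariesI[of "0[obj C (n+1)]" n] d_rules(3)[of "n + 1"] by simp
 show "b +[obj C n] c : boundaries C n" if b: "b : boundaries C n" and c: "c : boundaries C n"
 proof -
 obtain x y where "x :> obj C (n+1)" "b = diff C (n+1) x"
 "y :> obj C (n+1)" "c = diff C (n+1) y"
 using boundariesE[OF b] boundariesE[OF c] by metis
 thus ?thesis
 using boundariesI[of "x +[obj C (n+1)] y" n] d_rules(2)[of x "n + 1" y] by simp
 qed
 show "-[obj C n] b : boundaries C n" if b: "b : boundaries C n"
 proof -
 obtain x where "x :> obj C (n+1)" "b = diff C (n+1) x" using boundariesE[OF b] by metis
 thus ?thesis
 using boundariesI[of "-[obj C (n+1)] x" n] d_rules(4)[of x "n + 1"] by simp
 qed
qed

lemma carrier_homology: "carrier (homology C n) = hcls n ` cycles C n"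
 by(auto simp: homology_def A_FactGroup_def FactGroup_def RCOSETS_def a_r_coset_def r_coset_def)

lemma one_homology: "1[homology C n] = boundaries C n"
 by(simp add: homology_def A_FactGroup_def FactGroup_def)

lemma hcls_iff: "x : hcls n z \<longleftrightarrow> (EX b:boundaries C n. x = b +[obj C n] z)"
 by(auto simp: a_r_coset_def r_coset_def)

lemma hcls_self: "z :> obj C n ==> z : hcls n z"
proof -
 interpret N: abelian_group "obj C n" by(rule G)
 show "z :> obj C n ==> z : hcls n z"
 using boundaries_subgroup(1)[of n] by(force simp: hcls_iff)
qed

lemma hcls_eqI:
 assumes z: "z :> obj C n" and w: "w :> obj C n"
 and zw: "z -[obj C n] w : boundaries C n"
 shows "hcls n z = hcls n w"
proof -
 interpret N: abelian_group "obj C n" by(rule G)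
 have sub: "hcls n u <= hcls n v"
 if u: "u :> obj C n" and v: "v :> obj C n"
 and uv: "u -[obj C n] v : boundaries C n" for u v
 proof
 fix x assume "x : hcls n u"
 then obtain b where b: "b : boundaries C n" "x = b +[obj C n] u" by(auto simp: hcls_iff)
 have bc: "b :> obj C n" using b boundaries_closed by blast
 have "x = (b +[obj C n] (u -[obj C n] v)) +[obj C n] v"
 unfolding b(2) using bc u v by algebra
 thus "x : hcls n v" using boundaries_subgroup(2)[OF b(1) uv] by(auto simp: hcls_iff)
 qed
 have "-[obj C n] (z -[obj C n] w) = w -[obj C n] z" using z w by algebra
 hence "w -[obj C n] z : boundaries C n" using boundaries_subgroup(3)[OF zw] by simp
 thus ?thesis using sub[OF z w zw] sub[OF w z] by blast
qed

lemma hcls_eqD: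
 assumes z: "z :> obj C n" and w: "w :> obj C n" and eq: "hcls n z = hcls n w"
 shows "z -[obj C n] w : boundaries C n"
proof -
 interpret N: abelian_group "obj C n" by(rule G)
 obtain b where b: "b : boundaries C n" "z = b +[obj C n] w"
 using hcls_self[OF z] eq by(auto simp: hcls_iff)
 have "b :> obj C n" using b boundaries_closed by blast
 hence "z -[obj C n] w = b" unfolding b(2) using w by algebra
 thus ?thesis using b by simp
qed

lemma homology_zeroD:
 assumes "carrier (homology C n) = {1[homology C n]}" "z : cycles C n"
 shows "z : boundaries C n"
proof -
 have "hcls n z = boundaries C n" using assms by(auto simp: carrier_homology one_homology)
 moreover have "z :> obj C n" using assms by(simp add: cycles_def)
 ultimately show ?thesis using hcls_self by blast
qed

end

text \<open>Source and target degrees are independent, so that maps raising the degree, such as the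
  operator of Connes, are covered.\<close>

lemma homology_map_hcls:
 assumes "group_cpx C" "group_cpx D"
 and g: "!!x y. x :> obj C n ==> y :> obj C n ==> g (x +[obj C n] y) = g x +[obj D m] g y"
 and b: "!!b. b : boundaries C n ==> g b : boundaries D m"
 and z: "z :> obj C n" and gz: "g z :> obj D m"
 shows "homology_map D m g (boundaries C n +>\<^bsub>obj C n\<^esub> z) = boundaries D m +>\<^bsub>obj D m\<^esub> g z"
proof -
 interpret C: group_cpx C by fact
 interpret D: group_cpx D by fact
 interpret M: abelian_group "obj D m" by(rule D.G)
 have "D.hcls m (g x) = D.hcls m (g z)" if x: "x : C.hcls n z" for x
 proof -
 obtain b where bb: "b : boundaries C n" "x = b +[obj C n] z" using x by(auto simp: C.hcls_iff)
 have gb: "g b : boundaries D m" "g b :> obj D m" using b[OF bb(1)] D.boundaries_closed by auto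
 have "g x = g b +[obj D m] g z" unfolding bb(2) using g[OF C.boundaries_closed[OF bb(1)] z] .
 moreover have "(g b +[obj D m] g z) -[obj D m] g z = g b" using gb gz by algebra
 ultimately show ?thesis using gb gz by(intro D.hcls_eqI) simp_all
 qed
 hence "(%x. D.hcls m (g x)) ` C.hcls n z = {D.hcls m (g z)}"
 using C.hcls_self[OF z] by blast
 thus ?thesis by(simp add: homology_map_def)
qed

lemma bij_homology_map:
 assumes "group_cpx C" "group_cpx D"
 and f: "!!n. f n : ahom (obj C n) (obj D n)" and g: "!!n. g n : ahom (obj D n) (obj C n)"
 and fd: "!!n x. x :> obj C n ==> diff D n (f n x) = f (n-1) (diff C n x)"
 and gd: "!!n x. x :> obj D n ==> diff C n (g n x) = g (n-1) (diff D n x)"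
 and gf: "!!z. z : cycles C n ==> g n (f n z) -[obj C n] z : boundaries C n"
 and fg: "!!z. z : cycles D n ==> f n (g n z) -[obj D n] z : boundaries D n"
 shows "bij_betw (homology_map D n (f n)) (carrier (homology C n)) (carrier (homology D n))"
proof -
 interpret C: group_cpx C by fact
 interpret D: group_cpx D by fact
 note fr = ahom_rules[OF C.G D.G f] and gr = ahom_rules[OF D.G C.G g]
 have fb: "f n b : boundaries D n" if b: "b : boundaries C n" for b
 using b fd[of _ "n + 1"] fr(1)[of _ "n + 1"]
 by(auto simp: boundaries_def image_iff) (metis add_diff_cancel_right')
 have gb: "g n b : boundaries C n" if b: "b : boundaries D n" for b
 using b gd[of _ "n + 1"] gr(1)[of _ "n + 1"]
 by(auto simp: boundaries_def image_iff) (metis add_diff_cancel_right')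
 have fc: "f n z : cycles D n" if "z : cycles C n" for z
 using that fr(3)[of "n - 1"] by(simp add: cycles_def fd fr(1))
 have gc: "g n z : cycles C n" if "z : cycles D n" for z
 using that gr(3)[of "n - 1"] by(simp add: cycles_def gd gr(1))
 have cc: "z :> obj C n" if "z : cycles C n" for z using that by(simp add: cycles_def)
 have cd: "z :> obj D n" if "z : cycles D n" for z using that by(simp add: cycles_def)
 have F: "homology_map D n (f n) (C.hcls n z) = D.hcls n (f n z)" if "z : cycles C n" for z
 using that fb by(intro homology_map_hcls assms) (simp_all add: fr cc)
 have Gm: "homology_map C n (g n) (D.hcls n z) = C.hcls n (g n z)" if "z : cycles D n" for z
 using that gb by(intro homology_map_hcls assms) (simp_all add: gr cd)
 show ?thesis
 proof (rule bij_betw_byWitness[where f' = "homology_map C n (g n)"])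
 show "ALL a:carrier (homology C n). homology_map C n (g n) (homology_map D n (f n) a) = a"
 proof
 fix a assume "a :> homology C n"
 then obtain z where z: "z : cycles C n" "a = C.hcls n z" by(auto simp: C.carrier_homology)
 have "C.hcls n (g n (f n z)) = C.hcls n z" by(rule C.hcls_eqI[OF _ _ gf]) (intro cc gc fc z(1))+
 thus "homology_map C n (g n) (homology_map D n (f n) a) = a"
 using z by(simp add: F Gm fc)
 qed
 show "ALL a:carrier (homology D n). homology_map D n (f n) (homology_map C n (g n) a) = a"
 proof
 fix a assume "a :> homology D n"
 then obtain z where z: "z : cycles D n" "a = D.hcls n z" by(auto simp: D.carrier_homology)
 have "D.hcls n (f n (g n z)) = D.hcls n z" by(rule D.hcls_eqI[OF _ _ fg]) (intro cd fc gc z(1))+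
 thus "homology_map D n (f n) (homology_map C n (g n) a) = a"
 using z by(simp add: F Gm gc)
 qed
 show "homology_map D n (f n) ` carrier (homology C n) <= carrier (homology D n)"
 by(auto simp: C.carrier_homology D.carrier_homology F fc)
 show "homology_map C n (g n) ` carrier (homology D n) <= carrier (homology C n)"
 by(auto simp: C.carrier_homology D.carrier_homology Gm gc)
 qed
qed

lemma bimodule_group_cpx: "is_bimodule_cpx K A P ==> group_cpx P"
 unfolding group_cpx_def
 by(auto intro: bhom_ahom[OF cpx_diff] is_bimodule.axioms(2)[OF cpx_bim] cpx_diff_diff)

lemma obj_Tr [simp]: "obj (Tr A P) n = trob A (obj P n)"
 by(simp add: Tr_def)

lemma diff_Tr: "diff (Tr A P) n = trace_hom A (obj P (n-1)) (diff P n)"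
 by(simp add: Tr_def)

lemma trace_group_cpx:
 assumes P: "is_bimodule_cpx K A P"
 shows "group_cpx (Tr A P)"
proof -
 note Pb = cpx_bim[OF P] and Pd = cpx_diff[OF P]
 have dt: "diff (Tr A P) n (tr A (obj P n) x) = tr A (obj P (n-1)) (diff P n x)" if "x :> obj P n" for n x
 using that trace_hom_tr(2)[OF Pb Pb Pd] by(simp add: diff_Tr)
 show ?thesis
 proof (rule group_cpx.intro)
 show "abelian_group (obj (Tr A P) n)" for n
 using is_bimodule.TrG[OF Pb] by simp
 show "diff (Tr A P) n : ahom (obj (Tr A P) n) (obj (Tr A P) (n-1))" for n
 using trace_hom_tr(1)[OF Pb Pb Pd] by(simp add: diff_Tr)
 show "diff (Tr A P) (n-1) (diff (Tr A P) n z) = 0[obj (Tr A P) (n-2)]"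
 if z: "z :> obj (Tr A P) n" for n z
 proof -
 obtain x where x: "x :> obj P n" "z = tr A (obj P n) x"
 using z is_bimodule.tr_surj[OF Pb, of z n] by auto
 thus ?thesis
 using dt[of x n] dt[of "diff P n x" "n - 1"] bhom_cl[OF Pd x(1)] cpx_diff_diff[OF P x(1)]
 is_bimodule.tr_rules(3)[OF Pb, of "n - 2"] by simp
 qed
 qed
qed

lemma diff_Tr_tr:
 assumes P: "is_bimodule_cpx K A P" and x: "x :> obj P n"
 shows "diff (Tr A P) n (tr A (obj P n) x) = tr A (obj P (n-1)) (diff P n x)"
 using trace_hom_tr(2)[OF cpx_bim[OF P] cpx_bim[OF P] cpx_diff[OF P] x] by(simp add: diff_Tr)

lemma obj_shift [simp]: "obj (shift P t) n = obj P (t+n)"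
 by(simp add: shift_def)

lemma shift_is_cpx:
 assumes P: "is_bimodule_cpx K A P"
 shows "is_bimodule_cpx K A (shift P 1)"
 unfolding is_bimodule_cpx_def
proof (intro conjI allI ballI)
 note Pb = cpx_bim[OF P] and Pd = cpx_diff[OF P]
 fix n
 show "is_bimodule K A (obj (shift P 1) n)" using Pb by simp
 show "diff (shift P 1) n : bhom A (obj (shift P 1) n) (obj (shift P 1) (n-1))"
 using bhom_signed[OF Pb Pd, of "1 + n" 1] by(simp add: shift_def)
 fix x assume x: "x :> obj (shift P 1) n"
 interpret N: is_bimodule K A "obj P (n-1)" by(rule Pb)
 have "diff P (1+n) x :> obj P n" using x bhom_cl[OF Pd, of x "1 + n"] by simp
 thus "diff (shift P 1) (n-1) (diff (shift P 1) n x) = 0[obj (shift P 1) (n-2)]"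
 using x cpx_diff_diff[OF P, of x "1 + n"] bhom_rules[OF Pb Pb Pd[of n]]
 by(simp add: shift_def signed_def)
qed

text \<open>The shifted differential is the negative of the old one, and negation permutes the
  carrier on which it is evaluated.\<close>

lemma boundaries_Tr_shift:
 assumes P: "is_bimodule_cpx K A P"
 shows "boundaries (Tr A (shift P 1)) n = boundaries (Tr A P) (1+n)"
proof -
 note Pb = cpx_bim[OF P] and Pd = cpx_diff[OF P]
 note Sh = shift_is_cpx[OF P]
 interpret C: group_cpx "Tr A P" by(rule trace_group_cpx[OF P])
 interpret N1: is_bimodule K A "obj P (2+n)" by(rule Pb)
 interpret N0: is_bimodule K A "obj P (1+n)" by(rule Pb)
 interpret T1: abelian_group "trob A (obj P (2+n))" by(rule N1.TrG)
 have v: "diff (Tr A (shift P 1)) (n+1) z = -[trob A (obj P (1+n))] diff (Tr A P) (2+n) z"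
 if z: "z :> trob A (obj P (2+n))" for z
 proof -
 obtain x where x: "x :> obj P (2+n)" "z = tr A (obj P (2+n)) x" using z by(rule N1.tr_surj)
 have dx: "diff P (2+n) x :> obj P (1+n)" using bhom_cl[OF Pd x(1)] by simp
 have "diff (Tr A (shift P 1)) (n+1) z = tr A (obj P (1+n)) (-[obj P (1+n)] diff P (2+n) x)"
 using diff_Tr_tr[OF Sh, of x "n + 1"] x by(simp add: shift_def signed_def add.commute)
 also have "... = -[trob A (obj P (1+n))] tr A (obj P (1+n)) (diff P (2+n) x)"
 using dx by(rule N0.tr_rules)
 also have "tr A (obj P (1+n)) (diff P (2+n) x) = diff (Tr A P) (2+n) z"
 using diff_Tr_tr[OF P x(1)] x(2) by simp
 finally show ?thesis .
 qed
 have neg: "diff (Tr A P) (2+n) (-[trob A (obj P (2+n))] z) = -[trob A (obj P (1+n))] diff (Tr A P) (2+n) z"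
 if z: "z :> trob A (obj P (2+n))" for z
 using C.d_rules(4)[of z "2 + n"] z by simp
 have B1: "boundaries (Tr A (shift P 1)) n = (%z. diff (Tr A (shift P 1)) (n+1) z) ` carrier (trob A (obj P (2+n)))"
 by(simp add: boundaries_def add.commute)
 have B2: "boundaries (Tr A P) (1+n) = diff (Tr A P) (2+n) ` carrier (trob A (obj P (2+n)))"
 by(simp add: boundaries_def add.commute)
 show ?thesis
 proof (intro equalityI subsetI)
 fix b assume "b : boundaries (Tr A (shift P 1)) n"
 then obtain z where z: "z :> trob A (obj P (2+n))" "b = diff (Tr A (shift P 1)) (n+1) z"
 unfolding B1 by blast
 hence "b = diff (Tr A P) (2+n) (-[trob A (obj P (2+n))] z)" by(simp only: v neg)
 thus "b : boundaries (Tr A P) (1+n)" unfolding B2 using T1.a_inv_closed[OF z(1)] by blast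
 next
 fix b assume "b : boundaries (Tr A P) (1+n)"
 then obtain z where z: "z :> trob A (obj P (2+n))" "b = diff (Tr A P) (2+n) z"
 unfolding B2 by blast
 hence "b = diff (Tr A (shift P 1)) (n+1) (-[trob A (obj P (2+n))] z)"
 using v[OF T1.a_inv_closed[OF z(1)]] neg[OF T1.a_inv_closed[OF z(1)]] by simp
 thus "b : boundaries (Tr A (shift P 1)) n" unfolding B1 using T1.a_inv_closed[OF z(1)] by blast
 qed
qed

lemma Tr_map_tr:
 assumes "is_bimodule_cpx K A P" "is_bimodule_cpx K A Q" "f n : bhom A (obj P n) (obj Q n)"
 shows "Tr_map A Q f n : ahom (trob A (obj P n)) (trob A (obj Q n))"
 and "!!x. x :> obj P n ==> Tr_map A Q f n (tr A (obj P n) x) = tr A (obj Q n) (f n x)"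
 using trace_hom_tr[OF cpx_bim[OF assms(1)] cpx_bim[OF assms(2)] assms(3)]
 by(simp_all add: Tr_map_def)

section \<open>Projective resolutions\<close>

lemma projective_resolution_resolution:
 assumes "projective_resolution K A P \<mu>"
 shows "resolution K A P \<mu>"
proof -
 note R = assms[unfolded projective_resolution_def]
 have P: "is_bimodule_cpx K A P" and neg: "!!n. n < 0 ==> carrier (obj P n) = {0[obj P n]}"
 and H: "!!n. n > 0 ==> carrier (homology P n) = {1[homology P n]}"
 and \<mu>: "\<mu> : bhom A (obj P 0) (reg_bim A)"
 and \<mu>d: "!!x. x :> obj P 1 ==> \<mu> (diff P 1 x) = 0[A]"
 and bij: "bij_betw (%C. the_elem (\<mu> ` C)) (carrier (homology P 0)) (carrier A)"
 using R by auto
 interpret C: group_cpx P by(rule bimodule_group_cpx[OF P])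
 interpret N: is_bimodule K A "obj P 0" by(rule cpx_bim[OF P])
 interpret N': is_bimodule K A "obj P 1" by(rule cpx_bim[OF P])
 interpret Rg: is_bimodule K A "reg_bim A" by(rule N.reg_bim)
 note \<mu>r = bhom_rules[OF cpx_bim[OF P] Rg.is_bimodule_axioms \<mu>]
 have cyc: "cycles P 0 = carrier (obj P 0)"
 using neg[of "- 1"] C.d_rules(1)[of _ 0] by(auto simp: cycles_def)
 \<comment> \<open>As \<mu> kills boundaries, it is constant on classes. Through this equation the
   bijection on homology in degree 0 yields both that the kernel of \<mu> consists of boundaries and
   that \<mu> is onto.\<close>
 have the: "the_elem (\<mu> ` C.hcls 0 x) = \<mu> x" if x: "x :> obj P 0" for x
 proof -
 have "\<mu> u = \<mu> x" if u: "u : C.hcls 0 x" for u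
 proof -
 obtain y where y: "y :> obj P 1" "u = diff P 1 y +[obj P 0] x"
 using u unfolding C.hcls_iff by(auto simp: boundaries_def)
 hence "diff P 1 y :> obj P 0" using C.d_rules(1)[of y 1] by simp
 thus ?thesis using y x \<mu>r \<mu>d by(simp add: N.regular_simps)
 qed
 hence "\<mu> ` C.hcls 0 x = {\<mu> x}" using C.hcls_self[OF x] by blast
 thus ?thesis by simp
 qed
 have "x : diff P 1 ` carrier (obj P 1)" if x: "x :> obj P 0" and \<mu>x: "\<mu> x = 0[A]" for x
 proof -
 have z: "0[obj P 0] :> obj P 0" by simp
 have "the_elem (\<mu> ` C.hcls 0 x) = the_elem (\<mu> ` C.hcls 0 0[obj P 0])"
 using the[OF x] the[OF z] \<mu>x \<mu>r(3) by(simp add: N.regular_simps)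
 hence "C.hcls 0 x = C.hcls 0 0[obj P 0]"
 using bij x z by(auto simp: bij_betw_def inj_on_def C.carrier_homology cyc)
 hence "x -[obj P 0] 0[obj P 0] : boundaries P 0" using C.hcls_eqD[OF x z] by simp
 thus ?thesis using x by(simp add: boundaries_def)
 qed
 moreover have "\<mu> ` carrier (obj P 0) = carrier A"
 proof -
 have "carrier A = (%C. the_elem (\<mu> ` C)) ` carrier (homology P 0)" using bij by(simp add: bij_betw_def)
 also have "... = \<mu> ` carrier (obj P 0)" by(force simp: C.carrier_homology cyc the)
 finally show ?thesis by simp
 qed
 moreover have "x : diff P (n+1) ` carrier (obj P (n+1))"
 if "n > 0" "x :> obj P n" "diff P n x = 0[obj P (n-1)]" for n x
 using C.homology_zeroD[OF H[OF that(1)], of x] that by(simp add: cycles_def boundaries_def)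
 ultimately show ?thesis
 unfolding resolution_def using P neg \<mu> \<mu>d by auto
qed

text \<open>A contraction of the augmented complex that is linear over the right action. It exists for
 every projective resolution, since \<open>A\<close> is free as a right module; here it is transferred from the
 bar resolution.\<close>

locale right_contraction = augmented_cpx K A P \<mu>
 for K :: "'k ring" and A :: "('k, 'a) module" and P :: "('a, 'p) bimodule_cpx" and \<mu> :: "'p => 'a" +
 fixes s :: "int => 'p => 'p" and e :: 'p
 assumes neg: "!!n. n < 0 ==> carrier (obj P n) = {0[obj P n]}"
 and s: "!!n. s n : ahom (obj P n) (obj P (n+1))"
 and s_ract: "!!n x a. x :> obj P n ==> a :> A ==>
 s n (ract (obj P n) x a) = ract (obj P (n+1)) (s n x) a"
 and e: "e :> obj P 0"
 and contraction: "!!n x. x :> obj P n ==>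
 diff P (n+1) (s n x) +[obj P n] s (n-1) (diff P n x) +[obj P n]
 (if n = 0 then ract (obj P 0) e (\<mu> x) else 0[obj P n]) = x"
begin

lemmas s_rules = ahom_rules[OF PP.PG PP.PG s]
lemmas dP = bhom_rules[OF PP.PB PP.PB cpx_diff[OF P]]

text \<open>This is s \<otimes> 1. It respects balancing because s is linear over the right action,
  and it carries no sign because s stands in the left factor.\<close>

definition stens :: "int => ('p, 'p) tensor_gen fab => ('p, 'p) tensor_gen fab" where
 "stens n = plift (PP.T (n+1)) (%((i, x), (j, y)). PP.tc (n+1) (i+1) (s i x) j y)"

lemma stens:
 shows "stens n : ahom (PP.T n) (PP.T (n+1))"
 and "!!i x j y. i + j = n ==> x :> obj P i ==> y :> obj P j ==>
 stens n (PP.tc n i x j y) = PP.tc (n+1) (i+1) (s i x) j y"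
proof -
 have "stens n : ahom (PP.T n) (PP.T (n+1)) &
 (\<forall>i x j y. i + j = n --> x :> obj P i --> y :> obj P j -->
 stens n (PP.tc n i x j y) = PP.tc (n+1) (i+1) (s i x) j y)"
 unfolding stens_def
 using PP.tensor_lift[OF PP.TG, of n "%i x j y. PP.tc (n+1) (i+1) (s i x) j y" "n + 1"]
 by(simp add: PP.tc_closed s_rules PP.tc_rules1 PP.tc_rules2 s_ract PP.tc_bal)
 thus "stens n : ahom (PP.T n) (PP.T (n+1))"
 "!!i x j y. i + j = n ==> x :> obj P i ==> y :> obj P j ==>
 stens n (PP.tc n i x j y) = PP.tc (n+1) (i+1) (s i x) j y"
 by auto
qed

text \<open>The contraction of P is tensored with the identity. The cross terms s x \<otimes> d y
  have sign exponents i + 1 and i and cancel; the augmentation term e \<mu>(x) \<otimes> y is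
  balanced to e \<otimes> \<mu>(x) y, that is e \<otimes> \<open>cl\<close>.\<close>

lemma stens_contraction:
 assumes t: "t :> PP.T n"
 shows "diff (tensor A P P) (n+1) (stens n t) +[PP.T n] stens (n-1) (diff (tensor A P P) n t)
 +[PP.T n] PP.tc n 0 e n (cl n t) = t"
proof -
 interpret T: abelian_group "PP.T n" by(rule PP.TG)
 interpret T': abelian_group "PP.T (n-1)" by(rule PP.TG)
 have d1: "diff (tensor A P P) (n+1) : ahom (PP.T (n+1)) (PP.T n)"
 using bhom_ahom[OF PP.tensor_diff(1)[of "n + 1"]] by simp
 have s1: "stens (n-1) : ahom (PP.T (n-1)) (PP.T n)" using stens(1)[of "n - 1"] by simp
 note s1r = ahom_rules[OF PP.TG PP.TG s1]
 show ?thesis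
 proof (rule PP.tensor_ext[OF PP.TG _ ahom_id t])
 show "(%t. diff (tensor A P P) (n+1) (stens n t) +[PP.T n] stens (n-1) (diff (tensor A P P) n t)
 +[PP.T n] PP.tc n 0 e n (cl n t)) : ahom (PP.T n) (PP.T n)"
 by(intro ahom_plus[OF PP.TG] ahom_comp[OF stens(1) d1] ahom_comp[OF bhom_ahom[OF PP.tensor_diff(1)] s1]
 ahom_comp[OF bhom_ahom[OF cl_hom] PP.tc_ahom2] e) simp
 fix i x j y assume ij: "i + j = n" and x: "x :> obj P i" and y: "y :> obj P j"
 interpret N: is_bimodule K A "obj P i" by(rule PP.PB)
 have dx: "diff P i x :> obj P (i-1)" and dy: "diff P j y :> obj P (j-1)"
 and sx: "s i x :> obj P (i+1)"
 using x y by(simp_all add: dP s_rules)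
 have dsx: "diff P (i+1) (s i x) :> obj P i" using dP(1)[OF sx] by simp
 have sdx: "s (i-1) (diff P i x) :> obj P i" using s_rules(1)[OF dx] by simp
 let ?w = "PP.tc n (i+1) (s i x) (j-1) (diff P j y)"
 have w: "?w :> PP.T n" using ij sx dy by(simp add: PP.tc_closed)
 have A1: "diff (tensor A P P) (n+1) (stens n (PP.tc n i x j y))
 = PP.tc n i (diff P (i+1) (s i x)) j y +[PP.T n] signed (PP.T n) (i+1) ?w"
 using ij x y sx PP.tensor_diff(2)[of "i + 1" j "n + 1" "s i x" y] by(simp add: stens(2))
 have st: "stens (n-1) (PP.tc (n-1) k u l v) = PP.tc n (k+1) (s k u) l v"
 if "k + l = n - 1" "u :> obj P k" "v :> obj P l" for k u l v
 using stens(2)[OF that] by simp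
 have A2: "stens (n-1) (diff (tensor A P P) n (PP.tc n i x j y))
 = PP.tc n i (s (i-1) (diff P i x)) j y +[PP.T n] signed (PP.T n) i ?w"
 using ij x y dx dy by(simp add: PP.tensor_diff(2) s1r PP.tc_closed st)
 have A3: "PP.tc n 0 e n (cl n (PP.tc n i x j y))
 = PP.tc n i (if i = 0 then ract (obj P 0) e (\<mu> x) else 0[obj P i]) j y"
 proof (cases "i = 0")
 case True
 thus ?thesis using ij x y e by(simp add: cl_tc PP.tc_bal \<mu>_rules)
 next
 case False
 thus ?thesis using ij x y e PP.tc_rules1(3)[OF ij y] PP.tc_rules2(3)[of 0 n n e] by(simp add: cl_tc)
 qed
 have c: "(if i = 0 then ract (obj P 0) e (\<mu> x) else 0[obj P i]) :> obj P i" (is "?e : _")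
 using e x N.ract_closed \<mu>_rules(1) by auto
 have sum: "PP.tc n i (diff P (i+1) (s i x)) j y +[PP.T n] PP.tc n i (s (i-1) (diff P i x)) j y
 +[PP.T n] PP.tc n i ?e j y = PP.tc n i x j y"
 using contraction[OF x] PP.tc_rules1(2)[OF ij y dsx sdx] PP.tc_rules1(2)[OF ij y N.B.a_closed[OF dsx sdx] c]
 by simp
 have cl: "PP.tc n i (diff P (i+1) (s i x)) j y :> PP.T n"
 "PP.tc n i (s (i-1) (diff P i x)) j y :> PP.T n" "PP.tc n i ?e j y :> PP.T n"
 using PP.tc_closed ij y dsx sdx c by blast+
 have alg: "a +[PP.T n] signed (PP.T n) (i+1) ?w +[PP.T n] (b +[PP.T n] signed (PP.T n) i ?w) +[PP.T n] c
 = a +[PP.T n] b +[PP.T n] c"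
 if abc: "a :> PP.T n" "b :> PP.T n" "c :> PP.T n" for a b c
 proof (cases "even i")
 case True
 have "a +[PP.T n] -[PP.T n] ?w +[PP.T n] (b +[PP.T n] ?w) +[PP.T n] c = a +[PP.T n] b +[PP.T n] c"
 using abc w by algebra
 thus ?thesis using True by(simp add: signed_def)
 next
 case False
 have "a +[PP.T n] ?w +[PP.T n] (b +[PP.T n] -[PP.T n] ?w) +[PP.T n] c = a +[PP.T n] b +[PP.T n] c"
 using abc w by algebra
 thus ?thesis using False by(simp add: signed_def)
 qed
 show "diff (tensor A P P) (n+1) (stens n (PP.tc n i x j y)) +[PP.T n]
 stens (n-1) (diff (tensor A P P) n (PP.tc n i x j y)) +[PP.T n] PP.tc n 0 e n (cl n (PP.tc n i x j y)) = PP.tc n i x j y"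
 unfolding A1 A2 A3 alg[OF cl] by(rule sum)
 qed
qed

lemma unit_tensor_diff:
 assumes y: "y :> obj P n"
 shows "diff (tensor A P P) n (PP.tc n 0 e n y) = PP.tc (n-1) 0 e (n-1) (diff P n y)"
proof -
 interpret T: abelian_group "PP.T (n-1)" by(rule PP.TG)
 have "diff P 0 e :> obj P (- 1)" using dP(1)[OF e] by simp
 hence "diff P 0 e = 0[obj P (- 1)]" using neg[of "- 1"] by simp
 moreover have "PP.tc (n-1) (- 1) 0[obj P (- 1)] n y = 0[PP.T (n-1)]"
 using y by(intro PP.tc_rules1(3)) simp_all
 ultimately show ?thesis
 using PP.tensor_diff(2)[of 0 n n e y] y e by(simp add: signed_def PP.tc_closed dP)
qed

text \<open>By \<open>stens_contraction\<close> a cycle t differs from a boundary by e \<otimes>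
  \<open>cl\<close> t. If \<open>cl\<close> t is d w, this term is the boundary of e \<otimes> w, so
  exactness of P \<otimes> P is reduced to exactness of P.\<close>

lemma tensor_exact:
 assumes t: "t :> PP.T n" and dt: "diff (tensor A P P) n t = 0[PP.T (n-1)]"
 and ex: "cl n t : diff P (n+1) ` carrier (obj P (n+1))"
 shows "t : diff (tensor A P P) (n+1) ` carrier (PP.T (n+1))"
proof -
 interpret T: abelian_group "PP.T n" by(rule PP.TG)
 interpret T1: abelian_group "PP.T (n+1)" by(rule PP.TG)
 obtain w where w: "w :> obj P (n+1)" "cl n t = diff P (n+1) w" using ex by blast
 have d1: "diff (tensor A P P) (n+1) : ahom (PP.T (n+1)) (PP.T n)"
 using bhom_ahom[OF PP.tensor_diff(1)[of "n + 1"]] by simp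
 note d1r = ahom_rules[OF PP.TG PP.TG d1]
 have st: "stens n t :> PP.T (n+1)" using ahom_closed[OF stens(1) t] .
 have ew: "PP.tc (n+1) 0 e (n+1) w :> PP.T (n+1)" using w e by(simp add: PP.tc_closed)
 have "stens (n-1) 0[PP.T (n-1)] = 0[PP.T n]"
 using ahom_rules(3)[OF PP.TG PP.TG stens(1), of "n - 1"] by simp
 hence "t = diff (tensor A P P) (n+1) (stens n t) +[PP.T n] PP.tc n 0 e n (diff P (n+1) w)"
 using stens_contraction[OF t] dt w(2) d1r(1)[OF st] by simp
 also have "PP.tc n 0 e n (diff P (n+1) w) = diff (tensor A P P) (n+1) (PP.tc (n+1) 0 e (n+1) w)"
 using unit_tensor_diff[OF w(1)] by simp
 finally have "t = diff (tensor A P P) (n+1) (stens n t +[PP.T (n+1)] PP.tc (n+1) 0 e (n+1) w)"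
 using d1r(2)[OF st ew] by simp
 thus ?thesis using T1.a_closed[OF st ew] by blast
qed

end

section \<open>Multilinear maps on lists\<close>

definition klinear :: "'k ring => ('k, 'a) module => ('a => 'a) => bool" where
 "klinear K A L \<longleftrightarrow> (ALL a:carrier A. L a :> A) &
 (ALL a:carrier A. ALL b:carrier A. L (a +[A] b) = L a +[A] L b) &
 (ALL c:carrier K. ALL a:carrier A. L (c .*[A] a) = c .*[A] L a)"

text \<open>The target carries no scalar multiplication, so homogeneity says that a scalar may be moved
 between any two positions.\<close>

definition multilinear :: "'k ring => ('k, 'a) module => nat => ('t, 'z) ring_scheme => ('a list => 't) => bool" where
 "multilinear K A m T g \<longleftrightarrow> (ALL as:Tg A m. g as :> T &
 (\<forall>k < m. ALL a:carrier A. ALL b:carrier A.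
 g (as[k := a +[A] b]) = g (as[k := a]) +[T] g (as[k := b])) &
 (\<forall>k < m. \<forall>l < m. ALL c:carrier K.
 g (as[k := c .*[A] as ! k]) = g (as[l := c .*[A] as ! l])))"

text \<open>A change of one entry of the list changes a single entry of the result, through a linear
  map \<open>L\<close> that may depend on the other entries. Multilinearity is preserved under
  composition with such list operations, so each operation is checked once.\<close>

definition slotwise_linear :: "'k ring => ('k, 'a) module => nat => nat => ('a list => 'a list) => bool" where
 "slotwise_linear K A m m' F \<longleftrightarrow> (ALL as:Tg A m. F as : Tg A m' &
 (\<forall>k < m. \<exists>k' < m'. \<exists>L. klinear K A L & (ALL a:carrier A. F (as[k := a]) = (F as)[k' := L a])))"

definition face :: "('k, 'a) module => nat => 'a list => 'a list" where
 "face A i as = take i as @ (as ! i *[A] as ! (i+1)) # drop (i+2) as"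

lemma gens_iff: "as : Tg A m \<longleftrightarrow> length as = m & set as <= carrier A"
 by(simp add: tpow_gens_def)

lemma gens_update: "as : Tg A m ==> a :> A ==> as[k := a] : Tg A m"
 using set_update_subset_insert[of as k a] by(auto simp: gens_iff)

lemma gens_nth: "as : Tg A m ==> k < m ==> as ! k :> A"
 by(auto simp: gens_iff)

lemma multilinear_closed: "multilinear K A m T g ==> as : Tg A m ==> g as :> T"
 by(simp add: multilinear_def)

lemma multilinear_add:
 "multilinear K A m T g ==> as : Tg A m ==> k < m ==> a :> A ==> b :> A ==>
 g (as[k := a +[A] b]) = g (as[k := a]) +[T] g (as[k := b])"
 by(simp add: multilinear_def)

lemma multilinear_smult:
 "multilinear K A m T g ==> as : Tg A m ==> k < m ==> l < m ==> c :> K ==>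
 g (as[k := c .*[A] as ! k]) = g (as[l := c .*[A] as ! l])"
 unfolding multilinear_def by blast

lemma tpow_rels_cases:
 assumes "u : tpow_rels K A m"
 obtains as a b bs where "u = frag_of (as @ (a +[A] b) # bs) - frag_of (as @ a # bs) - frag_of (as @ b # bs)"
 "length as + length bs + 1 = m" "set as <= carrier A" "set bs <= carrier A"
 "a :> A" "b :> A"
 | as c a b bs where "u = frag_of (as @ (c .*[A] a) # b # bs) - frag_of (as @ a # (c .*[A] b) # bs)"
 "length as + length bs + 2 = m" "set as <= carrier A" "set bs <= carrier A"
 "c :> K" "a :> A" "b :> A"
 using assms unfolding tpow_rels_def by blast

context assoc_algebra
begin

abbreviation "pt \<equiv> pure_tensor K A"

lemma klinear_id: "klinear K A (%a. a)"
 by(simp add: klinear_def)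

lemma klinear_mult_left: "x :> A ==> klinear K A (%a. x *[A] a)"
 by(simp add: klinear_def A.r_distr smult_mult_right)

lemma klinear_mult_right: "x :> A ==> klinear K A (%a. a *[A] x)"
 by(simp add: klinear_def A.l_distr smult_mult_left)

lemma klinear_comp: "klinear K A L ==> klinear K A L' ==> klinear K A (%a. L' (L a))"
 by(simp add: klinear_def)

lemma multilinear_slotwise:
 assumes g: "multilinear K A m' T g" and F: "slotwise_linear K A m m' F"
 shows "multilinear K A m T (%as. g (F as))"
 unfolding multilinear_def
proof (intro ballI conjI allI impI)
 fix as assume as: "as : Tg A m"
 have Fas: "F as : Tg A m'" using F as by(simp add: slotwise_linear_def)
 show "g (F as) :> T" using g Fas by(simp add: multilinear_def)
 {
 fix k a b assume k: "k < m" and ab: "a :> A" "b :> A"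
 obtain k' L where "k' < m'" "klinear K A L" "!!a. a :> A ==> F (as[k := a]) = (F as)[k' := L a]"
 using F as k unfolding slotwise_linear_def by blast
 thus "g (F (as[k := a +[A] b])) = g (F (as[k := a])) +[T] g (F (as[k := b]))"
 using g Fas ab by(simp add: multilinear_def klinear_def)
 }
 \<comment> \<open>The entry at k' of \<open>F as\<close> is L of the old entry at k, and L is
   homogeneous; hence scaling one entry of the argument scales one entry of the value.\<close>
 have sc: "\<exists>k' < m'. F (as[k := c .*[A] as ! k]) = (F as)[k' := c .*[A] F as ! k']"
 if k: "k < m" and c: "c :> K" for k c
 proof -
 obtain k' L where L: "k' < m'" "klinear K A L" "!!a. a :> A ==> F (as[k := a]) = (F as)[k' := L a]"
 using F as k unfolding slotwise_linear_def by blast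
 have a: "as ! k :> A" using gens_nth[OF as k] .
 have "F as = (F as)[k' := L (as ! k)]" using L(3)[OF a] by simp
 hence "F as ! k' = L (as ! k)"
 using L(1) Fas by(metis nth_list_update_eq gens_iff)
 hence "F (as[k := c .*[A] as ! k]) = (F as)[k' := c .*[A] F as ! k']"
 using L a c by(simp add: klinear_def smult_closed)
 thus ?thesis using L(1) by blast
 qed
 fix k l c assume kl: "k < m" "l < m" and c: "c :> K"
 obtain k' l' where "k' < m'" "l' < m'" "F (as[k := c .*[A] as ! k]) = (F as)[k' := c .*[A] F as ! k']"
 "F (as[l := c .*[A] as ! l]) = (F as)[l' := c .*[A] F as ! l']"
 using sc kl c by blast
 moreover from this have "g ((F as)[k' := c .*[A] F as ! k']) = g ((F as)[l' := c .*[A] F as ! l'])"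
 using g Fas c unfolding multilinear_def by blast
 ultimately show "g (F (as[k := c .*[A] as ! k])) = g (F (as[l := c .*[A] as ! l]))"
 by simp
qed

lemma multilinear_cong:
 assumes g: "multilinear K A m T g" and eq: "!!as. as : Tg A m ==> g' as = g as"
 shows "multilinear K A m T g'"
 unfolding multilinear_def
proof (intro ballI conjI allI impI)
 fix as assume as: "as : Tg A m"
 show "g' as :> T" using multilinear_closed[OF g as] eq[OF as] by simp
 show "g' (as[k := a +[A] b]) = g' (as[k := a]) +[T] g' (as[k := b])"
 if "k < m" "a :> A" "b :> A" for k a b
 using multilinear_add[OF g as that] that by(simp add: eq gens_update[OF as])
 show "g' (as[k := c .*[A] as ! k]) = g' (as[l := c .*[A] as ! l])"
 if "k < m" "l < m" "c :> K" for k l c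
 using multilinear_smult[OF g as that] that
 by(simp add: eq gens_update[OF as] smult_closed gens_nth[OF as])
qed

text \<open>When the target does have scalars, comparing every slot with one common operator
  \<open>sc\<close> is easier than comparing two slots with each other.\<close>

lemma multilinear_scalI:
 assumes "!!as. as : Tg A m ==> g as :> T"
 and "!!as k a b. as : Tg A m ==> k < m ==> a :> A ==> b :> A ==>
 g (as[k := a +[A] b]) = g (as[k := a]) +[T] g (as[k := b])"
 and "!!as k c. as : Tg A m ==> k < m ==> c :> K ==>
 g (as[k := c .*[A] as ! k]) = sc c (g as)"
 shows "multilinear K A m T g"
 using assms by(simp add: multilinear_def)

lemma multilinear_ahom:
 assumes g: "multilinear K A m T g" and h: "h : ahom T T'"
 shows "multilinear K A m T' (%as. h (g as))"
 unfolding multilinear_def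
proof (intro ballI conjI allI impI)
 fix as assume as: "as : Tg A m"
 have c: "g bs :> T" if "bs : Tg A m" for bs using g that by(simp add: multilinear_def)
 show "h (g as) :> T'" using c[OF as] ahom_closed[OF h] by blast
 show "h (g (as[k := a +[A] b])) = h (g (as[k := a])) +[T'] h (g (as[k := b]))"
 if "k < m" "a :> A" "b :> A" for k a b
 proof -
 have "g (as[k := a +[A] b]) = g (as[k := a]) +[T] g (as[k := b])"
 using g as that by(simp add: multilinear_def)
 thus ?thesis using ahom_add[OF h] c gens_update[OF as] that by simp
 qed
 show "h (g (as[k := c .*[A] as ! k])) = h (g (as[l := c .*[A] as ! l]))"
 if "k < m" "l < m" "c :> K" for k l c
 using g as that unfolding multilinear_def by metis
qed

lemma multilinear_finsum:
 assumes T: "abelian_group T" and g: "!!i. i : I ==> multilinear K A m T (g i)"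
 shows "multilinear K A m T (%as. \<Oplus>\<^bsub>T\<^esub>i\<in>I. g i as)"
proof -
 interpret T: abelian_group T by(rule T)
 have c: "g i bs :> T" if "bs : Tg A m" "i : I" for i bs
 using g[OF that(2)] that(1) by(simp add: multilinear_def)
 show ?thesis
 unfolding multilinear_def
 proof (intro ballI conjI allI impI)
 fix as assume as: "as : Tg A m"
 show "(\<Oplus>\<^bsub>T\<^esub>i\<in>I. g i as) :> T" using c[OF as] by(intro T.finsum_closed) auto
 show "(\<Oplus>\<^bsub>T\<^esub>i\<in>I. g i (as[k := a +[A] b])) = (\<Oplus>\<^bsub>T\<^esub>i\<in>I. g i (as[k := a])) +[T] (\<Oplus>\<^bsub>T\<^esub>i\<in>I. g i (as[k := b]))"
 if k: "k < m" and a: "a :> A" and b: "b :> A" for k a b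
 proof -
 have "(\<Oplus>\<^bsub>T\<^esub>i\<in>I. g i (as[k := a +[A] b])) = (\<Oplus>\<^bsub>T\<^esub>i\<in>I. g i (as[k := a]) +[T] g i (as[k := b]))"
 by(rule T.finsum_cong')
 (auto intro!: multilinear_add[OF g as k a b] T.a_closed c gens_update[OF as] a b)
 also have "... = (\<Oplus>\<^bsub>T\<^esub>i\<in>I. g i (as[k := a])) +[T] (\<Oplus>\<^bsub>T\<^esub>i\<in>I. g i (as[k := b]))"
 by(rule T.finsum_addf) (auto intro!: c gens_update[OF as] a b)
 finally show ?thesis .
 qed
 show "(\<Oplus>\<^bsub>T\<^esub>i\<in>I. g i (as[k := c .*[A] as ! k])) = (\<Oplus>\<^bsub>T\<^esub>i\<in>I. g i (as[l := c .*[A] as ! l]))"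
 if k: "k < m" and l: "l < m" and cc: "c :> K" for k l c
 proof (rule T.finsum_cong')
 show "(%i. g i (as[l := c .*[A] as ! l])) : I \<rightarrow> carrier T"
 using c gens_update[OF as smult_closed[OF cc gens_nth[OF as l]]] by blast
 show "g i (as[k := c .*[A] as ! k]) = g i (as[l := c .*[A] as ! l])" if "i : I" for i
 by(rule multilinear_smult[OF g[OF that] as k l cc])
 qed simp
 qed
qed

lemma slotwise_comp:
 assumes F: "slotwise_linear K A m m' F" and G: "slotwise_linear K A m' m'' G"
 shows "slotwise_linear K A m m'' (%as. G (F as))"
 unfolding slotwise_linear_def
proof (intro ballI conjI allI impI)
 fix as assume as: "as : Tg A m"
 have Fas: "F as : Tg A m'" using F as by(simp add: slotwise_linear_def)
 thus "G (F as) : Tg A m''" using G by(simp add: slotwise_linear_def)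
 fix k assume k: "k < m"
 obtain k' L where L: "k' < m'" "klinear K A L" "!!a. a :> A ==> F (as[k := a]) = (F as)[k' := L a]"
 using F as k unfolding slotwise_linear_def by blast
 obtain k'' L' where L': "k'' < m''" "klinear K A L'"
 "!!a. a :> A ==> G ((F as)[k' := a]) = (G (F as))[k'' := L' a]"
 using G Fas L(1) unfolding slotwise_linear_def by blast
 show "\<exists>k'' < m''. \<exists>L. klinear K A L & (ALL a:carrier A. G (F (as[k := a])) = (G (F as))[k'' := L a])"
 using L L' klinear_comp[OF L(2) L'(2)]
 by(intro exI[of _ k''] conjI exI[of _ "%a. L' (L a)"]) (auto simp: klinear_def)
qed

lemma slotwise_Cons: "x :> A ==> slotwise_linear K A m (Suc m) ((#) x)"
 unfolding slotwise_linear_def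
proof (intro ballI conjI allI impI)
 fix as k assume "x :> A" "as : Tg A m" "k < m"
 thus "\<exists>k' < Suc m. \<exists>L. klinear K A L & (ALL a:carrier A. x # as[k := a] = (x # as)[k' := L a])"
 by(intro exI[of _ "Suc k"] conjI exI[of _ "%a. a"]) (simp_all add: klinear_id)
qed (simp add: gens_iff)

lemma slotwise_snoc: "x :> A ==> slotwise_linear K A m (Suc m) (%as. as @ [x])"
 unfolding slotwise_linear_def
proof (intro ballI conjI allI impI)
 fix as k assume "x :> A" "as : Tg A m" "k < m"
 thus "\<exists>k' < Suc m. \<exists>L. klinear K A L & (ALL a:carrier A. as[k := a] @ [x] = (as @ [x])[k' := L a])"
 by(intro exI[of _ k] conjI exI[of _ "%a. a"]) (simp_all add: klinear_id gens_iff list_update_append)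
qed (simp add: gens_iff)

lemma slotwise_rotate1: "slotwise_linear K A m m rotate1"
 unfolding slotwise_linear_def
proof (intro ballI conjI allI impI)
 fix as k assume as: "as : Tg A m" and k: "k < m"
 then obtain b bs where b: "as = b # bs" by(cases as) (auto simp: gens_iff)
 show "\<exists>k' < m. \<exists>L. klinear K A L & (ALL a:carrier A. rotate1 (as[k := a]) = (rotate1 as)[k' := L a])"
 proof (cases k)
 case 0
 thus ?thesis using as b
 by(intro exI[of _ "length bs"] conjI exI[of _ "%a. a"]) (simp_all add: klinear_id gens_iff)
 next
 case (Suc l)
 thus ?thesis using as b k
 by(intro exI[of _ l] conjI exI[of _ "%a. a"]) (simp_all add: klinear_id gens_iff list_update_append)
 qed
qed (simp add: gens_iff)

lemma slotwise_rotate: "slotwise_linear K A m m (rotate i)"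
proof (induction i)
 case 0
 thus ?case
 by(auto simp: slotwise_linear_def intro!: klinear_id)
next
 case (Suc i)
 have "rotate (Suc i) = (%as. rotate1 (rotate i as))" by(simp add: fun_eq_iff)
 thus ?case using slotwise_comp[OF Suc slotwise_rotate1] by simp
qed

lemma slotwise_face: assumes i: "i < m" shows "slotwise_linear K A (Suc m) m (face A i)"
 unfolding slotwise_linear_def
proof (intro ballI conjI allI impI)
 fix as assume as: "as : Tg A (Suc m)"
 have "as ! i :> A" "as ! Suc i :> A" using gens_nth[OF as] i by simp_all
 thus "face A i as : Tg A m"
 using as i by(auto simp: gens_iff face_def dest: in_set_takeD in_set_dropD)
 fix k assume k: "k < Suc m"
 have len: "length as = Suc m" using as by(simp add: gens_iff)
 consider "k < i" | "k = i" | "k = Suc i" | "k > Suc i" by linarith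
 thus "\<exists>k' < m. \<exists>L. klinear K A L & (ALL a:carrier A. face A i (as[k := a]) = (face A i as)[k' := L a])"
 proof cases
 case 1
 thus ?thesis using i len
 by(intro exI[of _ k] conjI exI[of _ "%a. a"])
 (simp_all add: klinear_id face_def list_update_append take_update_swap drop_update_cancel)
 next
 case 2
 thus ?thesis using i len \<open>as ! Suc i :> A\<close>
 by(intro exI[of _ i] conjI exI[of _ "%a. a *[A] as ! Suc i"])
 (simp_all add: klinear_mult_right face_def list_update_append)
 next
 case 3
 thus ?thesis using i len \<open>as ! i :> A\<close>
 by(intro exI[of _ i] conjI exI[of _ "%a. as ! i *[A] a"])
 (simp_all add: klinear_mult_left face_def list_update_append)
 next
 case 4
 then obtain l where l: "k = Suc (Suc (i + l))" by(metis Suc_leI le_iff_add less_iff_Suc_add add_Suc add_Suc_right)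
 thus ?thesis using i len k
 by(intro exI[of _ "k - 1"] conjI exI[of _ "%a. a"])
 (simp_all add: klinear_id face_def list_update_append drop_update_swap)
 qed
qed

lemma slotwise_left_mult:
 assumes x: "x :> A"
 shows "slotwise_linear K A (Suc m) (Suc m) (%as. (x *[A] hd as) # tl as)"
 unfolding slotwise_linear_def
proof (intro ballI conjI allI impI)
 fix as assume as: "as : Tg A (Suc m)"
 then obtain b bs where b: "as = b # bs" by(cases as) (auto simp: gens_iff)
 thus "(x *[A] hd as) # tl as : Tg A (Suc m)" using x as by(simp add: gens_iff)
 fix k assume k: "k < Suc m"
 show "\<exists>k' < Suc m. \<exists>L. klinear K A L &
 (ALL a:carrier A. (x *[A] hd (as[k := a])) # tl (as[k := a]) = ((x *[A] hd as) # tl as)[k' := L a])"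
 proof (cases k)
 case 0
 thus ?thesis using b x by(intro exI[of _ 0] conjI exI[of _ "%a. x *[A] a"]) (simp_all add: klinear_mult_left)
 next
 case (Suc l)
 thus ?thesis using b k by(intro exI[of _ k] conjI exI[of _ "%a. a"]) (simp_all add: klinear_id)
 qed
qed

lemma slotwise_right_mult:
 assumes x: "x :> A"
 shows "slotwise_linear K A (Suc m) (Suc m) (%as. butlast as @ [last as *[A] x])"
 unfolding slotwise_linear_def
proof (intro ballI conjI allI impI)
 fix as assume as: "as : Tg A (Suc m)"
 then obtain b bs where b: "as = bs @ [b]" by(cases as rule: rev_cases) (auto simp: gens_iff)
 have len: "length bs = m" using as b by(simp add: gens_iff)
 show "butlast as @ [last as *[A] x] : Tg A (Suc m)" using x as b by(simp add: gens_iff)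
 fix k assume k: "k < Suc m"
 show "\<exists>k' < Suc m. \<exists>L. klinear K A L &
 (ALL a:carrier A. butlast (as[k := a]) @ [last (as[k := a]) *[A] x] = (butlast as @ [last as *[A] x])[k' := L a])"
 proof (cases "k = m")
 case True
 thus ?thesis using b x len
 by(intro exI[of _ m] conjI exI[of _ "%a. a *[A] x"]) (simp_all add: klinear_mult_right list_update_append)
 next
 case False
 thus ?thesis using b k len
 by(intro exI[of _ k] conjI exI[of _ "%a. a"]) (simp_all add: klinear_id list_update_append)
 qed
qed

lemma multilinear_rels:
 assumes T: "abelian_group T" and g: "multilinear K A m T g" and u: "u : tpow_rels K A m"
 shows "frag_eval T g u = 0[T]"
proof -
 \<comment> \<open>The evaluation lemmas live in \<open>presented_group\<close>; the empty set of
   relations gives an instance on the required generators.\<close>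
 interpret E: presented_group "Tg A m" "{}" "presented (Tg A m) {}"
 by(rule presented_groupI) simp
 have gc: "g as :> T" if "as : Tg A m" for as using g that by(simp add: multilinear_def)
 from u show ?thesis
 proof (cases rule: tpow_rels_cases)
 case (1 as a b bs)
 have "g ((as @ a # bs)[length as := a +[A] b])
 = g ((as @ a # bs)[length as := a]) +[T] g ((as @ a # bs)[length as := b])"
 using 1 by(intro multilinear_add[OF g]) (simp_all add: gens_iff)
 thus ?thesis unfolding 1(1)
 by(intro E.frag_eval_diff3[OF T gc]) (use 1 in \<open>simp_all add: gens_iff\<close>)
 next
 case (2 as c a b bs)
 let ?u = "as @ a # b # bs"
 have "?u : Tg A m" using 2 by(simp add: gens_iff)
 hence "g (?u[length as := c .*[A] ?u ! length as]) = g (?u[Suc (length as) := c .*[A] ?u ! Suc (length as)])"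
 using 2 by(intro multilinear_smult[OF g]) simp_all
 thus ?thesis unfolding 2(1)
 by(intro E.frag_eval_diff2[OF T gc])
 (use 2 in \<open>simp_all add: gens_iff smult_closed list_update_append nth_append\<close>)
 qed
qed

lemma tpow_rels_keys: "u : tpow_rels K A m ==> pkeys u <= Tg A m"
 by(cases rule: tpow_rels_cases)
 (auto simp: gens_iff smult_closed dest!: subsetD[OF keys_frag_diff2] subsetD[OF keys_frag_diff3])

lemma tpow_presented: "presented_group (Tg A m) (tpow_rels K A m) (tpow K A m)"
 unfolding tpow_def by(rule presented_groupI) (rule tpow_rels_keys)

lemma pure_tensor_eq: "as : Tg A m ==> pt as = gen_class (Tg A m) (tpow_rels K A m) as"
 by(simp add: pure_tensor_def gens_iff)

lemma multilinear_pure_tensor: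
 assumes "presented_group (Tg A m) (tpow_rels K A m) Q"
 shows "multilinear K A m Q pt"
proof -
 interpret Q: presented_group "Tg A m" "tpow_rels K A m" Q by fact
 \<comment> \<open>The relations move a scalar only between neighbouring slots. Induction carries it
   to slot 0, which serves as common reference for any two slots.\<close>
 have zero: "pt (as[k := c .*[A] as ! k]) = pt (as[0 := c .*[A] as ! 0])"
 if as: "as : Tg A m" and k: "k < m" and c: "c :> K" for as k c
 using k
 proof (induction k)
 case (Suc k)
 have len: "length as = m" using as by(simp add: gens_iff)
 have split: "as = take k as @ as ! k # as ! Suc k # drop (Suc (Suc k)) as"
 using Suc.prems len by(simp add: Cons_nth_drop_Suc)
 have u: "as[k := c .*[A] as ! k] = take k as @ (c .*[A] as ! k) # as ! Suc k # drop (Suc (Suc k)) as"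
 using Suc.prems len by(subst split) (simp add: list_update_append)
 have v: "as[Suc k := c .*[A] as ! Suc k] = take k as @ as ! k # (c .*[A] as ! Suc k) # drop (Suc (Suc k)) as"
 using Suc.prems len by(subst split) (simp add: list_update_append)
 have g: "as[k := c .*[A] as ! k] : Tg A m" "as[Suc k := c .*[A] as ! Suc k] : Tg A m"
 using as Suc.prems c gens_nth[OF as] by(auto intro!: gens_update smult_closed)
 have "frag_of (as[k := c .*[A] as ! k]) - frag_of (as[Suc k := c .*[A] as ! Suc k]) : tpow_rels K A m"
 proof -
 have "length (take k as) + length (drop (Suc (Suc k)) as) + 2 = m" "set (take k as) <= carrier A"
 "set (drop (Suc (Suc k)) as) <= carrier A" "as ! k :> A" "as ! Suc k :> A"
 using as Suc.prems gens_nth[OF as] by(auto simp: gens_iff dest: in_set_takeD in_set_dropD)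
 thus ?thesis unfolding u v tpow_rels_def using c by blast
 qed
 hence "pt (as[k := c .*[A] as ! k]) = pt (as[Suc k := c .*[A] as ! Suc k])"
 using Q.gen_diff2[OF _ g] g by(simp add: pure_tensor_eq[of _ m])
 thus ?case using Suc by simp
 qed simp
 show ?thesis
 unfolding multilinear_def
 proof (intro ballI conjI allI impI)
 fix as assume as: "as : Tg A m"
 show "pt as :> Q" using as by(simp add: pure_tensor_eq Q.gen_closed)
 show "pt (as[k := a +[A] b]) = pt (as[k := a]) +[Q] pt (as[k := b])"
 if k: "k < m" and ab: "a :> A" "b :> A" for k a b
 proof -
 have len: "length as = m" using as by(simp add: gens_iff)
 have u: "as[k := z] = take k as @ z # drop (Suc k) as" for z
 using k len by(simp add: upd_conv_take_nth_drop)
 have "frag_of (as[k := a +[A] b]) - frag_of (as[k := a]) - frag_of (as[k := b]) : tpow_rels K A m"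
 proof -
 have "length (take k as) + length (drop (Suc k) as) + 1 = m" "set (take k as) <= carrier A"
 "set (drop (Suc k) as) <= carrier A"
 using as k by(auto simp: gens_iff dest: in_set_takeD in_set_dropD)
 thus ?thesis unfolding u tpow_rels_def using ab by blast
 qed
 moreover have "as[k := z] : Tg A m" if "z :> A" for z using gens_update[OF as that] .
 ultimately show ?thesis using Q.gen_diff3[of "as[k := a +[A] b]" "as[k := a]" "as[k := b]"] ab
 by(simp add: pure_tensor_eq[of _ m])
 qed
 show "pt (as[k := c .*[A] as ! k]) = pt (as[l := c .*[A] as ! l])"
 if "k < m" "l < m" "c :> K" for k l c
 using zero[OF as that(1,3)] zero[OF as that(2,3)] by simp
 qed
qed

lemma multilinear_lift:
 assumes Q: "presented_group (Tg A m) (tpow_rels K A m) Q"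
 and T: "abelian_group T" and g: "multilinear K A m T g"
 shows "plift T g : ahom Q T" "!!as. as : Tg A m ==> plift T g (pt as) = g as"
proof -
 interpret Q: presented_group "Tg A m" "tpow_rels K A m" Q by fact
 have gc: "g as :> T" if "as : Tg A m" for as using g that by(simp add: multilinear_def)
 show "plift T g : ahom Q T"
 by(rule Q.lift_hom(1)[OF T gc multilinear_rels[OF T g]])
 show "plift T g (pt as) = g as" if "as : Tg A m" for as
 using Q.lift_hom(2)[OF T gc multilinear_rels[OF T g] that] that by(simp add: pure_tensor_eq)
qed

section \<open>The bar resolution\<close>

abbreviation "Bar \<equiv> bar_obj K A"

abbreviation (input) "Bc \<equiv> bar K A"
abbreviation (input) "BBc \<equiv> tensor A (bar K A) (bar K A)"
abbreviation (input) "Bi n \<equiv> Bar (int n)"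

definition bar_lact :: "'a => 'a list => 'a list" where
 "bar_lact = (%a as. (a *[A] hd as) # tl as)"

definition bar_ract :: "'a list => 'a => 'a list" where
 "bar_ract = (%as a. butlast as @ [last as *[A] a])"

lemma bar_obj_eq: "Bi n = presented_bimodule (Tg A (n+2)) (tpow_rels K A (n+2)) bar_lact bar_ract"
 by(simp add: bar_obj_def bar_lact_def bar_ract_def)

lemma bar_obj_neg_eq: "n < 0 ==> Bar n = presented_bimodule {} {} bar_lact bar_ract"
 by(simp add: bar_obj_def bar_lact_def bar_ract_def)

lemma bar_presented: "presented_bimod K A (Tg A (n+2)) (tpow_rels K A (n+2)) bar_lact bar_ract"
proof -
 obtain m where m: "n + 2 = m" by simp
 hence m': "0 < m" "Suc n < m" "m = Suc (Suc n)" by auto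
 let ?S = "Tg A m" and ?R = "tpow_rels K A m"
 let ?Q = "presented ?S ?R"
 have Q: "presented_group ?S ?R ?Q" using tpow_presented[of m] by(simp add: tpow_def)
 interpret Q: presented_group ?S ?R ?Q by(rule Q)
 note ml = multilinear_pure_tensor[OF Q]
 have lm: "multilinear K A m ?Q (%as. pt (bar_lact a as))" if "a :> A" for a
 using multilinear_slotwise[OF ml, of m] slotwise_left_mult[OF that, of "Suc n"] by(simp add: bar_lact_def m')
 have rm: "multilinear K A m ?Q (%as. pt (bar_ract as a))" if "a :> A" for a
 using multilinear_slotwise[OF ml, of m] slotwise_right_mult[OF that, of "Suc n"] by(simp add: bar_ract_def m')
 have lc: "bar_lact a as : ?S" and rc: "bar_ract as a : ?S" if "a :> A" "as : ?S" for a as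
 using that slotwise_left_mult[OF that(1), of "Suc n"] slotwise_right_mult[OF that(1), of "Suc n"]
 by(simp_all add: slotwise_linear_def bar_lact_def bar_ract_def m')
 have g: "gen_class ?S ?R as = pt as" if "as : ?S" for as using that by(simp add: pure_tensor_eq)
 have ev: "frag_eval ?Q (%as. gen_class ?S ?R (F as)) u = 0[?Q]"
 if F: "!!as. as : ?S ==> F as : ?S" and m: "multilinear K A m ?Q (%as. pt (F as))" and u: "u : ?R" for F u
 proof -
 have "multilinear K A m ?Q (%as. gen_class ?S ?R (F as))"
 by(rule multilinear_cong[OF m]) (rule g[OF F])
 thus ?thesis by(rule multilinear_rels[OF Q.abelian_group_presented _ u])
 qed
 have hd0: "bar_lact a as = as[0 := a *[A] as ! 0]" if "as : ?S" for a as
 using that by(cases as) (auto simp: bar_lact_def gens_iff m')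
 have last1: "bar_ract as a = as[Suc n := as ! Suc n *[A] a]" if "as : ?S" for a as
 using that by(cases as rule: rev_cases) (auto simp: bar_ract_def gens_iff list_update_append nth_append m')
 show ?thesis unfolding m
 proof
 fix a b as assume a: "a :> A" and b: "b :> A" and as: "as : ?S"
 note n0 = gens_nth[OF as m'(1)] and n1 = gens_nth[OF as m'(2)]
 have len: "length as = m" using as by(simp add: gens_iff)
 show "gen_class ?S ?R (bar_lact (a +[A] b) as) = gen_class ?S ?R (bar_lact a as) +[?Q] gen_class ?S ?R (bar_lact b as)"
 using multilinear_add[OF ml as m'(1), of "a *[A] as ! 0" "b *[A] as ! 0"] as a b n0 gens_update[OF as]
 by(simp add: g hd0 A.l_distr)
 show "gen_class ?S ?R (bar_ract as (a +[A] b)) = gen_class ?S ?R (bar_ract as a) +[?Q] gen_class ?S ?R (bar_ract as b)"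
 using multilinear_add[OF ml as m'(2), of "as ! Suc n *[A] a" "as ! Suc n *[A] b"] as a b n1 gens_update[OF as]
 by(simp add: g last1 A.r_distr)
 have ls: "bar_lact b as : ?S" "bar_ract as a : ?S" "bar_ract as b : ?S" using lc[OF b as] rc[OF a as] rc[OF b as] by auto
 show "gen_class ?S ?R (bar_lact (a *[A] b) as) = gen_class ?S ?R (bar_lact a (bar_lact b as))"
 using a b n0 len as ls(1) m' by(simp add: hd0 A.m_assoc)
 show "gen_class ?S ?R (bar_ract as (a *[A] b)) = gen_class ?S ?R (bar_ract (bar_ract as a) b)"
 using a b n1 len as ls(2) m' by(simp add: last1 A.m_assoc)
 show "gen_class ?S ?R (bar_ract (bar_lact a as) b) = gen_class ?S ?R (bar_lact a (bar_ract as b))"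
 using a b len lc[OF a as] ls(3) as m' by(simp add: hd0 last1 list_update_swap)
 next
 fix as assume as: "as : ?S"
 note n0 = gens_nth[OF as m'(1)] and n1 = gens_nth[OF as m'(2)]
 have len: "length as = m" using as by(simp add: gens_iff)
 show "gen_class ?S ?R (bar_lact 1[A] as) = gen_class ?S ?R as" using n0 as by(simp add: hd0)
 show "gen_class ?S ?R (bar_ract as 1[A]) = gen_class ?S ?R as" using n1 as by(simp add: last1)
 fix c assume c: "c :> K"
 have "pt (as[0 := c .*[A] as ! 0]) = pt (as[Suc n := c .*[A] as ! Suc n])"
 by(rule multilinear_smult[OF ml as m'(1,2) c])
 thus "gen_class ?S ?R (bar_lact (c .*[A] 1[A]) as) = gen_class ?S ?R (bar_ract as (c .*[A] 1[A]))"
 using c as n0 n1 gens_update[OF as]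
 by(simp add: hd0 last1 smult_mult_left smult_mult_right g smult_closed)
 qed (use tpow_rels_keys lc rc ev lm rm in auto)
qed

lemma empty_presented: "presented_bimod K A {} {} bar_lact bar_ract"
 by(unfold_locales) auto

lemma bar_bim: "is_bimodule K A (Bar n)"
proof (cases "n < 0")
 case True
 thus ?thesis using presented_bimod.bimodule_M[OF empty_presented] by(simp add: bar_obj_neg_eq)
next
 case False
 then obtain m where "n = int m" by(metis nonneg_int_cases not_less)
 thus ?thesis using presented_bimod.bimodule_M[OF bar_presented, of m] by(simp add: bar_obj_eq)
qed

lemma bar_group: "abelian_group (Bar n)"
 by(rule is_bimodule.axioms(2)[OF bar_bim])

lemma bar_obj_presented: "presented_group (Tg A (n+2)) (tpow_rels K A (n+2)) (Bi n)"
 unfolding bar_obj_eq by(rule presented_bimodule_group) (rule tpow_rels_keys)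

lemma bar_neg: assumes "n < 0" shows "carrier (Bar n) = {0[Bar n]}"
proof -
 interpret P: presented_group "{}" "{}" "Bar n"
 unfolding bar_obj_neg_eq[OF assms] by(rule presented_bimodule_group) simp
 have "z = 0[Bar n]" if "z :> Bar n" for z
 using that by(rule P.hom_ext[OF bar_group ahom_id ahom_const_zero[OF bar_group], rotated]) simp
 thus ?thesis by auto
qed

lemma pt_multilinear: "multilinear K A (n+2) (Bi n) pt"
 by(rule multilinear_pure_tensor[OF bar_obj_presented])

lemma pt_closed: "as : Tg A (n+2) ==> pt as :> Bi n"
 using pt_multilinear by(simp add: multilinear_def)

lemma bar_ext:
 assumes "abelian_group T" "f : ahom (Bi n) T" "g : ahom (Bi n) T" "z :> Bi n"
 and eq: "!!as. as : Tg A (n+2) ==> f (pt as) = g (pt as)"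
 shows "f z = g z"
 by(rule presented_group.hom_ext[OF bar_obj_presented assms(1-3) _ assms(4)])
 (simp add: pure_tensor_eq[symmetric] eq)

lemmas bar_lift = multilinear_lift[OF bar_obj_presented]

lemma lact_pt: "a :> A ==> as : Tg A (n+2) ==>
 lact (Bi n) a (pt as) = pt ((a *[A] hd as) # tl as)"
 using presented_bimod.lact_M(2)[OF bar_presented, of a as n] presented_bimod.l_closed[OF bar_presented, of a as n]
 by(simp add: bar_obj_eq pure_tensor_eq bar_lact_def)

lemma ract_pt: "a :> A ==> as : Tg A (n+2) ==>
 ract (Bi n) (pt as) a = pt (butlast as @ [last as *[A] a])"
 using presented_bimod.ract_M(2)[OF bar_presented, of a as n] presented_bimod.r_closed[OF bar_presented, of a as n]
 by(simp add: bar_obj_eq pure_tensor_eq bar_ract_def)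

lemma scal_pt: assumes "c :> K" "as : Tg A (n+2)" "k < n + 2"
 shows "pt (as[k := c .*[A] as ! k]) = scal A (Bi n) c (pt as)"
proof -
 obtain b bs where b: "as = b # bs" using assms by(cases as) (auto simp: gens_iff)
 have "pt (as[k := c .*[A] as ! k]) = pt (as[0 := c .*[A] as ! 0])"
 by(rule multilinear_smult[OF pt_multilinear assms(2,3) _ assms(1)]) simp
 also have "... = scal A (Bi n) c (pt as)"
 using assms b by(simp add: lact_pt scalar_closed smult_mult_left gens_iff)
 finally show ?thesis .
qed

lemma bar_hom_lift:
 assumes N: "is_bimodule K A N" and g: "multilinear K A (n+2) N g"
 and l: "!!a as. a :> A ==> as : Tg A (n+2) ==> g ((a *[A] hd as) # tl as) = lact N a (g as)"
 and r: "!!a as. a :> A ==> as : Tg A (n+2) ==> g (butlast as @ [last as *[A] a]) = ract N (g as) a"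
 shows "plift N g : bhom A (Bi n) N"
proof -
 interpret N: is_bimodule K A N by(rule N)
 interpret B: is_bimodule K A "Bi n" by(rule bar_bim)
 note L = bar_lift[OF N.B.abelian_group_axioms g]
 have lc: "(a *[A] hd as) # tl as : Tg A (n+2)" "butlast as @ [last as *[A] a] : Tg A (n+2)"
 if "a :> A" "as : Tg A (n+2)" for a as
 using that slotwise_left_mult[OF that(1), of "Suc n"] slotwise_right_mult[OF that(1), of "Suc n"]
 by(simp_all add: slotwise_linear_def)
 have Ll: "plift N g (pt ((a *[A] hd as) # tl as)) = lact N a (g as)"
 and Lr: "plift N g (pt (butlast as @ [last as *[A] a])) = ract N (g as) a"
 if "a :> A" "as : Tg A (n+2)" for a as
 using L(2)[OF lc(1)[OF that]] l[OF that] L(2)[OF lc(2)[OF that]] r[OF that] by simp_all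
 show ?thesis
 proof (rule bimodule_homI[OF L(1)])
 fix a x assume a: "a :> A" and x: "x :> Bi n"
 show "plift N g (lact (Bi n) a x) = lact N a (plift N g x)"
 by(rule bar_ext[OF N.B.abelian_group_axioms ahom_comp[OF B.lact_ahom[OF a] L(1)] ahom_comp[OF L(1) N.lact_ahom[OF a]] x])
 (simp add: lact_pt[of _ _ n] a L(2) Ll)
 show "plift N g (ract (Bi n) x a) = ract N (plift N g x) a"
 by(rule bar_ext[OF N.B.abelian_group_axioms ahom_comp[OF B.ract_ahom[OF a] L(1)] ahom_comp[OF L(1) N.ract_ahom[OF a]] x])
 (simp add: ract_pt[of _ _ n] a L(2) Lr)
 qed
qed

end

lemma face_0: "face A 0 (a # b # cs) = (a *[A] b) # cs"
 by(simp add: face_def)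

lemma face_Suc: "face A (Suc i) (a # as) = a # face A i as"
 by(simp add: face_def)

lemma face_snoc: "Suc i < length bs ==> face A i (bs @ [b]) = face A i bs @ [b]"
 by(simp add: face_def nth_append)

lemma face_last: "length bs = Suc i ==> face A i (bs @ [b]) = butlast bs @ [last bs *[A] b]"
 by(cases bs rule: rev_cases) (auto simp: face_def nth_append)

context assoc_algebra
begin

lemma obj_bar [simp]: "obj Bc = Bar"
 by(simp add: bar_def)

lemma face_closed: "as : Tg A (Suc m) ==> i < m ==> face A i as : Tg A m"
 using slotwise_face[of i m] by(simp add: slotwise_linear_def)

lemma face_left_mult:
 assumes "as : Tg A (Suc (Suc m))" "a :> A" "i < Suc m"
 shows "face A i ((a *[A] hd as) # tl as) = (a *[A] hd (face A i as)) # tl (face A i as)"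
proof -
 obtain b c cs where b: "as = b # c # cs"
 using assms by(cases as; cases "tl as") (auto simp: gens_iff)
 thus ?thesis using assms by(cases i) (auto simp: face_0 face_Suc A.m_assoc gens_iff)
qed

lemma face_right_mult:
 assumes as: "as : Tg A (Suc (Suc m))" and a: "a :> A" and i: "i < Suc m"
 shows "face A i (butlast as @ [last as *[A] a]) = butlast (face A i as) @ [last (face A i as) *[A] a]"
proof -
 obtain bs b where b: "as = bs @ [b]" using as by(cases as rule: rev_cases) (auto simp: gens_iff)
 have len: "length bs = Suc m" and mem: "set bs <= carrier A" "b :> A" using as b by(auto simp: gens_iff)
 show ?thesis
 proof (cases "i = m")
 case True
 have "last bs :> A" using mem len last_in_set[of bs] by(cases bs) auto
 thus ?thesis using True b len mem a by(simp add: face_last A.m_assoc)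
 next
 case False
 thus ?thesis using b len i by(simp add: face_snoc)
 qed
qed

lemma bar_diff:
 shows "diff Bc (int (Suc n)) : bhom A (Bi (Suc n)) (Bi n)"
 and "!!as. as : Tg A (n+3) ==> diff Bc (int (Suc n)) (pt as)
 = (\<Oplus>\<^bsub>Bi n\<^esub>i\<in>{..Suc n}. signed (Bi n) (int i) (pt (face A i as)))"
proof -
 interpret N: is_bimodule K A "Bi n" by(rule bar_bim)
 note NG = N.B.abelian_group_axioms
 let ?g = "%as. \<Oplus>\<^bsub>Bi n\<^esub>i\<in>{..Suc n}. signed (Bi n) (int i) (pt (face A i as))"
 have D: "diff Bc (int (Suc n)) = plift (Bi n) ?g"
 by(simp add: bar_def face_def atLeast0AtMost nat_add_distrib)
 have ml: "multilinear K A (Suc n + 2) (Bi n) ?g"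
 proof (rule multilinear_finsum[OF NG])
 fix i assume "i : {..Suc n}"
 hence "slotwise_linear K A (Suc n + 2) (n+2) (face A i)" using slotwise_face[of i "n + 2"] by simp
 thus "multilinear K A (Suc n + 2) (Bi n) (%as. signed (Bi n) (int i) (pt (face A i as)))"
 by(intro multilinear_ahom[OF _ N.B.signed_ahom] multilinear_slotwise[OF pt_multilinear])
 qed
 have c: "pt (face A i as) :> Bi n" if "as : Tg A (Suc n + 2)" "i : {..Suc n}" for i as
 using face_closed[of as "n + 2" i] that by(intro pt_closed) simp
 have "plift (Bi n) ?g : bhom A (Bi (Suc n)) (Bi n)"
 proof (rule bar_hom_lift[OF bar_bim ml])
 fix a as assume a: "a :> A" and as: "as : Tg A (Suc n + 2)"
 have as': "as : Tg A (Suc (Suc (Suc n)))" using as by simp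
 have fc: "face A i as : Tg A (n+2)" if "i : {..Suc n}" for i
 using face_closed[of as "n + 2" i] as that by simp
 have "lact (Bi n) a (?g as) = (\<Oplus>\<^bsub>Bi n\<^esub>i\<in>{..Suc n}. lact (Bi n) a (signed (Bi n) (int i) (pt (face A i as))))"
 using c[OF as] by(intro N.B.finsum_ahom[OF NG N.lact_ahom[OF a]]) auto
 also have "... = ?g ((a *[A] hd as) # tl as)"
 proof (rule N.B.finsum_cong')
 fix i assume i: "i : {..Suc n}"
 show "lact (Bi n) a (signed (Bi n) (int i) (pt (face A i as)))
 = signed (Bi n) (int i) (pt (face A i ((a *[A] hd as) # tl as)))"
 using face_left_mult[OF as' a, of i] i a c[OF as i] lact_pt[OF a fc[OF i]] by(simp add: N.lact_rules(6))
 qed (use as slotwise_left_mult[OF a, of "Suc n + 1"] in \<open>auto intro!: c simp: slotwise_linear_def\<close>)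
 finally show "?g ((a *[A] hd as) # tl as) = lact (Bi n) a (?g as)" by simp
 have "ract (Bi n) (?g as) a = (\<Oplus>\<^bsub>Bi n\<^esub>i\<in>{..Suc n}. ract (Bi n) (signed (Bi n) (int i) (pt (face A i as))) a)"
 using c[OF as] by(intro N.B.finsum_ahom[OF NG N.ract_ahom[OF a]]) auto
 also have "... = ?g (butlast as @ [last as *[A] a])"
 proof (rule N.B.finsum_cong')
 fix i assume i: "i : {..Suc n}"
 show "ract (Bi n) (signed (Bi n) (int i) (pt (face A i as))) a
 = signed (Bi n) (int i) (pt (face A i (butlast as @ [last as *[A] a])))"
 using face_right_mult[OF as' a, of i] i a c[OF as i] ract_pt[OF a fc[OF i]] by(simp add: N.ract_rules(6))
 qed (use as slotwise_right_mult[OF a, of "Suc n + 1"] in \<open>auto intro!: c simp: slotwise_linear_def\<close>)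
 finally show "?g (butlast as @ [last as *[A] a]) = ract (Bi n) (?g as) a" by simp
 qed
 thus "diff Bc (int (Suc n)) : bhom A (Bi (Suc n)) (Bi n)" by(simp only: D)
 show "diff Bc (int (Suc n)) (pt as) = ?g as" if "as : Tg A (n+3)" for as
 unfolding D using that by(intro bar_lift(2)[OF NG ml]) (simp add: numeral_3_eq_3)
qed

lemma bar_diff_nonpos: "n <= 0 ==> diff Bc n x = 0[Bar (n-1)]"
 by(simp add: bar_def)

lemma bar_diff_hom: "diff Bc n : bhom A (Bar n) (Bar (n-1))"
proof (cases "n <= 0")
 case True
 hence "diff Bc n = (%x. 0[Bar (n-1)])" by(simp add: fun_eq_iff bar_diff_nonpos)
 thus ?thesis using bhom_zero[OF bar_bim] by simp
next
 case False
 then obtain m where "n = int (Suc m)" using zero_less_imp_eq_int[of n] by(metis gr0_implies_Suc not_less)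
 thus ?thesis using bar_diff(1)[of m] by simp
qed

section \<open>The extra degeneracy and the contraction of the augmented bar complex\<close>

definition bar_s :: "int => 'a list fab => 'a list fab" where
 "bar_s n = (if n < 0 then (%_. 0[Bar (n+1)]) else plift (Bar (n+1)) (%as. pt (1[A] # as)))"

lemma bar_s_nat:
 shows "bar_s (int n) : ahom (Bi n) (Bi (Suc n))"
 and "!!as. as : Tg A (n+2) ==> bar_s (int n) (pt as) = pt (1[A] # as)"
proof -
 have "slotwise_linear K A (n+2) (Suc n + 2) ((#) 1[A])" using slotwise_Cons[of "1[A]" "n + 2"] by simp
 hence ml: "multilinear K A (n+2) (Bi (Suc n)) (%as. pt (1[A] # as))"
 by(rule multilinear_slotwise[OF pt_multilinear])
 have D: "bar_s (int n) = plift (Bi (Suc n)) (%as. pt (1[A] # as))"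
 by(simp add: bar_s_def add.commute)
 show "bar_s (int n) : ahom (Bi n) (Bi (Suc n))"
 unfolding D by(rule bar_lift(1)[OF bar_group ml])
 show "bar_s (int n) (pt as) = pt (1[A] # as)" if "as : Tg A (n+2)" for as
 unfolding D by(rule bar_lift(2)[OF bar_group ml that])
qed

lemma bar_s_ahom: "bar_s n : ahom (Bar n) (Bar (n+1))"
proof (cases "n < 0")
 case True
 hence "bar_s n = (%_. 0[Bar (n+1)])" by(simp add: bar_s_def)
 thus ?thesis using ahom_const_zero[OF bar_group] by simp
next
 case False
 then obtain m where "n = int m" using nonneg_int_cases[of n] by auto
 thus ?thesis using bar_s_nat(1)[of m] by(simp add: add.commute)
qed

lemma bar_s_ract:
 assumes x: "x :> Bar n" and a: "a :> A"
 shows "bar_s n (ract (Bar n) x a) = ract (Bar (n+1)) (bar_s n x) a"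
proof (cases "n < 0")
 case True
 interpret N: is_bimodule K A "Bar (n+1)" by(rule bar_bim)
 show ?thesis using True a by(simp add: bar_s_def N.ract_rules)
next
 case False
 then obtain m where m: "n = int m" using nonneg_int_cases[of n] by auto
 have m1: "n + 1 = int (Suc m)" using m by simp
 interpret N: is_bimodule K A "Bi (Suc m)" by(rule bar_bim)
 interpret M: is_bimodule K A "Bi m" by(rule bar_bim)
 have "bar_s (int m) (ract (Bi m) x a) = ract (Bi (Suc m)) (bar_s (int m) x) a"
 proof (rule bar_ext[OF bar_group ahom_comp[OF M.ract_ahom[OF a] bar_s_nat(1)] ahom_comp[OF bar_s_nat(1) N.ract_ahom[OF a]]])
 show "x :> Bi m" using x m by simp
 fix as assume as: "as : Tg A (m+2)"
 have r: "butlast as @ [last as *[A] a] : Tg A (m+2)"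
 using as slotwise_right_mult[OF a, of "Suc m"] by(simp add: slotwise_linear_def)
 have "as ~= []" using as by(auto simp: gens_iff)
 moreover have "1[A] # as : Tg A (Suc m + 2)" using as by(simp add: gens_iff)
 ultimately show "bar_s (int m) (ract (Bi m) (pt as) a) = ract (Bi (Suc m)) (bar_s (int m) (pt as)) a"
 using ract_pt[OF a as] ract_pt[OF a, of "1[A] # as" "Suc m"] bar_s_nat(2)[OF as] bar_s_nat(2)[OF r] by simp
 qed
 thus ?thesis unfolding m1 by(simp add: m)
qed

lemma Ba:
 shows "Ba A : bhom A (Bar 0) (reg_bim A)"
 and "!!a b. a :> A ==> b :> A ==> Ba A (pt [a, b]) = a *[A] b"
proof -
 interpret N: is_bimodule K A "reg_bim A" by(rule reg_bim)
 let ?g = "%as. hd as *[A] last as"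
 have two: "\<exists>a b. as = [a, b] & a :> A & b :> A" if "as : Tg A (0+2)" for as
 using that by(cases as; cases "tl as") (auto simp: gens_iff)
 have ml: "multilinear K A (0+2) (reg_bim A) ?g"
 proof (rule multilinear_scalI[where sc = "smult A"])
 fix as and k :: nat assume as: "as : Tg A (0+2)" and k: "k < 0 + 2"
 obtain a b where ab: "as = [a, b]" "a :> A" "b :> A" using two[OF as] by blast
 have k': "k = 0 | k = 1" using k by auto
 show "?g (as[k := x +[A] y]) = ?g (as[k := x]) +[reg_bim A] ?g (as[k := y])"
 if "x :> A" "y :> A" for x y
 using k' ab that by(auto simp: regular_simps A.l_distr A.r_distr)
 show "?g (as[k := c .*[A] as ! k]) = c .*[A] ?g as" if "c :> K" for c
 using k' ab that by(auto simp: smult_mult_left smult_mult_right)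
 next
 fix as assume "as : Tg A (0+2)"
 thus "?g as :> reg_bim A" using two by(force simp: regular_simps)
 qed
 have "plift (reg_bim A) ?g : bhom A (Bi 0) (reg_bim A)"
 by(rule bar_hom_lift[OF reg_bim ml]; drule two) (auto simp: regular_simps A.m_assoc)
 thus "Ba A : bhom A (Bar 0) (reg_bim A)" by(simp add: bar_augmentation_def)
 show "Ba A (pt [a, b]) = a *[A] b" if "a :> A" "b :> A" for a b
 using bar_lift(2)[OF N.B.abelian_group_axioms ml, of "[a, b]"] that
 by(simp add: bar_augmentation_def gens_iff)
qed

text \<open>After a unit is put in front, face 0 returns the original list, while face i + 1 is face
  i behind the unit and enters with the opposite sign. Hence d s + s d telescopes to the identity,
  and in degree 0 the leftover 1 \<otimes> a b is the augmentation term.\<close>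

lemma bar_contraction:
 assumes x: "x :> Bar n"
 shows "diff Bc (n+1) (bar_s n x) +[Bar n] bar_s (n-1) (diff Bc n x) +[Bar n]
 (if n = 0 then ract (Bar 0) (pt [1[A], 1[A]]) (Ba A x) else 0[Bar n]) = x"
proof (cases "n < 0")
 case True
 interpret N: is_bimodule K A "Bar n" by(rule bar_bim)
 have "x = 0[Bar n]" using bar_neg[OF True] x by blast
 thus ?thesis using True by(simp add: bar_diff_nonpos bar_s_def)
next
 case False
 then obtain m where m: "n = int m" using nonneg_int_cases[of n] by auto
 interpret N: is_bimodule K A "Bi m" by(rule bar_bim)
 note NG = N.B.abelian_group_axioms
 have d1: "diff Bc (int m + 1) : ahom (Bi (Suc m)) (Bi m)"
 using bhom_ahom[OF bar_diff(1)[of m]] by(simp add: add.commute)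
 have s1: "bar_s (int m - 1) : ahom (Bar (int m - 1)) (Bi m)"
 using bar_s_ahom[of "int m - 1"] by simp
 have e: "pt [1[A], 1[A]] :> Bar 0" using pt_closed[of "[1[A], 1[A]]" 0] by(simp add: gens_iff)
 have alg1: "-[Bi m] u +[Bi m] w +[Bi m] 0[Bi m] +[Bi m] u = w"
 and alg2: "-[Bi m] u +[Bi m] w +[Bi m] u +[Bi m] 0[Bi m] = w"
 if "u :> Bi m" "w :> Bi m" for u w
 using that by algebra+
 have hom3: "(%x. if int m = 0 then ract (Bar 0) (pt [1[A], 1[A]]) (Ba A x) else 0[Bi m])
 : ahom (Bi m) (Bi m)"
 proof (cases "m = 0")
 case True
 have h: "Ba A : ahom (Bar 0) A"
 using bhom_ahom[OF Ba(1)] by(simp add: hom_def regular_simps)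
 show ?thesis
 using ahom_comp[OF h is_bimodule.ract_ahom'[OF bar_bim e]] True by simp
 next
 case False
 thus ?thesis using ahom_const_zero[OF NG] by simp
 qed
 have "diff Bc (int m + 1) (bar_s (int m) x) +[Bi m] bar_s (int m - 1) (diff Bc (int m) x) +[Bi m]
 (if int m = 0 then ract (Bar 0) (pt [1[A], 1[A]]) (Ba A x) else 0[Bi m]) = x"
 proof (rule bar_ext[OF NG _ ahom_id])
 show "(%x. diff Bc (int m + 1) (bar_s (int m) x) +[Bi m] bar_s (int m - 1) (diff Bc (int m) x) +[Bi m]
 (if int m = 0 then ract (Bar 0) (pt [1[A], 1[A]]) (Ba A x) else 0[Bi m])) : ahom (Bi m) (Bi m)"
 by(intro ahom_plus[OF NG] ahom_comp[OF bar_s_nat(1) d1] ahom_comp[OF bhom_ahom[OF bar_diff_hom] s1] hom3)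
 show "x :> Bi m" using x m by simp
 fix as assume as: "as : Tg A (m+2)"
 obtain b bs where b: "as = b # bs" "b :> A" using as by(cases as) (auto simp: gens_iff)
 have as1: "1[A] # as : Tg A (m+3)" using as by(simp add: gens_iff)
 have fc: "1[A] # face A i as : Tg A (m+2)" if "i < Suc m" for i
 using face_closed[of as "Suc m" i] as that by(simp add: gens_iff)
 let ?v = "%i. signed (Bi m) (int i) (pt (1[A] # face A i as))"
 have vc: "?v : {..m} \<rightarrow> carrier (Bi m)"
 using fc by(auto intro!: N.B.signed_closed pt_closed)
 let ?V = "\<Oplus>\<^bsub>Bi m\<^esub>i\<in>{..m}. ?v i"
 have Vc: "?V :> Bi m" by(rule N.B.finsum_closed[OF vc])
 have p: "pt as :> Bi m" by(rule pt_closed[OF as])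
 have ds: "diff Bc (int m + 1) (bar_s (int m) (pt as)) = -[Bi m] ?V +[Bi m] pt as"
 proof -
 have "diff Bc (int m + 1) (bar_s (int m) (pt as))
 = (\<Oplus>\<^bsub>Bi m\<^esub>i\<in>{..Suc m}. signed (Bi m) (int i) (pt (face A i (1[A] # as))))"
 using bar_diff(2)[OF as1] bar_s_nat(2)[OF as] by(simp add: add.commute)
 also have "... = (\<Oplus>\<^bsub>Bi m\<^esub>i\<in>{..m}. signed (Bi m) (int (Suc i)) (pt (face A (Suc i) (1[A] # as))))
 +[Bi m] signed (Bi m) (int 0) (pt (face A 0 (1[A] # as)))"
 using face_closed[OF as1[unfolded numeral_3_eq_3 add_Suc_right]]
 by(intro N.B.finsum_Suc2) (auto intro!: N.B.signed_closed pt_closed)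
 also have "signed (Bi m) (int 0) (pt (face A 0 (1[A] # as))) = pt as"
 using b by(simp add: face_0 signed_def)
 also have "(\<Oplus>\<^bsub>Bi m\<^esub>i\<in>{..m}. signed (Bi m) (int (Suc i)) (pt (face A (Suc i) (1[A] # as))))
 = (\<Oplus>\<^bsub>Bi m\<^esub>i\<in>{..m}. -[Bi m] ?v i)"
 using vc fc by(intro N.B.finsum_cong') (auto simp: face_Suc signed_def pt_closed)
 also have "... = -[Bi m] ?V"
 using N.B.finsum_ahom[OF NG ahom_uminus[OF NG ahom_id] vc] by simp
 finally show ?thesis .
 qed
 show "diff Bc (int m + 1) (bar_s (int m) (pt as)) +[Bi m] bar_s (int m - 1) (diff Bc (int m) (pt as)) +[Bi m]
 (if int m = 0 then ract (Bar 0) (pt [1[A], 1[A]]) (Ba A (pt as)) else 0[Bi m]) = pt as"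
 proof (cases m)
 case 0
 then obtain c where c: "as = [b, c]" "c :> A" using as b by(cases bs) (auto simp: gens_iff)
 have vc0: "?v : {0} \<rightarrow> carrier (Bi m)" using vc 0 by simp
 have "?V = ?v 0" using N.B.finsum_0[OF vc0] by(simp only: 0)
 hence "?V = pt [1[A], b *[A] c]" using c by(simp add: face_0 signed_def)
 moreover have "ract (Bar 0) (pt [1[A], 1[A]]) (Ba A (pt as)) = pt [1[A], b *[A] c]"
 using ract_pt[of "b *[A] c" "[1[A], 1[A]]" 0] b(2) c by(simp add: Ba(2) gens_iff)
 moreover have "bar_s (int m - 1) (diff Bc (int m) (pt as)) = 0[Bi m]"
 using 0 by(simp add: bar_s_def)
 moreover have "-[Bi m] ?V +[Bi m] pt as +[Bi m] 0[Bi m] +[Bi m] ?V = pt as"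
 by(rule alg1[OF Vc p])
 ultimately show ?thesis unfolding ds using 0 by simp
 next
 case (Suc l)
 have m1: "int m - 1 = int l" using Suc by simp
 interpret L: is_bimodule K A "Bi l" by(rule bar_bim)
 have as': "as : Tg A (l+3)" using as Suc by(simp add: numeral_3_eq_3)
 have fl: "face A i as : Tg A (l+2)" if "i : {..Suc l}" for i
 using face_closed[of as "l + 2" i] as Suc that by simp
 have sl: "bar_s (int l) : ahom (Bi l) (Bi m)" using bar_s_nat(1)[of l] Suc by simp
 have "bar_s (int l) (diff Bc (int m) (pt as))
 = bar_s (int l) (\<Oplus>\<^bsub>Bi l\<^esub>i\<in>{..Suc l}. signed (Bi l) (int i) (pt (face A i as)))"
 using bar_diff(2)[OF as'] Suc by simp
 also have "... = (\<Oplus>\<^bsub>Bi m\<^esub>i\<in>{..Suc l}. bar_s (int l) (signed (Bi l) (int i) (pt (face A i as))))"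
 using fl by(intro L.B.finsum_ahom[OF NG sl]) (auto intro!: L.B.signed_closed pt_closed)
 also have "... = ?V" unfolding Suc[symmetric]
 using vc fl Suc
 by(intro N.B.finsum_cong') (auto simp: ahom_rules(6)[OF L.B.abelian_group_axioms NG sl] pt_closed bar_s_nat(2))
 finally have sd: "bar_s (int m - 1) (diff Bc (int m) (pt as)) = ?V" unfolding m1 .
 have "-[Bi m] ?V +[Bi m] pt as +[Bi m] ?V +[Bi m] 0[Bi m] = pt as"
 by(rule alg2[OF Vc p])
 thus ?thesis unfolding ds sd using Suc by simp
 qed
 qed
 thus ?thesis by(simp only: m)
qed

lemma bar_augmentation_diff:
 assumes x: "x :> Bar 1"
 shows "Ba A (diff Bc 1 x) = 0[A]"
proof -
 interpret R: is_bimodule K A "reg_bim A" by(rule reg_bim)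
 interpret B0: is_bimodule K A "Bar 0" by(rule bar_bim)
 note \<mu>r = bhom_rules[OF bar_bim reg_bim Ba(1)]
 have d1: "diff Bc 1 : bhom A (Bar 1) (Bar 0)" using bar_diff(1)[of 0] by simp
 have "Ba A (diff Bc 1 x) = 0[reg_bim A]"
 proof (rule bar_ext[where n = 1 and f = "%x. Ba A (diff Bc 1 x)" and g = "%x. 0[reg_bim A]",
 OF R.B.abelian_group_axioms _ ahom_const_zero[OF R.B.abelian_group_axioms]])
 show "(%x. Ba A (diff Bc 1 x)) : ahom (Bi 1) (reg_bim A)"
 using bhom_ahom[OF bhom_comp[OF d1 Ba(1)]] by simp
 show "x :> Bi 1" using x by simp
 fix as assume as: "as : Tg A (1+2)"
 then obtain a b c where abc: "as = [a, b, c]" "a :> A" "b :> A" "c :> A"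
 by(cases as; cases "tl as"; cases "tl (tl as)") (auto simp: gens_iff)
 have p: "pt [a *[A] b, c] :> Bar 0" "pt [a, b *[A] c] :> Bar 0"
 using abc pt_closed[of _ 0] by(auto simp: gens_iff)
 have "diff Bc 1 (pt as) = (\<Oplus>\<^bsub>Bar 0\<^esub>i\<in>{..Suc 0}. signed (Bar 0) (int i) (pt (face A i as)))"
 using bar_diff(2)[of as 0] as by(simp add: numeral_3_eq_3)
 also have "... = -[Bar 0] pt [a, b *[A] c] +[Bar 0] pt [a *[A] b, c]"
 proof -
 have f: "(%i. signed (Bar 0) (int i) (pt (face A i as))) : {..Suc 0} \<rightarrow> carrier (Bar 0)"
 using p abc(1) by(auto simp: face_0 face_Suc le_Suc_eq)
 have f0: "(%i. signed (Bar 0) (int (Suc i)) (pt (face A (Suc i) as))) : {0} \<rightarrow> carrier (Bar 0)"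
 using p abc(1) by(auto simp: face_0 face_Suc)
 show ?thesis
 unfolding B0.B.finsum_Suc2[OF f] B0.B.finsum_0[OF f0] using abc(1) by(simp add: face_0 face_Suc signed_def)
 qed
 finally show "Ba A (diff Bc 1 (pt as)) = 0[reg_bim A]"
 using p abc by(simp add: \<mu>r Ba(2) A.m_assoc R.B.l_neg regular_simps(1))
 qed
 thus ?thesis by(simp add: regular_simps)
qed

text \<open>Every element of degree \<open>n + 1\<close> is a sum of elements \<open>a s(y)\<close>, on which \<open>d d\<close> vanishes by
 induction, using \<open>d s = 1 - s d\<close> twice.\<close>

lemma bar_diff_diff:
 assumes "x :> Bi (Suc n)"
 shows "diff Bc (int n) (diff Bc (int (Suc n)) x) = 0[Bar (int n - 1)]"
 using assms
proof (induction n arbitrary: x)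
 case 0
 thus ?case by(simp add: bar_diff_nonpos)
next
 case (Suc n)
 let ?d = "diff Bc"
 interpret N: is_bimodule K A "Bi n" by(rule bar_bim)
 interpret N1: is_bimodule K A "Bi (Suc n)" by(rule bar_bim)
 note NG = N.B.abelian_group_axioms
 note d1 = bar_diff(1)[of n] and d2 = bar_diff(1)[of "Suc n"]
 note d1r = bhom_rules[OF bar_bim bar_bim d1] and d2r = bhom_rules[OF bar_bim bar_bim d2]
 have key: "?d (int (Suc n)) (?d (int (Suc (Suc n))) (bar_s (int (Suc n)) y)) = 0[Bi n]"
 if y: "y :> Bi (Suc n)" for y
 proof -
 have sy: "bar_s (int (Suc n)) y :> Bar (int (Suc (Suc n)))" using ahom_closed[OF bar_s_nat(1) y] .
 have dy: "?d (int (Suc n)) y :> Bi n" using d1r(1)[OF y] .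
 have sdy: "bar_s (int n) (?d (int (Suc n)) y) :> Bi (Suc n)" using ahom_closed[OF bar_s_nat(1) dy] .
 let ?u = "?d (int (Suc (Suc n))) (bar_s (int (Suc n)) y)"
 have u: "?u :> Bi (Suc n)" using d2r(1)[OF sy] .
 have "?u +[Bi (Suc n)] bar_s (int n) (?d (int (Suc n)) y) +[Bi (Suc n)] 0[Bi (Suc n)] = y"
 using bar_contraction[OF y] by(simp add: add.commute)
 hence "?u +[Bi (Suc n)] bar_s (int n) (?d (int (Suc n)) y) = y"
 unfolding N1.B.r_zero[OF N1.B.a_closed[OF u sdy]] .
 hence "?d (int (Suc n)) ?u +[Bi n] ?d (int (Suc n)) (bar_s (int n) (?d (int (Suc n)) y)) = ?d (int (Suc n)) y"
 using d1r(2)[OF u sdy] by simp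
 moreover have "?d (int (Suc n)) (bar_s (int n) (?d (int (Suc n)) y)) = ?d (int (Suc n)) y"
 proof -
 have c: "?d (int (Suc n)) (bar_s (int n) (?d (int (Suc n)) y)) :> Bi n" using d1r(1)[OF sdy] .
 have z: "bar_s (int n - 1) (?d (int n) (?d (int (Suc n)) y)) = 0[Bi n]"
 using Suc.IH[OF y] ahom_rules(3)[OF bar_group bar_group bar_s_ahom, of "int n - 1"] by simp
 have z2: "(if int n = 0 then ract (Bar 0) (pt [1[A], 1[A]]) (Ba A (?d (int (Suc n)) y)) else 0[Bi n]) = 0[Bi n]"
 proof (cases "n = 0")
 case True
 interpret B0: is_bimodule K A "Bar 0" by(rule bar_bim)
 have "pt [1[A], 1[A]] :> Bar 0" using pt_closed[of "[1[A], 1[A]]" 0] by(simp add: gens_iff)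
 thus ?thesis using True y bar_augmentation_diff[of y] by(simp add: B0.ract_rules')
 qed simp
 show ?thesis using bar_contraction[OF dy] c z z2 by(simp add: add.commute)
 qed
 ultimately have "?d (int (Suc n)) ?u +[Bi n] ?d (int (Suc n)) y = ?d (int (Suc n)) y" by simp
 moreover have "?d (int (Suc n)) ?u
 = (?d (int (Suc n)) ?u +[Bi n] ?d (int (Suc n)) y) -[Bi n] ?d (int (Suc n)) y"
 using d1r(1)[OF u] dy by algebra
 ultimately show ?thesis using N.B.a_minus_self[OF dy] by simp
 qed
 have "?d (int (Suc n)) (?d (int (Suc (Suc n))) x) = 0[Bi n]"
 proof (rule bar_ext[OF NG bhom_ahom[OF bhom_comp[OF d2 d1]] ahom_const_zero[OF NG] Suc.prems])
 fix as assume as: "as : Tg A (Suc (Suc n) + 2)"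
 obtain a bs where ab: "as = a # bs" "a :> A" "bs : Tg A (Suc n + 2)"
 using as by(cases as) (auto simp: gens_iff)
 have b: "pt bs :> Bi (Suc n)" using pt_closed[OF ab(3)] .
 have one: "1[A] # bs : Tg A (Suc (Suc n) + 2)" using ab(3) by(simp add: gens_iff)
 have p: "pt as = lact (Bar (int (Suc (Suc n)))) a (bar_s (int (Suc n)) (pt bs))"
 using lact_pt[OF ab(2) one] ab bar_s_nat(2)[OF ab(3)] by simp
 have sb: "bar_s (int (Suc n)) (pt bs) :> Bar (int (Suc (Suc n)))" using ahom_closed[OF bar_s_nat(1) b] .
 show "?d (int (Suc n)) (?d (int (Suc (Suc n))) (pt as)) = 0[Bi n]"
 unfolding p using key[OF b] by(simp only: d2r(7)[OF ab(2) sb] d1r(7)[OF ab(2) d2r(1)[OF sb]] N.lact_rules(3)[OF ab(2)])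
 qed
 thus ?case by simp
qed

lemma bar_is_cpx: "is_bimodule_cpx K A Bc"
 unfolding is_bimodule_cpx_def obj_bar
proof (intro conjI allI ballI)
 show "is_bimodule K A (Bar n)" "diff Bc n : bhom A (Bar n) (Bar (n-1))" for n
 by(rule bar_bim bar_diff_hom)+
 show "diff Bc (n-1) (diff Bc n x) = 0[Bar (n-2)]" if x: "x :> Bar n" for n x
 proof (cases "n <= 1")
 case True
 thus ?thesis by(simp add: bar_diff_nonpos)
 next
 case False
 then obtain m where "n - 1 = int m" using nonneg_int_cases[of "n - 1"] by auto
 hence "n = int (Suc m)" "n - 1 = int m" "n - 2 = int m - 1" by simp_all
 thus ?thesis using bar_diff_diff[of x m] x by simp
 qed
qed

lemma bar_right_contraction:
 "right_contraction K A Bc (Ba A) bar_s (pt [1[A], 1[A]])"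
proof (intro right_contraction.intro augmented_cpx.intro augmented_cpx_axioms.intro
 right_contraction_axioms.intro assoc_algebra_axioms)
 show "pt [1[A], 1[A]] :> obj Bc 0"
 using pt_closed[of "[1[A], 1[A]]" 0] by(simp add: gens_iff)
 show "diff Bc (n+1) (bar_s n x) +[obj Bc n] bar_s (n-1) (diff Bc n x) +[obj Bc n]
 (if n = 0 then ract (obj Bc 0) (pt [1[A], 1[A]]) (Ba A x) else 0[obj Bc n]) = x"
 if "x :> obj Bc n" for n x
 using bar_contraction[of x n] that by(simp only: obj_bar)
qed (simp_all add: bar_is_cpx Ba(1) bar_augmentation_diff bar_neg bar_s_ahom bar_s_ract)

end

lemma (in right_contraction) contraction_exact:
 assumes x: "x :> obj P n" and dx: "diff P n x = 0[obj P (n-1)]" and \<mu>x: "n = 0 ==> \<mu> x = 0[A]"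
 shows "x : diff P (n+1) ` carrier (obj P (n+1))"
proof -
 interpret N: is_bimodule K A "obj P n" by(rule PP.PB)
 interpret N0: is_bimodule K A "obj P 0" by(rule PP.PB)
 have sx: "s n x :> obj P (n+1)" using s_rules(1)[OF x] .
 have "s (n-1) 0[obj P (n-1)] = 0[obj P n]" using s_rules(3)[of "n - 1"] by simp
 moreover have "diff P (n+1) (s n x) :> obj P n" using dP(1)[OF sx] by simp
 moreover have "(if n = 0 then ract (obj P 0) e (\<mu> x) else 0[obj P n]) = 0[obj P n]"
 using \<mu>x e by(simp add: N0.ract_rules')
 ultimately have "x = diff P (n+1) (s n x)" using contraction[OF x] dx by simp
 thus ?thesis using sx by blast
qed

lemma (in assoc_algebra) bar_resolution: "resolution K A Bc (Ba A)"
proof -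
 interpret B: right_contraction K A "bar K A" "Ba A" bar_s "pt [1[A], 1[A]]"
 by(rule bar_right_contraction)
 have "a : Ba A ` carrier (Bar 0)" if a: "a :> A" for a
 using Ba(2)[OF a A.one_closed] pt_closed[of "[a, 1[A]]" 0] a
 by(auto simp: gens_iff image_iff intro!: bexI[of _ "pt [a, 1[A]]"])
 hence onto: "Ba A ` carrier (Bar 0) = carrier A"
 using bhom_cl[OF Ba(1)] by(auto simp: regular_simps)
 have "x : diff Bc 1 ` carrier (Bar 1)" if "x :> Bar 0" "Ba A x = 0[A]" for x
 using B.contraction_exact[of x 0] that by(simp add: bar_diff_nonpos)
 thus ?thesis
 unfolding resolution_def
 using B.P B.\<mu> B.\<mu>_d B.neg B.contraction_exact onto by auto
qed

section \<open>Lifting out of the bar resolution\<close>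

text \<open>\<open>Bar n = A \<otimes> A\<^sup>n \<otimes> A\<close> is free over a basis of the vector space \<open>A\<^sup>n\<close>; a linear section of the
 given epimorphism replaces the choice of a basis.\<close>

context assoc_algebra
begin

lemma nonneg_int: "\<not> n < 0 ==> (!!m. n = int m ==> thesis) ==> thesis" for n :: int
 using nonneg_int_cases[of n] by auto

lemma gens_hd: "as : Tg A (n+2) ==> \<exists>a bs. as = a # bs & bs ~= [] & a :> A & bs : Tg A (n+1)"
 by(cases as; cases "tl as") (auto simp: gens_iff)

lemma gens_last: "as : Tg A (n+2) ==> \<exists>a bs. as = bs @ [a] & bs ~= [] & a :> A & bs : Tg A (n+1)"
 by(cases as rule: rev_cases; cases "butlast as") (auto simp: gens_iff)

lemma linear_section_ex:
 assumes "is_bimodule K A N" "is_bimodule K A Q" "p : bhom A N Q"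
 shows "\<exists>\<sigma>. (ALL q:p ` carrier N. \<sigma> q :> N & p (\<sigma> q) = q) &
 (ALL q:p ` carrier N. ALL r:p ` carrier N. \<sigma> (q +[Q] r) = \<sigma> q +[N] \<sigma> r) &
 (ALL c:carrier K. ALL q:p ` carrier N. \<sigma> (scal A Q c q) = scal A N c (\<sigma> q))"
 by(rule linear_section[OF assms], rule exI, intro conjI ballI) assumption+

lemma bar_lifts:
 assumes N: "is_bimodule K A N" and Q: "is_bimodule K A Q"
 shows "lifts A (Bar n) N Q"
 unfolding lifts_def
proof (intro ballI impI)
 fix f p assume f: "f : bhom A (Bar n) Q" and p: "p : bhom A N Q"
 and sub: "f ` carrier (Bar n) <= p ` carrier N"
 interpret N: is_bimodule K A N by(rule N)
 interpret Q: is_bimodule K A Q by(rule Q)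
 show "EX g:bhom A (Bar n) N. ALL x:carrier (Bar n). p (g x) = f x"
 proof (cases "n < 0")
 case True
 thus ?thesis
 using bhom_zero[OF N, of "Bar n"] bar_neg[OF True] bhom_rules(3)[OF N Q p]
 bhom_rules(3)[OF bar_bim Q f] by(intro bexI[of _ "%x. 0[N]"]) auto
 next
 case False
 then obtain m where n: "n = int m" by(rule nonneg_int)
 note f = f[unfolded n] and sub = sub[unfolded n]
 note fr = bhom_rules[OF bar_bim Q f] and pr = bhom_rules[OF N Q p]
 obtain \<sigma> where \<sigma>': "(ALL q:p ` carrier N. \<sigma> q :> N & p (\<sigma> q) = q) &
 (ALL q:p ` carrier N. ALL r:p ` carrier N. \<sigma> (q +[Q] r) = \<sigma> q +[N] \<sigma> r) &
 (ALL c:carrier K. ALL q:p ` carrier N. \<sigma> (scal A Q c q) = scal A N c (\<sigma> q))"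
 using linear_section_ex[OF N Q p] by(rule exE)
 have \<sigma>: "!!q. q : p ` carrier N ==> \<sigma> q :> N" "!!q. q : p ` carrier N ==> p (\<sigma> q) = q"
 "!!q r. q : p ` carrier N ==> r : p ` carrier N ==> \<sigma> (q +[Q] r) = \<sigma> q +[N] \<sigma> r"
 "!!c q. c :> K ==> q : p ` carrier N ==> \<sigma> (scal A Q c q) = scal A N c (\<sigma> q)"
 using \<sigma>' by blast+
 \<comment> \<open>\<open>M\<close> replaces the two outer entries by units, so that only the inner
   factors pass through the section \<sigma>; \<open>g\<close> restores the outer entries by the
   actions on N. This makes the lift a bimodule homomorphism although \<sigma> is merely
   linear.\<close>
 define M where "M as = 1[A] # butlast (tl as) @ [1[A]]" for as
 define g where "g as = lact N (hd as) (ract N (\<sigma> (f (pt (M as)))) (last as))" for as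
 have Mc: "M as : Tg A (m+2)" and hl: "hd as :> A" "last as :> A"
 if asg: "as : Tg A (m+2)" for as
 proof -
 obtain a bs where a: "as = a # bs" "bs ~= []" using gens_hd[OF asg] by blast
 then obtain cs b where "bs = cs @ [b]" by(cases bs rule: rev_cases) auto
 thus "M as : Tg A (m+2)" "hd as :> A" "last as :> A"
 using asg a by(auto simp: M_def gens_iff)
 qed
 have im: "f x : p ` carrier N" if "x :> Bi m" for x using sub that by blast
 have Mup0: "M (as[0 := x]) = M as & hd (as[0 := x]) = x & last (as[0 := x]) = last as & as ! 0 = hd as"
 and Mup1: "M (as[Suc m := x]) = M as & hd (as[Suc m := x]) = hd as & last (as[Suc m := x]) = x & as ! Suc m = last as"
 and Mup2: "k < m + 2 ==> k ~= 0 ==> k ~= Suc m ==> M (as[k := x]) = (M as)[k := x] & hd (as[k := x]) = hd as &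
 last (as[k := x]) = last as & M as ! k = as ! k"
 if as: "as : Tg A (m+2)" for as k x
 proof -
 obtain a bs where a: "as = a # bs" "bs ~= []" using gens_hd[OF as] by blast
 then obtain cs b where b: "as = a # cs @ [b]" by(cases bs rule: rev_cases) auto
 have len: "length cs = m" using as b by(simp add: gens_iff)
 show "M (as[0 := x]) = M as & hd (as[0 := x]) = x & last (as[0 := x]) = last as & as ! 0 = hd as"
 "M (as[Suc m := x]) = M as & hd (as[Suc m := x]) = hd as & last (as[Suc m := x]) = x & as ! Suc m = last as"
 using len by(simp_all add: b M_def list_update_append nth_append butlast_append)
 show "M (as[k := x]) = (M as)[k := x] & hd (as[k := x]) = hd as & last (as[k := x]) = last as & M as ! k = as ! k"
 if "k < m + 2" "k ~= 0" "k ~= Suc m"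
 using that len by(cases k) (simp_all add: b M_def list_update_append nth_append butlast_append)
 qed
 have fpt: "f (pt (M as)) : p ` carrier N" "\<sigma> (f (pt (M as))) :> N" if "as : Tg A (m+2)" for as
 using im[OF pt_closed[OF Mc[OF that]]] \<sigma>(1) by auto
 have gc: "g as :> N" if "as : Tg A (m+2)" for as
 using fpt[OF that] hl[OF that] by(simp add: g_def N.lact_closed N.ract_closed)
 have ml: "multilinear K A (m+2) N g"
 proof (rule multilinear_scalI[OF gc])
 fix as k x y assume as: "as : Tg A (m+2)" and k: "k < m + 2" and x: "x :> A" and y: "y :> A"
 have \<sigma>a: "\<sigma> (f (pt ((M as)[k := x +[A] y]))) = \<sigma> (f (pt ((M as)[k := x]))) +[N] \<sigma> (f (pt ((M as)[k := y])))"
 using multilinear_add[OF pt_multilinear Mc[OF as] k x y] pt_closed[OF gens_update[OF Mc[OF as] x]]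
 pt_closed[OF gens_update[OF Mc[OF as] y]] im \<sigma>(3) by(simp add: fr)
 have c: "\<sigma> (f (pt ((M as)[k := z]))) :> N" if "z :> A" for z
 using \<sigma>(1) im[OF pt_closed[OF gens_update[OF Mc[OF as] that]]] by blast
 have M: "M (as[k := z]) = M as & hd (as[k := z]) = z & last (as[k := z]) = last as" if "k = 0" for z
 using Mup0[OF as] that by simp
 have L: "M (as[k := z]) = M as & hd (as[k := z]) = hd as & last (as[k := z]) = z" if "k = Suc m" for z
 using Mup1[OF as] that by simp
 have I: "M (as[k := z]) = (M as)[k := z] & hd (as[k := z]) = hd as & last (as[k := z]) = last as"
 if "k ~= 0" "k ~= Suc m" for z
 using Mup2[OF as k that] by simp
 consider "k = 0" | "k = Suc m" | "k ~= 0" "k ~= Suc m" by blast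
 thus "g (as[k := x +[A] y]) = g (as[k := x]) +[N] g (as[k := y])"
 proof cases
 case 1
 show ?thesis unfolding g_def using M[OF 1] N.lact_add_left[OF x y N.ract_closed[OF fpt(2)[OF as] hl(2)[OF as]]] by simp
 next
 case 2
 show ?thesis unfolding g_def using L[OF 2] N.ract_add_right[OF fpt(2)[OF as] x y]
 N.lact_add_right[OF hl(1)[OF as] N.ract_closed[OF fpt(2)[OF as] x] N.ract_closed[OF fpt(2)[OF as] y]] by simp
 next
 case 3
 show ?thesis unfolding g_def using I[OF 3] \<sigma>a N.ract_add_left[OF c[OF x] c[OF y] hl(2)[OF as]]
 N.lact_add_right[OF hl(1)[OF as] N.ract_closed[OF c[OF x] hl(2)[OF as]] N.ract_closed[OF c[OF y] hl(2)[OF as]]] by simp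
 qed
 next
 fix as k c assume as: "as : Tg A (m+2)" and k: "k < m + 2" and c: "c :> K"
 have \<sigma>s: "\<sigma> (f (pt ((M as)[k := c .*[A] M as ! k]))) = scal A N c (\<sigma> (f (pt (M as))))"
 using scal_pt[OF c Mc[OF as] k] pt_closed[OF Mc[OF as]] im \<sigma>(4) c by(simp add: fr scalar_closed)
 consider "k = 0" | "k = Suc m" | "k ~= 0" "k ~= Suc m" by blast
 thus "g (as[k := c .*[A] as ! k]) = scal A N c (g as)"
 proof cases
 case 1
 have *: "M (as[k := c .*[A] as ! k]) = M as" "hd (as[k := c .*[A] as ! k]) = c .*[A] as ! k"
 "last (as[k := c .*[A] as ! k]) = last as" "as ! k = hd as"
 using Mup0[OF as] 1 by simp_all
 show ?thesis unfolding g_def *(1-3) unfolding *(4)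
 by(rule N.lact_smult(1)[OF c hl(1)[OF as] N.ract_closed[OF fpt(2)[OF as] hl(2)[OF as]]])
 next
 case 2
 have *: "M (as[k := c .*[A] as ! k]) = M as" "hd (as[k := c .*[A] as ! k]) = hd as"
 "last (as[k := c .*[A] as ! k]) = c .*[A] as ! k" "as ! k = last as"
 using Mup1[OF as] 2 by simp_all
 show ?thesis unfolding g_def *(1-3) unfolding *(4) N.ract_smult(1)[OF c hl(2)[OF as] fpt(2)[OF as]]
 by(rule N.lact_smult(2)[OF c hl(1)[OF as] N.ract_closed[OF fpt(2)[OF as] hl(2)[OF as]]])
 next
 case 3
 have *: "M (as[k := c .*[A] as ! k]) = (M as)[k := c .*[A] as ! k]" "hd (as[k := c .*[A] as ! k]) = hd as"
 "last (as[k := c .*[A] as ! k]) = last as" and **: "M as ! k = as ! k"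
 using Mup2[OF as k] 3 by simp_all
 show ?thesis unfolding g_def * \<sigma>s[unfolded **] N.ract_smult(2)[OF c hl(2)[OF as] fpt(2)[OF as]]
 by(rule N.lact_smult(2)[OF c hl(1)[OF as] N.ract_closed[OF fpt(2)[OF as] hl(2)[OF as]]])
 qed
 qed
 have dec: "\<exists>a cs b. as = a # cs @ [b] & a :> A & b :> A & length cs = m & set cs <= carrier A"
 if as: "as : Tg A (m+2)" for as
 proof -
 obtain a bs where a: "as = a # bs" "bs ~= []" using gens_hd[OF as] by blast
 then obtain cs b where b: "as = a # cs @ [b]" by(cases bs rule: rev_cases) auto
 thus ?thesis using as by(auto simp: gens_iff)
 qed
 have G: "plift N g : bhom A (Bi m) N"
 proof (rule bar_hom_lift[OF N ml])
 fix a as assume a: "a :> A" and as: "as : Tg A (m+2)"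
 obtain b cs d where b: "as = b # cs @ [d]" "b :> A" "d :> A" using dec[OF as] by blast
 have c: "\<sigma> (f (pt (M as))) :> N" using fpt[OF as] by simp
 show "g ((a *[A] hd as) # tl as) = lact N a (g as)"
 using a b c by(simp add: g_def M_def N.lact_mult N.ract_closed)
 show "g (butlast as @ [last as *[A] a]) = ract N (g as) a"
 using a b c by(simp add: g_def M_def butlast_append N.ract_mult N.lact_ract N.ract_closed)
 qed
 have pG: "p (plift N g x) = f x" if x: "x :> Bi m" for x
 proof (rule bar_ext[OF Q.B.abelian_group_axioms bhom_ahom[OF bhom_comp[OF G p]] bhom_ahom[OF f] x])
 fix as assume as: "as : Tg A (m+2)"
 obtain a cs b where b: "as = a # cs @ [b]" "a :> A" "b :> A" "length cs = m" "set cs <= carrier A"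
 using dec[OF as] by blast
 have q: "pt (M as) :> Bi m" using pt_closed[OF Mc[OF as]] .
 interpret B: is_bimodule K A "Bi m" by(rule bar_bim)
 have 1: "1[A] # cs @ [b] : Tg A (m+2)" using b by(simp add: gens_iff)
 have "lact (Bi m) a (ract (Bi m) (pt (M as)) b) = pt as"
 using ract_pt[OF b(3) Mc[OF as]] lact_pt[OF b(2) 1] b by(simp add: M_def butlast_append)
 hence "f (pt as) = lact Q a (ract Q (f (pt (M as))) b)"
 using fr(7)[OF b(2) B.ract_closed[OF q b(3)]] fr(8)[OF b(3) q] by simp
 moreover have "p (g as) = lact Q a (ract Q (f (pt (M as))) b)"
 using b fpt[OF as] by(simp add: g_def pr N.ract_closed \<sigma>(2))
 ultimately show "p (plift N g (pt as)) = f (pt as)"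
 using bar_lift(2)[OF N.B.abelian_group_axioms ml as] by simp
 qed
 show ?thesis unfolding n using G pG by blast
 qed
qed

text \<open>A pairing given on pairs of lists is first extended in the second argument, for a fixed
  list in the first; the result is again multilinear in that list. No tensor product of bar modules
  over the field has to be presented.\<close>

definition bar_bilift :: "('t, 'z) ring_scheme => ('a list => 'a list => 't)
 => 'a list fab => 'a list fab => 't" where
 "bar_bilift T g x y = plift T (%as. plift T (%bs. g as bs) y) x"

lemma bar_bilift:
 assumes T: "abelian_group T"
 and ml1: "!!bs. bs : Tg A (j+2) ==> multilinear K A (i+2) T (%as. g as bs)"
 and ml2: "!!as. as : Tg A (i+2) ==> multilinear K A (j+2) T (%bs. g as bs)"
 shows "!!y. y :> Bi j ==> (%x. bar_bilift T g x y) : ahom (Bi i) T"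
 and "!!x. x :> Bi i ==> (%y. bar_bilift T g x y) : ahom (Bi j) T"
 and "!!as bs. as : Tg A (i+2) ==> bs : Tg A (j+2) ==> bar_bilift T g (pt as) (pt bs) = g as bs"
proof -
 interpret T: abelian_group T by(rule T)
 define h where "h y as = plift T (%bs. g as bs) y" for y as
 have h1: "(%y. h y as) : ahom (Bi j) T" and h2: "bs : Tg A (j+2) ==> h (pt bs) as = g as bs"
 if "as : Tg A (i+2)" for as bs
 unfolding h_def using bar_lift[OF T ml2[OF that]] by simp_all
 have hm: "multilinear K A (i+2) T (h y)" if y: "y :> Bi j" for y
 unfolding multilinear_def
 proof (intro ballI conjI allI impI)
 fix as assume as: "as : Tg A (i+2)"
 note up = gens_update[OF as]
 show "h y as :> T" using ahom_closed[OF h1[OF as] y] .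
 show "h y (as[k := a +[A] b]) = h y (as[k := a]) +[T] h y (as[k := b])"
 if k: "k < i + 2" and a: "a :> A" and b: "b :> A" for k a b
 by(rule bar_ext[OF T h1[OF up[OF M.a_closed[OF a b]]] ahom_plus[OF T h1[OF up[OF a]] h1[OF up[OF b]]] y])
 (simp add: h2[OF up[OF M.a_closed[OF a b]]] h2[OF up[OF a]] h2[OF up[OF b]] multilinear_add[OF ml1 as k a b])
 show "h y (as[k := c .*[A] as ! k]) = h y (as[l := c .*[A] as ! l])"
 if k: "k < i + 2" and l: "l < i + 2" and c: "c :> K" for k l c
 proof -
 have u: "as[k := c .*[A] as ! k] : Tg A (i+2)" "as[l := c .*[A] as ! l] : Tg A (i+2)"
 using up smult_closed[OF c gens_nth[OF as k]] smult_closed[OF c gens_nth[OF as l]] by blast+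
 show ?thesis
 by(rule bar_ext[OF T h1[OF u(1)] h1[OF u(2)] y]) (simp only: h2[OF u(1)] h2[OF u(2)] multilinear_smult[OF ml1 as k l c])
 qed
 qed
 have b: "bar_bilift T g x y = plift T (h y) x" for x y
 unfolding bar_bilift_def h_def by simp
 show 1: "(%x. bar_bilift T g x y) : ahom (Bi i) T" if y: "y :> Bi j" for y
 unfolding b using bar_lift(1)[OF T hm[OF y]] by simp
 have v: "bar_bilift T g (pt as) y = h y as" if "as : Tg A (i+2)" "y :> Bi j" for as y
 unfolding b using bar_lift(2)[OF T hm[OF that(2)] that(1)] .
 show "(%y. bar_bilift T g x y) : ahom (Bi j) T" if x: "x :> Bi i" for x
 proof (rule ahomI)
 interpret B: is_bimodule K A "Bi j" by(rule bar_bim)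
 fix y z assume y: "y :> Bi j" and z: "z :> Bi j"
 show "bar_bilift T g x y :> T" using ahom_closed[OF 1[OF y] x] .
 show "bar_bilift T g x (y +[Bi j] z) = bar_bilift T g x y +[T] bar_bilift T g x z"
 by(rule bar_ext[OF T 1[OF B.B.a_closed[OF y z]] ahom_plus[OF T 1[OF y] 1[OF z]] x])
 (simp only: v[OF _ B.B.a_closed[OF y z]] v[OF _ y] v[OF _ z] ahom_add[OF h1 y z])
 qed
 show "bar_bilift T g (pt as) (pt bs) = g as bs"
 if "as : Tg A (i+2)" "bs : Tg A (j+2)" for as bs
 using v[OF that(1) pt_closed[OF that(2)]] h2[OF that] by simp
qed

lemma bar_biext:
 assumes T: "abelian_group T"
 and F1: "!!y. y :> Bi j ==> (%x. F x y) : ahom (Bi i) T"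
 and F2: "!!as. as : Tg A (i+2) ==> (%y. F (pt as) y) : ahom (Bi j) T"
 and G1: "!!y. y :> Bi j ==> (%x. G x y) : ahom (Bi i) T"
 and G2: "!!as. as : Tg A (i+2) ==> (%y. G (pt as) y) : ahom (Bi j) T"
 and eq: "!!as bs. as : Tg A (i+2) ==> bs : Tg A (j+2) ==> F (pt as) (pt bs) = G (pt as) (pt bs)"
 and x: "x :> Bi i" and y: "y :> Bi j"
 shows "F x y = G x y"
proof (rule bar_ext[OF T F1[OF y] G1[OF y] x])
 fix as assume as: "as : Tg A (i+2)"
 show "F (pt as) y = G (pt as) y"
 by(rule bar_ext[OF T F2[OF as] G2[OF as] y]) (rule eq[OF as])
qed

lemma bar_tensor: "tensor_product K A Bc Bc"
 by(rule tensor_productI[OF bar_is_cpx bar_is_cpx])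

end

section \<open>The Connes operator on the trace of the bar resolution\<close>

text \<open>It plays two parts: it is the normal form in the trace of a bar element, whose last
  factor is carried around to the front, and it is the last face of the cyclic bar complex.\<close>

definition wrap :: "('k, 'a) module => 'a list => 'a list" where
 "wrap A as = (last as *[A] hd as) # butlast (tl as)"

definition cyclic_face :: "('k, 'a) module => nat => nat => 'a list => 'a list" where
 "cyclic_face A n k w = (if k < n then face A k w else wrap A w)"

lemma wrap_snoc: "bs ~= [] ==> wrap A (bs @ [b]) = (b *[A] hd bs) # tl bs"
 by(cases bs) (simp_all add: wrap_def)

lemma face_append_left: "Suc k < length xs ==> face A k (xs @ ys) = face A k xs @ ys"
 by(simp add: face_def nth_append)

lemma face_append_right: "face A (length xs + k) (xs @ ys) = xs @ face A k ys"
 by(simp add: face_def nth_append)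

lemma face_middle: "face A (length xs) (xs @ a # b # ys) = xs @ (a *[A] b) # ys"
 by(simp add: face_def nth_append)

lemma length_face: "Suc k < length xs ==> length (face A k xs) = length xs - 1"
 by(simp add: face_def)

text \<open>Rotation by i makes face k multiply the original entries k + i and k + i + 1, counted
  modulo n + 1; at k + i = n this is the product across the seam. Once k + i exceeds n, the two
  merged entries both lie in the rotated part, or its last one meets the first of the rest, so one
  rotation fewer remains.\<close>

lemma cyclic_face_rotate:
 assumes len: "length w = Suc n" and i: "i <= n" and k: "1 <= k" "k <= n"
 shows "k + i <= n ==> cyclic_face A n k (rotate i w) = rotate i (cyclic_face A n (k+i) w)"
 and "n < k + i ==> cyclic_face A n k (rotate i w) = rotate (i-1) (cyclic_face A n (k + i - Suc n) w)"
proof -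
 define xs ys where xs: "xs = take i w" and ys: "ys = drop i w"
 have w: "w = xs @ ys" and lx: "length xs = i" and ly: "length ys = Suc n - i"
 using len i by(simp_all add: xs ys)
 have r: "rotate i w = ys @ xs" using rotate_append[of xs ys] w lx by simp
 show "cyclic_face A n k (rotate i w) = rotate i (cyclic_face A n (k+i) w)" if ki: "k + i <= n"
 proof (cases "k + i < n")
 case True
 have "face A (i+k) (xs @ ys) = xs @ face A k ys" using face_append_right[of A xs k ys] lx by simp
 thus ?thesis
 using True face_append_left[of k ys A xs] ly rotate_append[of xs "face A k ys"] lx
 unfolding cyclic_face_def r by(simp add: w add.commute)
 next
 case False
 hence n: "n = k + i" using ki by simp
 show ?thesis
 proof (cases "i = 0")
 case True thus ?thesis using n by simp
 next
 case False
 obtain x xs' where x: "xs = x # xs'" using False lx by(cases xs) auto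
 obtain y ys' where y: "ys = ys' @ [y]" using ly i by(cases ys rule: rev_cases) auto
 have k': "k = length ys'" "k < n" using y ly n False by auto
 have "wrap A w = ((y *[A] x) # xs') @ ys'"
 using wrap_snoc[of "x # xs' @ ys'" A y] by(simp add: w x y)
 moreover have "i = length ((y *[A] x) # xs')" using lx x by simp
 ultimately have "rotate i (wrap A w) = ys' @ (y *[A] x) # xs'" by(simp only: rotate_append)
 thus ?thesis
 using face_middle[of A ys' y x xs'] k' n unfolding cyclic_face_def r by(simp add: x y)
 qed
 qed
 show "cyclic_face A n k (rotate i w) = rotate (i-1) (cyclic_face A n (k + i - Suc n) w)" if ki: "n < k + i"
 proof (cases "k < n")
 case True
 define l where "l = k + i - Suc n"
 have l: "k = length ys + l" "Suc l < length xs" "l < n" using ki True i lx ly by(simp_all add: l_def)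
 show ?thesis
 using True l(3) face_append_right[of A ys l xs] face_append_left[OF l(2), of A ys]
 rotate_append[of "face A l xs" ys] length_face[OF l(2), of A] lx
 unfolding cyclic_face_def r l_def[symmetric] by(simp add: w l(1)[symmetric])
 next
 case False
 hence kn: "k = n" using k by simp
 have i0: "i ~= 0" using ki kn by simp
 obtain x xs' where x: "xs = xs' @ [x]" using i0 lx by(cases xs rule: rev_cases) auto
 obtain y ys' where y: "ys = y # ys'" using ly i by(cases ys) auto
 have "length xs' = i - 1" "i - 1 < n" using x lx i i0 by auto
 thus ?thesis
 using face_middle[of A xs' x y ys'] rotate_append[of xs' "(x *[A] y) # ys'"] wrap_snoc[of "y # ys' @ xs'" A x]
 unfolding cyclic_face_def r using kn i0 by(simp add: w x y)
 qed
qed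

text \<open>The exchange of rotation and face read off from \<open>cyclic_face_rotate\<close>: a
  pair (rotation, face) goes to the pair (face, rotation) in which the face is applied first.
  Injectivity and equal cardinalities make it a bijection.\<close>

definition cyclic_reindex :: "nat => nat \<times> nat => nat \<times> nat" where
 "cyclic_reindex n = (%(i, k). if k + i <= n then (k + i, i) else (k + i - Suc n, i - 1))"

lemma cyclic_reindex:
 shows "inj_on (cyclic_reindex n) ({..n} \<times> {1..n})"
 and "cyclic_reindex n ` ({..n} \<times> {1..n}) = {..n} \<times> {..<n}"
proof -
 show inj: "inj_on (cyclic_reindex n) ({..n} \<times> {1..n})"
 by(rule inj_onI) (auto simp: cyclic_reindex_def split: if_splits)
 show "cyclic_reindex n ` ({..n} \<times> {1..n}) = {..n} \<times> {..<n}"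
 proof (rule card_seteq)
 show "cyclic_reindex n ` ({..n} \<times> {1..n}) <= {..n} \<times> {..<n}"
 by(auto simp: cyclic_reindex_def split: if_splits)
 show "card ({..n} \<times> {..<n}) <= card (cyclic_reindex n ` ({..n} \<times> {1..n}))"
 using card_image[OF inj] by(simp add: card_cartesian_product)
 qed simp
qed

lemma (in abelian_group) finsum_product:
 assumes I: "finite I" and J: "finite J" and f: "!!i j. i : I ==> j : J ==> f (i, j) :> G"
 shows "(\<Oplus>i\<in>I. \<Oplus>j\<in>J. f (i, j)) = (\<Oplus>p\<in>I \<times> J. f p)"
 using I f
proof (induction I rule: finite_induct)
 case (insert i I)
 have c: "(%j. f (i, j)) : J \<rightarrow> carrier G" using insert.prems by auto
 have "(\<Oplus>i'\<in>insert i I. \<Oplus>j\<in>J. f (i', j)) = (\<Oplus>j\<in>J. f (i, j)) \<oplus> (\<Oplus>i'\<in>I. \<Oplus>j\<in>J. f (i', j))"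
 using insert c by(intro finsum_insert) (auto intro!: finsum_closed)
 also have "(\<Oplus>j\<in>J. f (i, j)) = (\<Oplus>p\<in>Pair i ` J. f p)"
 using insert.prems by(subst finsum_reindex) (auto simp: inj_on_def)
 also have "(\<Oplus>i'\<in>I. \<Oplus>j\<in>J. f (i', j)) = (\<Oplus>p\<in>I \<times> J. f p)" using insert by auto
 also have "(\<Oplus>p\<in>Pair i ` J. f p) \<oplus> (\<Oplus>p\<in>I \<times> J. f p) = (\<Oplus>p\<in>Pair i ` J \<union> I \<times> J. f p)"
 using insert J by(intro finsum_Un_disjoint[symmetric]) auto
 also have "Pair i ` J \<union> I \<times> J = insert i I \<times> J" by auto
 finally show ?case .
qed simp

lemma (in abelian_group) finsum_eqI:
 assumes "!!i. i : I ==> f i = g i" "!!i. i : I ==> g i :> G"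
 shows "finsum G f I = finsum G g I"
 by(rule finsum_cong') (use assms in auto)

text \<open>The sum is u - u + u. It occurs for the three faces of a list with two inserted units
  that absorb a unit.\<close>

lemma (in abelian_group) finsum_signed_three:
 assumes u: "u :> G"
 shows "(\<Oplus>k\<in>{0, 1, 2 :: nat}. signed G (int k) u) = u"
proof -
 have "(\<Oplus>k\<in>{0, 1, 2 :: nat}. signed G (int k) u) = signed G 0 u \<oplus> (signed G 1 u \<oplus> signed G 2 u)"
 using u by(simp add: Pi_iff)
 also have "... = u" using u by(simp add: signed_def r_neg2 l_neg)
 finally show ?thesis .
qed

lemma (in abelian_group) signed_even: "even (m-n) ==> signed G m x = signed G n x"
 by(auto simp: signed_def)

lemma (in abelian_group) signed_finsum:
 "u : I \<rightarrow> carrier G ==> signed G m (\<Oplus>i\<in>I. u i) = (\<Oplus>i\<in>I. signed G m (u i))"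
 using finsum_ahom[OF abelian_group_axioms signed_ahom] .

context assoc_algebra
begin

abbreviation "TB n \<equiv> trob A (Bar n)"

lemmas TBG = is_bimodule.TrG[OF bar_bim]

lemmas TB_closed [simp] = abelian_group.signed_closed[OF TBG] abelian_monoid.a_closed[OF abelian_group.axioms(1)[OF TBG]]
 abelian_monoid.r_zero[OF abelian_group.axioms(1)[OF TBG]]

lemmas tpow_group = presented_group.abelian_group_presented[OF tpow_presented]

lemmas tpow_signed_closed [simp] = abelian_group.signed_closed[OF tpow_group]

lemma multilinear_plus:
 assumes T: "abelian_group T" and f: "multilinear K A m T f" and g: "multilinear K A m T g"
 shows "multilinear K A m T (%as. f as +[T] g as)"
 unfolding multilinear_def
proof (intro ballI conjI allI impI)
 interpret T: abelian_group T by(rule T)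
 fix as assume as: "as : Tg A m"
 note c = multilinear_closed[OF f] multilinear_closed[OF g]
 show "f as +[T] g as :> T" using c as by simp
 show "f (as[k := a +[A] b]) +[T] g (as[k := a +[A] b]) = f (as[k := a]) +[T] g (as[k := a]) +[T] (f (as[k := b]) +[T] g (as[k := b]))"
 if k: "k < m" and a: "a :> A" and b: "b :> A" for k a b
 unfolding multilinear_add[OF f as k a b] multilinear_add[OF g as k a b]
 using c gens_update[OF as a] gens_update[OF as b] by(simp add: T.a_ac)
 show "f (as[k := c .*[A] as ! k]) +[T] g (as[k := c .*[A] as ! k]) = f (as[l := c .*[A] as ! l]) +[T] g (as[l := c .*[A] as ! l])"
 if "k < m" "l < m" "c :> K" for k l c
 unfolding multilinear_smult[OF f as that] multilinear_smult[OF g as that] ..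
qed

text \<open>The class in the trace that corresponds to a list of n + 1 entries: a unit is appended
  to serve as the right outer factor of the bar module.\<close>

definition kp :: "nat => 'a list => ('a \<times> 'a list fab) fab" where
 "kp n w = tr A (Bi n) (pt (w @ [1[A]]))"

lemma snoc_gens: "w : Tg A (Suc n) ==> w @ [1[A]] : Tg A (n+2)"
 by(simp add: gens_iff)

lemma kp_multilinear: "multilinear K A (Suc n) (TB (int n)) (kp n)"
proof -
 have "multilinear K A (Suc n) (Bi n) (%w. pt (w @ [1[A]]))"
 by(rule multilinear_slotwise[OF pt_multilinear]) (use slotwise_snoc[of "1[A]" "Suc n"] in simp)
 from multilinear_ahom[OF this is_bimodule.tr_ahom[OF bar_bim]] show ?thesis by(simp add: kp_def[abs_def])
qed

lemmas kp_closed = multilinear_closed[OF kp_multilinear]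

text \<open>Rotating by n + 1 brings the last entry to the front, after which face 0 performs the
  product; slotwise linearity is known for both operations.\<close>

lemma slotwise_wrap: "slotwise_linear K A (n+2) (Suc n) (wrap A)"
proof -
 have "slotwise_linear K A (n+2) (Suc n) (%as. face A 0 (rotate (Suc n) as))"
 using slotwise_comp[OF slotwise_rotate[of "Suc (Suc n)" "Suc n"] slotwise_face[of 0 "Suc n"]] by simp
 moreover have "face A 0 (rotate (Suc n) as) = wrap A as" if as: "as : Tg A (n+2)" for as
 proof -
 obtain b bs where b: "as = bs @ [b]" "bs ~= []" "bs : Tg A (n+1)" using gens_last[OF as] by blast
 hence "rotate (Suc n) as = b # bs" using rotate_append[of bs "[b]"] by(simp add: gens_iff del: rotate_Suc)
 thus ?thesis using b wrap_snoc[of bs A b] by(cases bs) (simp_all add: face_0 del: rotate_Suc)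
 qed
 ultimately show ?thesis by(simp add: slotwise_linear_def gens_update del: rotate_Suc)
qed

lemma wrap_closed: "as : Tg A (n+2) ==> wrap A as : Tg A (Suc n)"
 using slotwise_wrap by(simp add: slotwise_linear_def)

lemma tr_pt: assumes as: "as : Tg A (n+2)"
 shows "tr A (Bi n) (pt as) = kp n (wrap A as)"
proof -
 interpret B: is_bimodule K A "Bi n" by(rule bar_bim)
 obtain b bs where b: "as = bs @ [b]" "bs ~= []" "b :> A" "bs : Tg A (n+1)" using gens_last[OF as] by blast
 have g: "bs @ [1[A]] : Tg A (n+2)" using b by(simp add: gens_iff)
 have "pt as = ract (Bi n) (pt (bs @ [1[A]])) b" using ract_pt[OF b(3) g] b by simp
 moreover have "pt (wrap A as @ [1[A]]) = lact (Bi n) b (pt (bs @ [1[A]]))"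
 using lact_pt[OF b(3) g] b wrap_snoc[of bs A b] by(cases bs) simp_all
 ultimately show ?thesis using B.tr_comm[OF b(3) pt_closed[OF g]] by(simp add: kp_def)
qed

lemma trace_bar_ext:
 assumes Z: "abelian_group Z" and f: "f : ahom (TB (int n)) Z" and g: "g : ahom (TB (int n)) Z" and z: "z :> TB (int n)"
 and eq: "!!w. w : Tg A (Suc n) ==> f (kp n w) = g (kp n w)"
 shows "f z = g z"
proof -
 note ta = is_bimodule.tr_ahom[OF bar_bim, of "int n"]
 obtain x where x: "x :> Bi n" "z = tr A (Bi n) x" by(rule is_bimodule.tr_surj[OF bar_bim z])
 show ?thesis unfolding x(2)
 by(rule bar_ext[OF Z ahom_comp[OF ta f] ahom_comp[OF ta g] x(1)]) (simp only: tr_pt eq wrap_closed)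
qed

lemma wrap_comm:
 assumes a: "a :> A" and as: "as : Tg A (n+2)"
 shows "wrap A ((a *[A] hd as) # tl as) = wrap A (butlast as @ [last as *[A] a])"
proof -
 obtain c cs where c: "as = c # cs" "cs ~= []" "c :> A" using gens_hd[OF as] by blast
 then obtain d ds where d: "cs = ds @ [d]" by(cases cs rule: rev_cases) auto
 hence "d :> A" using as c by(simp add: gens_iff)
 thus ?thesis using a c d by(simp add: wrap_def A.m_assoc butlast_append)
qed

text \<open>With \<open>wrap\<close> as normal form, \<open>wrap_comm\<close> is precisely the
  descent condition of \<open>trace_lift\<close>. Thus multilinear maps on lists of n + 1 entries
  induce maps on the trace.\<close>

lemma trace_bar_lift:
 assumes Z: "abelian_group Z" and g: "multilinear K A (Suc n) Z g"
 and F: "!!a x. a :> A ==> x :> Bi n ==>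
 F (a, x) = plift Z (%as. g (wrap A as)) (lact (Bi n) a x)"
 shows "plift Z F : ahom (TB (int n)) Z"
 and "!!w. w : Tg A (Suc n) ==> plift Z F (kp n w) = g w"
proof -
 interpret B: is_bimodule K A "Bi n" by(rule bar_bim)
 note ml = multilinear_slotwise[OF g slotwise_wrap]
 note L = bar_lift[OF Z ml]
 have c: "plift Z (%as. g (wrap A as)) (lact (Bi n) a x) = plift Z (%as. g (wrap A as)) (ract (Bi n) x a)"
 if a: "a :> A" and x: "x :> Bi n" for a x
 proof (rule bar_ext[OF Z ahom_comp[OF B.lact_ahom[OF a] L(1)] ahom_comp[OF B.ract_ahom[OF a] L(1)] x])
 fix as assume as: "as : Tg A (n+2)"
 have l: "(a *[A] hd as) # tl as : Tg A (n+2)" "butlast as @ [last as *[A] a] : Tg A (n+2)"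
 using as slotwise_left_mult[OF a, of "n + 1"] slotwise_right_mult[OF a, of "n + 1"] by(simp_all add: slotwise_linear_def)
 show "plift Z (%as. g (wrap A as)) (lact (Bi n) a (pt as)) = plift Z (%as. g (wrap A as)) (ract (Bi n) (pt as) a)"
 unfolding lact_pt[OF a as] ract_pt[OF a as] L(2)[OF l(1)] L(2)[OF l(2)] wrap_comm[OF a as] ..
 qed
 show "plift Z F : ahom (TB (int n)) Z"
 by(rule B.trace_lift(1)[OF Z L(1)]) (rule c F, assumption+)+
 have T: "plift Z F (tr A (Bi n) x) = plift Z (%as. g (wrap A as)) x" if "x :> Bi n" for x
 by(rule B.trace_lift(2)[OF Z L(1) _ _ that]) (rule c F, assumption+)+
 show "plift Z F (kp n w) = g w" if w: "w : Tg A (Suc n)" for w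
 proof -
 have "wrap A (w @ [1[A]]) = w" using w by(cases w) (auto simp: gens_iff wrap_def butlast_append)
 thus ?thesis using T[OF pt_closed[OF snoc_gens[OF w]]] L(2)[OF snoc_gens[OF w]] by(simp add: kp_def)
 qed
qed

lemma trace_bar_to_tpow_kp:
 shows "trace_bar_to_tpow K A n : ahom (TB (int n)) (tpow K A (n+1))"
 and "!!w. w : Tg A (Suc n) ==> trace_bar_to_tpow K A n (kp n w) = pt w"
proof -
 interpret B: is_bimodule K A "Bi n" by(rule bar_bim)
 let ?Z = "tpow K A (Suc n)"
 have Z: "abelian_group ?Z" by(rule presented_group.abelian_group_presented[OF tpow_presented])
 have g: "multilinear K A (Suc n) ?Z pt" by(rule multilinear_pure_tensor[OF tpow_presented])
 note L = bar_lift[OF Z multilinear_slotwise[OF g slotwise_wrap]]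
 let ?G = "%a as. pt ((last as *[A] a *[A] hd as) # butlast (tl as))"
 have w: "(last as *[A] a *[A] hd as) # butlast (tl as) = wrap A ((a *[A] hd as) # tl as)"
 and l: "(a *[A] hd as) # tl as : Tg A (n+2)"
 if a: "a :> A" and as: "as : Tg A (n+2)" for a as
 proof -
 obtain c cs where c: "as = c # cs" "cs ~= []" "c :> A" using gens_hd[OF as] by blast
 then obtain d ds where d: "cs = ds @ [d]" by(cases cs rule: rev_cases) auto
 hence "d :> A" using as c by(simp add: gens_iff)
 thus "(last as *[A] a *[A] hd as) # butlast (tl as) = wrap A ((a *[A] hd as) # tl as)"
 using a c d by(simp add: wrap_def A.m_assoc butlast_append)
 show "(a *[A] hd as) # tl as : Tg A (n+2)"
 using as a c by(simp add: gens_iff)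
 qed
 have F: "(%(a, t). plift ?Z (?G a) t) (a, x) = plift ?Z (%as. pt (wrap A as)) (lact (Bi n) a x)"
 if a: "a :> A" and x: "x :> Bi n" for a x
 proof -
 have sl: "slotwise_linear K A (n+2) (n+2) (%as. (a *[A] hd as) # tl as)" using slotwise_left_mult[OF a, of "n + 1"] by simp
 have "multilinear K A (n+2) ?Z (?G a)"
 by(rule multilinear_cong[OF multilinear_slotwise[OF multilinear_slotwise[OF g slotwise_wrap] sl]]) (simp add: w[OF a])
 note M = bar_lift[OF Z this]
 show ?thesis unfolding prod.case
 by(rule bar_ext[OF Z M(1) ahom_comp[OF B.lact_ahom[OF a] L(1)] x])
 (simp only: M(2) lact_pt[OF a] L(2)[OF l[OF a]] w[OF a])
 qed
 have D: "trace_bar_to_tpow K A n = plift ?Z (%(a, t). plift ?Z (?G a) t)"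
 by(simp add: trace_bar_to_tpow_def)
 show "trace_bar_to_tpow K A n : ahom (TB (int n)) (tpow K A (n+1))"
 unfolding D using trace_bar_lift(1)[OF Z g F] by simp
 show "trace_bar_to_tpow K A n (kp n w) = pt w" if "w : Tg A (Suc n)" for w
 unfolding D using trace_bar_lift(2)[OF Z g F that] .
qed

lemma tpow_to_trace_bar_pt:
 shows "tpow_to_trace_bar K A n : ahom (tpow K A (n+1)) (TB (int n))"
 and "!!w. w : Tg A (Suc n) ==> tpow_to_trace_bar K A n (pt w) = kp n w"
proof -
 have D: "tpow_to_trace_bar K A n = plift (TB (int n)) (kp n)"
 by(simp add: tpow_to_trace_bar_def kp_def[abs_def] tr_def)
 note L = multilinear_lift[OF tpow_presented TBG kp_multilinear]
 show "tpow_to_trace_bar K A n : ahom (tpow K A (n+1)) (TB (int n))" using L(1) by(simp add: D)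
 show "tpow_to_trace_bar K A n (pt w) = kp n w" if "w : Tg A (Suc n)" for w
 unfolding D using L(2)[OF that] .
qed

text \<open>The two halves of the Connes operator in degree \<open>n\<close>, and the contracting homotopy of the second
 half.\<close>

definition connes_sum :: "nat => nat => ('a list => 'a list) => 'a list => ('a \<times> 'a list fab) fab" where
 "connes_sum n m F w = (\<Oplus>\<^bsub>TB (int m)\<^esub>i\<in>{..n}. signed (TB (int m)) (int (i * n)) (kp m (F (rotate i w))))"

text \<open>With the unit placed behind the first entry, the second half of the formula of Connes
  becomes a signed sum over rotations of the same shape as the first half, where the unit is placed
  in front.\<close>

definition ins1 :: "'a list => 'a list" where "ins1 w = hd w # 1[A] # tl w"

lemma slotwise_ins1: "slotwise_linear K A (Suc n) (n+2) ins1"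
proof -
 have "slotwise_linear K A (Suc n) (n+2) (%w. rotate (Suc n) (1[A] # rotate 1 w))"
 using slotwise_comp[OF slotwise_comp[OF slotwise_rotate[of "Suc n" 1] slotwise_Cons[of "1[A]" "Suc n"]]
 slotwise_rotate[of "Suc (Suc n)" "Suc n"]] by simp
 moreover have "rotate (Suc n) (1[A] # rotate 1 w) = ins1 w" if w: "w : Tg A (Suc n)" for w
 proof -
 obtain c cs where c: "w = c # cs" "length cs = n" using w by(cases w) (auto simp: gens_iff)
 hence "1[A] # rotate 1 w = (1[A] # cs) @ [c]" by simp
 moreover have "rotate (Suc n) ((1[A] # cs) @ [c]) = [c] @ (1[A] # cs)"
 using rotate_append[of "1[A] # cs" "[c]"] c by(simp del: rotate_Suc)
 ultimately show ?thesis by(simp only:) (simp add: ins1_def c)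
 qed
 ultimately show ?thesis by(simp add: slotwise_linear_def gens_update del: rotate_Suc)
qed

lemma rotate_gens: "w : Tg A m ==> rotate i w : Tg A m"
 by(simp add: gens_iff)

lemma connes_sum_multilinear:
 assumes F: "slotwise_linear K A (Suc n) (Suc m) F"
 shows "multilinear K A (Suc n) (TB (int m)) (connes_sum n m F)"
proof -
 have "multilinear K A (Suc n) (TB (int m)) (%w. signed (TB (int m)) (int (i * n)) (kp m (F (rotate i w))))" for i
 by(rule multilinear_ahom[OF multilinear_slotwise[OF kp_multilinear slotwise_comp[OF slotwise_rotate F]]
 abelian_group.signed_ahom[OF TBG]])
 from multilinear_finsum[OF TBG this] show ?thesis by(simp add: connes_sum_def[abs_def])
qed

definition trace_extension :: "nat => nat => ('a list => ('a \<times> 'a list fab) fab)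
 => ('a \<times> 'a list fab) fab => ('a \<times> 'a list fab) fab" where
 "trace_extension n m g = plift (TB (int m)) (%(a, x).
 plift (TB (int m)) (%as. g (wrap A as)) (lact (Bi n) a x))"

lemma trace_extension:
 assumes "multilinear K A (Suc n) (TB (int m)) g"
 shows "trace_extension n m g : ahom (TB (int n)) (TB (int m))"
 and "!!w. w : Tg A (Suc n) ==> trace_extension n m g (kp n w) = g w"
 using trace_bar_lift[OF TBG assms] by(simp_all add: trace_extension_def)

text \<open>The last face of \<open>w @ [1]\<close> merely removes the unit and leaves w as a bar
  element; the trace then carries the last entry of w to the front. This is how the ordinary faces
  turn into the cyclic ones.\<close>

lemma diff_kp:
 assumes w: "w : Tg A (n+2)"
 shows "diff (Tr A Bc) (int (Suc n)) (kp (Suc n) w)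
 = (\<Oplus>\<^bsub>TB (int n)\<^esub>k\<in>{..Suc n}. signed (TB (int n)) (int k) (kp n (cyclic_face A (Suc n) k w)))"
proof -
 interpret N: is_bimodule K A "Bi n" by(rule bar_bim)
 interpret T: abelian_group "TB (int n)" by(rule TBG)
 have w1: "w @ [1[A]] : Tg A (Suc n + 2)" using w by(simp add: gens_iff)
 have len: "length w = Suc (Suc n)" and mem: "set w <= carrier A" using w by(simp_all add: gens_iff)
 have fc: "face A k (w @ [1[A]]) : Tg A (n+2)" if "k <= Suc n" for k
 using face_closed[of "w @ [1[A]]" "n + 2" k] w1 that by simp
 have "diff (Tr A Bc) (int (Suc n)) (kp (Suc n) w) = tr A (Bi n) (diff Bc (int (Suc n)) (pt (w @ [1[A]])))"
 unfolding kp_def using diff_Tr_tr[OF bar_is_cpx, of "pt (w @ [1[A]])" "int (Suc n)"] pt_closed[OF w1] by simp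
 also have "... = tr A (Bi n) (\<Oplus>\<^bsub>Bi n\<^esub>k\<in>{..Suc n}. signed (Bi n) (int k) (pt (face A k (w @ [1[A]]))))"
 using bar_diff(2)[of "w @ [1[A]]" n] w1 by(simp add: numeral_3_eq_3)
 also have "... = (\<Oplus>\<^bsub>TB (int n)\<^esub>k\<in>{..Suc n}. tr A (Bi n) (signed (Bi n) (int k) (pt (face A k (w @ [1[A]])))))"
 by(rule N.B.finsum_ahom[OF TBG N.tr_ahom]) (auto intro!: pt_closed fc simp del: add_2_eq_Suc')
 also have "... = (\<Oplus>\<^bsub>TB (int n)\<^esub>k\<in>{..Suc n}. signed (TB (int n)) (int k) (kp n (cyclic_face A (Suc n) k w)))"
 proof (rule T.finsum_eqI)
 fix k assume "k : {..Suc n}"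
 hence k: "k <= Suc n" by simp
 have "tr A (Bi n) (pt (face A k (w @ [1[A]]))) = kp n (cyclic_face A (Suc n) k w)"
 proof (cases "k < Suc n")
 case True
 thus ?thesis using face_snoc[of k w A "1[A]"] len by(simp add: kp_def cyclic_face_def)
 next
 case False
 have "w ~= []" using len by auto
 hence "last w :> A" using mem last_in_set[of w] by blast
 with \<open>w ~= []\<close> have "face A k (w @ [1[A]]) = w" using face_last[of w k A "1[A]"] False k len by simp
 thus ?thesis using tr_pt[OF w] False by(simp add: cyclic_face_def)
 qed
 thus "tr A (Bi n) (signed (Bi n) (int k) (pt (face A k (w @ [1[A]]))))
 = signed (TB (int n)) (int k) (kp n (cyclic_face A (Suc n) k w))"
 using pt_closed[OF fc[OF k]] by(simp add: N.tr_rules)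
 have "cyclic_face A (Suc n) k w : Tg A (Suc n)"
 using face_closed[of w "Suc n" k] wrap_closed[OF w] w by(simp add: cyclic_face_def)
 thus "signed (TB (int n)) (int k) (kp n (cyclic_face A (Suc n) k w)) :> TB (int n)"
 using kp_closed by simp
 qed
 finally show ?thesis .
qed

abbreviation "ins2 \<equiv> %w. ins1 (ins1 w)"

lemma slotwise_ins2: "slotwise_linear K A (Suc n) (Suc (n+2)) ins2"
 using slotwise_comp[of "Suc n" "Suc (Suc n)" ins1 "Suc (Suc (Suc n))" ins1] slotwise_ins1[of n] slotwise_ins1[of "Suc n"] by simp

lemma ins_closed: "w : Tg A (Suc n) ==> ins1 w : Tg A (n+2)"
 "w : Tg A (Suc n) ==> ins2 w : Tg A (n+3)"
 using slotwise_ins1[of n] slotwise_ins2[of n] by(simp_all add: slotwise_linear_def numeral_3_eq_3)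

lemma cyclic_face_closed: "w : Tg A (n+2) ==> k <= Suc n ==> cyclic_face A (Suc n) k w : Tg A (Suc n)"
 using face_closed[of w "Suc n" k] wrap_closed[of w n] by(simp add: cyclic_face_def)

text \<open>Faces 0, 1 and 2 each absorb one of the two inserted units and leave the other. The
  later faces act behind the units, which shifts their index by two.\<close>

lemma cyclic_face_ins2:
 assumes w: "w : Tg A (Suc n)"
 shows "k <= 2 ==> cyclic_face A (n+2) k (ins2 w) = ins1 w"
 and "1 <= k ==> k <= n ==> cyclic_face A (n+2) (k+2) (ins2 w) = ins2 (cyclic_face A n k w)"
proof -
 obtain c t where c: "w = c # t" "c :> A" "set t <= carrier A" "length t = n"
 using w by(cases w) (auto simp: gens_iff)
 have e: "ins2 (c # u) = c # 1[A] # 1[A] # u" "ins1 (c # u) = c # 1[A] # u" for u by(simp_all add: ins1_def)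
 show "cyclic_face A (n+2) k (ins2 w) = ins1 w" if k: "k <= 2"
 proof -
 consider "k = 0" | "k = 1" | "k = 2" using k by linarith
 thus ?thesis
 proof cases
 case 3
 thus ?thesis unfolding c(1) e using c(2-4)
 by(cases t) (simp_all add: cyclic_face_def wrap_def face_0 face_Suc numeral_2_eq_2)
 qed (use c(2-4) in \<open>simp_all add: c(1) e cyclic_face_def face_0 face_Suc\<close>)
 qed
 show "cyclic_face A (n+2) (k+2) (ins2 w) = ins2 (cyclic_face A n k w)" if k: "1 <= k" "k <= n"
 proof (cases "k < n")
 case True
 obtain l where l: "k = Suc l" using k by(cases k) auto
 have "face A (Suc (Suc (Suc l))) (c # 1[A] # 1[A] # t) = c # 1[A] # 1[A] # face A l t" by(simp add: face_Suc)
 moreover have "face A (Suc l) (c # t) = c # face A l t" by(simp add: face_Suc)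
 ultimately show ?thesis using True unfolding c(1) cyclic_face_def e by(simp add: l ins1_def)
 next
 case False
 hence "k = n" "t ~= []" using k c by auto
 thus ?thesis using c(4) unfolding c(1) cyclic_face_def e by(simp add: ins1_def wrap_def)
 qed
qed

text \<open>The three faces that absorb a unit contribute u - u + u = u, and the index shift by two
  preserves the remaining signs. The product of the first two entries of w is blocked by the units,
  so the second sum starts at 1.\<close>

lemma diff_kp_ins2:
 assumes w: "w : Tg A (Suc n)"
 shows "diff (Tr A Bc) (int (n+2)) (kp (n+2) (ins2 w)) = kp (n+1) (ins1 w) +[TB (int (n+1))]
 (\<Oplus>\<^bsub>TB (int (n+1))\<^esub>k\<in>{1..n}. signed (TB (int (n+1))) (int k) (kp (n+1) (ins2 (cyclic_face A n k w))))"
proof -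
 interpret T: abelian_group "TB (int (n+1))" by(rule TBG)
 let ?T = "TB (int (n+1))"
 let ?f = "%k. signed ?T (int k) (kp (n+1) (cyclic_face A (n+2) k (ins2 w)))"
 have i2: "ins2 w : Tg A (Suc n + 2)" using ins_closed(2)[OF w] by(simp add: numeral_3_eq_3)
 have c: "kp (n+1) (cyclic_face A (n+2) k (ins2 w)) :> ?T" if "k <= n + 2" for k
 using kp_closed[OF cyclic_face_closed[OF i2, of k]] that by simp
 have u: "kp (n+1) (ins1 w) :> ?T" using kp_closed[of "ins1 w" "n + 1"] ins_closed(1)[OF w] by simp
 have split: "{..n + 2} = {0, 1, 2} \<union> (%k. k + 2) ` {1..n}"
 proof -
 have "k : (%k. k + 2) ` {1..n}" if "k <= n + 2" "k ~= 0" "k ~= 1" "k ~= 2" for k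
 using that by(intro image_eqI[of _ _ "k - 2"]) auto
 thus ?thesis by auto
 qed
 have "diff (Tr A Bc) (int (n+2)) (kp (n+2) (ins2 w)) = (\<Oplus>\<^bsub>?T\<^esub>k\<in>{..n + 2}. ?f k)"
 using diff_kp[OF i2] by simp
 also have "... = (\<Oplus>\<^bsub>?T\<^esub>k\<in>{0, 1, 2}. ?f k) +[?T] (\<Oplus>\<^bsub>?T\<^esub>k\<in>(%k. k + 2) ` {1..n}. ?f k)"
 unfolding split by(rule T.finsum_Un_disjoint) (use c in auto)
 also have "(\<Oplus>\<^bsub>?T\<^esub>k\<in>{0, 1, 2}. ?f k) = (\<Oplus>\<^bsub>?T\<^esub>k\<in>{0, 1, 2}. signed ?T (int k) (kp (n+1) (ins1 w)))"
 by(rule T.finsum_eqI) (use cyclic_face_ins2(1)[OF w] u in auto)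
 also have "... = kp (n+1) (ins1 w)" by(rule T.finsum_signed_three[OF u])
 also have "(\<Oplus>\<^bsub>?T\<^esub>k\<in>(%k. k + 2) ` {1..n}. ?f k) = (\<Oplus>\<^bsub>?T\<^esub>k\<in>{1..n}. ?f (k+2))"
 by(rule T.finsum_reindex) (use c in \<open>auto simp: inj_on_def\<close>)
 also have "... = (\<Oplus>\<^bsub>?T\<^esub>k\<in>{1..n}. signed ?T (int k) (kp (n+1) (ins2 (cyclic_face A n k w))))"
 proof (rule T.finsum_eqI)
 fix k assume k: "k : {1..n}"
 hence e: "cyclic_face A (n+2) (k+2) (ins2 w) = ins2 (cyclic_face A n k w)" using cyclic_face_ins2(2)[OF w] by simp
 show "?f (k+2) = signed ?T (int k) (kp (n+1) (ins2 (cyclic_face A n k w)))" unfolding e by(rule T.signed_even) simp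
 show "signed ?T (int k) (kp (n+1) (ins2 (cyclic_face A n k w))) :> ?T" using c[of "k + 2"] k unfolding e by simp
 qed
 finally show ?thesis .
qed

text \<open>With \<open>N\<close> the signed norm over the cyclic rotations, the sum over the faces other than the first
 one commutes with \<open>N\<close> up to the full Hochschild boundary.\<close>

lemma cyclic_double_sum:
 assumes w: "w : Tg A (n+2)"
 defines "T \<equiv> TB (int (n+2))"
 shows "(\<Oplus>\<^bsub>T\<^esub>i\<in>{..Suc n}. signed T (int (i * Suc n)) (\<Oplus>\<^bsub>T\<^esub>k\<in>{1..Suc n}. signed T (int k)
 (kp (n+2) (ins2 (cyclic_face A (Suc n) k (rotate i w))))))
 = (\<Oplus>\<^bsub>T\<^esub>k\<in>{..Suc n}. signed T (int k) (connes_sum n (n+2) ins2 (cyclic_face A (Suc n) k w)))"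
proof -
 interpret T: abelian_group T unfolding T_def by(rule TBG)
 have len: "length w = Suc (Suc n)" using w by(simp add: gens_iff)
 \<comment> \<open>\<open>f\<close> is indexed by (rotation, face) with the face taken last,
   \<open>g\<close> by (face, rotation) with the face taken first; \<open>cyclic_reindex\<close>
   carries one to the other.\<close>
 define f where "f = (%(i, k). signed T (int (i * Suc n) + int k) (kp (n+2) (ins2 (cyclic_face A (Suc n) k (rotate i w)))))"
 define g where "g = (%(k, i). signed T (int k + int (i * n)) (kp (n+2) (ins2 (rotate i (cyclic_face A (Suc n) k w)))))"
 have cf: "kp (n+2) (ins2 (cyclic_face A (Suc n) k (rotate i w))) :> T" if "k <= Suc n" for i k
 unfolding T_def using ins_closed(2)[OF cyclic_face_closed[OF rotate_gens[OF w] that]] kp_closed[of _ "n + 2"] by(simp add: numeral_3_eq_3)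
 have cg: "kp (n+2) (ins2 (rotate i (cyclic_face A (Suc n) k w))) :> T" if "k <= Suc n" for i k
 unfolding T_def using ins_closed(2)[OF rotate_gens[OF cyclic_face_closed[OF w that]]] kp_closed[of _ "n + 2"] by(simp add: numeral_3_eq_3)
 have "(\<Oplus>\<^bsub>T\<^esub>i\<in>{..Suc n}. signed T (int (i * Suc n)) (\<Oplus>\<^bsub>T\<^esub>k\<in>{1..Suc n}. signed T (int k)
 (kp (n+2) (ins2 (cyclic_face A (Suc n) k (rotate i w)))))) = (\<Oplus>\<^bsub>T\<^esub>i\<in>{..Suc n}. \<Oplus>\<^bsub>T\<^esub>k\<in>{1..Suc n}. f (i, k))"
 proof (rule T.finsum_eqI)
 fix i assume "i : {..Suc n}"
 have "signed T (int (i * Suc n)) (\<Oplus>\<^bsub>T\<^esub>k\<in>{1..Suc n}. signed T (int k) (kp (n+2) (ins2 (cyclic_face A (Suc n) k (rotate i w)))))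
 = (\<Oplus>\<^bsub>T\<^esub>k\<in>{1..Suc n}. signed T (int (i * Suc n)) (signed T (int k) (kp (n+2) (ins2 (cyclic_face A (Suc n) k (rotate i w))))))"
 by(rule T.signed_finsum) (use cf in auto)
 also have "... = (\<Oplus>\<^bsub>T\<^esub>k\<in>{1..Suc n}. f (i, k))"
 by(rule T.finsum_eqI) (use cf T.signed_signed in \<open>auto simp: f_def simp del: mult_Suc_right of_nat_mult of_nat_Suc\<close>)
 finally show "signed T (int (i * Suc n)) (\<Oplus>\<^bsub>T\<^esub>k\<in>{1..Suc n}. signed T (int k) (kp (n+2) (ins2 (cyclic_face A (Suc n) k (rotate i w)))))
 = (\<Oplus>\<^bsub>T\<^esub>k\<in>{1..Suc n}. f (i, k))" .
 qed (use cf in \<open>auto simp: f_def intro!: T.finsum_closed\<close>)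
 also have "... = (\<Oplus>\<^bsub>T\<^esub>p\<in>{..Suc n} \<times> {1..Suc n}. f p)"
 by(rule T.finsum_product) (use cf in \<open>auto simp: f_def\<close>)
 also have "... = (\<Oplus>\<^bsub>T\<^esub>p\<in>{..Suc n} \<times> {1..Suc n}. g (cyclic_reindex (Suc n) p))"
 proof (rule T.finsum_eqI)
 fix p assume p: "p : {..Suc n} \<times> {1..Suc n}"
 then obtain i k where ik: "p = (i, k)" "i <= Suc n" "1 <= k" "k <= Suc n" by auto
 note R = cyclic_face_rotate[OF len ik(2-4), of A]
 show "f p = g (cyclic_reindex (Suc n) p)"
 proof (cases "k + i <= Suc n")
 case True
 have "signed T (int (i * Suc n) + int k) x = signed T (int (k+i) + int (i * n)) x" for x
 by(rule T.signed_even) (simp add: algebra_simps)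
 thus ?thesis using R(1)[OF True] True by(simp add: f_def g_def ik cyclic_reindex_def)
 next
 case False
 define i' l where "i' = i - 1" and "l = k + i - Suc (Suc n)"
 hence i: "i = Suc i'" "k + i = Suc (Suc n) + l" using False ik by auto
 \<comment> \<open>This relation makes the exponents i (n + 1) + k and l + i' n congruent modulo 2,
   with i = i' + 1; it accounts for the rotation lost on passing the seam.\<close>
 hence "int k + int i' = 1 + int n + int l" by linarith
 hence "even (int k + int i') = even (1 + int n + int l)" by simp
 moreover have l': "k + i - Suc (Suc n) = l" "i - 1 = i'" by(simp_all add: l_def i'_def)
 ultimately have "signed T (int (i * Suc n) + int k) x = signed T (int (k + i - Suc (Suc n)) + int ((i-1) * n)) x" for x
 unfolding l' by(intro T.signed_even) (auto simp: i(1) algebra_simps)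
 thus ?thesis using R(2) False by(simp add: f_def g_def ik cyclic_reindex_def)
 qed
 have "cyclic_reindex (Suc n) p : {..Suc n} \<times> {..<Suc n}" using cyclic_reindex(2)[of "Suc n"] p by blast
 thus "g (cyclic_reindex (Suc n) p) :> T" using cg by(auto simp: g_def)
 qed
 also have "... = (\<Oplus>\<^bsub>T\<^esub>p\<in>cyclic_reindex (Suc n) ` ({..Suc n} \<times> {1..Suc n}). g p)"
 by(rule T.finsum_reindex[symmetric]) (use cg cyclic_reindex[of "Suc n"] in \<open>auto simp: g_def\<close>)
 also have "... = (\<Oplus>\<^bsub>T\<^esub>p\<in>{..Suc n} \<times> {..n}. g p)"
 unfolding cyclic_reindex(2) lessThan_Suc_atMost ..
 also have "... = (\<Oplus>\<^bsub>T\<^esub>k\<in>{..Suc n}. \<Oplus>\<^bsub>T\<^esub>i\<in>{..n}. g (k, i))"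
 by(rule T.finsum_product[symmetric]) (use cg in \<open>auto simp: g_def\<close>)
 also have "... = (\<Oplus>\<^bsub>T\<^esub>k\<in>{..Suc n}. signed T (int k) (connes_sum n (n+2) ins2 (cyclic_face A (Suc n) k w)))"
 proof (rule T.finsum_eqI)
 fix k assume k: "k : {..Suc n}"
 have "signed T (int k) (connes_sum n (n+2) ins2 (cyclic_face A (Suc n) k w))
 = (\<Oplus>\<^bsub>T\<^esub>i\<in>{..n}. signed T (int k) (signed T (int (i * n)) (kp (n+2) (ins2 (rotate i (cyclic_face A (Suc n) k w))))))"
 unfolding connes_sum_def T_def[symmetric] by(rule T.signed_finsum) (use cg k in auto)
 also have "... = (\<Oplus>\<^bsub>T\<^esub>i\<in>{..n}. g (k, i))"
 by(rule T.finsum_eqI) (use cg k T.signed_signed in \<open>auto simp: g_def simp del: of_nat_mult\<close>)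
 finally show "(\<Oplus>\<^bsub>T\<^esub>i\<in>{..n}. g (k, i)) = signed T (int k) (connes_sum n (n+2) ins2 (cyclic_face A (Suc n) k w))" by simp
 moreover have "(\<Oplus>\<^bsub>T\<^esub>i\<in>{..n}. g (k, i)) :> T"
 by(rule T.finsum_closed) (use cg k in \<open>auto simp: g_def\<close>)
 ultimately show "signed T (int k) (connes_sum n (n+2) ins2 (cyclic_face A (Suc n) k w)) :> T" by simp
 qed
 finally show ?thesis .
qed

lemma diff_connes_ins2:
 assumes w: "w : Tg A (Suc n)"
 shows "diff (Tr A Bc) (int (n+2)) (connes_sum n (n+2) ins2 w) = connes_sum n (n+1) ins1 w +[TB (int (n+1))]
 (\<Oplus>\<^bsub>TB (int (n+1))\<^esub>i\<in>{..n}. signed (TB (int (n+1))) (int (i * n)) (\<Oplus>\<^bsub>TB (int (n+1))\<^esub>k\<in>{1..n}.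
 signed (TB (int (n+1))) (int k) (kp (n+1) (ins2 (cyclic_face A n k (rotate i w))))))"
proof -
 let ?T = "TB (int (n+1))"
 interpret S: abelian_group "TB (int (n+2))" by(rule TBG)
 interpret T: abelian_group ?T by(rule TBG)
 interpret G: group_cpx "Tr A Bc" by(rule trace_group_cpx[OF bar_is_cpx])
 have d: "diff (Tr A Bc) (int (n+2)) : ahom (TB (int (n+2))) ?T"
 using group_cpx.d[OF trace_group_cpx[OF bar_is_cpx], of "int (n+2)"] by simp
 note dr = ahom_rules[OF TBG TBG d]
 have c2: "kp (n+2) (ins2 (rotate i w)) :> TB (int (n+2))" for i
 using kp_closed[of _ "n + 2"] ins_closed(2)[OF rotate_gens[OF w]] by(simp add: numeral_3_eq_3)
 have c1: "kp (n+1) (ins1 (rotate i w)) :> ?T" for i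
 using kp_closed[of _ "n + 1"] ins_closed(1)[OF rotate_gens[OF w]] by simp
 let ?X = "%i. \<Oplus>\<^bsub>?T\<^esub>k\<in>{1..n}. signed ?T (int k) (kp (n+1) (ins2 (cyclic_face A n k (rotate i w))))"
 have X: "?X i :> ?T" for i
 proof (rule T.finsum_closed, rule Pi_I)
 fix k assume k: "k : {1..n}"
 then obtain m where m: "n = Suc m" by(cases n) auto
 show "signed ?T (int k) (kp (n+1) (ins2 (cyclic_face A n k (rotate i w)))) :> ?T"
 using ins_closed(2)[OF cyclic_face_closed[of "rotate i w" m k]] rotate_gens[OF w] k m kp_closed[of _ "n + 1"]
 by(simp add: numeral_3_eq_3)
 qed
 have "diff (Tr A Bc) (int (n+2)) (connes_sum n (n+2) ins2 w)
 = (\<Oplus>\<^bsub>?T\<^esub>i\<in>{..n}. diff (Tr A Bc) (int (n+2)) (signed (TB (int (n+2))) (int (i * n)) (kp (n+2) (ins2 (rotate i w)))))"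
 unfolding connes_sum_def by(rule S.finsum_ahom[OF TBG d]) (use c2 in auto)
 also have "... = (\<Oplus>\<^bsub>?T\<^esub>i\<in>{..n}. signed ?T (int (i * n)) (kp (n+1) (ins1 (rotate i w))) +[?T] signed ?T (int (i * n)) (?X i))"
 proof (rule T.finsum_eqI)
 fix i
 show "diff (Tr A Bc) (int (n+2)) (signed (TB (int (n+2))) (int (i * n)) (kp (n+2) (ins2 (rotate i w))))
 = signed ?T (int (i * n)) (kp (n+1) (ins1 (rotate i w))) +[?T] signed ?T (int (i * n)) (?X i)"
 unfolding dr(6)[OF c2] diff_kp_ins2[OF rotate_gens[OF w]] by(rule T.signed_add[OF c1 X])
 qed (use c1 X in \<open>auto intro!: T.a_closed\<close>)
 also have "... = connes_sum n (n+1) ins1 w +[?T] (\<Oplus>\<^bsub>?T\<^esub>i\<in>{..n}. signed ?T (int (i * n)) (?X i))"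
 unfolding connes_sum_def by(rule T.finsum_addf) (use c1 X in auto)
 finally show ?thesis .
qed

section \<open>The two halves of the operator of Connes on the trace\<close>

definition connes_trace :: "nat => ('a \<times> 'a list fab) fab => ('a \<times> 'a list fab) fab" where
 "connes_trace n = trace_extension n (n+1) (connes_sum n (n+1) ((#) 1[A]))"

definition connes_trace' :: "nat => ('a \<times> 'a list fab) fab => ('a \<times> 'a list fab) fab" where
 "connes_trace' n = trace_extension n (n+1) (connes_sum n (n+1) ins1)"

lemma connes_sums:
 "multilinear K A (Suc n) (TB (int (n+1))) (connes_sum n (n+1) ((#) 1[A]))"
 "multilinear K A (Suc n) (TB (int (n+1))) (connes_sum n (n+1) ins1)"
 "multilinear K A (Suc n) (TB (int (n+2))) (connes_sum n (n+2) ins2)"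
 by(rule connes_sum_multilinear; use slotwise_Cons[of "1[A]" "Suc n"] slotwise_ins1[of n] slotwise_ins2[of n] in simp)+

lemmas connes_trace = trace_extension[OF connes_sums(1), folded connes_trace_def]
lemmas connes_trace' = trace_extension[OF connes_sums(2), folded connes_trace'_def]

text \<open>Inserting two units gives a map U that raises the degree by two and satisfies d U =
  \<open>connes_trace'\<close> + U d, by \<open>diff_connes_ins2\<close> and
  \<open>cyclic_double_sum\<close>. On a cycle the last term vanishes. In degree 0 the sum over the
  remaining faces is empty.\<close>

lemma connes_trace'_boundary:
 assumes z: "z :> TB (int n)" and dz: "diff (Tr A Bc) (int n) z = 0[TB (int n - 1)]"
 shows "connes_trace' n z : boundaries (Tr A Bc) (int (n+1))"
proof -
 note U = trace_extension[OF connes_sums(3)]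
 let ?U = "%n. trace_extension n (n+2) (connes_sum n (n+2) ins2)"
 let ?T = "TB (int (n+1))"
 interpret T: abelian_group ?T by(rule TBG)
 have d: "diff (Tr A Bc) (int (n+2)) : ahom (TB (int (n+2))) ?T"
 using group_cpx.d[OF trace_group_cpx[OF bar_is_cpx], of "int (n+2)"] by simp
 have "diff (Tr A Bc) (int (n+2)) (?U n z) = connes_trace' n z"
 proof (cases n)
 case 0
 show ?thesis
 proof (rule trace_bar_ext[OF TBG ahom_comp[OF U(1) d] connes_trace'(1) z])
 fix w assume w: "w : Tg A (Suc n)"
 have "connes_sum n (n+1) ins1 w :> ?T" using multilinear_closed[OF connes_sums(2) w] .
 moreover have "{1..n} = {}" using 0 by simp
 ultimately show "diff (Tr A Bc) (int (n+2)) (?U n (kp n w)) = connes_trace' n (kp n w)"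
 using diff_connes_ins2[OF w] unfolding U(2)[OF w] connes_trace'(2)[OF w]
 by(simp only: T.finsum_empty T.signed_zero T.finsum_zero T.r_zero)
 qed
 next
 case (Suc m)
 have dm: "diff (Tr A Bc) (int n) : ahom (TB (int n)) (TB (int m))"
 using group_cpx.d[OF trace_group_cpx[OF bar_is_cpx], of "int n"] by(simp add: Suc)
 have Um: "?U m : ahom (TB (int m)) ?T" using U(1)[of m] by(simp add: Suc)
 note Ur = ahom_rules[OF TBG TBG Um]
 have "diff (Tr A Bc) (int (n+2)) (?U n z) = connes_trace' n z +[?T] ?U m (diff (Tr A Bc) (int n) z)"
 proof (rule trace_bar_ext[OF TBG ahom_comp[OF U(1) d] ahom_plus[OF TBG connes_trace'(1) ahom_comp[OF dm Um]] z])
 fix w assume w: "w : Tg A (Suc n)"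
 have w': "w : Tg A (m+2)" using w by(simp add: Suc)
 interpret Tm: abelian_group "TB (int m)" by(rule TBG)
 have cl: "cyclic_face A (Suc m) k w : Tg A (Suc m)" if "k : {..Suc m}" for k
 using cyclic_face_closed[OF w'] that by simp
 have "?U m (diff (Tr A Bc) (int (Suc m)) (kp (Suc m) w))
 = (\<Oplus>\<^bsub>?T\<^esub>k\<in>{..Suc m}. ?U m (signed (TB (int m)) (int k) (kp m (cyclic_face A (Suc m) k w))))"
 unfolding diff_kp[OF w'] by(rule Tm.finsum_ahom[OF TBG Um]) (use kp_closed[OF cl] in auto)
 also have "... = (\<Oplus>\<^bsub>?T\<^esub>k\<in>{..Suc m}. signed ?T (int k) (connes_sum m (m+2) ins2 (cyclic_face A (Suc m) k w)))"
 proof (rule T.finsum_eqI)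
 fix k assume k: "k : {..Suc m}"
 show "?U m (signed (TB (int m)) (int k) (kp m (cyclic_face A (Suc m) k w)))
 = signed ?T (int k) (connes_sum m (m+2) ins2 (cyclic_face A (Suc m) k w))"
 unfolding Ur(6)[OF kp_closed[OF cl[OF k]]] U(2)[OF cl[OF k]] ..
 show "signed ?T (int k) (connes_sum m (m+2) ins2 (cyclic_face A (Suc m) k w)) :> ?T"
 using multilinear_closed[OF connes_sums(3) cl[OF k]] by(simp add: Suc)
 qed
 finally have "?U m (diff (Tr A Bc) (int n) (kp n w)) = (\<Oplus>\<^bsub>?T\<^esub>i\<in>{..n}. signed ?T (int (i * n)) (\<Oplus>\<^bsub>?T\<^esub>k\<in>{1..n}.
 signed ?T (int k) (kp (n+1) (ins2 (cyclic_face A n k (rotate i w))))))"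
 using cyclic_double_sum[OF w'] by(simp add: Suc)
 thus "diff (Tr A Bc) (int (n+2)) (?U n (kp n w)) = connes_trace' n (kp n w) +[?T] ?U m (diff (Tr A Bc) (int n) (kp n w))"
 unfolding U(2)[OF w] connes_trace'(2)[OF w] diff_connes_ins2[OF w] by simp
 qed
 moreover have "diff (Tr A Bc) (int n) z = 0[TB (int m)]" using dz by(simp add: Suc)
 ultimately show ?thesis using Ur(3) ahom_closed[OF connes_trace'(1) z] by simp
 qed
 moreover have "?U n z :> TB (int (n+2))" using ahom_closed[OF U(1) z] .
 ultimately show ?thesis
 unfolding boundaries_def by(intro image_eqI[of _ _ "?U n z"]) (simp_all add: add.commute)
qed

lemma connes_chain:
 assumes z: "z :> TB (int n)"
 shows "tpow_to_trace_bar K A (n+1) (connes_tpow K A n (trace_bar_to_tpow K A n z))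
 = connes_trace n z +[TB (int (n+1))] connes_trace' n z"
proof -
 let ?S = "tpow K A (n+2)" and ?T = "TB (int (n+1))"
 have SG: "abelian_group ?S" and TP: "abelian_group (tpow K A (n+1))"
 by(rule presented_group.abelian_group_presented[OF tpow_presented])+
 interpret S: abelian_group ?S by(rule SG)
 interpret T: abelian_group ?T by(rule TBG)
 have ptm: "multilinear K A (n+2) ?S pt" by(rule multilinear_pure_tensor[OF tpow_presented])
 have ml: "multilinear K A (Suc n) ?S (%w. \<Oplus>\<^bsub>?S\<^esub>i\<in>{0..n}. signed ?S (int (i * n)) (pt (F (rotate i w))))"
 if F: "slotwise_linear K A (Suc n) (n+2) F" for F
 by(rule multilinear_finsum[OF SG]) (rule multilinear_ahom[OF multilinear_slotwise[OF ptm slotwise_comp[OF slotwise_rotate F]] S.signed_ahom])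
 have s1: "slotwise_linear K A (Suc n) (n+2) ((#) 1[A])" using slotwise_Cons[of "1[A]" "Suc n"] by simp
 let ?E = "%F w. \<Oplus>\<^bsub>?S\<^esub>i\<in>{0..n}. signed ?S (int (i * n)) (pt (F (rotate i w)))"
 have "multilinear K A (Suc n) ?S (%w. ?E ((#) 1[A]) w +[?S] ?E ins1 w)"
 by(rule multilinear_plus[OF SG ml[OF s1] ml[OF slotwise_ins1]])
 note C = multilinear_lift[OF tpow_presented SG this]
 have D: "connes_tpow K A n = plift ?S (%w. ?E ((#) 1[A]) w +[?S] ?E ins1 w)"
 by(simp add: connes_tpow_def Let_def ins1_def)
 have C1: "connes_tpow K A n : ahom (tpow K A (n+1)) ?S" using C(1) by(simp add: D)
 have t: "tpow_to_trace_bar K A (n+1) : ahom ?S ?T" using tpow_to_trace_bar_pt(1)[of "n + 1"] by simp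
 note tr' = ahom_rules[OF SG TBG t]
 show ?thesis
 proof (rule trace_bar_ext[OF TBG ahom_comp[OF trace_bar_to_tpow_kp(1) ahom_comp[OF C1 t]] ahom_plus[OF TBG connes_trace(1) connes_trace'(1)] z])
 fix w assume w: "w : Tg A (Suc n)"
 have E: "?E F w :> ?S" "tpow_to_trace_bar K A (n+1) (?E F w) = connes_sum n (n+1) F w"
 if F: "slotwise_linear K A (Suc n) (n+2) F" for F
 proof -
 show "?E F w :> ?S" using multilinear_closed[OF ml[OF F] w] .
 have Fg: "F (rotate i w) : Tg A (n+2)" for i using F rotate_gens[OF w] by(simp add: slotwise_linear_def)
 note pc = multilinear_closed[OF ptm Fg]
 have "tpow_to_trace_bar K A (n+1) (?E F w) = (\<Oplus>\<^bsub>?T\<^esub>i\<in>{0..n}. tpow_to_trace_bar K A (n+1) (signed ?S (int (i * n)) (pt (F (rotate i w)))))"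
 by(rule S.finsum_ahom[OF TBG t]) (use pc in auto)
 also have "... = connes_sum n (n+1) F w" unfolding connes_sum_def atLeast0AtMost
 proof (rule T.finsum_eqI)
 fix i
 have g: "F (rotate i w) : Tg A (Suc (n+1))" using Fg by simp
 show "tpow_to_trace_bar K A (n+1) (signed ?S (int (i * n)) (pt (F (rotate i w)))) = signed ?T (int (i * n)) (kp (n+1) (F (rotate i w)))"
 unfolding tr'(6)[OF pc] tpow_to_trace_bar_pt(2)[OF g] ..
 show "signed ?T (int (i * n)) (kp (n+1) (F (rotate i w))) :> ?T" using kp_closed[OF g] by(rule T.signed_closed)
 qed
 finally show "tpow_to_trace_bar K A (n+1) (?E F w) = connes_sum n (n+1) F w" .
 qed
 have "connes_tpow K A n (pt w) = ?E ((#) 1[A]) w +[?S] ?E ins1 w" unfolding D by(rule C(2)[OF w])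
 thus "tpow_to_trace_bar K A (n+1) (connes_tpow K A n (trace_bar_to_tpow K A n (kp n w))) = connes_trace n (kp n w) +[?T] connes_trace' n (kp n w)"
 unfolding trace_bar_to_tpow_kp(2)[OF w] connes_trace(2)[OF w] connes_trace'(2)[OF w]
 using tr'(2)[OF E(1)[OF s1] E(1)[OF slotwise_ins1[of n]]] E(2)[OF s1] E(2)[OF slotwise_ins1[of n]] by simp
 qed
qed

end

section \<open>A diagonal and a homotopy on the bar resolution\<close>

text \<open>Merging the two inner outer-factors identifies the tensor product over A of bar modules
  of degrees i and j with the bar module of degree i + j + 1: lists of lengths i + 2 and j + 2 give
  one of length i + j + 3.\<close>

definition bar_prod :: "('k, 'a) module => 'a list => 'a list => 'a list" where
 "bar_prod A as bs = butlast as @ (last as *[A] hd bs) # tl bs"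

lemma bar_prod_snoc: "bar_prod A (as @ [a]) (b # bs) = as @ (a *[A] b) # bs"
 by(simp add: bar_prod_def)

context assoc_algebra
begin

text \<open>The product has i + j + 2 faces. The first i + 1 come from the left factor and the other
  j + 1 from the right one; at the merged entry this is associativity.\<close>

lemma face_bar_prod:
 assumes as: "as : Tg A (i+2)" and bs: "bs : Tg A (j+2)"
 shows "l <= i ==> face A l (bar_prod A as bs) = bar_prod A (face A l as) bs"
 and "m <= j ==> face A (Suc i + m) (bar_prod A as bs) = bar_prod A as (face A m bs)"
proof -
 obtain a cs where a: "as = cs @ [a]" "cs ~= []" "a :> A" "cs : Tg A (i+1)" using gens_last[OF as] by blast
 obtain b ds where b: "bs = b # ds" "ds ~= []" "b :> A" "ds : Tg A (j+1)" using gens_hd[OF bs] by blast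
 have lc: "length cs = Suc i" and ld: "length ds = Suc j" using a b by(simp_all add: gens_iff)
 obtain c cs' where c: "cs = cs' @ [c]" using a(2) by(cases cs rule: rev_cases) auto
 obtain d ds' where d: "ds = d # ds'" using b(2) by(cases ds) auto
 have cd: "c :> A" "d :> A" using a b c d by(simp_all add: gens_iff)
 show "face A l (bar_prod A as bs) = bar_prod A (face A l as) bs" if "l <= i"
 proof (cases "l = i")
 case True
 hence l: "l = length cs'" using c lc by simp
 show ?thesis
 using face_middle[of A cs' c "a *[A] b" ds] face_middle[of A cs' c a "[]"] bar_prod_snoc[of A "cs' @ [c]" a b ds]
 bar_prod_snoc[of A cs' "c *[A] a" b ds] a(3) b(3) cd by(simp add: l a(1) b(1) c A.m_assoc)
 next
 case False
 hence "Suc l < length cs" using that lc by simp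
 thus ?thesis
 using face_append_left[of l cs A "(a *[A] b) # ds"] face_append_left[of l cs A "[a]"]
 by(simp add: a(1) b(1) bar_prod_snoc)
 qed
 show "face A (Suc i + m) (bar_prod A as bs) = bar_prod A as (face A m bs)" if "m <= j"
 proof -
 have "face A (Suc i + m) (bar_prod A as bs) = cs @ face A m ((a *[A] b) # ds)"
 using face_append_right[of A cs m "(a *[A] b) # ds"] lc by(simp add: a(1) b(1) bar_prod_snoc)
 also have "... = bar_prod A as (face A m bs)"
 proof (cases m)
 case 0
 thus ?thesis using a(3) b(3) cd by(simp add: a(1) b(1) d face_0 bar_prod_snoc A.m_assoc)
 next
 case (Suc m')
 thus ?thesis by(simp add: a(1) b(1) face_Suc bar_prod_snoc)
 qed
 finally show ?thesis .
 qed
qed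

lemma slotwise_append: "set xs <= carrier A ==> slotwise_linear K A m (m + length xs) (%as. as @ xs)"
proof (induction xs rule: rev_induct)
 case (snoc x xs)
 thus ?case using slotwise_comp[OF snoc.IH slotwise_snoc[of x]] by simp
qed (auto simp: slotwise_linear_def intro!: exI[of _ "%a. a"] klinear_id)

lemma slotwise_prepend: "set xs <= carrier A ==> slotwise_linear K A m (m + length xs) (%as. xs @ as)"
proof (induction xs)
 case (Cons x xs)
 thus ?case using slotwise_comp[OF Cons.IH slotwise_Cons[of x]] by simp
qed (auto simp: slotwise_linear_def intro!: exI[of _ "%a. a"] klinear_id)

lemma slotwise_bar_prod:
 shows "bs : Tg A (j+2) ==> slotwise_linear K A (i+2) (Suc (i+j) + 2) (%as. bar_prod A as bs)"
 and "as : Tg A (i+2) ==> slotwise_linear K A (j+2) (Suc (i+j) + 2) (%bs. bar_prod A as bs)"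
proof -
 show "slotwise_linear K A (i+2) (Suc (i+j) + 2) (%as. bar_prod A as bs)" if bs: "bs : Tg A (j+2)"
 proof -
 obtain b ds where b: "bs = b # ds" "ds ~= []" "b :> A" "ds : Tg A (j+1)" using gens_hd[OF bs] by blast
 have ds: "set ds <= carrier A" "length ds = Suc j" using b by(simp_all add: gens_iff)
 show ?thesis
 using slotwise_comp[OF slotwise_right_mult[OF b(3), of "Suc i"] slotwise_append[OF ds(1)]] ds(2)
 by(simp add: b(1) bar_prod_def add.commute)
 qed
 show "slotwise_linear K A (j+2) (Suc (i+j) + 2) (%bs. bar_prod A as bs)" if as: "as : Tg A (i+2)"
 proof -
 obtain a cs where a: "as = cs @ [a]" "cs ~= []" "a :> A" "cs : Tg A (i+1)" using gens_last[OF as] by blast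
 have cs: "set cs <= carrier A" "length cs = Suc i" using a by(simp_all add: gens_iff)
 show ?thesis
 using slotwise_comp[OF slotwise_left_mult[OF a(3), of "Suc j"] slotwise_prepend[OF cs(1)]] cs(2)
 by(simp add: a(1) bar_prod_def add.commute)
 qed
qed

lemma bar_prod_closed: "as : Tg A (i+2) ==> bs : Tg A (j+2) ==> bar_prod A as bs : Tg A (Suc (i+j) + 2)"
 using slotwise_bar_prod(1)[of bs j i] unfolding slotwise_linear_def by blast

definition bar_star :: "nat => nat => 'a list fab => 'a list fab => 'a list fab" where
 "bar_star i j = bar_bilift (Bar (int (Suc (i+j)))) (%as bs. pt (bar_prod A as bs))"

lemma bar_star:
 shows "y :> Bi j ==> (%x. bar_star i j x y) : ahom (Bi i) (Bar (int (Suc (i+j))))"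
 and "x :> Bi i ==> (%y. bar_star i j x y) : ahom (Bi j) (Bar (int (Suc (i+j))))"
 and "as : Tg A (i+2) ==> bs : Tg A (j+2) ==> bar_star i j (pt as) (pt bs) = pt (bar_prod A as bs)"
 unfolding bar_star_def
 by(rule bar_bilift[OF bar_group], rule multilinear_slotwise[OF pt_multilinear slotwise_bar_prod(1)], assumption,
 rule multilinear_slotwise[OF pt_multilinear slotwise_bar_prod(2)], assumption+)+

lemma bar_star_actions:
 assumes x: "x :> Bi i" and y: "y :> Bi j" and a: "a :> A"
 shows "bar_star i j (lact (Bi i) a x) y = lact (Bar (int (Suc (i+j)))) a (bar_star i j x y)"
 and "bar_star i j x (ract (Bi j) y a) = ract (Bar (int (Suc (i+j)))) (bar_star i j x y) a"
 and "bar_star i j (ract (Bi i) x a) y = bar_star i j x (lact (Bi j) a y)"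
proof -
 interpret I: is_bimodule K A "Bi i" by(rule bar_bim)
 interpret J: is_bimodule K A "Bi j" by(rule bar_bim)
 interpret S: is_bimodule K A "Bar (int (Suc (i+j)))" by(rule bar_bim)
 have l: "(a *[A] hd as) # tl as : Tg A (m+2)" and r: "butlast as @ [last as *[A] a] : Tg A (m+2)"
 if "as : Tg A (m+2)" for as m
 using that slotwise_left_mult[OF a, of "m + 1"] slotwise_right_mult[OF a, of "m + 1"] by(simp_all add: slotwise_linear_def)
 note h1 = bar_star(1)[of _ j i] and h2 = bar_star(2)[of _ i j]
 show "bar_star i j (lact (Bi i) a x) y = lact (Bar (int (Suc (i+j)))) a (bar_star i j x y)"
 proof (rule bar_biext[where F = "%x y. bar_star i j (lact (Bi i) a x) y"
 and G = "%x y. lact (Bar (int (Suc (i+j)))) a (bar_star i j x y)", OF bar_group _ _ _ _ _ x y])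
 fix as bs assume as: "as : Tg A (i+2)" and bs: "bs : Tg A (j+2)"
 obtain b cs where b: "as = b # cs" "cs ~= []" "b :> A" using gens_hd[OF as] by blast
 show "bar_star i j (lact (Bi i) a (pt as)) (pt bs) = lact (Bar (int (Suc (i+j)))) a (bar_star i j (pt as) (pt bs))"
 unfolding lact_pt[OF a as] bar_star(3)[OF l[OF as] bs] bar_star(3)[OF as bs] lact_pt[OF a bar_prod_closed[OF as bs]]
 using b by(simp add: bar_prod_def)
 qed (rule ahom_comp[OF I.lact_ahom[OF a] h1], assumption, rule h2[OF I.lact_closed[OF a pt_closed]], assumption,
 rule ahom_comp[OF h1 S.lact_ahom[OF a]], assumption, rule ahom_comp[OF h2[OF pt_closed] S.lact_ahom[OF a]], assumption)
 show "bar_star i j x (ract (Bi j) y a) = ract (Bar (int (Suc (i+j)))) (bar_star i j x y) a"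
 proof (rule bar_biext[where F = "%x y. bar_star i j x (ract (Bi j) y a)"
 and G = "%x y. ract (Bar (int (Suc (i+j)))) (bar_star i j x y) a", OF bar_group _ _ _ _ _ x y])
 fix as bs assume as: "as : Tg A (i+2)" and bs: "bs : Tg A (j+2)"
 obtain b cs where b: "bs = cs @ [b]" "cs ~= []" using gens_last[OF bs] by blast
 then obtain c ds where c: "cs = c # ds" by(cases cs) auto
 show "bar_star i j (pt as) (ract (Bi j) (pt bs) a) = ract (Bar (int (Suc (i+j)))) (bar_star i j (pt as) (pt bs)) a"
 unfolding ract_pt[OF a bs] bar_star(3)[OF as r[OF bs]] bar_star(3)[OF as bs] ract_pt[OF a bar_prod_closed[OF as bs]]
 using b by(simp add: bar_prod_def c butlast_append)
 qed (rule h1[OF J.ract_closed[OF _ a]], assumption, rule ahom_comp[OF J.ract_ahom[OF a] h2[OF pt_closed]], assumption,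
 rule ahom_comp[OF h1 S.ract_ahom[OF a]], assumption, rule ahom_comp[OF h2[OF pt_closed] S.ract_ahom[OF a]], assumption)
 show "bar_star i j (ract (Bi i) x a) y = bar_star i j x (lact (Bi j) a y)"
 proof (rule bar_biext[where F = "%x y. bar_star i j (ract (Bi i) x a) y"
 and G = "%x y. bar_star i j x (lact (Bi j) a y)", OF bar_group _ _ _ _ _ x y])
 fix as bs assume as: "as : Tg A (i+2)" and bs: "bs : Tg A (j+2)"
 obtain c cs where c: "as = cs @ [c]" "c :> A" using gens_last[OF as] by blast
 obtain b ds where b: "bs = b # ds" "b :> A" using gens_hd[OF bs] by blast
 show "bar_star i j (ract (Bi i) (pt as) a) (pt bs) = bar_star i j (pt as) (lact (Bi j) a (pt bs))"
 unfolding lact_pt[OF a bs] ract_pt[OF a as] bar_star(3)[OF r[OF as] bs] bar_star(3)[OF as l[OF bs]]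
 using a b c by(simp add: bar_prod_def A.m_assoc)
 qed (rule ahom_comp[OF I.ract_ahom[OF a] h1], assumption, rule h2[OF I.ract_closed[OF pt_closed a]], assumption,
 rule h1[OF J.lact_closed[OF a]], assumption, rule ahom_comp[OF J.lact_ahom[OF a] h2[OF pt_closed]], assumption)
qed

text \<open>The sign (-1)^i is chosen so that the interior terms of d \<phi> and \<phi> d cancel;
  the product itself satisfies d(x y) = d(x) y - (-1)^i x d(y) when i and j are positive.\<close>

definition bar_phi :: "int => ('a list fab, 'a list fab) tensor_gen fab => 'a list fab" where
 "bar_phi n = plift (Bar (n+1)) (%((i, x), (j, y)). if i < 0 | j < 0 then 0[Bar (n+1)]
 else signed (Bar (n+1)) (int (nat i)) (bar_star (nat i) (nat j) x y))"

interpretation BB: tensor_product K A "bar K A" "bar K A" by(rule bar_tensor)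

lemma bar_tensor_ext:
 assumes Z: "abelian_group Z" and f: "f : ahom (BB.T n) Z" and g: "g : ahom (BB.T n) Z" and t: "t :> BB.T n"
 and eq: "!!i j as bs. int i + int j = n ==> as : Tg A (i+2) ==> bs : Tg A (j+2) ==>
 f (BB.tc n (int i) (pt as) (int j) (pt bs)) = g (BB.tc n (int i) (pt as) (int j) (pt bs))"
 shows "f t = g t"
proof (rule BB.tensor_ext[OF Z f g t])
 fix i x j y assume n: "i + j = n" and x: "x :> obj Bc i" and y: "y :> obj Bc j"
 note fr = ahom_rules[OF BB.TG Z f] and gr = ahom_rules[OF BB.TG Z g]
 consider "i < 0" | "j < 0" | "\<not> i < 0" "\<not> j < 0" by blast
 thus "f (BB.tc n i x j y) = g (BB.tc n i x j y)"
 proof cases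
 case 1
 hence "x = 0[obj Bc i]" using bar_neg x by simp
 thus ?thesis using BB.tc_rules1(3)[OF n y] by(simp add: fr(3) gr(3))
 next
 case 2
 hence "y = 0[obj Bc j]" using bar_neg y by simp
 thus ?thesis using BB.tc_rules2(3)[OF n x] by(simp add: fr(3) gr(3))
 next
 case 3
 then obtain i' j' where ij: "i = int i'" "j = int j'" using nonneg_int by metis
 note n = n[unfolded ij]
 have x: "x :> Bar (int i')" and y: "y :> Bar (int j')" using x y ij by simp_all
 have t1: "(%x. BB.tc n (int i') x (int j') y) : ahom (Bar (int i')) (BB.T n)" if "y :> Bar (int j')" for y
 using BB.tc_ahom1[OF n, of y] that by simp
 have t2: "(%y. BB.tc n (int i') x (int j') y) : ahom (Bar (int j')) (BB.T n)" if "x :> Bar (int i')" for x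
 using BB.tc_ahom2[OF n, of x] that by simp
 show ?thesis unfolding ij
 proof (rule bar_biext[where F = "%x y. f (BB.tc n (int i') x (int j') y)"
 and G = "%x y. g (BB.tc n (int i') x (int j') y)", OF Z _ _ _ _ _ x y])
 show "f (BB.tc n (int i') (pt as) (int j') (pt bs)) = g (BB.tc n (int i') (pt as) (int j') (pt bs))"
 if "as : Tg A (i' + 2)" "bs : Tg A (j' + 2)" for as bs by(rule eq[OF n that])
 qed (rule ahom_comp[OF t1 f], assumption, rule ahom_comp[OF t2[OF pt_closed] f], assumption,
 rule ahom_comp[OF t1 g], assumption, rule ahom_comp[OF t2[OF pt_closed] g], assumption)
 qed
qed

text \<open>Through \<open>bar_star\<close> the tensor square in degree n is the direct sum of bar
  modules of degree i + j + 1 with i + j = n, so a family of homomorphisms from these assembles to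
  one homomorphism. The scheme serves \<open>bar_phi\<close> and later the construction of
  lifts.\<close>

lemma bar_tensor_hom:
 assumes N: "is_bimodule K A N"
 and g: "!!i j. int i + int j = n ==> g i j : bhom A (Bar (int (Suc (i+j)))) N"
 and F: "F = plift N (%((i, x), (j, y)). if i < 0 | j < 0 then 0[N] else g (nat i) (nat j) (bar_star (nat i) (nat j) x y))"
 shows "F : bhom A (BB.T n) N"
 and "!!i j x y. int i + int j = n ==> x :> Bi i ==> y :> Bi j ==>
 F (BB.tc n (int i) x (int j) y) = g i j (bar_star i j x y)"
proof -
 interpret N: is_bimodule K A N by(rule N)
 define G where "G i x j y = (if i < 0 | j < 0 then 0[N] else g (nat i) (nat j) (bar_star (nat i) (nat j) x y))" for i x j y
 have D: "F = plift N (%((i, x), (j, y)). G i x j y)" by(simp add: F G_def)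
 have G: "G i x j y :> N &
 (ALL x':carrier (Bar i). G i (x +[Bar i] x') j y = G i x j y +[N] G i x' j y) &
 (ALL y':carrier (Bar j). G i x j (y +[Bar j] y') = G i x j y +[N] G i x j y') &
 (ALL a:carrier A. G i (ract (Bar i) x a) j y = G i x j (lact (Bar j) a y) &
 G i (lact (Bar i) a x) j y = lact N a (G i x j y) & G i x j (ract (Bar j) y a) = ract N (G i x j y) a)"
 if n: "i + j = n" and x: "x :> Bar i" and y: "y :> Bar j" for i x j y
 proof (cases "i < 0 | j < 0")
 case True
 hence G0: "G i x j y = 0[N]" for x y by(simp add: G_def)
 show ?thesis unfolding G0 by(simp add: N.lact_rules N.ract_rules)
 next
 case False
 then obtain i' j' where ij: "i = int i'" "j = int j'" using nonneg_int by metis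
 have Gn: "G i x j y = g i' j' (bar_star i' j' x y)" for x y using False by(simp add: G_def ij)
 note x = x[unfolded ij] and y = y[unfolded ij] and gr = bhom_rules[OF bar_bim N g[OF n[unfolded ij]]]
 note c = ahom_closed[OF bar_star(1)]
 show ?thesis unfolding Gn unfolding ij
 using x y by(auto simp del: of_nat_Suc simp: ahom_add[OF bar_star(1)] ahom_add[OF bar_star(2)] gr c bar_star_actions)
 qed
 note L = BB.tensor_lift[OF N.B.abelian_group_axioms, of n G, folded D]
 have L1: "F : ahom (BB.T n) N" and L2: "!!i x j y. i + j = n ==> x :> Bar i ==> y :> Bar j ==>
 F (BB.tc n i x j y) = G i x j y"
 using L G by simp_all
 show "F : bhom A (BB.T n) N"
 proof (rule BB.tensor_bim_homI[OF N L1])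
 fix i x j y a assume n: "i + j = n" and x: "x :> obj Bc i" and y: "y :> obj Bc j" and a: "a :> A"
 interpret I: is_bimodule K A "Bar i" by(rule bar_bim)
 interpret J: is_bimodule K A "Bar j" by(rule bar_bim)
 note x = x[unfolded obj_bar] and y = y[unfolded obj_bar]
 show "F (BB.tc n i (lact (obj Bc i) a x) j y) = lact N a (F (BB.tc n i x j y))"
 unfolding obj_bar L2[OF n I.lact_closed[OF a x] y] L2[OF n x y] using G[OF n x y] a by blast
 show "F (BB.tc n i x j (ract (obj Bc j) y a)) = ract N (F (BB.tc n i x j y)) a"
 unfolding obj_bar L2[OF n x J.ract_closed[OF y a]] L2[OF n x y] using G[OF n x y] a by blast
 qed
 show "F (BB.tc n (int i) x (int j) y) = g i j (bar_star i j x y)"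
 if "int i + int j = n" "x :> Bi i" "y :> Bi j" for i j x y
 using L2[OF that] by(simp add: G_def)
qed

lemma bar_phi_signed: "int i + int j = n ==> signed (Bar (n+1)) (int i) : bhom A (Bar (int (Suc (i+j)))) (Bar (n+1))"
 using bhom_signed[OF bar_bim bhom_id, of "n + 1" "int i"] by(auto simp: algebra_simps)

lemma bar_phi:
 shows "bar_phi n : bhom A (BB.T n) (Bar (n+1))"
 and "!!i j x y. int i + int j = n ==> x :> Bi i ==> y :> Bi j ==>
 bar_phi n (BB.tc n (int i) x (int j) y) = signed (Bar (n+1)) (int i) (bar_star i j x y)"
proof -
 show "bar_phi n : bhom A (BB.T n) (Bar (n+1))"
 by(rule bar_tensor_hom(1)[OF bar_bim bar_phi_signed bar_phi_def])
 show "bar_phi n (BB.tc n (int i) x (int j) y) = signed (Bar (n+1)) (int i) (bar_star i j x y)"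
 if "int i + int j = n" "x :> Bi i" "y :> Bi j" for i j x y
 by(rule bar_tensor_hom(2)[OF bar_bim bar_phi_signed bar_phi_def that])
qed

interpretation BC: right_contraction K A "bar K A" "Ba A" bar_s "pt [1[A], 1[A]]"
 by(rule bar_right_contraction)

text \<open>The faces fall into those of the left and of the right factor. For i > 0 the sum L is
  the product with the differential of the left factor; for i = 0 its only face multiplies the left
  factor completely into the right one, which produces the counit. The same holds for R and
  j.\<close>

lemma bar_diff_prod:
 assumes as: "as : Tg A (i+2)" and bs: "bs : Tg A (j+2)"
 defines "M \<equiv> Bi (i+j)"
 defines "L \<equiv> (\<Oplus>\<^bsub>M\<^esub>l\<in>{..i}. signed M (int l) (pt (bar_prod A (face A l as) bs)))"
 and "R \<equiv> (\<Oplus>\<^bsub>M\<^esub>m\<in>{..j}. signed M (int m) (pt (bar_prod A as (face A m bs))))"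
 shows "L :> M" "R :> M"
 and "diff Bc (int (Suc (i+j))) (pt (bar_prod A as bs)) = L +[M] signed M (int (Suc i)) R"
 and "if i = 0 then L = lact M (Ba A (pt as)) (pt bs)
 else L = bar_star (i-1) j (diff Bc (int i) (pt as)) (pt bs)"
 and "if j = 0 then R = ract M (pt as) (Ba A (pt bs))
 else R = bar_star i (j-1) (pt as) (diff Bc (int j) (pt bs))"
proof -
 interpret M: is_bimodule K A M unfolding M_def by(rule bar_bim)
 have P: "bar_prod A as bs : Tg A (Suc (i + j + 2))" using bar_prod_closed[OF as bs] by simp
 have fP: "pt (face A k (bar_prod A as bs)) :> M" if "k <= Suc (i+j)" for k
 unfolding M_def using face_closed[OF P, of k] that by(intro pt_closed) simp
 have Lc: "pt (bar_prod A (face A l as) bs) :> M" if "l <= i" for l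
 using fP[of l] face_bar_prod(1)[OF as bs that] that by simp
 have Rc: "pt (bar_prod A as (face A m bs)) :> M" if "m <= j" for m
 using fP[of "Suc i + m"] face_bar_prod(2)[OF as bs that] that by simp
 show Lcl: "L :> M" unfolding L_def using Lc by(intro M.B.finsum_closed) auto
 show Rcl: "R :> M" unfolding R_def using Rc by(intro M.B.finsum_closed) auto
 have split: "{..Suc (i+j)} = {..i} \<union> (%m. Suc i + m) ` {..j}"
 proof -
 have "k : (%m. Suc i + m) ` {..j}" if "k <= Suc (i+j)" "\<not> k <= i" for k
 using that by(intro image_eqI[of _ _ "k - Suc i"]) auto
 thus ?thesis by auto
 qed
 let ?f = "%k. signed M (int k) (pt (face A k (bar_prod A as bs)))"
 have "diff Bc (int (Suc (i+j))) (pt (bar_prod A as bs)) = (\<Oplus>\<^bsub>M\<^esub>k\<in>{..Suc (i+j)}. ?f k)"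
 unfolding M_def using bar_diff(2)[of "bar_prod A as bs" "i + j"] P by(simp add: numeral_3_eq_3)
 also have "... = (\<Oplus>\<^bsub>M\<^esub>k\<in>{..i}. ?f k) +[M] (\<Oplus>\<^bsub>M\<^esub>k\<in>(%m. Suc i + m) ` {..j}. ?f k)"
 unfolding split by(rule M.B.finsum_Un_disjoint) (use fP in auto)
 also have "(\<Oplus>\<^bsub>M\<^esub>k\<in>{..i}. ?f k) = L"
 unfolding L_def by(rule M.B.finsum_eqI) (use Lc face_bar_prod(1)[OF as bs] in auto)
 also have "(\<Oplus>\<^bsub>M\<^esub>k\<in>(%m. Suc i + m) ` {..j}. ?f k) = (\<Oplus>\<^bsub>M\<^esub>m\<in>{..j}. ?f (Suc i + m))"
 by(rule M.B.finsum_reindex) (use fP in \<open>auto simp: inj_on_def\<close>)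
 also have "... = (\<Oplus>\<^bsub>M\<^esub>m\<in>{..j}. signed M (int (Suc i)) (signed M (int m) (pt (bar_prod A as (face A m bs)))))"
 by(rule M.B.finsum_eqI) (use Rc face_bar_prod(2)[OF as bs] M.B.signed_signed in \<open>auto simp del: of_nat_Suc add_Suc\<close>)
 also have "... = signed M (int (Suc i)) R"
 unfolding R_def by(rule M.B.signed_finsum[symmetric]) (use Rc in auto)
 finally show "diff Bc (int (Suc (i+j))) (pt (bar_prod A as bs)) = L +[M] signed M (int (Suc i)) R" .
 have pa: "pt as :> Bi i" and pb: "pt bs :> Bi j" using pt_closed as bs by blast+
 show "if i = 0 then L = lact M (Ba A (pt as)) (pt bs)
 else L = bar_star (i-1) j (diff Bc (int i) (pt as)) (pt bs)"
 proof (cases i)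
 case 0
 obtain a b where ab: "as = [a, b]" "a :> A" "b :> A"
 using as 0 by(cases as; cases "tl as") (auto simp: gens_iff)
 have "L = pt (bar_prod A (face A 0 as) bs)" unfolding L_def using Lc[of 0] 0 by(simp add: signed_def)
 thus ?thesis
 using 0 ab bs by(simp add: M_def bar_prod_def face_0 Ba lact_pt)
 next
 case (Suc k)
 interpret I: abelian_group "Bi k" by(rule bar_group)
 have S: "(%x. bar_star k j x (pt bs)) : ahom (Bi k) M" unfolding M_def using bar_star(1)[OF pb, of k] by(simp add: Suc)
 have fg: "face A l as : Tg A (k+2)" if "l : {..Suc k}" for l using face_closed[of as "k + 2" l] as that by(simp add: Suc)
 have "bar_star k j (diff Bc (int (Suc k)) (pt as)) (pt bs)
 = (\<Oplus>\<^bsub>M\<^esub>l\<in>{..Suc k}. bar_star k j (signed (Bi k) (int l) (pt (face A l as))) (pt bs))"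
 using bar_diff(2)[of as k] as Suc I.finsum_ahom[OF M.B.abelian_group_axioms S, of "%l. signed (Bi k) (int l) (pt (face A l as))" "{..Suc k}"]
 pt_closed[OF fg] by(simp add: numeral_3_eq_3 Pi_iff)
 also have "... = L" unfolding L_def Suc
 by(rule M.B.finsum_eqI)
 (use Lc Suc pt_closed[OF fg] ahom_rules(6)[OF bar_group M.B.abelian_group_axioms S] bar_star(3)[OF fg bs] in \<open>auto simp del: of_nat_Suc\<close>)
 finally show ?thesis by(simp add: Suc)
 qed
 show "if j = 0 then R = ract M (pt as) (Ba A (pt bs))
 else R = bar_star i (j-1) (pt as) (diff Bc (int j) (pt bs))"
 proof (cases j)
 case 0
 obtain a b where ab: "bs = [a, b]" "a :> A" "b :> A"
 using bs 0 by(cases bs; cases "tl bs") (auto simp: gens_iff)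
 have "R = pt (bar_prod A as (face A 0 bs))" unfolding R_def using Rc[of 0] 0 by(simp add: signed_def)
 thus ?thesis
 using 0 ab as by(simp add: M_def bar_prod_def face_0 Ba ract_pt)
 next
 case (Suc k)
 interpret J: abelian_group "Bi k" by(rule bar_group)
 have S: "(%y. bar_star i k (pt as) y) : ahom (Bi k) M" unfolding M_def using bar_star(2)[OF pa, of k] by(simp add: Suc)
 have fg: "face A l bs : Tg A (k+2)" if "l : {..Suc k}" for l using face_closed[of bs "k + 2" l] bs that by(simp add: Suc)
 have "bar_star i k (pt as) (diff Bc (int (Suc k)) (pt bs))
 = (\<Oplus>\<^bsub>M\<^esub>l\<in>{..Suc k}. bar_star i k (pt as) (signed (Bi k) (int l) (pt (face A l bs))))"
 using bar_diff(2)[of bs k] bs Suc J.finsum_ahom[OF M.B.abelian_group_axioms S, of "%l. signed (Bi k) (int l) (pt (face A l bs))" "{..Suc k}"]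
 pt_closed[OF fg] by(simp add: numeral_3_eq_3 Pi_iff)
 also have "... = R" unfolding R_def Suc
 by(rule M.B.finsum_eqI)
 (use Rc Suc pt_closed[OF fg] ahom_rules(6)[OF bar_group M.B.abelian_group_axioms S] bar_star(3)[OF as fg] in \<open>auto simp del: of_nat_Suc\<close>)
 finally show ?thesis by(simp add: Suc)
 qed
qed

text \<open>In d \<phi> the contribution is (-1)^i L - R, and \<phi> d returns the negative of each
  summand as long as its degree is positive. The summands with i = 0 or j = 0 survive, and these are
  the two counits.\<close>

lemma bar_phi_homotopy:
 assumes t: "t :> BB.T n"
 shows "diff Bc (n+1) (bar_phi n t) +[Bar n] bar_phi (n-1) (diff BBc n t)
 = BC.cl n t -[Bar n] BC.cr n t"
proof -
 have d: "diff Bc (n+1) : ahom (Bar (n+1)) (Bar n)" using bhom_ahom[OF bar_diff_hom[of "n + 1"]] by simp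
 have p: "bar_phi (n-1) : ahom (BB.T (n-1)) (Bar n)" using bhom_ahom[OF bar_phi(1)[of "n - 1"]] by simp
 have cl: "BC.cl n : ahom (BB.T n) (Bar n)" and cr: "BC.cr n : ahom (BB.T n) (Bar n)"
 using bhom_ahom[OF BC.cl_hom[of n]] bhom_ahom[OF BC.cr_hom[of n]] by simp_all
 note dr = ahom_rules[OF bar_group bar_group d] and pr = ahom_rules[OF BB.TG bar_group p]
 show ?thesis
 proof (rule bar_tensor_ext[OF bar_group _ ahom_minus[OF bar_group cl cr] t])
 show "(%t. diff Bc (n+1) (bar_phi n t) +[Bar n] bar_phi (n-1) (diff BBc n t)) : ahom (BB.T n) (Bar n)"
 by(rule ahom_plus[OF bar_group ahom_comp[OF bhom_ahom[OF bar_phi(1)] d] ahom_comp[OF bhom_ahom[OF BB.tensor_diff(1)] p]])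
 fix i j as bs assume n: "int i + int j = n" and as: "as : Tg A (i+2)" and bs: "bs : Tg A (j+2)"
 have n': "n = int (i+j)" using n by simp
 define M where "M = Bar n"
 interpret M: is_bimodule K A M unfolding M_def by(rule bar_bim)
 define L where "L = (\<Oplus>\<^bsub>M\<^esub>l\<in>{..i}. signed M (int l) (pt (bar_prod A (face A l as) bs)))"
 define R where "R = (\<Oplus>\<^bsub>M\<^esub>m\<in>{..j}. signed M (int m) (pt (bar_prod A as (face A m bs))))"
 note B = bar_diff_prod[OF as bs, folded n', folded M_def, folded L_def R_def]
 have pa: "pt as :> Bi i" and pb: "pt bs :> Bi j" using pt_closed as bs by blast+
 have pa': "pt as :> obj Bc (int i)" and pb': "pt bs :> obj Bc (int j)" using pa pb by simp_all
 have n1: "n + 1 = int (Suc (i+j))" using n by simp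
 have pc: "pt (bar_prod A as bs) :> Bar (n+1)" unfolding n1 by(rule pt_closed[OF bar_prod_closed[OF as bs]])
 have 1: "diff Bc (n+1) (bar_phi n (BB.tc n (int i) (pt as) (int j) (pt bs))) = signed M (int i) (L +[M] signed M (int (Suc i)) R)"
 unfolding bar_phi(2)[OF n pa pb] bar_star(3)[OF as bs] dr(6)[OF pc] unfolding n1 B(3) M_def ..
 have da: "diff Bc (int i) (pt as) :> Bar (int i - 1)" and db: "diff Bc (int j) (pt bs) :> Bar (int j - 1)"
 using bhom_cl[OF bar_diff_hom pa] bhom_cl[OF bar_diff_hom pb] by simp_all
 have nn: "int i - 1 + int j = n - 1" "int i + (int j - 1) = n - 1" using n by simp_all
 have tc1: "BB.tc (n-1) (int i - 1) (diff Bc (int i) (pt as)) (int j) (pt bs) :> BB.T (n-1)"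
 by(rule BB.tc_closed[OF nn(1)]) (use da pb in simp_all)
 have tc2: "BB.tc (n-1) (int i) (pt as) (int j - 1) (diff Bc (int j) (pt bs)) :> BB.T (n-1)"
 by(rule BB.tc_closed[OF nn(2)]) (use db pa in simp_all)
 interpret T: is_bimodule K A "BB.T (n-1)" by(rule BB.tensor_bim)
 have A1: "bar_phi (n-1) (BB.tc (n-1) (int i - 1) (diff Bc (int i) (pt as)) (int j) (pt bs)) =
 (if i = 0 then 0[M] else -[M] signed M (int i) L)"
 proof (cases i)
 case 0
 have "diff Bc (int i) (pt as) = 0[obj Bc (int i - 1)]" using 0 bar_diff_nonpos by simp
 thus ?thesis using BB.tc_rules1(3)[OF nn(1) pb'] pr(3) 0 by(simp add: M_def)
 next
 case (Suc k)
 have k: "int i - 1 = int k" "int k + int j = n - 1" using Suc n by simp_all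
 show ?thesis using bar_phi(2)[OF k(2) da[unfolded k(1)] pb] B(4) Suc B(1) M.B.minus_minus[OF B(1)]
 by(simp add: k(1)[unfolded Suc] M_def signed_def)
 qed
 have A2: "bar_phi (n-1) (BB.tc (n-1) (int i) (pt as) (int j - 1) (diff Bc (int j) (pt bs))) =
 (if j = 0 then 0[M] else signed M (int i) R)"
 proof (cases j)
 case 0
 have "diff Bc (int j) (pt bs) = 0[obj Bc (int j - 1)]" using 0 bar_diff_nonpos by simp
 thus ?thesis using BB.tc_rules2(3)[OF nn(2) pa'] pr(3) 0 by(simp add: M_def)
 next
 case (Suc k)
 have k: "int j - 1 = int k" "int i + int k = n - 1" using Suc n by simp_all
 show ?thesis using bar_phi(2)[OF k(2) pa db[unfolded k(1)]] B(5) Suc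
 by(simp add: k(1)[unfolded Suc] M_def)
 qed
 have 2: "bar_phi (n-1) (diff BBc n (BB.tc n (int i) (pt as) (int j) (pt bs)))
 = (if i = 0 then 0[M] else -[M] signed M (int i) L) +[M] signed M (int i) (if j = 0 then 0[M] else signed M (int i) R)"
 unfolding BB.tensor_diff(2)[OF n pa' pb'] pr(2)[OF tc1 T.B.signed_closed[OF tc2]] pr(6)[OF tc2] A1 A2 M_def ..
 have C1: "BC.cl n (BB.tc n (int i) (pt as) (int j) (pt bs)) = (if i = 0 then L else 0[M])"
 using BC.cl_tc[OF n pa' pb'] B(4) n by(auto simp: M_def)
 have C2: "BC.cr n (BB.tc n (int i) (pt as) (int j) (pt bs)) = (if j = 0 then R else 0[M])"
 using BC.cr_tc[OF n pa' pb'] B(5) n by(auto simp: M_def)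
 have ss: "signed M (int i) (signed M (int (Suc i)) R) = -[M] R" "signed M (int i) (signed M (int i) R) = R"
 using B(2) by(auto simp: signed_def)
 have alg: "(l +[M] -[M] r) +[M] (-[M] l +[M] r) = 0[M]"
 "(l +[M] -[M] r) +[M] (0[M] +[M] r) = l"
 "(l +[M] -[M] r) +[M] (-[M] l +[M] 0[M]) = -[M] r"
 "(l +[M] -[M] r) +[M] (0[M] +[M] 0[M]) = l +[M] -[M] r"
 if "l :> M" "r :> M" for l r
 using that M.B.abelian_group_axioms by algebra+
 have s0: "signed M 0 L = L" by(simp add: signed_def)
 have "signed M (int i) (L +[M] signed M (int (Suc i)) R) +[M]
 ((if i = 0 then 0[M] else -[M] signed M (int i) L) +[M] signed M (int i) (if j = 0 then 0[M] else signed M (int i) R))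
 = (if i = 0 then L else 0[M]) -[M] (if j = 0 then R else 0[M])"
 unfolding M.B.signed_add[OF B(1) M.B.signed_closed[OF B(2)]] ss M.B.minus_eq
 using alg[OF M.B.signed_closed[OF B(1), of "int i"] B(2)] ss(2) B(1,2) s0
 by(cases "i = 0"; cases "j = 0") simp_all
 thus "diff Bc (n+1) (bar_phi n (BB.tc n (int i) (pt as) (int j) (pt bs))) +[Bar n]
 bar_phi (n-1) (diff BBc n (BB.tc n (int i) (pt as) (int j) (pt bs)))
 = BC.cl n (BB.tc n (int i) (pt as) (int j) (pt bs)) -[Bar n] BC.cr n (BB.tc n (int i) (pt as) (int j) (pt bs))"
 unfolding 1 2 C1 C2 M_def .
 qed
qed

end

text \<open>Bookkeeping for \<open>bar_delta_chain\<close>: Z and Y are the values on y of the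
  diagonal and of e \<otimes> -. Along y = d s y + u + w they decompose into D, U + S, W and into E,
  U, W respectively, while the contraction of the tensor square decomposes Z into Q, S and
  Y.\<close>

lemma (in abelian_group) delta_cancel:
 assumes c: "D :> G" "E :> G" "U :> G" "W :> G" "S :> G" "Q :> G"
 and 1: "D \<oplus> (U \<oplus> S) \<oplus> W = Z" and 2: "E \<oplus> U \<oplus> W = Y" and 3: "Q \<oplus> S \<oplus> Y = Z"
 shows "E \<oplus> Q = D"
proof -
 have "(E \<oplus> Q) \<oplus> (U \<oplus> (S \<oplus> W)) = Q \<oplus> S \<oplus> (E \<oplus> U \<oplus> W)" using c by(simp add: a_ac)
 also have "... = D \<oplus> (U \<oplus> (S \<oplus> W))" unfolding 2 3 1[symmetric] using c by(simp add: a_ac)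
 finally show ?thesis using c by(simp add: add.right_cancel)
qed

section \<open>The diagonal of the bar resolution\<close>

context assoc_algebra
begin

interpretation BB: tensor_product K A "bar K A" "bar K A" by(rule bar_tensor)

interpretation BC: right_contraction K A "bar K A" "Ba A" bar_s "pt [1[A], 1[A]]"
 by(rule bar_right_contraction)

text \<open>The list is cut behind entry i, and each of the two pieces receives a unit of its own at
  the cut, since both are bar elements with their own outer factors.\<close>

definition delta_term :: "nat => nat => 'a list => ('a list fab, 'a list fab) tensor_gen fab" where
 "delta_term n i as = tensor_class A Bc Bc (int n)
 ((int i, pt (take (Suc i) as @ [1[A]])), (int (n-i), pt (1[A] # drop (Suc i) as)))"

definition bdel :: "int => 'a list fab => ('a list fab, 'a list fab) tensor_gen fab" where
 "bdel n = (if n < 0 then (%_. 0[tensor_obj A Bc Bc n])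
 else plift (tensor_obj A Bc Bc n)
 (%as. \<Oplus>\<^bsub>tensor_obj A Bc Bc n\<^esub>i\<in>{..nat n}. delta_term (nat n) i as))"

lemma delta_gens:
 assumes as: "as : Tg A (n+2)" and i: "i <= n"
 shows "take (Suc i) as @ [1[A]] : Tg A (i+2)" "1[A] # drop (Suc i) as : Tg A (n - i + 2)"
 using assms by(auto simp: gens_iff dest: in_set_takeD in_set_dropD)

lemma delta_closed:
 assumes as: "as : Tg A (n+2)" and i: "i <= n"
 shows "delta_term n i as :> BB.T (int n)"
 unfolding delta_term_def
 by(rule BB.tc_closed) (use i pt_closed[OF delta_gens(1)[OF assms]] pt_closed[OF delta_gens(2)[OF assms]] in simp_all)

lemma delta_multilinear:
 assumes i: "i <= n"
 shows "multilinear K A (n+2) (BB.T (int n)) (delta_term n i)"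
proof (rule multilinear_scalI[where sc = "scal A (BB.T (int n))"])
 fix as assume as: "as : Tg A (n+2)"
 show "delta_term n i as :> BB.T (int n)" by(rule delta_closed[OF as i])
 note F = delta_gens(1)[OF as i] and G = delta_gens(2)[OF as i]
 have len: "length as = n + 2" using as by(simp add: gens_iff)
 fix k assume k: "k < n + 2"
 have ij: "int i + int (n-i) = int n" using i by simp
 have x: "pt (take (Suc i) as @ [1[A]]) :> obj Bc (int i)" and y: "pt (1[A] # drop (Suc i) as) :> obj Bc (int (n-i))"
 using pt_closed[OF F] pt_closed[OF G] by simp_all
 have l: "take (Suc i) (as[k := z]) @ [1[A]] = (take (Suc i) as @ [1[A]])[k := z]" "drop (Suc i) (as[k := z]) = drop (Suc i) as"
 "(take (Suc i) as @ [1[A]]) ! k = as ! k" "k < i + 2" if "k <= i" for z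
 using that len i by(simp_all add: take_update_swap list_update_append nth_append)
 \<comment> \<open>The right piece loses i + 1 entries but gains a leading unit, so position k of
   the list becomes k - i.\<close>
 have r: "take (Suc i) (as[k := z]) = take (Suc i) as" "1[A] # drop (Suc i) (as[k := z]) = (1[A] # drop (Suc i) as)[k - i := z]"
 "(1[A] # drop (Suc i) as) ! (k-i) = as ! k" "k - i < n - i + 2" if ki: "\<not> k <= i" for z
 proof -
 obtain m where m: "k = Suc (i+m)" using ki less_imp_Suc_add[of i k] by auto
 show "take (Suc i) (as[k := z]) = take (Suc i) as" "1[A] # drop (Suc i) (as[k := z]) = (1[A] # drop (Suc i) as)[k - i := z]"
 "(1[A] # drop (Suc i) as) ! (k-i) = as ! k" "k - i < n - i + 2"
 using k len by(simp_all add: m drop_update_swap)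
 qed
 show "delta_term n i (as[k := u +[A] v]) = delta_term n i (as[k := u]) +[BB.T (int n)] delta_term n i (as[k := v])"
 if u: "u :> A" and v: "v :> A" for u v
 proof (cases "k <= i")
 case True
 have p: "pt ((take (Suc i) as @ [1[A]])[k := z]) :> obj Bc (int i)" if "z :> A" for z
 using pt_closed[OF gens_update[OF F that]] by simp
 show ?thesis unfolding delta_term_def l[OF True] multilinear_add[OF pt_multilinear F l(4)[OF True] u v]
 using BB.tc_rules1(2)[OF ij y p[OF u] p[OF v]] by simp
 next
 case False
 have p: "pt ((1[A] # drop (Suc i) as)[k - i := z]) :> obj Bc (int (n-i))" if "z :> A" for z
 using pt_closed[OF gens_update[OF G that]] by simp
 show ?thesis unfolding delta_term_def r[OF False] multilinear_add[OF pt_multilinear G r(4)[OF False] u v]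
 using BB.tc_rules2(2)[OF ij x p[OF u] p[OF v]] by simp
 qed
 show "delta_term n i (as[k := c .*[A] as ! k]) = scal A (BB.T (int n)) c (delta_term n i as)" if c: "c :> K" for c
 proof (cases "k <= i")
 case True
 have "pt ((take (Suc i) as @ [1[A]])[k := c .*[A] as ! k]) = scal A (Bi i) c (pt (take (Suc i) as @ [1[A]]))"
 using scal_pt[OF c F l(4)[OF True]] l(3)[OF True] by simp
 thus ?thesis unfolding delta_term_def l(1,2)[OF True] using BB.lact_tc[OF ij x scalar_closed[OF c] y] by simp
 next
 case False
 have "pt ((1[A] # drop (Suc i) as)[k - i := c .*[A] as ! k]) = scal A (Bi (n-i)) c (pt (1[A] # drop (Suc i) as))"
 using scal_pt[OF c G r(4)[OF False]] r(3)[OF False] by simp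
 moreover have "scal A (Bi i) c (pt (take (Suc i) as @ [1[A]])) = ract (Bi i) (pt (take (Suc i) as @ [1[A]])) (c .*[A] 1[A])"
 using is_bimodule.central[OF bar_bim c] x by simp
 ultimately show ?thesis unfolding delta_term_def r(1,2)[OF False]
 using BB.lact_tc[OF ij x scalar_closed[OF c] y] BB.tc_bal[OF ij x scalar_closed[OF c] y] by simp
 qed
qed

lemma bar_delta_pt:
 shows "bdel (int n) : bhom A (Bi n) (BB.T (int n))"
 and "!!as. as : Tg A (n+2) ==> bdel (int n) (pt as) = (\<Oplus>\<^bsub>BB.T (int n)\<^esub>i\<in>{..n}. delta_term n i as)"
proof -
 interpret T: is_bimodule K A "BB.T (int n)" by(rule BB.tensor_bim)
 note TG = T.B.abelian_group_axioms
 let ?g = "%as. \<Oplus>\<^bsub>BB.T (int n)\<^esub>i\<in>{..n}. delta_term n i as"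
 have D: "bdel (int n) = plift (BB.T (int n)) ?g" by(simp add: bdel_def)
 have ml: "multilinear K A (n+2) (BB.T (int n)) ?g"
 by(rule multilinear_finsum[OF TG]) (use delta_multilinear in auto)
 show "bdel (int n) (pt as) = ?g as" if "as : Tg A (n+2)" for as
 unfolding D by(rule bar_lift(2)[OF TG ml that])
 show "bdel (int n) : bhom A (Bi n) (BB.T (int n))" unfolding D
 proof (rule bar_hom_lift[OF BB.tensor_bim ml])
 fix a as assume a: "a :> A" and as: "as : Tg A (n+2)"
 have lg: "(a *[A] hd as) # tl as : Tg A (n+2)" "butlast as @ [last as *[A] a] : Tg A (n+2)"
 using as slotwise_left_mult[OF a, of "n + 1"] slotwise_right_mult[OF a, of "n + 1"] by(simp_all add: slotwise_linear_def)
 have len: "length as = n + 2" using as by(simp add: gens_iff)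
 have xy: "pt (take (Suc i) as @ [1[A]]) :> obj Bc (int i)" "pt (1[A] # drop (Suc i) as) :> obj Bc (int (n-i))"
 "int i + int (n-i) = int n" if "i <= n" for i
 using that pt_closed[OF delta_gens(1)[OF as that]] pt_closed[OF delta_gens(2)[OF as that]] by simp_all
 have "lact (BB.T (int n)) a (?g as) = (\<Oplus>\<^bsub>BB.T (int n)\<^esub>i\<in>{..n}. lact (BB.T (int n)) a (delta_term n i as))"
 by(rule T.B.finsum_ahom[OF TG T.lact_ahom[OF a]]) (use delta_closed[OF as] in auto)
 also have "... = ?g ((a *[A] hd as) # tl as)"
 proof (rule T.B.finsum_eqI)
 fix i assume "i : {..n}"
 hence i: "i <= n" by simp
 have "lact (Bi i) a (pt (take (Suc i) as @ [1[A]])) = pt (take (Suc i) ((a *[A] hd as) # tl as) @ [1[A]])"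
 using lact_pt[OF a delta_gens(1)[OF as i]] len by(cases as) simp_all
 moreover have "drop (Suc i) ((a *[A] hd as) # tl as) = drop (Suc i) as" using len by(cases as) simp_all
 ultimately show "lact (BB.T (int n)) a (delta_term n i as) = delta_term n i ((a *[A] hd as) # tl as)"
 unfolding delta_term_def using BB.lact_tc[OF xy(3,1)[OF i] a xy(2)[OF i]] by simp
 show "delta_term n i ((a *[A] hd as) # tl as) :> BB.T (int n)" by(rule delta_closed[OF lg(1) i])
 qed
 finally show "?g ((a *[A] hd as) # tl as) = lact (BB.T (int n)) a (?g as)" by simp
 have "ract (BB.T (int n)) (?g as) a = (\<Oplus>\<^bsub>BB.T (int n)\<^esub>i\<in>{..n}. ract (BB.T (int n)) (delta_term n i as) a)"
 by(rule T.B.finsum_ahom[OF TG T.ract_ahom[OF a]]) (use delta_closed[OF as] in auto)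
 also have "... = ?g (butlast as @ [last as *[A] a])"
 proof (rule T.B.finsum_eqI)
 fix i assume "i : {..n}"
 hence i: "i <= n" by simp
 obtain bs b where b: "as = bs @ [b]" "length bs = Suc n" using len by(cases as rule: rev_cases) auto
 have "ract (Bi (n-i)) (pt (1[A] # drop (Suc i) as)) a = pt (1[A] # drop (Suc i) (butlast as @ [last as *[A] a]))"
 using ract_pt[OF a delta_gens(2)[OF as i]] b i by simp
 moreover have "take (Suc i) (butlast as @ [last as *[A] a]) = take (Suc i) as" using b i by simp
 ultimately show "ract (BB.T (int n)) (delta_term n i as) a = delta_term n i (butlast as @ [last as *[A] a])"
 unfolding delta_term_def using BB.ract_tc[OF xy(3,1)[OF i] a xy(2)[OF i]] by simp
 show "delta_term n i (butlast as @ [last as *[A] a]) :> BB.T (int n)" by(rule delta_closed[OF lg(2) i])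
 qed
 finally show "?g (butlast as @ [last as *[A] a]) = ract (BB.T (int n)) (?g as) a" by simp
 qed
qed

lemma bar_delta_hom: "bdel n : bhom A (Bar n) (BB.T n)"
proof (cases "n < 0")
 case True
 thus ?thesis using bhom_zero[OF BB.tensor_bim] by(simp add: bdel_def)
next
 case False
 then obtain m where "n = int m" by(rule nonneg_int)
 thus ?thesis using bar_delta_pt(1) by simp
qed

lemmas bar_delta_rules = bhom_rules[OF bar_bim BB.tensor_bim bar_delta_hom]

text \<open>The left counit sees only the term with i = 0 and the right one only that with i = n; in
  these the augmentation returns the outer entry that was split off.\<close>

lemma bar_delta_counit:
 assumes x: "x :> Bar n"
 shows "BC.cl n (bdel n x) = x" and "BC.cr n (bdel n x) = x"
proof -
 have "BC.cl n (bdel n x) = x & BC.cr n (bdel n x) = x"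
 proof (cases "n < 0")
 case True
 have "BC.cl n (bdel n x) :> Bar n" "BC.cr n (bdel n x) :> Bar n"
 using bhom_cl[OF BC.cl_hom bar_delta_rules(1)[OF x]] bhom_cl[OF BC.cr_hom bar_delta_rules(1)[OF x]] by simp_all
 thus ?thesis using bar_neg[OF True] x by simp
 next
 case False
 then obtain m where m: "n = int m" by(rule nonneg_int)
 interpret B: is_bimodule K A "Bi m" by(rule bar_bim)
 interpret T: is_bimodule K A "BB.T (int m)" by(rule BB.tensor_bim)
 have cl: "BC.cl (int m) : ahom (BB.T (int m)) (Bi m)" and cr: "BC.cr (int m) : ahom (BB.T (int m)) (Bi m)"
 using bhom_ahom[OF BC.cl_hom[of "int m"]] bhom_ahom[OF BC.cr_hom[of "int m"]] by simp_all
 have dl: "bdel (int m) : ahom (Bi m) (BB.T (int m))" by(rule bhom_ahom[OF bar_delta_hom])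
 have g: "BC.cl (int m) (bdel (int m) (pt as)) = pt as" "BC.cr (int m) (bdel (int m) (pt as)) = pt as"
 if as: "as : Tg A (m+2)" for as
 proof -
 have pa: "pt as :> Bi m" by(rule pt_closed[OF as])
 have xy: "pt (take (Suc i) as @ [1[A]]) :> obj Bc (int i)" "pt (1[A] # drop (Suc i) as) :> obj Bc (int (m-i))"
 "int i + int (m-i) = int m" if "i <= m" for i
 using that pt_closed[OF delta_gens(1)[OF as that]] pt_closed[OF delta_gens(2)[OF as that]] by simp_all
 obtain a bs where a: "as = a # bs" "a :> A" "bs ~= []" using gens_hd[OF as] by blast
 obtain b cs where b: "as = cs @ [b]" "b :> A" using gens_last[OF as] by blast
 have lc: "length cs = Suc m" using as b by(simp add: gens_iff)
 have l0: "BC.cl (int m) (delta_term m i as) = (if 0 = i then pt as else 0[Bi m])" if "i : {..m}" for i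
 using BC.cl_tc[OF xy(3,1,2), of i] that lact_pt[OF a(2) delta_gens(2)[OF as le0]] a
 by(auto simp: delta_term_def Ba)
 have r0: "BC.cr (int m) (delta_term m i as) = (if m = i then pt as else 0[Bi m])" if "i : {..m}" for i
 using BC.cr_tc[OF xy(3,1,2), of i] that ract_pt[OF b(2) delta_gens(1)[OF as le_refl]] b lc
 by(auto simp: delta_term_def Ba)
 have "BC.cl (int m) (bdel (int m) (pt as)) = (\<Oplus>\<^bsub>Bi m\<^esub>i\<in>{..m}. BC.cl (int m) (delta_term m i as))"
 unfolding bar_delta_pt(2)[OF as] by(rule T.B.finsum_ahom[OF bar_group cl]) (use delta_closed[OF as] in auto)
 also have "... = (\<Oplus>\<^bsub>Bi m\<^esub>i\<in>{..m}. (if 0 = i then pt as else 0[Bi m]))"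
 by(rule B.B.finsum_eqI) (use l0 pa in auto)
 also have "... = pt as" using pa by(intro B.B.finsum_singleton) auto
 finally show "BC.cl (int m) (bdel (int m) (pt as)) = pt as" .
 have "BC.cr (int m) (bdel (int m) (pt as)) = (\<Oplus>\<^bsub>Bi m\<^esub>i\<in>{..m}. BC.cr (int m) (delta_term m i as))"
 unfolding bar_delta_pt(2)[OF as] by(rule T.B.finsum_ahom[OF bar_group cr]) (use delta_closed[OF as] in auto)
 also have "... = (\<Oplus>\<^bsub>Bi m\<^esub>i\<in>{..m}. (if m = i then pt as else 0[Bi m]))"
 by(rule B.B.finsum_eqI) (use r0 pa in auto)
 also have "... = pt as" using pa by(intro B.B.finsum_singleton) auto
 finally show "BC.cr (int m) (bdel (int m) (pt as)) = pt as" .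
 qed
 have "BC.cl (int m) (bdel (int m) x) = x"
 by(rule bar_ext[OF bar_group ahom_comp[OF dl cl] ahom_id x[unfolded m]]) (rule g(1))
 moreover have "BC.cr (int m) (bdel (int m) x) = x"
 by(rule bar_ext[OF bar_group ahom_comp[OF dl cr] ahom_id x[unfolded m]]) (rule g(2))
 ultimately show ?thesis by(simp add: m)
 qed
 thus "BC.cl n (bdel n x) = x" "BC.cr n (bdel n x) = x" by auto
qed

abbreviation (input) "bar_e \<equiv> pt [1[A], 1[A]]"

lemma bar_e_closed: "bar_e :> Bar 0"
 using pt_closed[of "[1[A], 1[A]]" 0] by(simp add: gens_iff)

lemma unit_tensor_ahom: "BB.tc n 0 bar_e n : ahom (Bar n) (BB.T n)"
 using BB.tc_ahom2[of 0 n n bar_e] bar_e_closed by simp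

text \<open>With a unit in front, the first cut splits off the unit element e, and every later cut
  is a cut of the old list with the unit put before its left piece. This recursion replaces direct
  manipulation of the double sums of faces and cuts.\<close>

lemma bar_delta_s:
 assumes z: "z :> Bar n"
 shows "bdel (n+1) (bar_s n z) = BB.tc (n+1) 0 bar_e (n+1) (bar_s n z) +[BB.T (n+1)] BC.stens n (bdel n z)"
proof (cases "n < 0")
 case True
 have "z = 0[Bar n]" using bar_neg[OF True] z by simp
 moreover have "bar_s n 0[Bar n] = 0[Bar (n+1)]" using ahom_rules(3)[OF bar_group bar_group bar_s_ahom] .
 moreover have "BB.tc (n+1) 0 bar_e (n+1) 0[Bar (n+1)] = 0[BB.T (n+1)]" using ahom_rules(3)[OF bar_group BB.TG unit_tensor_ahom] .
 moreover have "BC.stens n 0[BB.T n] = 0[BB.T (n+1)]" using ahom_rules(3)[OF BB.TG BB.TG BC.stens(1)] .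
 ultimately show ?thesis
 using bar_delta_rules(3)[of n] bar_delta_rules(3)[of "n + 1"] abelian_monoid.r_zero[OF abelian_group.axioms(1)[OF BB.TG[of "n + 1"]]]
 abelian_monoid.zero_closed[OF abelian_group.axioms(1)[OF BB.TG[of "n + 1"]]] by simp
next
 case False
 then obtain m where m: "n = int m" by(rule nonneg_int)
 have n1: "n + 1 = int (Suc m)" by(simp add: m)
 interpret T: abelian_group "BB.T (int (Suc m))" by(rule BB.TG)
 interpret Tm: abelian_group "BB.T (int m)" by(rule BB.TG)
 have s: "bar_s (int m) : ahom (Bi m) (Bi (Suc m))" by(rule bar_s_nat(1))
 have st: "BC.stens (int m) : ahom (BB.T (int m)) (BB.T (int (Suc m)))" using BC.stens(1)[of "int m"] by(simp add: add.commute)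
 note dh = bhom_ahom[OF bar_delta_hom]
 show ?thesis unfolding n1 unfolding m
 proof (rule bar_ext[OF BB.TG ahom_comp[OF s dh] ahom_plus[OF BB.TG ahom_comp[OF s unit_tensor_ahom] ahom_comp[OF dh st]] z[unfolded m]])
 fix as assume as: "as : Tg A (m+2)"
 have as1: "1[A] # as : Tg A (Suc m + 2)" using as by(simp add: gens_iff)
 have e0: "delta_term (Suc m) 0 (1[A] # as) = BB.tc (int (Suc m)) 0 bar_e (int (Suc m)) (pt (1[A] # as))"
 by(simp add: delta_term_def)
 have eS: "delta_term (Suc m) (Suc i) (1[A] # as) = BC.stens (int m) (delta_term m i as)" if i: "i <= m" for i
 proof -
 have xy: "pt (take (Suc i) as @ [1[A]]) :> obj Bc (int i)" "pt (1[A] # drop (Suc i) as) :> obj Bc (int (m-i))"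
 "int i + int (m-i) = int m"
 using i pt_closed[OF delta_gens(1)[OF as i]] pt_closed[OF delta_gens(2)[OF as i]] by simp_all
 have k: "int m + 1 = int (Suc m)" "int i + 1 = int (Suc i)" by simp_all
 show ?thesis unfolding delta_term_def BC.stens(2)[OF xy(3,1,2)] bar_s_nat(2)[OF delta_gens(1)[OF as i]] k by simp
 qed
 have "bdel (int (Suc m)) (pt (1[A] # as)) = (\<Oplus>\<^bsub>BB.T (int (Suc m))\<^esub>i\<in>{..m}. delta_term (Suc m) (Suc i) (1[A] # as)) +[BB.T (int (Suc m))] delta_term (Suc m) 0 (1[A] # as)"
 unfolding bar_delta_pt(2)[OF as1] by(rule T.finsum_Suc2) (use delta_closed[OF as1] in auto)
 also have "(\<Oplus>\<^bsub>BB.T (int (Suc m))\<^esub>i\<in>{..m}. delta_term (Suc m) (Suc i) (1[A] # as)) = (\<Oplus>\<^bsub>BB.T (int (Suc m))\<^esub>i\<in>{..m}. BC.stens (int m) (delta_term m i as))"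
 by(rule T.finsum_eqI) (use eS ahom_closed[OF st delta_closed[OF as]] in auto)
 also have "... = BC.stens (int m) (bdel (int m) (pt as))"
 unfolding bar_delta_pt(2)[OF as] by(rule Tm.finsum_ahom[OF BB.TG st, symmetric]) (use delta_closed[OF as] in auto)
 finally show "bdel (int (Suc m)) (bar_s (int m) (pt as)) = BB.tc (int (Suc m)) 0 bar_e (int (Suc m)) (bar_s (int m) (pt as)) +[BB.T (int (Suc m))] BC.stens (int m) (bdel (int m) (pt as))"
 unfolding bar_s_nat(2)[OF as] e0[symmetric]
 using T.a_comm[OF ahom_closed[OF st bar_delta_rules(1)[OF pt_closed[OF as]]] delta_closed[OF as1 le0]] by simp
 qed
qed

text \<open>Both sides are bimodule homomorphisms and every pure tensor is a s(y), so s(y) suffices.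
  There \<open>bar_delta_s\<close> applies, and the contractions of the bar complex and of its
  tensor square combine with the induction hypothesis for y one degree lower.\<close>

lemma bar_delta_chain:
 assumes x: "x :> Bar n"
 shows "diff BBc n (bdel n x) = bdel (n-1) (diff Bc n x)"
proof -
 have Tneg: "carrier (BB.T k) = {0[BB.T k]}" if "k < 0" for k
 using BB.tensor_neg[OF _ _ that] bar_neg by simp
 have c1: "diff BBc n (bdel n x) :> BB.T (n-1)"
 if "x :> Bar n" for n x using bhom_cl[OF BB.tensor_diff(1) bar_delta_rules(1)[OF that]] .
 have c2: "bdel (n-1) (diff Bc n x) :> BB.T (n-1)" if "x :> Bar n" for n x
 using bar_delta_rules(1)[OF bhom_cl[OF bar_diff_hom that]] .
 have nonpos: "diff BBc n (bdel n x) = bdel (n-1) (diff Bc n x)"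
 if "x :> Bar n" "n <= 0" for n x using c1[OF that(1)] c2[OF that(1)] Tneg[of "n - 1"] that(2) by simp
 have pos: "diff BBc (int m) (bdel (int m) x) = bdel (int m - 1) (diff Bc (int m) x)"
 if "x :> Bi m" for m x
 using that
 proof (induction m arbitrary: x)
 case 0
 thus ?case using nonpos[of x 0] by simp
 next
 case (Suc m)
 have dT: "diff BBc (int (Suc m)) : bhom A (BB.T (int (Suc m))) (BB.T (int m))"
 using BB.tensor_diff(1)[of "int (Suc m)"] by simp
 have d: "diff Bc (int (Suc m)) : bhom A (Bi (Suc m)) (Bi m)" by(rule bar_diff(1))
 have f: "(%x. diff BBc (int (Suc m)) (bdel (int (Suc m)) x)) : bhom A (Bi (Suc m)) (BB.T (int m))"
 by(rule bhom_comp[OF bar_delta_hom dT])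
 have g: "(%x. bdel (int m) (diff Bc (int (Suc m)) x)) : bhom A (Bi (Suc m)) (BB.T (int m))"
 by(rule bhom_comp[OF d bar_delta_hom])
 have S1: "int m + 1 = int (Suc m)" by simp
 have key: "diff BBc (int (Suc m)) (bdel (int (Suc m)) (bar_s (int m) y))
 = bdel (int m) (diff Bc (int (Suc m)) (bar_s (int m) y))" if y: "y :> Bi m" for y
 proof -
 interpret T: abelian_group "BB.T (int m)" by(rule BB.TG)
 interpret B: is_bimodule K A "Bi m" by(rule bar_bim)
 note de = bar_delta_rules[where n = "int m"]
 note dr = bhom_rules[OF BB.tensor_bim BB.tensor_bim dT]
 note ur = ahom_rules[OF bar_group BB.TG unit_tensor_ahom[of "int m"]]
 have sy: "bar_s (int m) y :> Bi (Suc m)" by(rule ahom_closed[OF bar_s_nat(1) y])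
 define dsy where "dsy = diff Bc (int (Suc m)) (bar_s (int m) y)"
 define u where "u = bar_s (int m - 1) (diff Bc (int m) y)"
 define w where "w = (if int m = 0 then ract (Bar 0) bar_e (Ba A y) else 0[Bi m])"
 have dy: "diff Bc (int m) y :> Bar (int m - 1)" by(rule bhom_cl[OF bar_diff_hom y])
 have dsyc: "dsy :> Bi m" unfolding dsy_def by(rule bhom_cl[OF d sy])
 have uc: "u :> Bi m" unfolding u_def using ahom_closed[OF bar_s_ahom dy] by simp
 have \<mu>: "m = 0 ==> Ba A y :> A"
 using bhom_cl[OF Ba(1), of y] y by(simp add: regular_simps)
 have wc: "w :> Bi m" unfolding w_def using \<mu> is_bimodule.ract_closed[OF bar_bim bar_e_closed] by auto
 have sum: "dsy +[Bi m] u +[Bi m] w = y"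
 using bar_contraction[OF y] by(simp only: dsy_def u_def w_def S1)
 have Du: "bdel (int m) u = BB.tc (int m) 0 bar_e (int m) u +[BB.T (int m)] BC.stens (int m - 1) (bdel (int m - 1) (diff Bc (int m) y))"
 using bar_delta_s[OF dy] by(simp add: u_def)
 \<comment> \<open>In degree 0 the element w is e \<mu>(y), and the diagonal of e is e \<otimes> e;
   in higher degrees w is zero.\<close>
 have Dw: "bdel (int m) w = BB.tc (int m) 0 bar_e (int m) w"
 proof (cases m)
 case 0
 interpret T0: abelian_group "BB.T 0" by(rule BB.TG)
 have eg: "[1[A], 1[A]] : Tg A (0+2)" by(simp add: gens_iff)
 have "delta_term 0 0 [1[A], 1[A]] :> BB.T 0" using delta_closed[OF eg le_refl] by simp
 hence "bdel 0 bar_e = delta_term 0 0 [1[A], 1[A]]" using bar_delta_pt(2)[OF eg] by simp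
 hence "bdel 0 bar_e = BB.tc 0 0 bar_e 0 bar_e" by(simp add: delta_term_def)
 thus ?thesis
 using bar_delta_rules(8)[where n = 0 and x = bar_e, OF _ bar_e_closed] BB.ract_tc[of 0 0 0 bar_e _ bar_e] bar_e_closed \<mu> 0 by(simp add: w_def)
 next
 case (Suc k)
 thus ?thesis using de(3) ur(3) by(simp add: w_def)
 qed
 have eq1: "bdel (int m) dsy +[BB.T (int m)] bdel (int m) u +[BB.T (int m)] bdel (int m) w = bdel (int m) y"
 unfolding sum[symmetric] using dsyc uc wc by(simp add: de)
 have eq2: "BB.tc (int m) 0 bar_e (int m) dsy +[BB.T (int m)] BB.tc (int m) 0 bar_e (int m) u +[BB.T (int m)] BB.tc (int m) 0 bar_e (int m) w = BB.tc (int m) 0 bar_e (int m) y"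
 unfolding sum[symmetric] using dsyc uc wc by(simp add: ur)
 have Dy: "bdel (int m) y :> BB.T (int m)" using de(1)[OF y] .
 have eq3: "diff BBc (int (Suc m)) (BC.stens (int m) (bdel (int m) y)) +[BB.T (int m)]
 BC.stens (int m - 1) (bdel (int m - 1) (diff Bc (int m) y)) +[BB.T (int m)] BB.tc (int m) 0 bar_e (int m) y = bdel (int m) y"
 using BC.stens_contraction[OF Dy] bar_delta_counit(1)[OF y] Suc.IH[OF y] by(simp only: S1)
 have stc: "BC.stens (int m) (bdel (int m) y) :> BB.T (int (Suc m))" using ahom_closed[OF BC.stens(1) Dy] by(simp only: S1)
 have "BC.stens (int m - 1) : ahom (BB.T (int m - 1)) (BB.T (int m))" using BC.stens(1)[of "int m - 1"] by simp
 note Sc = ahom_closed[OF this bar_delta_rules(1)[OF dy]]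
 have "BB.tc (int m) 0 bar_e (int m) dsy +[BB.T (int m)] diff BBc (int (Suc m)) (BC.stens (int m) (bdel (int m) y)) = bdel (int m) dsy"
 by(rule T.delta_cancel[OF de(1)[OF dsyc] ur(1)[OF dsyc] ur(1)[OF uc] ur(1)[OF wc] Sc dr(1)[OF stc] eq1[unfolded Du Dw] eq2 eq3])
 moreover have "diff BBc (int (Suc m)) (BB.tc (int (Suc m)) 0 bar_e (int (Suc m)) (bar_s (int m) y)) = BB.tc (int m) 0 bar_e (int m) dsy"
 unfolding dsy_def using BC.unit_tensor_diff[of "bar_s (int m) y" "int (Suc m)"] sy by simp
 moreover have "bdel (int (Suc m)) (bar_s (int m) y) = BB.tc (int (Suc m)) 0 bar_e (int (Suc m)) (bar_s (int m) y) +[BB.T (int (Suc m))] BC.stens (int m) (bdel (int m) y)"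
 using bar_delta_s[OF y] by(simp only: S1)
 moreover have "BB.tc (int (Suc m)) 0 bar_e (int (Suc m)) (bar_s (int m) y) :> BB.T (int (Suc m))" by(rule ahom_closed[OF unit_tensor_ahom sy])
 ultimately show ?thesis using dr(2)[OF _ stc] by(simp only: dsy_def)
 qed
 have "diff BBc (int (Suc m)) (bdel (int (Suc m)) x) = bdel (int m) (diff Bc (int (Suc m)) x)"
 proof (rule bar_ext[OF BB.TG bhom_ahom[OF f] bhom_ahom[OF g] Suc.prems])
 fix as assume as: "as : Tg A (Suc m + 2)"
 obtain a bs where a: "as = a # bs" "a :> A" "bs : Tg A (Suc m + 1)" using gens_hd[OF as] by blast
 have bs: "bs : Tg A (m+2)" using a(3) by simp
 have b1: "1[A] # bs : Tg A (Suc m + 2)" using bs by(simp add: gens_iff)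
 have p: "pt as = lact (Bi (Suc m)) a (pt (1[A] # bs))" using lact_pt[OF a(2) b1] a by simp
 show "diff BBc (int (Suc m)) (bdel (int (Suc m)) (pt as)) = bdel (int m) (diff Bc (int (Suc m)) (pt as))"
 unfolding p bhom_lact[OF f a(2) pt_closed[OF b1]] bhom_lact[OF g a(2) pt_closed[OF b1]]
 using key[OF pt_closed[OF bs]] by(simp only: bar_s_nat(2)[OF bs])
 qed
 thus ?case by simp
 qed
 show ?thesis
 proof (cases "n <= 0")
 case True thus ?thesis using nonpos[OF x] by simp
 next
 case False
 then obtain m where m: "n = int m" using nonneg_int[of n] by auto
 show ?thesis using pos[of x m] x by(simp add: m)
 qed
qed

text \<open>After the swap, the pieces of the i-th cut appear in reversed order, and the product
  merges the closing end of one with the beginning of the other. The result is the list rotated by i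
  + 1 behind a unit, which is a term of the first half of the formula of Connes.\<close>

lemma phi_swap_delta:
 assumes x: "x :> Bi n"
 shows "trace_hom A (Bi (n+1)) (bar_phi (int n)) (swap_tr A Bc Bc (int n) (bdel (int n) x))
 = connes_trace n (tr A (Bi n) x)"
proof -
 let ?Z = "TB (int (n+1))"
 interpret Z: abelian_group ?Z by(rule TBG)
 interpret T: is_bimodule K A "BB.T (int n)" by(rule BB.tensor_bim)
 have \<phi>: "bar_phi (int n) : bhom A (BB.T (int n)) (Bi (n+1))" using bar_phi(1)[of "int n"] by(simp add: add.commute)
 note th = trace_hom_tr[OF BB.tensor_bim bar_bim \<phi>]
 note dh = trace_hom_tr[OF bar_bim BB.tensor_bim bar_delta_hom[of "int n"]]
 define f where "f z = trace_hom A (Bi (n+1)) (bar_phi (int n)) (trace_swap A Bc Bc (int n)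
 (trace_hom A (BB.T (int n)) (bdel (int n)) z))" for z
 have fh: "f : ahom (TB (int n)) ?Z" unfolding f_def[abs_def] by(rule ahom_comp[OF ahom_comp[OF dh(1) BB.trace_swap_tr(1)] th(1)])
 have ft: "f (tr A (Bi n) y) = trace_hom A (Bi (n+1)) (bar_phi (int n)) (swap_tr A Bc Bc (int n) (bdel (int n) y))"
 if y: "y :> Bi n" for y
 unfolding f_def dh(2)[OF y] BB.trace_swap_tr(2)[OF bar_delta_rules(1)[OF y]] ..
 have "f (tr A (Bi n) x) = connes_trace n (tr A (Bi n) x)"
 proof (rule trace_bar_ext[OF TBG fh connes_trace(1) ahom_closed[OF is_bimodule.tr_ahom[OF bar_bim] x]])
 fix w assume w: "w : Tg A (Suc n)"
 have wg: "w @ [1[A]] : Tg A (n+2)" by(rule snoc_gens[OF w])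
 have len: "length w = Suc n" using w by(simp add: gens_iff)
 let ?g = "%z. trace_hom A (Bi (n+1)) (bar_phi (int n)) (swap_tr A Bc Bc (int n) z)"
 have gh: "?g : ahom (BB.T (int n)) ?Z" by(rule ahom_comp[OF BB.swap_tr_hom(1) th(1)])
 note thr = ahom_rules[OF BB.opposite[THEN tensor_product.tensor_bim, THEN is_bimodule.TrG] TBG th(1)]
 \<comment> \<open>The cut behind entry i becomes rotation by i + 1; the last cut gives the full
   rotation, counted as rotation by 0.\<close>
 define h where "h i = Suc i mod Suc n" for i
 have hS: "h i = (if i = n then 0 else Suc i)" if "i <= n" for i using that by(simp add: h_def)
 let ?s = "%i. signed ?Z (int (i * n)) (kp (n+1) (1[A] # rotate i w))"
 have kpc: "kp (n+1) (1[A] # rotate i w) :> ?Z" for i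
 by(rule kp_closed) (use w in \<open>simp add: gens_iff\<close>)
 have summand: "?g (delta_term n i (w @ [1[A]])) = ?s (h i)" if i: "i <= n" for i
 proof -
 note D = delta_gens[OF wg i]
 have xy: "pt (take (Suc i) (w @ [1[A]]) @ [1[A]]) :> obj Bc (int i)" "pt (1[A] # drop (Suc i) (w @ [1[A]])) :> obj Bc (int (n-i))"
 "int i + int (n-i) = int n" "int (n-i) + int i = int n"
 using i pt_closed[OF D(1)] pt_closed[OF D(2)] by simp_all
 have xy': "pt (take (Suc i) (w @ [1[A]]) @ [1[A]]) :> Bi i" "pt (1[A] # drop (Suc i) (w @ [1[A]])) :> Bi (n-i)"
 using xy by simp_all
 let ?t = "BB.tc (int n) (int (n-i)) (pt (1[A] # drop (Suc i) (w @ [1[A]]))) (int i) (pt (take (Suc i) (w @ [1[A]]) @ [1[A]]))"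
 have tcl: "?t :> BB.T (int n)" by(rule BB.tc_closed[OF xy(4,2,1)])
 interpret N: is_bimodule K A "Bi (n+1)" by(rule bar_bim)
 obtain c cs where c: "take (Suc i) w = c # cs" using len by(cases w) auto
 have cA: "c :> A" using c w in_set_takeD[of c "Suc i" w] by(auto simp: gens_iff)
 have "bar_prod A (1[A] # drop (Suc i) (w @ [1[A]])) (take (Suc i) (w @ [1[A]]) @ [1[A]]) = 1[A] # (drop (Suc i) w @ take (Suc i) w) @ [1[A]]"
 using i len cA bar_prod_snoc[of A "1[A] # drop (Suc i) w" "1[A]" c "cs @ [1[A]]"] by(simp add: c)
 also have "drop (Suc i) w @ take (Suc i) w = rotate (Suc i) w"
 using rotate_append[of "take (Suc i) w" "drop (Suc i) w"] len i by(simp del: rotate_Suc)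
 also have "rotate (Suc i) w = rotate (h i) w" using rotate_conv_mod[of "Suc i" w] len by(simp add: h_def del: rotate_Suc)
 finally have bp: "bar_prod A (1[A] # drop (Suc i) (w @ [1[A]])) (take (Suc i) (w @ [1[A]]) @ [1[A]]) = (1[A] # rotate (h i) w) @ [1[A]]" by simp
 have pc: "pt ((1[A] # rotate (h i) w) @ [1[A]]) :> Bi (n+1)"
 by(rule pt_closed) (use w in \<open>simp add: gens_iff\<close>)
 have n1: "int n + 1 = int (n+1)" by simp
 have ph: "bar_phi (int n) ?t = signed (Bi (n+1)) (int (n-i)) (pt ((1[A] # rotate (h i) w) @ [1[A]]))"
 using bar_phi(2)[OF xy(4) xy'(2,1)] bar_star(3)[OF D(2,1)] unfolding bp n1 by simp
 \<comment> \<open>The swap contributes i (n - i) and \<open>bar_phi\<close> contributes n - i.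
   Their sum (i + 1)(n - i) is congruent to (i + 1) n modulo 2 because i (i + 1) is even.\<close>
 have sg: "even (int i * int (n-i) + int (n-i) - int (h i * n))"
 proof (cases "i = n")
 case False
 then obtain d where d: "n = i + d" using i le_Suc_ex by blast
 have "h i = Suc i" using False hS[OF i] by simp
 thus ?thesis by(simp add: d algebra_simps)
 qed (simp add: hS)
 have "?g (delta_term n i (w @ [1[A]])) = signed ?Z (int i * int (n-i)) (tr A (Bi (n+1)) (bar_phi (int n) ?t))"
 unfolding delta_term_def BB.swap_tr_hom(2)[OF xy(3,1,2)] thr(6)[OF ahom_closed[OF T.tr_ahom tcl]] th(2)[OF tcl] ..
 also have "... = signed ?Z (int i * int (n-i)) (signed ?Z (int (n-i)) (kp (n+1) (1[A] # rotate (h i) w)))"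
 unfolding ph N.tr_rules(6)[OF pc] kp_def ..
 also have "... = ?s (h i)" unfolding Z.signed_signed[OF kpc] by(rule Z.signed_even[OF sg])
 finally show ?thesis .
 qed
 have inj: "inj_on h {..n}" by(rule inj_onI) (auto simp: hS split: if_splits)
 have img: "h ` {..n} = {..n}"
 by(rule card_seteq) (use card_image[OF inj] in \<open>auto simp: hS\<close>)
 have "f (kp n w) = ?g (bdel (int n) (pt (w @ [1[A]])))" unfolding kp_def by(rule ft[OF pt_closed[OF wg]])
 also have "... = (\<Oplus>\<^bsub>?Z\<^esub>i\<in>{..n}. ?g (delta_term n i (w @ [1[A]])))"
 unfolding bar_delta_pt(2)[OF wg] by(rule T.B.finsum_ahom[OF TBG gh]) (use delta_closed[OF wg] in auto)
 also have "... = (\<Oplus>\<^bsub>?Z\<^esub>i\<in>{..n}. ?s (h i))"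
 by(rule Z.finsum_eqI) (use summand kpc in auto)
 also have "... = (\<Oplus>\<^bsub>?Z\<^esub>i\<in>h ` {..n}. ?s i)"
 by(rule Z.finsum_reindex[symmetric]) (use inj kpc in auto)
 also have "... = connes_trace n (kp n w)" unfolding img connes_trace(2)[OF w] connes_sum_def ..
 finally show "f (kp n w) = connes_trace n (kp n w)" .
 qed
 thus ?thesis unfolding ft[OF x] .
qed

end

section \<open>Lifting homomorphisms out of the tensor square of the bar resolution\<close>

context assoc_algebra
begin

interpretation BB: tensor_product K A "bar K A" "bar K A" by(rule bar_tensor)

text \<open>Inverse to \<open>bar_prod\<close> on classes: the list is cut behind entry i and only
  the left piece is completed by a unit, so the merged entry stays with the right factor.\<close>

definition split_term :: "nat => nat => 'a list => ('a list fab, 'a list fab) tensor_gen fab" where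
 "split_term n i cs = tensor_class A Bc Bc (int n)
 ((int i, pt (take (Suc i) cs @ [1[A]])), (int (n-i), pt (drop (Suc i) cs)))"

lemma split_gens:
 assumes cs: "cs : Tg A (n+3)" and i: "i <= n"
 shows "take (Suc i) cs @ [1[A]] : Tg A (i+2)" "drop (Suc i) cs : Tg A (n - i + 2)"
 using assms by(auto simp: gens_iff dest: in_set_takeD in_set_dropD)

lemma split_tensor:
 assumes cs: "cs : Tg A (n+3)" and i: "i <= n"
 shows "int i + int (n-i) = int n" "pt (take (Suc i) cs @ [1[A]]) :> obj Bc (int i)"
 "pt (drop (Suc i) cs) :> obj Bc (int (n-i))"
 using i pt_closed[OF split_gens(1)[OF assms]] pt_closed[OF split_gens(2)[OF assms]] by simp_all

lemma split_multilinear: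
 assumes i: "i <= n"
 shows "multilinear K A (n+3) (BB.T (int n)) (split_term n i)"
proof (rule multilinear_scalI[where sc = "scal A (BB.T (int n))"])
 fix as assume as: "as : Tg A (n+3)"
 note F = split_gens(1)[OF as i] and G = split_gens(2)[OF as i] and ij = split_tensor(1)[OF as i]
 and x = split_tensor(2)[OF as i] and y = split_tensor(3)[OF as i]
 show "split_term n i as :> BB.T (int n)" unfolding split_term_def by(rule BB.tc_closed[OF ij x y])
 have len: "length as = n + 3" using as by(simp add: gens_iff)
 fix k assume k: "k < n + 3"
 have l: "take (Suc i) (as[k := z]) @ [1[A]] = (take (Suc i) as @ [1[A]])[k := z]" "drop (Suc i) (as[k := z]) = drop (Suc i) as"
 "(take (Suc i) as @ [1[A]]) ! k = as ! k" "k < i + 2" if "k <= i" for z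
 using that len i by(simp_all add: take_update_swap list_update_append nth_append)
 have r: "take (Suc i) (as[k := z]) = take (Suc i) as" "drop (Suc i) (as[k := z]) = (drop (Suc i) as)[k - Suc i := z]"
 "drop (Suc i) as ! (k - Suc i) = as ! k" "k - Suc i < n - i + 2" if "\<not> k <= i" for z
 using that k len i by(simp_all add: drop_update_swap)
 show "split_term n i (as[k := u +[A] v]) = split_term n i (as[k := u]) +[BB.T (int n)] split_term n i (as[k := v])"
 if u: "u :> A" and v: "v :> A" for u v
 proof (cases "k <= i")
 case True
 have p: "pt ((take (Suc i) as @ [1[A]])[k := z]) :> obj Bc (int i)" if "z :> A" for z
 using pt_closed[OF gens_update[OF F that]] by simp
 show ?thesis unfolding split_term_def l[OF True] multilinear_add[OF pt_multilinear F l(4)[OF True] u v]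
 using BB.tc_rules1(2)[OF ij y p[OF u] p[OF v]] by simp
 next
 case False
 have p: "pt ((drop (Suc i) as)[k - Suc i := z]) :> obj Bc (int (n-i))" if "z :> A" for z
 using pt_closed[OF gens_update[OF G that]] by simp
 show ?thesis unfolding split_term_def r[OF False] multilinear_add[OF pt_multilinear G r(4)[OF False] u v]
 using BB.tc_rules2(2)[OF ij x p[OF u] p[OF v]] by simp
 qed
 show "split_term n i (as[k := c .*[A] as ! k]) = scal A (BB.T (int n)) c (split_term n i as)" if c: "c :> K" for c
 proof (cases "k <= i")
 case True
 have "pt ((take (Suc i) as @ [1[A]])[k := c .*[A] as ! k]) = scal A (Bi i) c (pt (take (Suc i) as @ [1[A]]))"
 using scal_pt[OF c F l(4)[OF True]] l(3)[OF True] by simp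
 thus ?thesis unfolding split_term_def l(1,2)[OF True] using BB.lact_tc[OF ij x scalar_closed[OF c] y] by simp
 next
 case False
 have "pt ((drop (Suc i) as)[k - Suc i := c .*[A] as ! k]) = scal A (Bi (n-i)) c (pt (drop (Suc i) as))"
 using scal_pt[OF c G r(4)[OF False]] r(3)[OF False] by simp
 thus ?thesis unfolding split_term_def r(1,2)[OF False]
 using BB.lact_tc[OF ij x scalar_closed[OF c] y] BB.tc_bal[OF ij x scalar_closed[OF c] y] is_bimodule.central[OF bar_bim c, of _ "int i"] x by simp
 qed
qed

lemmas split_closed = multilinear_closed[OF split_multilinear]

lemma split_actions:
 assumes i: "i <= n" and a: "a :> A" and as: "as : Tg A (n+3)"
 shows "split_term n i ((a *[A] hd as) # tl as) = lact (BB.T (int n)) a (split_term n i as)"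
 and "split_term n i (butlast as @ [last as *[A] a]) = ract (BB.T (int n)) (split_term n i as) a"
proof -
 note xy = split_tensor[OF as i]
 obtain b bs where b: "as = b # bs" using as by(cases as) (auto simp: gens_iff)
 show "split_term n i ((a *[A] hd as) # tl as) = lact (BB.T (int n)) a (split_term n i as)"
 unfolding split_term_def BB.lact_tc[OF xy(1,2) a xy(3)] using lact_pt[OF a split_gens(1)[OF as i]] by(simp add: b)
 obtain cs c where c: "as = cs @ [c]" "length cs = n + 2" using as by(cases as rule: rev_cases) (auto simp: gens_iff)
 show "split_term n i (butlast as @ [last as *[A] a]) = ract (BB.T (int n)) (split_term n i as) a"
 unfolding split_term_def BB.ract_tc[OF xy(1,2) a xy(3)] using ract_pt[OF a split_gens(2)[OF as i]] c i by simp
qed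

text \<open>The maps \<open>S i\<close> and \<open>bar_star\<close> exhibit the tensor square as a
  sum of bar modules, so the lifting problem is solved on each summand by \<open>bar_lifts\<close>
  and reassembled by \<open>bar_tensor_hom\<close>.\<close>

lemma bar_tensor_lifts:
 assumes N: "is_bimodule K A N" and Q: "is_bimodule K A Q"
 shows "lifts A (BB.T n) N Q"
 unfolding lifts_def
proof (intro ballI impI)
 fix f p assume f: "f : bhom A (BB.T n) Q" and p: "p : bhom A N Q" and sub: "f ` carrier (BB.T n) <= p ` carrier N"
 define S where "S i = plift (BB.T n) (split_term (nat n) i)" for i
 note qg = is_bimodule.axioms(2)[OF Q]
 have S: "S i : bhom A (Bar (int (Suc (i+j)))) (BB.T n)"
 "cs : Tg A (Suc (i+j) + 2) ==> S i (pt cs) = split_term (nat n) i cs" if n: "int i + int j = n" for i j cs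
 proof -
 have m: "n = int (i+j)" "Suc (i+j) + 2 = i + j + 3" "i <= i + j" using n by simp_all
 note ml = split_multilinear[OF m(3)]
 show "S i : bhom A (Bar (int (Suc (i+j)))) (BB.T n)" unfolding S_def m(1) nat_int
 by(rule bar_hom_lift[OF BB.tensor_bim]) (simp_all only: m(2) ml split_actions[OF m(3)])
 show "S i (pt cs) = split_term (nat n) i cs" if "cs : Tg A (Suc (i+j) + 2)"
 unfolding S_def m(1) nat_int by(rule bar_lift(2)[OF BB.TG _ that]) (simp only: m(2) ml)
 qed
 have "\<exists>g. int i + int j = n --> g : bhom A (Bar (int (Suc (i+j)))) N & (ALL x:carrier (Bar (int (Suc (i+j)))). p (g x) = f (S i x))" for i j
 proof (cases "int i + int j = n")
 case True
 show ?thesis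
 by(rule liftsD[OF bar_lifts[OF N Q] bhom_comp[OF S(1)[OF True] f] p])
 (use sub bhom_cl[OF S(1)[OF True]] in blast)+
 qed simp
 then obtain g where g: "int i + int j = n ==> g i j : bhom A (Bar (int (Suc (i+j)))) N"
 "int i + int j = n ==> x :> Bar (int (Suc (i+j))) ==> p (g i j x) = f (S i x)" for i j x by metis
 define F where "F = plift N (%((i, x), (j, y)). if i < 0 | j < 0 then 0[N] else g (nat i) (nat j) (bar_star (nat i) (nat j) x y))"
 have F1: "F : bhom A (BB.T n) N" by(rule bar_tensor_hom(1)[OF N g(1) F_def])
 have F2: "F (BB.tc n (int i) x (int j) y) = g i j (bar_star i j x y)"
 if "int i + int j = n" "x :> Bi i" "y :> Bi j" for i j x y
 by(rule bar_tensor_hom(2)[OF N g(1) F_def that])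
 have "p (F t) = f t" if t: "t :> BB.T n" for t
 proof (rule bar_tensor_ext[OF qg bhom_ahom[OF bhom_comp[OF F1 p]] bhom_ahom[OF f] t])
 fix i j as bs assume n: "int i + int j = n" and as: "as : Tg A (i+2)" and bs: "bs : Tg A (j+2)"
 obtain a cs where a: "as = cs @ [a]" "a :> A" "cs : Tg A (i+1)" using gens_last[OF as] by blast
 obtain b ds where b: "bs = b # ds" using gens_hd[OF bs] by blast
 have c1: "cs @ [1[A]] : Tg A (i+2)" "length cs = Suc i" using a by(simp_all add: gens_iff)
 have p1: "pt (cs @ [1[A]]) :> obj Bc (int i)" "pt bs :> obj Bc (int j)" using pt_closed[OF c1(1)] pt_closed[OF bs] by simp_all
 note P = bar_prod_closed[OF as bs]
 have p0: "pt as :> Bi i" "pt bs :> Bi j" using pt_closed[OF as] pt_closed[OF bs] by simp_all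
 have m: "nat n = i + j" using n by simp
 \<comment> \<open>Multiplying and splitting again leaves the factor a on the right of the cut; the
   balancing relation moves it back to the left.\<close>
 have "split_term (nat n) i (bar_prod A as bs) = BB.tc n (int i) (pt (cs @ [1[A]])) (int j) (lact (Bi j) a (pt bs))"
 unfolding lact_pt[OF a(2) bs] using c1(2) n by(simp add: split_term_def m a(1) b bar_prod_snoc)
 also have "... = BB.tc n (int i) (pt as) (int j) (pt bs)"
 using BB.tc_bal[OF n p1(1) a(2) p1(2)] ract_pt[OF a(2) c1(1)] a(1,2) by simp
 finally show "p (F (BB.tc n (int i) (pt as) (int j) (pt bs))) = f (BB.tc n (int i) (pt as) (int j) (pt bs))"
 unfolding F2[OF n p0(1) p0(2)] bar_star(3)[OF as bs] g(2)[OF n pt_closed[OF P]] S(2)[OF n P] by simp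
 qed
 thus "EX g:bhom A (BB.T n) N. ALL x:carrier (BB.T n). p (g x) = f x" using F1 by blast
qed

end

section \<open>Comparison with an arbitrary projective resolution\<close>

context abelian_group
begin

lemma minus_swap_cancel:
 "a :> G ==> b :> G ==> (a \<ominus> b) \<oplus> (b \<ominus> a) = \<zero>"
 by(simp add: minus_eq a_assoc r_neg r_neg1)

lemma add_minus_cancel:
 assumes "a :> G" "x :> G" "y :> G"
 shows "(a \<oplus> x) \<ominus> (a \<oplus> y) = x \<ominus> y"
proof -
 have "(a \<oplus> x) \<ominus> (a \<oplus> y) = (a \<oplus> \<ominus> a) \<oplus> (x \<oplus> \<ominus> y)"
 using assms by(simp only: minus_eq minus_add a_ac a_closed a_inv_closed)
 thus ?thesis using assms by(simp add: r_neg minus_eq)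
qed

lemma minus_minus_cancel:
 assumes "p :> G" "q :> G" "c :> G"
 shows "(p \<ominus> c) \<ominus> (q \<ominus> c) = p \<ominus> q"
 using add_minus_cancel[of "\<ominus> c" p q] assms by(simp only: minus_eq a_comm a_closed a_inv_closed)

lemma add_minus_interchange:
 assumes "a :> G" "b :> G" "a' :> G" "b' :> G"
 shows "(a \<ominus> b) \<oplus> (a' \<ominus> b') = (a \<oplus> a') \<ominus> (b \<oplus> b')"
 using assms by(simp only: minus_eq minus_add a_ac a_closed a_inv_closed)

text \<open>Here e stands for the terms of \<epsilon>, l and r for the left and right counits of the
  diagonal homotopy, and c for the common counit of the transported bar diagonal, which drops out of
  the difference.\<close>

lemma homotopy_cancel:
 assumes c: "e1 :> G" "e2 :> G" "l1 :> G" "l2 :> G" "r1 :> G" "r2 :> G"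
 "p :> G" "q :> G" "c :> G"
 and e: "e1 \<oplus> e2 = p \<ominus> q" and l: "l1 \<oplus> l2 = p \<ominus> c" and r: "r1 \<oplus> r2 = q \<ominus> c"
 shows "(e1 \<ominus> (l1 \<ominus> r1)) \<oplus> (e2 \<ominus> (l2 \<ominus> r2)) = \<zero>"
proof -
 have "(e1 \<ominus> (l1 \<ominus> r1)) \<oplus> (e2 \<ominus> (l2 \<ominus> r2)) = (e1 \<oplus> e2) \<ominus> ((l1 \<oplus> l2) \<ominus> (r1 \<oplus> r2))"
 using c by(simp add: add_minus_interchange)
 also have "... = \<zero>" unfolding e l r using c by(simp add: minus_minus_cancel)
 finally show ?thesis .
qed

end

context assoc_algebra
begin

lemma null_homotopy_0:
 assumes C: "is_bimodule_cpx K A C" and D: "is_bimodule_cpx K A D"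
 and exact: "!!n x. n > 0 ==> x :> obj D n ==> diff D n x = 0[obj D (n-1)] ==>
 x : diff D (n+1) ` carrier (obj D (n+1))"
 and neg: "!!n. n < 0 ==> carrier (obj C n) = {0[obj C n]}"
 and lift: "!!n. lifts A (obj C n) (obj D (n+1)) (obj D n)"
 and f: "!!n. f n : bhom A (obj C n) (obj D n)"
 and comm: "!!n x. x :> obj C n ==> diff D n (f n x) = f (n-1) (diff C n x)"
 and start: "!!x. x :> obj C 0 ==> f 0 x : diff D 1 ` carrier (obj D 1)"
 shows "\<exists>h. (\<forall>n. h n : bhom A (obj C n) (obj D (n+1))) &
 (\<forall>n. ALL x:carrier (obj C n). diff D (n+1) (h n x) +[obj D n] h (n-1) (diff C n x) = f n x)"
proof (rule null_homotopy[where k = 0 and f = f, OF C D])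
 show "x : diff D (n+1) ` carrier (obj D (n+1))"
 if "n > 0" "x :> obj D n" "diff D n x = 0[obj D (n-1)]" for n x by(rule exact[OF that])
 show "carrier (obj C n) = {0[obj C n]}" if "n < 0" for n by(rule neg[OF that])
 show "lifts A (obj C n) (obj D (n + 0 + 1)) (obj D (n+0))" for n using lift[of n] by simp
 show "f n : bhom A (obj C n) (obj D (n+0))" for n using f[of n] by simp
 show "diff D (n+0) (f n x) = f (n-1) (signed (obj C (n-1)) 0 (diff C n x))"
 if "n >= 1" "x :> obj C n" for n x using comm[OF that(2)] by(simp add: signed_def)
 show "f 0 x : diff D (0+1) ` carrier (obj D (0+1))" if "x :> obj C 0" for x using start[OF that] by simp
 fix h assume h1: "!!n. h n : bhom A (obj C n) (obj D (n + 0 + 1))"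
 and h2: "!!n x. x :> obj C n ==> diff D (n + 0 + 1) (h n x)
 = f n x -[obj D (n+0)] h (n-1) (signed (obj C (n-1)) 0 (diff C n x))"
 show "\<exists>h. (\<forall>n. h n : bhom A (obj C n) (obj D (n+1))) &
 (\<forall>n. ALL x:carrier (obj C n). diff D (n+1) (h n x) +[obj D n] h (n-1) (diff C n x) = f n x)"
 proof (rule exI[of _ h], intro conjI allI ballI)
 show "h n : bhom A (obj C n) (obj D (n+1))" for n using h1[of n] by simp
 fix n x assume x: "x :> obj C n"
 interpret N: is_bimodule K A "obj D n" by(rule cpx_bim[OF D])
 have a: "f n x :> obj D n" by(rule bhom_cl[OF f x])
 have b: "h (n-1) (diff C n x) :> obj D n"
 using bhom_cl[OF h1[of "n - 1"] bhom_cl[OF cpx_diff[OF C] x]] by simp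
 show "diff D (n+1) (h n x) +[obj D n] h (n-1) (diff C n x) = f n x"
 using h2[OF x] a b by(simp add: signed_def N.B.minus_eq N.B.a_assoc N.B.l_neg)
 qed
qed

text \<open>A map of degree one that anticommutes with the differentials is a chain map to the
  shift. Its image in degree 0 lies in degree 1 of D and consists of cycles, so exactness starts the
  homotopy without an augmentation condition. The sign of the shift is absorbed into h'.\<close>

lemma null_homotopy_1:
 assumes C: "is_bimodule_cpx K A C" and D: "resolution K A D \<mu>"
 and neg: "!!n. n < 0 ==> carrier (obj C n) = {0[obj C n]}"
 and lift: "!!n m. lifts A (obj C n) (obj D (m+1)) (obj D m)"
 and f: "!!n. f n : bhom A (obj C n) (obj D (1+n))"
 and comm: "!!n x. x :> obj C n ==>
 diff D (1+n) (f n x) +[obj D n] f (n-1) (diff C n x) = 0[obj D n]"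
 shows "\<exists>h h'. (\<forall>n. h n : bhom A (obj C n) (obj D (1 + n + 1))) &
 (\<forall>n. h' n : bhom A (obj C (n-1)) (obj D (1+n))) &
 (\<forall>n. ALL x:carrier (obj C n). f n x = diff D (1 + n + 1) (h n x) +[obj D (1+n)] h' n (diff C n x))"
proof -
 have Dc: "is_bimodule_cpx K A D" and ex: "!!n x. n > 0 ==> x :> obj D n ==> diff D n x = 0[obj D (n-1)] ==>
 x : diff D (n+1) ` carrier (obj D (n+1))"
 using D unfolding resolution_def by auto
 note Db = cpx_bim[OF Dc] and Cb = cpx_bim[OF C]
 have fm: "f (n-1) : bhom A (obj C (n-1)) (obj D n)" for n using f[of "n - 1"] by simp
 have dc: "diff C n x :> obj C (n-1)" if "x :> obj C n" for n x by(rule bhom_cl[OF cpx_diff[OF C] that])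
 have dD: "diff D (1+n) : bhom A (obj D (1+n)) (obj D n)" for n using cpx_diff[OF Dc, of "1 + n"] by simp
 have comm': "diff D (1+n) (f n x) = -[obj D n] f (n-1) (diff C n x)" if x: "x :> obj C n" for n x
 proof -
 interpret N: is_bimodule K A "obj D n" by(rule Db)
 show ?thesis using comm[OF x] bhom_cl[OF fm dc[OF x]] bhom_cl[OF dD bhom_cl[OF f x]]
 by(simp add: N.B.minus_equality)
 qed
 show ?thesis
 proof (rule null_homotopy[where k = 1 and f = f, OF C Dc])
 show "x : diff D (n+1) ` carrier (obj D (n+1))"
 if "n > 1" "x :> obj D n" "diff D n x = 0[obj D (n-1)]" for n x using ex[OF _ that(2,3)] that(1) by simp
 show "carrier (obj C n) = {0[obj C n]}" if "n < 0" for n by(rule neg[OF that])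
 show "lifts A (obj C n) (obj D (n + 1 + 1)) (obj D (n+1))" for n by(rule lift)
 show "f n : bhom A (obj C n) (obj D (n+1))" for n using f[of n] by(simp add: add.commute)
 show "diff D (n+1) (f n x) = f (n-1) (signed (obj C (n-1)) 1 (diff C n x))" if x: "x :> obj C n" for n x
 using comm'[OF x] bhom_rules(4)[OF Cb Db fm dc[OF x]] by(simp add: signed_def add.commute)
 show "f 0 x : diff D (1+1) ` carrier (obj D (1+1))" if x: "x :> obj C 0" for x
 proof (rule ex)
 show "f 0 x :> obj D 1" using bhom_cl[OF f x] by simp
 interpret N: is_bimodule K A "obj D 0" by(rule Db)
 have "diff C 0 x = 0[obj C (0-1)]" using dc[OF x] neg[of "0 - 1"] by simp
 hence "f (0-1) (diff C 0 x) = 0[obj D 0]" using bhom_rules(3)[OF Cb Db fm, of 0] by simp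
 thus "diff D 1 (f 0 x) = 0[obj D (1-1)]" using comm'[OF x] by simp
 qed simp
 fix h assume h1: "!!n. h n : bhom A (obj C n) (obj D (n + 1 + 1))"
 and h2: "!!n x. x :> obj C n ==> diff D (n + 1 + 1) (h n x)
 = f n x -[obj D (n+1)] h (n-1) (signed (obj C (n-1)) 1 (diff C n x))"
 define h' where "h' n = (%y. -[obj D (1+n)] h (n-1) y)" for n
 have i: "n - 1 + 1 + 1 = 1 + n" "n + 1 = 1 + n" for n :: int by simp_all
 have hm: "h (n-1) : bhom A (obj C (n-1)) (obj D (1+n))" for n using h1[of "n - 1"] by(simp add: add.commute)
 show ?thesis
 proof (rule exI[of _ h], rule exI[of _ h'], intro conjI allI ballI)
 show "h n : bhom A (obj C n) (obj D (1 + n + 1))" for n using h1[of n] unfolding i(2)[of n] .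
 show "h' n : bhom A (obj C (n-1)) (obj D (1+n))" for n
 unfolding h'_def by(rule bhom_uminus[OF Db hm])
 fix n x assume x: "x :> obj C n"
 interpret N: is_bimodule K A "obj D (1+n)" by(rule Db)
 have a: "f n x :> obj D (1+n)" by(rule bhom_cl[OF f x])
 have b: "h (n-1) (diff C n x) :> obj D (1+n)" by(rule bhom_cl[OF hm dc[OF x]])
 have "signed (obj C (n-1)) 1 (diff C n x) = -[obj C (n-1)] diff C n x" by(simp add: signed_def)
 hence "diff D (1 + n + 1) (h n x) = f n x -[obj D (1+n)] (-[obj D (1+n)] h (n-1) (diff C n x))"
 using h2[OF x] bhom_rules(4)[OF Cb Db hm dc[OF x]] unfolding i(2)[of n] by simp
 thus "f n x = diff D (1 + n + 1) (h n x) +[obj D (1+n)] h' n (diff C n x)"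
 unfolding h'_def using a b by(simp add: N.B.minus_eq N.B.a_assoc N.B.r_neg)
 qed
 qed
qed

text \<open>The representative x of a cycle of the trace need not be a cycle; it is only the class
  of d x that vanishes. As h' induces a map of traces, the term h' d x vanishes there too, and d h x
  is a boundary.\<close>

lemma trace_homotopy_boundary:
 assumes C: "is_bimodule_cpx K A C" and D: "is_bimodule_cpx K A D"
 and h: "h : bhom A (obj C n) (obj D (m+1))" and h': "h' : bhom A (obj C (n-1)) (obj D m)"
 and x: "x :> obj C n" and dx: "tr A (obj C (n-1)) (diff C n x) = 0[trob A (obj C (n-1))]"
 shows "tr A (obj D m) (diff D (m+1) (h x) +[obj D m] h' (diff C n x)) : boundaries (Tr A D) m"
proof -
 interpret M: is_bimodule K A "obj D m" by(rule cpx_bim[OF D])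
 interpret G: group_cpx "Tr A D" by(rule trace_group_cpx[OF D])
 interpret T: abelian_group "trob A (obj D m)" by(rule M.TrG)
 have hx: "h x :> obj D (m+1)" by(rule bhom_cl[OF h x])
 have dxc: "diff C n x :> obj C (n-1)" by(rule bhom_cl[OF cpx_diff[OF C] x])
 have dh: "diff D (m+1) (h x) :> obj D m" using bhom_cl[OF cpx_diff[OF D] hx] by simp
 note th = trace_hom_tr[OF cpx_bim[OF C] cpx_bim[OF D] h']
 have "tr A (obj D m) (h' (diff C n x)) = 0[trob A (obj D m)]"
 using th(2)[OF dxc] dx ahom_rules(3)[OF is_bimodule.TrG[OF cpx_bim[OF C]] M.TrG th(1)] by simp
 hence "tr A (obj D m) (diff D (m+1) (h x) +[obj D m] h' (diff C n x)) = tr A (obj D m) (diff D (m+1) (h x))"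
 using M.tr_rules(2)[OF dh bhom_cl[OF h' dxc]] M.tr_rules(1)[OF dh] by simp
 also have "... = diff (Tr A D) (m+1) (tr A (obj D (m+1)) (h x))"
 using diff_Tr_tr[OF D hx] by simp
 also have "... : boundaries (Tr A D) m"
 using G.boundariesI[of "tr A (obj D (m+1)) (h x)" m] ahom_closed[OF is_bimodule.tr_ahom[OF cpx_bim[OF D]] hx] by simp
 finally show ?thesis .
qed

lemma resolution_augmented: "resolution K A P \<mu> ==> augmented_cpx K A P \<mu>"
 by(intro augmented_cpx.intro[OF assoc_algebra_axioms] augmented_cpx_axioms.intro) (auto simp: resolution_def)

lemma resolution_self_homotopy:
 assumes D: "resolution K A D \<mu>" and lift: "!!n. lifts A (obj D n) (obj D (n+1)) (obj D n)"
 and g: "g : bimodule_cpx_maps A D D" and gd: "!!n x. x :> obj D n ==> diff D n (g n x) = g (n-1) (diff D n x)"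
 and g0: "!!x. x :> obj D 0 ==> \<mu> (g 0 x) = \<mu> x"
 shows "\<exists>h. (\<forall>n. h n : bhom A (obj D n) (obj D (n+1))) &
 (\<forall>n. ALL x:carrier (obj D n). diff D (n+1) (h n x) +[obj D n] h (n-1) (diff D n x) = g n x -[obj D n] x)"
proof (rule null_homotopy_0)
 note D' = D[unfolded resolution_def]
 show Dc: "is_bimodule_cpx K A D" "is_bimodule_cpx K A D" using D' by auto
 note Db = cpx_bim[OF Dc(1)]
 have \<mu>: "\<mu> : bhom A (obj D 0) (reg_bim A)" using D' by auto
 show "x : diff D (n+1) ` carrier (obj D (n+1))"
 if "n > 0" "x :> obj D n" "diff D n x = 0[obj D (n-1)]" for n x using D' that by auto
 show "carrier (obj D n) = {0[obj D n]}" if "n < 0" for n using D' that by blast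
 show "lifts A (obj D n) (obj D (n+1)) (obj D n)" for n by(rule lift)
 show "(%x. g n x -[obj D n] x) : bhom A (obj D n) (obj D n)" for n
 by(rule bhom_minus[OF Db cpx_maps_hom[OF g] bhom_id])
 fix n x assume x: "x :> obj D n"
 show "diff D n (g n x -[obj D n] x) = g (n-1) (diff D n x) -[obj D (n-1)] diff D n x"
 using bhom_rules(5)[OF Db Db cpx_diff[OF Dc(1)] bhom_cl[OF cpx_maps_hom[OF g] x] x] gd[OF x] by simp
next
 fix x assume x: "x :> obj D 0"
 note D' = D[unfolded resolution_def]
 have Dc: "is_bimodule_cpx K A D" and \<mu>: "\<mu> : bhom A (obj D 0) (reg_bim A)" using D' by auto
 interpret N: is_bimodule K A "obj D 0" by(rule cpx_bim[OF Dc])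
 interpret R: is_bimodule K A "reg_bim A" by(rule reg_bim)
 note gx = bhom_cl[OF cpx_maps_hom[OF g] x]
 have "\<mu> (g 0 x -[obj D 0] x) = \<mu> x -[reg_bim A] \<mu> x"
 using bhom_rules(5)[OF cpx_bim[OF Dc] reg_bim \<mu> gx x] g0[OF x] by simp
 also have "... = 0[A]" using R.B.a_minus_self[OF bhom_cl[OF \<mu> x]] by(simp add: regular_simps)
 finally show "g 0 x -[obj D 0] x : diff D 1 ` carrier (obj D 1)"
 using D' N.B.minus_closed[OF gx x] by auto
qed

end

section \<open>The operator of the statement for any augmented complex with a diagonal and
  homotopies\<close>

locale trace_operator = augmented_cpx K A P \<mu>
 for K :: "'k ring" and A :: "('k, 'a) module" and P :: "('a, 'p) bimodule_cpx" and \<mu> :: "'p => 'a" +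
 fixes \<Delta> :: "int => 'p => ('p, 'p) tensor_gen fab"
 and \<phi> :: "int => ('p, 'p) tensor_gen fab => 'p" and \<epsilon> :: "int => 'p => 'p"
 assumes \<Delta>: "!!n. \<Delta> n : bhom A (obj P n) (tensor_obj A P P n)"
 and \<Delta>_diff: "!!n x. x :> obj P n ==> diff (tensor A P P) n (\<Delta> n x) = \<Delta> (n-1) (diff P n x)"
 and \<phi>: "!!n. \<phi> n : bhom A (tensor_obj A P P n) (obj P (1+n))"
 and \<phi>_diff: "!!n t. t :> tensor_obj A P P n ==>
 diff P (1+n) (\<phi> n t) +[obj P n] \<phi> (n-1) (diff (tensor A P P) n t) = cl n t -[obj P n] cr n t"
 and \<epsilon>: "!!n. \<epsilon> n : bhom A (obj P n) (obj P (1+n))"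
 and \<epsilon>_diff: "!!n x. x :> obj P n ==>
 diff P (1+n) (\<epsilon> n x) +[obj P n] \<epsilon> (n-1) (diff P n x) = cl n (\<Delta> n x) -[obj P n] cr n (\<Delta> n x)"
begin

abbreviation "TP n \<equiv> trob A (obj P n)"

abbreviation "trp n \<equiv> tr A (obj P n)"

abbreviation "trt n \<equiv> tr A (tensor_obj A P P n)"

definition op :: "int => ('a \<times> 'p) fab => ('a \<times> 'p) fab" where
 "op n z = trace_hom A (obj P (1+n)) (\<phi> n) (trace_swap A P P n (trace_hom A (tensor_obj A P P n) (\<Delta> n) z))
 +[TP (1+n)] trace_hom A (obj P (1+n)) (\<epsilon> n) z"

lemmas th_\<phi> = trace_hom_tr[OF PP.tensor_bim PP.PB \<phi>]
lemmas th_\<epsilon> = trace_hom_tr[OF PP.PB PP.PB \<epsilon>]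
lemmas th_\<Delta> = trace_hom_tr[OF PP.PB PP.tensor_bim \<Delta>]
lemmas TPG = is_bimodule.TrG[OF PP.PB]
lemmas trp_rules = is_bimodule.tr_rules[OF PP.PB]
lemmas trt_rules = is_bimodule.tr_rules[OF PP.tensor_bim]
lemmas \<phi>_rules = bhom_rules[OF PP.tensor_bim PP.PB \<phi>]
lemmas \<epsilon>_rules = bhom_rules[OF PP.PB PP.PB \<epsilon>]
lemmas \<Delta>_rules = bhom_rules[OF PP.PB PP.tensor_bim \<Delta>]

lemma op_ahom: "op n : ahom (TP n) (TP (1+n))"
 unfolding op_def[abs_def]
 by(rule ahom_plus[OF TPG ahom_comp[OF ahom_comp[OF th_\<Delta>(1) PP.trace_swap_tr(1)] th_\<phi>(1)] th_\<epsilon>(1)])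

lemma op_tr:
 assumes x: "x :> obj P n"
 shows "op n (trp n x) = trace_hom A (obj P (1+n)) (\<phi> n) (swap_tr A P P n (\<Delta> n x)) +[TP (1+n)] trp (1+n) (\<epsilon> n x)"
 unfolding op_def th_\<Delta>(2)[OF x] PP.trace_swap_tr(2)[OF \<Delta>_rules(1)[OF x]] th_\<epsilon>(2)[OF x] ..

text \<open>The swap takes values in a trace, whereas \<phi> acts on elements. A representative t of
  the swapped diagonal allows the operator to be computed inside P.\<close>

lemma op_rep:
 assumes x: "x :> obj P n" and t: "t :> PP.T n" and eq: "swap_tr A P P n (\<Delta> n x) = trt n t"
 shows "op n (trp n x) = trp (1+n) (\<phi> n t +[obj P (1+n)] \<epsilon> n x)"
 unfolding op_tr[OF x] eq th_\<phi>(2)[OF t] trp_rules(2)[OF \<phi>_rules(1)[OF t] \<epsilon>_rules(1)[OF x]] ..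

lemma swap_rep:
 assumes t: "t :> PP.T n"
 shows "EX u:carrier (PP.T n). swap_tr A P P n t = trt n u"
 using is_bimodule.tr_surj[OF PP.tensor_bim ahom_closed[OF PP.swap_tr_hom(1) t]] by metis

lemma swap_rep_diff:
 assumes t: "t :> PP.T n" and u: "u :> PP.T n" and eq: "swap_tr A P P n t = trt n u"
 shows "swap_tr A P P (n-1) (diff (tensor A P P) n t) = trt (n-1) (diff (tensor A P P) n u)"
 and "trp n (cl n u) = trp n (cr n t)" and "trp n (cr n u) = trp n (cl n t)"
 using PP.swap_tr_diff[OF t] trace_hom_tr(2)[OF PP.tensor_bim PP.tensor_bim PP.tensor_diff(1) u]
 trace_counit_swap[OF t] trace_hom_tr(2)[OF PP.tensor_bim PP.PB cl_hom u]
 trace_hom_tr(2)[OF PP.tensor_bim PP.PB cr_hom u] by(simp_all add: eq)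

text \<open>The homotopy identity of \<phi> at the representative t gives the counit difference of
  t; in the trace this is the counit difference of \<Delta> x with reversed sign, so it cancels the
  one produced by \<epsilon>.\<close>

lemma op_diff:
 assumes z: "z :> TP n"
 shows "diff (Tr A P) (1+n) (op n z) +[TP n] op (n-1) (diff (Tr A P) n z) = 0[TP n]"
proof -
 interpret N: is_bimodule K A "obj P n" by(rule PP.PB)
 interpret T: abelian_group "TP n" by(rule TPG)
 obtain x where x: "x :> obj P n" and zx: "z = trp n x" by(rule N.tr_surj[OF z])
 note Dx = \<Delta>_rules(1)[OF x]
 obtain t where t: "t :> PP.T n" "swap_tr A P P n (\<Delta> n x) = trt n t" using swap_rep[OF Dx] by(elim bexE)
 note S = swap_rep_diff[OF Dx t]
 have i: "1 + (n-1) = n" by simp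
 have dx: "diff P n x :> obj P (n-1)" by(rule bhom_cl[OF cpx_diff[OF P] x])
 have dt: "diff (tensor A P P) n t :> PP.T (n-1)" by(rule bhom_cl[OF PP.tensor_diff(1) t(1)])
 have d1: "diff P (1+n) : bhom A (obj P (1+n)) (obj P n)" using cpx_diff[OF P, of "1 + n"] by simp
 note dr = bhom_rules[OF PP.PB PP.PB d1]
 note f = \<phi>_rules(1)[OF t(1)] and e = \<epsilon>_rules(1)[OF x]
 have f': "\<phi> (n-1) (diff (tensor A P P) n t) :> obj P n" using \<phi>_rules(1)[OF dt] unfolding i .
 have e': "\<epsilon> (n-1) (diff P n x) :> obj P n" using \<epsilon>_rules(1)[OF dx] unfolding i .
 have cc: "cl n u :> obj P n" "cr n u :> obj P n" if "u :> PP.T n" for u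
 using bhom_cl[OF cl_hom that] bhom_cl[OF cr_hom that] .
 have "op (n-1) (trp (n-1) (diff P n x)) = trp n (\<phi> (n-1) (diff (tensor A P P) n t) +[obj P n] \<epsilon> (n-1) (diff P n x))"
 using op_rep[OF dx dt] S(1) unfolding \<Delta>_diff[OF x] i by simp
 moreover have "diff (Tr A P) (1+n) (op n z) = trp n (diff P (1+n) (\<phi> n t +[obj P (1+n)] \<epsilon> n x))"
 unfolding zx op_rep[OF x t] using diff_Tr_tr[OF P is_bimodule.axioms(2)[OF PP.PB, THEN abelian_group.axioms(1), THEN abelian_monoid.a_closed, OF f e]] by simp
 moreover have "diff (Tr A P) n z = trp (n-1) (diff P n x)" unfolding zx by(rule diff_Tr_tr[OF P x])
 ultimately have "diff (Tr A P) (1+n) (op n z) +[TP n] op (n-1) (diff (Tr A P) n z)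
 = trp n ((diff P (1+n) (\<phi> n t) +[obj P n] \<phi> (n-1) (diff (tensor A P P) n t)) +[obj P n]
 (diff P (1+n) (\<epsilon> n x) +[obj P n] \<epsilon> (n-1) (diff P n x)))"
 using f e f' e' dr(1)[OF f] dr(1)[OF e] by(simp add: dr(2) trp_rules(2) T.a_ac trp_rules(1))
 also have "... = trp n ((cl n t -[obj P n] cr n t) +[obj P n] (cl n (\<Delta> n x) -[obj P n] cr n (\<Delta> n x)))"
 unfolding \<phi>_diff[OF t(1)] \<epsilon>_diff[OF x] ..
 also have "... = (trp n (cr n (\<Delta> n x)) -[TP n] trp n (cl n (\<Delta> n x))) +[TP n] (trp n (cl n (\<Delta> n x)) -[TP n] trp n (cr n (\<Delta> n x)))"
 using cc[OF t(1)] cc[OF Dx] by(simp add: trp_rules(2,5) S(2,3))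
 also have "... = 0[TP n]"
 by(rule T.minus_swap_cancel[OF trp_rules(1)[OF cc(2)[OF Dx]] trp_rules(1)[OF cc(1)[OF Dx]]])
 finally show ?thesis .
qed

lemma op_boundary:
 assumes b: "b : boundaries (Tr A P) n"
 shows "op n b : boundaries (Tr A P) (1+n)"
proof -
 interpret G: group_cpx "Tr A P" by(rule trace_group_cpx[OF P])
 interpret T: abelian_group "TP (1+n)" by(rule TPG)
 obtain y where y: "y :> obj (Tr A P) (n+1)" and by': "b = diff (Tr A P) (n+1) y" by(rule G.boundariesE[OF b])
 have yc: "y :> TP (1+n)" using y by(simp add: add.commute)
 have oy: "op (1+n) y :> TP (1 + (1+n))" by(rule ahom_closed[OF op_ahom yc])
 have dc: "diff (Tr A P) (1 + (1+n)) (op (1+n) y) :> TP (1+n)" using G.d_rules(1)[of "op (1+n) y" "1 + (1+n)"] oy by simp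
 have bc: "op n b :> TP (1+n)" using ahom_closed[OF op_ahom] G.boundaries_closed[OF b] by simp
 have "diff (Tr A P) (1 + (1+n)) (op (1+n) y) +[TP (1+n)] op n b = 0[TP (1+n)]"
 using op_diff[OF yc] by(simp add: by' add.commute)
 hence "op n b = -[TP (1+n)] diff (Tr A P) (1 + (1+n)) (op (1+n) y)"
 using T.minus_equality[OF _ dc bc] T.a_comm[OF dc bc] by simp
 also have "... = diff (Tr A P) (1 + (1+n)) (-[TP (1 + (1+n))] op (1+n) y)"
 using G.d_rules(4)[of "op (1+n) y" "1 + (1+n)"] oy by simp
 also have "... : boundaries (Tr A P) (1+n)"
 proof -
 have "-[TP (1 + n + 1)] op (1+n) y :> obj (Tr A P) (1 + n + 1)"
 using abelian_group.a_inv_closed[OF TPG oy] by(simp add: add.commute)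
 from G.boundariesI[OF this] show ?thesis by(simp add: add.commute)
 qed
 finally show ?thesis .
qed

lemma op_scal:
 assumes c: "c :> K" and z: "z :> TP n"
 shows "op n (c .*[TP n] z) = c .*[TP (1+n)] op n z"
proof -
 interpret N: is_bimodule K A "obj P n" by(rule PP.PB)
 interpret M: is_bimodule K A "obj P (1+n)" by(rule PP.PB)
 obtain x where x: "x :> obj P n" and zx: "z = trp n x" by(rule N.tr_surj[OF z])
 have cx: "scal A (obj P n) c x :> obj P n" by(rule N.scal_closed[OF c x])
 note Dx = \<Delta>_rules(1)[OF x]
 note st = ahom_closed[OF PP.swap_tr_hom(1) Dx]
 have D: "\<Delta> n (scal A (obj P n) c x) = scal A (PP.T n) c (\<Delta> n x)" by(rule \<Delta>_rules(7)[OF scalar_closed[OF c] x])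
 have E: "\<epsilon> n (scal A (obj P n) c x) = scal A (obj P (1+n)) c (\<epsilon> n x)" by(rule \<epsilon>_rules(7)[OF scalar_closed[OF c] x])
 have "op n (c .*[TP n] z) = trace_hom A (obj P (1+n)) (\<phi> n) (c .*[trob A (PP.T n)] swap_tr A P P n (\<Delta> n x))
 +[TP (1+n)] trp (1+n) (scal A (obj P (1+n)) c (\<epsilon> n x))"
 unfolding zx N.smult_tr(2)[OF c x] op_tr[OF cx] D E PP.swap_tr_scal[OF c Dx] ..
 also have "... = c .*[TP (1+n)] trace_hom A (obj P (1+n)) (\<phi> n) (swap_tr A P P n (\<Delta> n x)) +[TP (1+n)] c .*[TP (1+n)] trp (1+n) (\<epsilon> n x)"
 unfolding trace_hom_scal[OF PP.tensor_bim PP.PB \<phi> c st] M.smult_tr(2)[OF c \<epsilon>_rules(1)[OF x]] ..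
 also have "... = c .*[TP (1+n)] op n z"
 unfolding zx op_tr[OF x] using ahom_add[OF M.smult_tr(1)[OF c] ahom_closed[OF th_\<phi>(1) st] trp_rules(1)[OF \<epsilon>_rules(1)[OF x]]] by simp
 finally show ?thesis .
qed

end

lemma (in abelian_group) add_minus_right:
 assumes a: "a :> G" and b: "b :> G"
 shows "b \<oplus> (a \<ominus> b) = a"
proof -
 have "b \<oplus> (a \<ominus> b) = a \<oplus> (b \<oplus> \<ominus> b)" using a b by(simp only: minus_eq a_ac a_closed a_inv_closed)
 thus ?thesis using a b by(simp add: r_neg)
qed

lemma (in assoc_algebra) bar_trace_operator:
 "trace_operator K A Bc (Ba A) bdel bar_phi (%n x. 0[Bar (1+n)])"
proof -
 interpret BB: tensor_product K A "bar K A" "bar K A" by(rule bar_tensor)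
 interpret BC: right_contraction K A "bar K A" "Ba A" bar_s "pt [1[A], 1[A]]"
 by(rule bar_right_contraction)
 have z: "diff Bc (1+n) 0[Bar (1+n)] = 0[Bar n]" for n
 using bhom_rules(3)[OF bar_bim bar_bim bar_diff_hom[of "1 + n"]] by simp
 show ?thesis
 proof
 show "bdel n : bhom A (obj Bc n) (BB.T n)" for n using bar_delta_hom by simp
 show "diff BBc n (bdel n x) = bdel (n-1) (diff Bc n x)"
 if "x :> obj Bc n" for n x using bar_delta_chain that by simp
 show "bar_phi n : bhom A (BB.T n) (obj Bc (1+n))" for n using bar_phi(1)[of n] by(simp add: add.commute)
 show "diff Bc (1+n) (bar_phi n t) +[obj Bc n] bar_phi (n-1) (diff BBc n t)
 = BC.cl n t -[obj Bc n] BC.cr n t" if "t :> BB.T n" for n t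
 using bar_phi_homotopy[OF that] by(simp add: add.commute)
 show "(%x. 0[Bar (1+n)]) : bhom A (obj Bc n) (obj Bc (1+n))" for n
 using bhom_zero[OF bar_bim] by simp
 fix n x assume "x :> obj Bc n"
 hence x: "x :> Bar n" by simp
 interpret N: is_bimodule K A "Bar n" by(rule bar_bim)
 have "0[Bar (1 + (n-1))] = 0[Bar n]" by simp
 thus "diff Bc (1+n) 0[Bar (1+n)] +[obj Bc n] 0[Bar (1 + (n-1))]
 = BC.cl n (bdel n x) -[obj Bc n] BC.cr n (bdel n x)"
 using z[of n] bar_delta_counit[OF x] x N.B.a_minus_self[OF x] by simp
 qed
qed

section \<open>Comparing the operators of P and of the bar resolution\<close>

locale resolution_comparison = trace_operator K A P \<mu> \<Delta> \<phi> \<epsilon>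
 for K :: "'k ring" and A :: "('k, 'a) module" and P :: "('a, 'p) bimodule_cpx" and \<mu> :: "'p => 'a"
 and \<Delta> :: "int => 'p => ('p, 'p) tensor_gen fab"
 and \<phi> :: "int => ('p, 'p) tensor_gen fab => 'p" and \<epsilon> :: "int => 'p => 'p" +
 fixes th :: "int => 'a list fab => 'p"
 assumes PR: "projective_resolution K A P \<mu>"
 and diagonal: "!!x. x :> obj P 0 ==> \<mu> (cl 0 (\<Delta> 0 x)) = \<mu> x"
 and th: "th : comparison_maps K A P \<mu>"
begin

sublocale B: trace_operator K A "bar K A" "Ba A" bdel bar_phi "%n x. 0[Bar (1+n)]"
 by(rule bar_trace_operator)

lemmas R = projective_resolution_resolution[OF PR]
lemmas R' = R[unfolded resolution_def]

lemma P_lifts: "is_bimodule K A N ==> is_bimodule K A Q ==> lifts A (obj P n) N Q"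
 using PR by(intro projective_lifts) (simp_all add: projective_resolution_def)

lemma th': "th : bimodule_cpx_maps A Bc P" "commutes_with_diff Bc P th"
 and th_aug: "x :> Bar 0 ==> \<mu> (th 0 x) = Ba A x"
 using th by(simp_all add: comparison_maps_def)

lemma th_hom: "th n : bhom A (Bar n) (obj P n)"
 using cpx_maps_hom[OF th'(1), of n] by simp

lemmas th_rules = bhom_rules[OF bar_bim PP.PB th_hom]

lemma th_diff: "x :> Bar n ==> diff P n (th n x) = th (n-1) (diff Bc n x)"
 using chain_mapD[OF bar_is_cpx P th', of x n] by simp

lemmas bar_d_closed = bhom_cl[OF bar_diff_hom]
lemmas P_d_closed = bhom_cl[OF cpx_diff[OF P]]

text \<open>In this direction the lifts come from the projectivity of P; for maps out of the bar
  resolution they come from \<open>bar_lifts\<close>.\<close>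

lemma inverse_exists:
 "\<exists>et. (\<forall>n. et n : bhom A (obj P n) (Bar n)) &
 (\<forall>n. ALL y:carrier (obj P n). diff Bc n (et n y) = et (n-1) (diff P n y)) &
 (ALL y:carrier (obj P 0). Ba A (et 0 y) = \<mu> y)"
proof (rule comparison_exists[OF P bar_resolution])
 show "\<mu> : bhom A (obj P 0) (reg_bim A)" by(rule \<mu>)
 show "\<mu> (diff P 1 x) = 0[A]" if "x :> obj P 1" for x by(rule \<mu>_d[OF that])
 show "carrier (obj P n) = {0[obj P n]}" if "n < 0" for n using R' that by blast
 show "lifts A (obj P 0) (obj Bc 0) (reg_bim A)" using P_lifts[OF bar_bim reg_bim] by simp
 show "lifts A (obj P n) (obj Bc n) (obj Bc (n-1))" for n using P_lifts[OF bar_bim bar_bim] by simp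
 fix et assume et: "et : bimodule_cpx_maps A P Bc" "commutes_with_diff P Bc et"
 and a: "!!x. x :> obj P 0 ==> Ba A (et 0 x) = \<mu> x"
 show ?thesis
 by(rule exI[of _ et]) (use cpx_maps_hom[OF et(1)] chain_mapD[OF P bar_is_cpx et] a in simp)
qed

lemma Tr_th:
 shows "Tr_map A P th n : ahom (trob A (obj Bc n)) (trob A (obj P n))"
 and "x :> obj Bc n ==> Tr_map A P th n (tr A (obj Bc n) x) = tr A (obj P n) (th n x)"
 by(rule Tr_map_tr[OF bar_is_cpx P cpx_maps_hom[OF th'(1)]], assumption?)+

lemma Tr_th_diff:
 assumes z: "z :> trob A (obj Bc n)"
 shows "diff (Tr A P) n (Tr_map A P th n z) = Tr_map A P th (n-1) (diff (Tr A Bc) n z)"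
proof -
 obtain x where x: "x :> obj Bc n" "z = tr A (obj Bc n) x"
 by(rule is_bimodule.tr_surj[OF cpx_bim[OF bar_is_cpx] z])
 have t: "th n x :> obj P n" using th_rules(1) x(1) by simp
 show ?thesis unfolding x(2) Tr_th(2)[OF x(1)] diff_Tr_tr[OF P t] diff_Tr_tr[OF bar_is_cpx x(1)]
 Tr_th(2)[OF bhom_cl[OF cpx_diff[OF bar_is_cpx] x(1)]] using th_diff x(1) by simp
qed

text \<open>Both composites of \<open>th\<close> with a comparison map backwards cover the identity
  of A, hence are homotopic to identities, and on cycles of the trace homotopies leave only
  boundaries.\<close>

lemma th_isomorphism:
 "bij_betw (homology_map (Tr A P) n (Tr_map A P th n)) (carrier (homology (Tr A Bc) n)) (carrier (homology (Tr A P) n))"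
proof -
 obtain et where et0: "(\<forall>n. et n : bhom A (obj P n) (Bar n)) &
 (\<forall>n. ALL y:carrier (obj P n). diff Bc n (et n y) = et (n-1) (diff P n y)) &
 (ALL y:carrier (obj P 0). Ba A (et 0 y) = \<mu> y)" using inverse_exists by(rule exE)
 have et: "et n : bhom A (obj P n) (Bar n)"
 and etd: "y :> obj P n ==> diff Bc n (et n y) = et (n-1) (diff P n y)"
 and eta: "y :> obj P 0 ==> Ba A (et 0 y) = \<mu> y" for n y
 using et0 by simp_all
 note etc = bhom_cl[OF et]
 have "\<exists>h. (\<forall>n. h n : bhom A (obj Bc n) (obj Bc (n+1))) &
 (\<forall>n. ALL x:carrier (obj Bc n). diff Bc (n+1) (h n x) +[obj Bc n] h (n-1) (diff Bc n x)
 = et n (th n x) -[obj Bc n] x)"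
 by(rule resolution_self_homotopy[OF bar_resolution, where g = "%n x. et n (th n x)"])
 (simp_all add: bar_lifts bar_bim bimodule_cpx_maps_def bhom_comp[OF th_hom et] etd th_diff th_rules(1) eta th_aug)
 then obtain h where h: "(\<forall>n. h n : bhom A (obj Bc n) (obj Bc (n+1))) &
 (\<forall>n. ALL x:carrier (obj Bc n). diff Bc (n+1) (h n x) +[obj Bc n] h (n-1) (diff Bc n x)
 = et n (th n x) -[obj Bc n] x)" by(rule exE)
 have "\<exists>H. (\<forall>n. H n : bhom A (obj P n) (obj P (n+1))) &
 (\<forall>n. ALL x:carrier (obj P n). diff P (n+1) (H n x) +[obj P n] H (n-1) (diff P n x) = th n (et n x) -[obj P n] x)"
 by(rule resolution_self_homotopy[OF R, where g = "%n x. th n (et n x)"])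
 (simp_all add: P_lifts PP.PB bimodule_cpx_maps_def bhom_comp[OF et th_hom] etd th_diff etc eta th_aug)
 then obtain H where H: "(\<forall>n. H n : bhom A (obj P n) (obj P (n+1))) &
 (\<forall>n. ALL x:carrier (obj P n). diff P (n+1) (H n x) +[obj P n] H (n-1) (diff P n x) = th n (et n x) -[obj P n] x)" by(rule exE)
 note Tth = Tr_th
 have et': "et n : bhom A (obj P n) (obj Bc n)" for n using et by simp
 have Tet: "Tr_map A Bc et n : ahom (trob A (obj P n)) (trob A (obj Bc n))"
 "x :> obj P n ==> Tr_map A Bc et n (tr A (obj P n) x) = tr A (obj Bc n) (et n x)" for n x
 by(rule Tr_map_tr[OF P bar_is_cpx et'], assumption?)+
 have bc: "th n x :> obj P n" if "x :> obj Bc n" for n x using th_rules(1) that by simp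
 show ?thesis
 proof (rule bij_homology_map[where f = "Tr_map A P th" and g = "Tr_map A Bc et"])
 show "group_cpx (Tr A Bc)" "group_cpx (Tr A P)" by(rule trace_group_cpx[OF bar_is_cpx], rule trace_group_cpx[OF P])
 show "Tr_map A P th n : ahom (obj (Tr A Bc) n) (obj (Tr A P) n)" for n using Tth(1)[of n] by simp
 show "Tr_map A Bc et n : ahom (obj (Tr A P) n) (obj (Tr A Bc) n)" for n using Tet(1)[of n] by simp
 show "diff (Tr A P) n (Tr_map A P th n z) = Tr_map A P th (n-1) (diff (Tr A Bc) n z)"
 if z: "z :> obj (Tr A Bc) n" for n z using Tr_th_diff[of z n] z by simp
 show "diff (Tr A Bc) n (Tr_map A Bc et n z) = Tr_map A Bc et (n-1) (diff (Tr A P) n z)"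
 if z: "z :> obj (Tr A P) n" for n z
 proof -
 obtain x where x: "x :> obj P n" "z = tr A (obj P n) x"
 by(rule is_bimodule.tr_surj[OF PP.PB]) (use z in simp)
 have e: "et n x :> obj Bc n" using etc[OF x(1)] by simp
 show ?thesis unfolding x(2) Tet(2)[OF x(1)] diff_Tr_tr[OF P x(1)] diff_Tr_tr[OF bar_is_cpx e]
 Tet(2)[OF P_d_closed[OF x(1)]] using etd x(1) by simp
 qed
 show "Tr_map A Bc et n (Tr_map A P th n z) -[obj (Tr A Bc) n] z : boundaries (Tr A Bc) n"
 if z: "z : cycles (Tr A Bc) n" for z
 proof -
 have zc: "z :> trob A (obj Bc n)" using z by(simp add: cycles_def)
 obtain x where x: "x :> obj Bc n" "z = tr A (obj Bc n) x"
 by(rule is_bimodule.tr_surj[OF cpx_bim[OF bar_is_cpx] zc])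
 have dx: "tr A (obj Bc (n-1)) (diff Bc n x) = 0[trob A (obj Bc (n-1))]"
 using z diff_Tr_tr[OF bar_is_cpx x(1)] x(2) by(simp add: cycles_def)
 have e: "et n (th n x) :> obj Bc n" using etc[OF bc[OF x(1)]] by simp
 have h1: "h n : bhom A (obj Bc n) (obj Bc (n+1))" "h (n-1) : bhom A (obj Bc (n-1)) (obj Bc n)"
 using spec[OF conjunct1[OF h], of n] spec[OF conjunct1[OF h], of "n - 1"] by simp_all
 have "tr A (obj Bc n) (et n (th n x) -[obj Bc n] x) : boundaries (Tr A Bc) n"
 using trace_homotopy_boundary[OF bar_is_cpx bar_is_cpx h1 x(1) dx] h[THEN conjunct2, rule_format, OF x(1)] by simp
 thus ?thesis
 unfolding x(2) Tth(2)[OF x(1)] Tet(2)[OF bc[OF x(1)]] using is_bimodule.tr_rules(5)[OF cpx_bim[OF bar_is_cpx] e x(1)] by simp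
 qed
 show "Tr_map A P th n (Tr_map A Bc et n z) -[obj (Tr A P) n] z : boundaries (Tr A P) n"
 if z: "z : cycles (Tr A P) n" for z
 proof -
 have zc: "z :> trob A (obj P n)" using z by(simp add: cycles_def)
 obtain x where x: "x :> obj P n" "z = tr A (obj P n) x" by(rule is_bimodule.tr_surj[OF PP.PB zc])
 have dx: "tr A (obj P (n-1)) (diff P n x) = 0[trob A (obj P (n-1))]"
 using z diff_Tr_tr[OF P x(1)] x(2) by(simp add: cycles_def)
 have e: "et n x :> obj Bc n" using etc[OF x(1)] by simp
 have h1: "H n : bhom A (obj P n) (obj P (n+1))" "H (n-1) : bhom A (obj P (n-1)) (obj P n)"
 using spec[OF conjunct1[OF H], of n] spec[OF conjunct1[OF H], of "n - 1"] by simp_all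
 have "tr A (obj P n) (th n (et n x) -[obj P n] x) : boundaries (Tr A P) n"
 using trace_homotopy_boundary[OF P P h1 x(1) dx] H[THEN conjunct2, rule_format, OF x(1)] by simp
 thus ?thesis
 unfolding x(2) Tet(2)[OF x(1)] Tth(2)[OF e] using trp_rules(5)[OF bc[OF e] x(1)] by simp
 qed
 qed
qed

text \<open>With H a homotopy from the identity to \<open>th\<close> after \<open>et\<close>, the
  transported contraction \<open>th\<close> s \<open>et\<close> contracts this composite up to the
  augmentation term; subtracting H corrects it to a contraction of the identity. All three maps are
  linear on the right.\<close>

lemma resolution_contraction: "\<exists>s e. right_contraction K A P \<mu> s e"
proof -
 obtain et where et0: "(\<forall>n. et n : bhom A (obj P n) (Bar n)) &
 (\<forall>n. ALL y:carrier (obj P n). diff Bc n (et n y) = et (n-1) (diff P n y)) &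
 (ALL y:carrier (obj P 0). Ba A (et 0 y) = \<mu> y)" using inverse_exists by(rule exE)
 have et: "et n : bhom A (obj P n) (Bar n)"
 and etd: "y :> obj P n ==> diff Bc n (et n y) = et (n-1) (diff P n y)"
 and eta: "y :> obj P 0 ==> Ba A (et 0 y) = \<mu> y" for n y
 using et0 by simp_all
 note etc = bhom_cl[OF et]
 have "\<exists>H. (\<forall>n. H n : bhom A (obj P n) (obj P (n+1))) &
 (\<forall>n. ALL x:carrier (obj P n). diff P (n+1) (H n x) +[obj P n] H (n-1) (diff P n x) = th n (et n x) -[obj P n] x)"
 by(rule resolution_self_homotopy[OF R, where g = "%n x. th n (et n x)"])
 (simp_all add: P_lifts PP.PB bimodule_cpx_maps_def bhom_comp[OF et th_hom] etd th_diff etc eta th_aug)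
 then obtain H where H0: "(\<forall>n. H n : bhom A (obj P n) (obj P (n+1))) &
 (\<forall>n. ALL x:carrier (obj P n). diff P (n+1) (H n x) +[obj P n] H (n-1) (diff P n x) = th n (et n x) -[obj P n] x)" by(rule exE)
 have H: "H n : bhom A (obj P n) (obj P (n+1))"
 and dH: "x :> obj P n ==> diff P (n+1) (H n x) +[obj P n] H (n-1) (diff P n x) = th n (et n x) -[obj P n] x" for n x
 using H0 by simp_all
 define s where "s n y = th (n+1) (bar_s n (et n y)) -[obj P (n+1)] H n y" for n y
 define e where "e = th 0 (pt [1[A], 1[A]])"
 have "right_contraction K A P \<mu> s e"
 proof
 show "carrier (obj P n) = {0[obj P n]}" if "n < 0" for n using R' that by blast
 show "s n : ahom (obj P n) (obj P (n+1))" for n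
 unfolding s_def[abs_def]
 by(rule ahom_minus[OF PP.PG ahom_comp[OF ahom_comp[OF bhom_ahom[OF et] bar_s_ahom] bhom_ahom[OF th_hom]] bhom_ahom[OF H]])
 show "e :> obj P 0" unfolding e_def by(rule th_rules(1)[OF bar_e_closed])
 fix n y assume y: "y :> obj P n"
 interpret N: is_bimodule K A "obj P n" by(rule PP.PB)
 interpret N1: is_bimodule K A "obj P (n+1)" by(rule PP.PB)
 have sc: "bar_s n (et n y) :> Bar (n+1)" by(rule ahom_closed[OF bar_s_ahom etc[OF y]])
 have u: "th (n+1) (bar_s n (et n y)) :> obj P (n+1)" by(rule th_rules(1)[OF sc])
 have Hy: "H n y :> obj P (n+1)" by(rule bhom_cl[OF H y])
 show "s n (ract (obj P n) y a) = ract (obj P (n+1)) (s n y) a" if a: "a :> A" for a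
 unfolding s_def bhom_ract[OF et a y] bar_s_ract[OF etc[OF y] a] th_rules(8)[OF a sc] bhom_ract[OF H a y]
 using N1.ract_rules(5)[OF a u Hy] by simp
 have dy: "diff P n y :> obj P (n-1)" by(rule P_d_closed[OF y])
 have Hm: "H (n-1) : bhom A (obj P (n-1)) (obj P n)" using H[of "n - 1"] by simp
 have dP: "diff P (n+1) : bhom A (obj P (n+1)) (obj P n)" using cpx_diff[OF P, of "n + 1"] by simp
 define a where "a = diff Bc (n+1) (bar_s n (et n y))"
 define b where "b = bar_s (n-1) (et (n-1) (diff P n y))"
 define c where "c = (if n = 0 then ract (Bar 0) (pt [1[A], 1[A]]) (Ba A (et n y)) else 0[Bar n])"
 have sum: "a +[Bar n] b +[Bar n] c = et n y"
 using bar_contraction[OF etc[OF y]] by(simp only: a_def b_def c_def etd[OF y])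
 interpret Bn: is_bimodule K A "Bar n" by(rule bar_bim)
 have ac: "a :> Bar n" unfolding a_def using bhom_cl[OF bar_diff_hom sc] by simp
 have bc: "b :> Bar n" unfolding b_def using ahom_closed[OF bar_s_ahom etc[OF dy]] by simp
 have \<mu>c: "n = 0 ==> \<mu> y :> A" using \<mu>_rules(1)[of y] y by simp
 have cc: "c :> Bar n" unfolding c_def
 using \<mu>c y eta[of y] is_bimodule.ract_closed[OF bar_bim bar_e_closed] by auto
 have tc: "th n c = (if n = 0 then ract (obj P 0) e (\<mu> y) else 0[obj P n])"
 unfolding c_def e_def using th_rules(8)[where n = 0, OF \<mu>c bar_e_closed] th_rules(3)[of n] eta[of y] y by auto
 have "diff P (n+1) (s n y) = th n a -[obj P n] diff P (n+1) (H n y)"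
 unfolding s_def bhom_rules(5)[OF PP.PB PP.PB dP u Hy] a_def using th_diff[OF sc] by simp
 moreover have "s (n-1) (diff P n y) = th n b -[obj P n] H (n-1) (diff P n y)"
 unfolding s_def b_def by simp
 moreover have "(th n a -[obj P n] p) +[obj P n] (th n b -[obj P n] q) +[obj P n] th n c = y"
 if p: "p :> obj P n" "q :> obj P n" and pq: "p +[obj P n] q = th n (et n y) -[obj P n] y" for p q
 proof -
 have t: "th n a :> obj P n" "th n b :> obj P n" "th n c :> obj P n"
 using th_rules(1)[OF ac] th_rules(1)[OF bc] th_rules(1)[OF cc] .
 have ts: "th n a +[obj P n] th n b +[obj P n] th n c = th n (et n y)"
 unfolding sum[symmetric] using ac bc cc by(simp add: th_rules)
 have "(th n a -[obj P n] p) +[obj P n] (th n b -[obj P n] q) +[obj P n] th n c = (th n a +[obj P n] th n b +[obj P n] th n c) -[obj P n] (p +[obj P n] q)"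
 using t p by(simp only: N.B.minus_eq N.B.minus_add N.B.a_ac N.B.a_closed N.B.a_inv_closed)
 also have "... = y"
 unfolding ts pq using y th_rules(1)[OF etc[OF y]] by(simp add: N.B.minus_eq N.B.minus_add N.B.minus_minus N.B.r_neg2 N.B.r_neg1)
 finally show ?thesis .
 qed
 ultimately show "diff P (n+1) (s n y) +[obj P n] s (n-1) (diff P n y) +[obj P n]
 (if n = 0 then ract (obj P 0) e (\<mu> y) else 0[obj P n]) = y"
 using bhom_cl[OF dP Hy] bhom_cl[OF Hm dy] dH[OF y] unfolding tc[symmetric] by simp
 qed
 thus ?thesis by blast
qed

abbreviation "Th \<equiv> tensor_map A P P th th"

lemma Th_hom: "Th n : bhom A (B.PP.T n) (PP.T n)"
 by(rule tensor_map_hom(1)[OF B.PP.tensor_product_axioms PP.tensor_product_axioms th'(1) th'(1)])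

lemmas Th_rules = bhom_rules[OF B.PP.tensor_bim PP.tensor_bim Th_hom]

lemma Th_diff: "t :> B.PP.T n ==> diff (tensor A P P) n (Th n t) = Th (n-1) (diff BBc n t)"
 by(rule tensor_map_chain[OF B.PP.tensor_product_axioms PP.tensor_product_axioms th' th'])

lemma Th_counit:
 assumes t: "t :> B.PP.T n"
 shows "cl n (Th n t) = th n (B.cl n t)" "cr n (Th n t) = th n (B.cr n t)"
 by(rule counit_natural[OF B.augmented_cpx_axioms augmented_cpx_axioms th'(1) _ t]; use th_aug in simp)+

lemma cl_rules: "x :> PP.T n ==> cl n x :> obj P n" "x :> PP.T n ==> cr n x :> obj P n"
 using bhom_cl[OF cl_hom] bhom_cl[OF cr_hom] by auto

text \<open>Both chain maps to P \<otimes> P have the same augmentation, by the normalisation of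
  \<Delta> and the counit of the bar diagonal. In all degrees \<open>tensor_exact\<close> reduces
  the lifting condition to exactness of P applied to the left counit.\<close>

lemma diagonal_homotopy:
 "\<exists>h. (\<forall>n. h n : bhom A (obj Bc n) (obj (tensor A P P) (n+1))) &
 (\<forall>n. ALL x:carrier (obj Bc n). diff (tensor A P P) (n+1) (h n x) +[obj (tensor A P P) n] h (n-1) (diff Bc n x)
 = \<Delta> n (th n x) -[PP.T n] Th n (bdel n x))"
proof (rule null_homotopy_0[OF bar_is_cpx PP.tensor_is_cpx])
 obtain s e where "right_contraction K A P \<mu> s e" using resolution_contraction by blast
 then interpret RC: right_contraction K A P \<mu> s e .
 show "x : diff (tensor A P P) (n+1) ` carrier (obj (tensor A P P) (n+1))"
 if n: "n > 0" and x: "x :> obj (tensor A P P) n" and dx: "diff (tensor A P P) n x = 0[obj (tensor A P P) (n-1)]" for n x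
 proof -
 have x': "x :> PP.T n" using x by simp
 have "diff P n (cl n x) = 0[obj P (n-1)]"
 using cl_diff[OF x'] dx bhom_rules(3)[OF PP.tensor_bim PP.PB cl_hom[of "n - 1"]] by simp
 hence "cl n x : diff P (n+1) ` carrier (obj P (n+1))" using R' n cl_rules(1)[OF x'] by blast
 thus ?thesis using RC.tensor_exact[OF x'] dx by simp
 qed
 show "carrier (obj Bc n) = {0[obj Bc n]}" if "n < 0" for n using bar_neg[OF that] by simp
 show "lifts A (obj Bc n) (obj (tensor A P P) (n+1)) (obj (tensor A P P) n)" for n
 using bar_lifts[OF PP.tensor_bim PP.tensor_bim] by simp
 show "(%x. \<Delta> n (th n x) -[PP.T n] Th n (bdel n x)) : bhom A (obj Bc n) (obj (tensor A P P) n)" for n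
 using bhom_minus[OF PP.tensor_bim bhom_comp[OF th_hom \<Delta>] bhom_comp[OF bar_delta_hom Th_hom]] by simp
 show "diff (tensor A P P) n (\<Delta> n (th n x) -[PP.T n] Th n (bdel n x))
 = \<Delta> (n-1) (th (n-1) (diff Bc n x)) -[PP.T (n-1)] Th (n-1) (bdel (n-1) (diff Bc n x))"
 if x: "x :> obj Bc n" for n x
 proof -
 have x': "x :> Bar n" using x by simp
 note t = th_rules(1)[OF x'] and b = bar_delta_rules(1)[OF x']
 show ?thesis
 unfolding bhom_rules(5)[OF PP.tensor_bim PP.tensor_bim PP.tensor_diff(1) \<Delta>_rules(1)[OF t] Th_rules(1)[OF b]]
 \<Delta>_diff[OF t] th_diff[OF x'] Th_diff[OF b] bar_delta_chain[OF x'] ..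
 qed
 show "\<Delta> 0 (th 0 x) -[PP.T 0] Th 0 (bdel 0 x) : diff (tensor A P P) 1 ` carrier (obj (tensor A P P) 1)"
 if x: "x :> obj Bc 0" for x
 proof -
 have x': "x :> Bar 0" using x by simp
 note t = th_rules(1)[OF x'] and b = bar_delta_rules(1)[OF x']
 interpret T: is_bimodule K A "PP.T 0" by(rule PP.tensor_bim)
 interpret Rb: is_bimodule K A "reg_bim A" by(rule reg_bim)
 let ?w = "\<Delta> 0 (th 0 x) -[PP.T 0] Th 0 (bdel 0 x)"
 have w: "?w :> PP.T 0" by(rule T.B.minus_closed[OF \<Delta>_rules(1)[OF t] Th_rules(1)[OF b]])
 have "carrier (PP.T (0-1)) = {0[PP.T (0-1)]}" using R' by(intro PP.tensor_neg) auto
 hence dw: "diff (tensor A P P) 0 ?w = 0[PP.T (0-1)]" using bhom_cl[OF PP.tensor_diff(1) w] by simp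
 have \<mu>m: "(%u. \<mu> (cl 0 u)) : bhom A (PP.T 0) (reg_bim A)" by(rule bhom_comp[OF cl_hom \<mu>])
 have "\<mu> (cl 0 ?w) = \<mu> (cl 0 (\<Delta> 0 (th 0 x))) -[reg_bim A] \<mu> (cl 0 (Th 0 (bdel 0 x)))"
 by(rule bhom_rules(5)[OF PP.tensor_bim reg_bim \<mu>m \<Delta>_rules(1)[OF t] Th_rules(1)[OF b]])
 also have "\<mu> (cl 0 (Th 0 (bdel 0 x))) = \<mu> (th 0 x)" unfolding Th_counit(1)[OF b] bar_delta_counit(1)[OF x'] ..
 also have "\<mu> (cl 0 (\<Delta> 0 (th 0 x))) = \<mu> (th 0 x)" by(rule diagonal[OF t])
 also have "\<mu> (th 0 x) -[reg_bim A] \<mu> (th 0 x) = 0[A]"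
 using Rb.B.a_minus_self[OF bhom_cl[OF \<mu> t]] by(simp add: regular_simps)
 finally have "cl 0 ?w : diff P 1 ` carrier (obj P 1)" using R' cl_rules(1)[OF w] by blast
 thus ?thesis using RC.tensor_exact[OF w dw] by simp
 qed
qed

text \<open>With the diagonal homotopy h, the operator at \<open>th\<close> x decomposes in the
  trace into the image c of the bar operator, the class of \<chi> at the swapped bar diagonal, the
  class of \<psi> at x, and a boundary d. Both \<chi> and \<psi> anticommute with the differentials
  and are therefore null-homotopic.\<close>

lemma op_comparison:
 assumes x: "x :> Bar n" and dx: "B.trp (n-1) (diff Bc n x) = 0[B.TP (n-1)]"
 shows "op n (trp n (th n x)) -[TP (1+n)] trace_hom A (obj P (1+n)) (th (1+n)) (B.op n (B.trp n x)) : boundaries (Tr A P) (1+n)"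
proof -
 obtain h where h0: "(\<forall>n. h n : bhom A (obj Bc n) (obj (tensor A P P) (n+1))) &
 (\<forall>n. ALL x:carrier (obj Bc n). diff (tensor A P P) (n+1) (h n x) +[obj (tensor A P P) n] h (n-1) (diff Bc n x)
 = \<Delta> n (th n x) -[PP.T n] Th n (bdel n x))" using diagonal_homotopy by(rule exE)
 have h: "h n : bhom A (Bar n) (PP.T (1+n))"
 and dh: "x :> Bar n ==> diff (tensor A P P) (1+n) (h n x) +[PP.T n] h (n-1) (diff Bc n x)
 = \<Delta> n (th n x) -[PP.T n] Th n (bdel n x)" for n x
 using h0[THEN conjunct1, rule_format, of n] h0[THEN conjunct2, rule_format, of x n] by(simp_all add: add.commute)
 have i: "1 + (n-1) = n" for n :: int by simp
 have hm: "h (n-1) : bhom A (Bar (n-1)) (PP.T n)" for n using h[of "n - 1"] unfolding i .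
 have dP: "diff P (1+n) : bhom A (obj P (1+n)) (obj P n)" for n using cpx_diff[OF P, of "1 + n"] by simp
 have dT: "diff (tensor A P P) (1+n) : bhom A (PP.T (1+n)) (PP.T n)" for n using PP.tensor_diff(1)[of "1 + n"] by simp
 \<comment> \<open>The defect of \<epsilon> at \<open>th\<close> x is the counit difference of
   \<Delta> (\<open>th\<close> x). Subtracting the counit difference of h removes it, because both
   counits of the transported bar diagonal equal \<open>th\<close> x.\<close>
 define \<psi> where "\<psi> n x = \<epsilon> n (th n x) -[obj P (1+n)] (cl (1+n) (h n x) -[obj P (1+n)] cr (1+n) (h n x))" for n x
 \<comment> \<open>By naturality of the counits, both summands have the same defect, so their
   difference anticommutes with the differentials.\<close>
 define \<chi> where "\<chi> n t = \<phi> n (Th n t) -[obj P (1+n)] th (1+n) (bar_phi n t)" for n t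
 have \<psi>h: "\<psi> n : bhom A (Bar n) (obj P (1+n))" for n
 unfolding \<psi>_def[abs_def]
 by(rule bhom_minus[OF PP.PB bhom_comp[OF th_hom \<epsilon>] bhom_minus[OF PP.PB bhom_comp[OF h cl_hom] bhom_comp[OF h cr_hom]]])
 have \<chi>h: "\<chi> n : bhom A (B.PP.T n) (obj P (1+n))" for n
 unfolding \<chi>_def[abs_def]
 using bhom_minus[OF PP.PB bhom_comp[OF Th_hom \<phi>] bhom_comp[OF B.\<phi> cpx_maps_hom[OF th'(1)]]] .
 have \<psi>d: "diff P (1+n) (\<psi> n x) +[obj P n] \<psi> (n-1) (diff Bc n x) = 0[obj P n]" if x: "x :> Bar n" for n x
 proof -
 interpret N: is_bimodule K A "obj P n" by(rule PP.PB)
 interpret N1: is_bimodule K A "obj P (1+n)" by(rule PP.PB)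
 note t = th_rules(1)[OF x] and b = bar_delta_rules(1)[OF x] and dx = bar_d_closed[OF x]
 note dr = bhom_rules[OF PP.PB PP.PB dP]
 note hx = bhom_cl[OF h x] and hdx = bhom_cl[OF hm dx]
 note dhx = bhom_cl[OF dT hx]
 note Dt = \<Delta>_rules(1)[OF t] and Tb = Th_rules(1)[OF b]
 have e1: "\<epsilon> n (th n x) :> obj P (1+n)" by(rule \<epsilon>_rules(1)[OF t])
 have e2: "\<epsilon> (n-1) (th (n-1) (diff Bc n x)) :> obj P n" using \<epsilon>_rules(1)[OF th_rules(1)[OF dx]] unfolding i .
 note c1 = cl_rules[OF hx]
 have 1: "diff P (1+n) (\<psi> n x) = diff P (1+n) (\<epsilon> n (th n x)) -[obj P n] (cl n (diff (tensor A P P) (1+n) (h n x)) -[obj P n] cr n (diff (tensor A P P) (1+n) (h n x)))"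
 unfolding \<psi>_def dr(5)[OF e1 N1.B.minus_closed[OF c1]] dr(5)[OF c1] using cl_diff[OF hx] cr_diff[OF hx] by simp
 have 2: "\<psi> (n-1) (diff Bc n x) = \<epsilon> (n-1) (th (n-1) (diff Bc n x)) -[obj P n]
 (cl n (h (n-1) (diff Bc n x)) -[obj P n] cr n (h (n-1) (diff Bc n x)))"
 unfolding \<psi>_def i ..
 have E: "diff P (1+n) (\<epsilon> n (th n x)) +[obj P n] \<epsilon> (n-1) (th (n-1) (diff Bc n x)) = cl n (\<Delta> n (th n x)) -[obj P n] cr n (\<Delta> n (th n x))"
 using \<epsilon>_diff[OF t] unfolding th_diff[OF x] .
 have L: "cl n (diff (tensor A P P) (1+n) (h n x)) +[obj P n] cl n (h (n-1) (diff Bc n x)) = cl n (\<Delta> n (th n x)) -[obj P n] th n x"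
 unfolding bhom_rules(2)[OF PP.tensor_bim PP.PB cl_hom dhx hdx, symmetric] dh[OF x]
 bhom_rules(5)[OF PP.tensor_bim PP.PB cl_hom Dt Tb] Th_counit(1)[OF b] bar_delta_counit(1)[OF x] ..
 have R: "cr n (diff (tensor A P P) (1+n) (h n x)) +[obj P n] cr n (h (n-1) (diff Bc n x)) = cr n (\<Delta> n (th n x)) -[obj P n] th n x"
 unfolding bhom_rules(2)[OF PP.tensor_bim PP.PB cr_hom dhx hdx, symmetric] dh[OF x]
 bhom_rules(5)[OF PP.tensor_bim PP.PB cr_hom Dt Tb] Th_counit(2)[OF b] bar_delta_counit(2)[OF x] ..
 show ?thesis unfolding 1 2
 by(rule N.B.homotopy_cancel[OF dr(1)[OF e1] e2 cl_rules(1)[OF dhx] cl_rules(1)[OF hdx] cl_rules(2)[OF dhx] cl_rules(2)[OF hdx]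
 cl_rules(1)[OF Dt] cl_rules(2)[OF Dt] t E L R])
 qed
 have \<chi>d: "diff P (1+n) (\<chi> n t) +[obj P n] \<chi> (n-1) (diff BBc n t) = 0[obj P n]"
 if t: "t :> B.PP.T n" for n t
 proof -
 interpret N: is_bimodule K A "obj P n" by(rule PP.PB)
 note dr = bhom_rules[OF PP.PB PP.PB dP]
 note Tt = Th_rules(1)[OF t] and dt = bhom_cl[OF B.PP.tensor_diff(1) t]
 have p1: "bar_phi n t :> Bar (1+n)" using B.\<phi>_rules(1)[OF t] by simp
 have p2: "bar_phi (n-1) (diff BBc n t) :> Bar n" using B.\<phi>_rules(1)[OF dt] by simp
 have d1: "diff Bc (1+n) (bar_phi n t) :> Bar n" using bar_d_closed[OF p1] by simp
 have q1: "\<phi> n (Th n t) :> obj P (1+n)" by(rule \<phi>_rules(1)[OF Tt])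
 have q2: "\<phi> (n-1) (Th (n-1) (diff BBc n t)) :> obj P n" using \<phi>_rules(1)[OF Th_rules(1)[OF dt]] unfolding i .
 have cb: "B.cl n t :> Bar n" "B.cr n t :> Bar n"
 using bhom_cl[OF B.cl_hom t] bhom_cl[OF B.cr_hom t] by simp_all
 have 1: "diff P (1+n) (\<chi> n t) = diff P (1+n) (\<phi> n (Th n t)) -[obj P n] th n (diff Bc (1+n) (bar_phi n t))"
 unfolding \<chi>_def dr(5)[OF q1 th_rules(1)[OF p1]] th_diff[OF p1] by simp
 have 2: "\<chi> (n-1) (diff BBc n t) = \<phi> (n-1) (Th (n-1) (diff BBc n t)) -[obj P n]
 th n (bar_phi (n-1) (diff BBc n t))"
 unfolding \<chi>_def i ..
 have E: "diff P (1+n) (\<phi> n (Th n t)) +[obj P n] \<phi> (n-1) (Th (n-1) (diff BBc n t)) = th n (B.cl n t) -[obj P n] th n (B.cr n t)"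
 using \<phi>_diff[OF Tt] unfolding Th_diff[OF t] Th_counit[OF t] .
 have "diff Bc (1+n) (bar_phi n t) +[Bar n] bar_phi (n-1) (diff BBc n t) = B.cl n t -[Bar n] B.cr n t"
 using B.\<phi>_diff[OF t] by simp
 hence F: "th n (diff Bc (1+n) (bar_phi n t)) +[obj P n] th n (bar_phi (n-1) (diff BBc n t)) = th n (B.cl n t) -[obj P n] th n (B.cr n t)"
 unfolding th_rules(2)[OF d1 p2, symmetric] th_rules(5)[OF cb, symmetric] by simp
 show ?thesis
 unfolding 1 2 N.B.add_minus_interchange[OF dr(1)[OF q1] th_rules(1)[OF d1] q2 th_rules(1)[OF p2]] E F
 by(rule N.B.a_minus_self[OF N.B.minus_closed[OF th_rules(1)[OF cb(1)] th_rules(1)[OF cb(2)]]])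
 qed
 have "\<exists>g g'. (\<forall>n. g n : bhom A (obj Bc n) (obj P (1 + n + 1))) &
 (\<forall>n. g' n : bhom A (obj Bc (n-1)) (obj P (1+n))) &
 (\<forall>n. ALL x:carrier (obj Bc n). \<psi> n x = diff P (1 + n + 1) (g n x) +[obj P (1+n)] g' n (diff Bc n x))"
 by(rule null_homotopy_1[OF bar_is_cpx R]) (simp_all add: bar_neg bar_lifts PP.PB \<psi>h \<psi>d)
 then obtain g g' where g0: "(\<forall>n. g n : bhom A (obj Bc n) (obj P (1 + n + 1))) &
 (\<forall>n. g' n : bhom A (obj Bc (n-1)) (obj P (1+n))) &
 (\<forall>n. ALL x:carrier (obj Bc n). \<psi> n x = diff P (1 + n + 1) (g n x) +[obj P (1+n)] g' n (diff Bc n x))"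
 by(elim exE) (rule that)
 have "\<exists>k k'. (\<forall>n. k n : bhom A (obj BBc n) (obj P (1 + n + 1))) &
 (\<forall>n. k' n : bhom A (obj BBc (n-1)) (obj P (1+n))) &
 (\<forall>n. ALL x:carrier (obj BBc n). \<chi> n x = diff P (1 + n + 1) (k n x) +[obj P (1+n)] k' n (diff BBc n x))"
 by(rule null_homotopy_1[OF B.PP.tensor_is_cpx R]) (simp_all add: bar_tensor_lifts PP.PB \<chi>h \<chi>d B.PP.tensor_neg bar_neg)
 then obtain k k' where k0: "(\<forall>n. k n : bhom A (obj BBc n) (obj P (1 + n + 1))) &
 (\<forall>n. k' n : bhom A (obj BBc (n-1)) (obj P (1+n))) &
 (\<forall>n. ALL x:carrier (obj BBc n). \<chi> n x = diff P (1 + n + 1) (k n x) +[obj P (1+n)] k' n (diff BBc n x))"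
 by(elim exE) (rule that)
 interpret G: group_cpx "Tr A P" by(rule trace_group_cpx[OF P])
 interpret M: is_bimodule K A "obj P (1+n)" by(rule PP.PB)
 interpret T: abelian_group "TP (1+n)" by(rule TPG)
 note t = th_rules(1)[OF x] and b = bar_delta_rules(1)[OF x] and xb = x[folded obj_bar] and hx = bhom_cl[OF h x]
 note dx' = dx[unfolded obj_bar]
 \<comment> \<open>\<open>t0\<close> and \<open>w\<close> represent the swapped bar diagonal and the
   swapped homotopy; the term h d x needs no representative since its class vanishes.\<close>
 obtain t0 where t0: "t0 :> B.PP.T n" "swap_tr A Bc Bc n (bdel n x) = B.trt n t0"
 using B.swap_rep[OF b] by(elim bexE)
 obtain w where w: "w :> PP.T (1+n)" "swap_tr A P P (1+n) (h n x) = trt (1+n) w"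
 using swap_rep[OF hx] by(elim bexE)
 note W = swap_rep_diff[OF hx w]
 have W1: "swap_tr A P P n (diff (tensor A P P) (1+n) (h n x)) = trt n (diff (tensor A P P) (1+n) w)" using W(1) by simp
 note dw = bhom_cl[OF dT w(1)] and dhx = bhom_cl[OF dT hx] and hdx = bhom_cl[OF hm bar_d_closed[OF x]]
 note Tt0 = Th_rules(1)[OF t0(1)] and Tb = Th_rules(1)[OF b] and Dt = \<Delta>_rules(1)[OF t]
 note sr = ahom_rules[OF PP.TG is_bimodule.TrG[OF PP.tensor_bim] PP.swap_tr_hom(1)]
 have z1: "swap_tr A P P n (h (n-1) (diff Bc n x)) = 0[trob A (PP.T n)]"
 proof -
 note th = trace_hom_tr[OF bar_bim PP.tensor_bim hm[of n]]
 have "tr A (PP.T n) (h (n-1) (diff Bc n x)) = trace_hom A (PP.T n) (h (n-1)) 0[trob A (Bar (n-1))]"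
 using th(2)[OF bar_d_closed[OF x]] dx' by simp
 also have "... = 0[trob A (PP.T n)]" by(rule ahom_rules(3)[OF TBG is_bimodule.TrG[OF PP.tensor_bim] th(1)])
 finally have z: "trt n (h (n-1) (diff Bc n x)) = 0[trob A (PP.T n)]" .
 show ?thesis
 unfolding PP.trace_swap_tr(2)[OF hdx, symmetric] z
 by(rule ahom_rules(3)[OF is_bimodule.TrG[OF PP.tensor_bim] is_bimodule.TrG[OF PP.tensor_bim] PP.trace_swap_tr(1)])
 qed
 have z2: "swap_tr A P P n (Th n (bdel n x)) = trt n (Th n t0)"
 unfolding swap_tr_natural[OF B.PP.tensor_product_axioms PP.tensor_product_axioms th'(1) th'(1) b] t0(2)
 by(rule trace_hom_tr(2)[OF B.PP.tensor_bim PP.tensor_bim Th_hom t0(1)])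
 interpret U: is_bimodule K A "PP.T n" by(rule PP.tensor_bim)
 interpret UT: abelian_group "trob A (PP.T n)" by(rule U.TrG)
 have "\<Delta> n (th n x) = Th n (bdel n x) +[PP.T n] (diff (tensor A P P) (1+n) (h n x) +[PP.T n] h (n-1) (diff Bc n x))"
 unfolding dh[OF x] using Dt Tb by(simp add: U.B.minus_eq U.B.a_ac U.B.r_neg1 U.B.r_neg2 U.B.r_neg)
 hence "swap_tr A P P n (\<Delta> n (th n x)) = trt n (Th n t0) +[trob A (PP.T n)] trt n (diff (tensor A P P) (1+n) w)"
 using sr(2)[OF Tb U.B.a_closed[OF dhx hdx]] sr(2)[OF dhx hdx] z1 z2 W1 UT.r_zero[OF trt_rules(1)[OF dw]] by simp
 also have "... = trt n (Th n t0 +[PP.T n] diff (tensor A P P) (1+n) w)" by(rule trt_rules(2)[OF Tt0 dw, symmetric])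
 finally have sw: "swap_tr A P P n (\<Delta> n (th n x)) = trt n (Th n t0 +[PP.T n] diff (tensor A P P) (1+n) w)" .
 have wt: "\<phi> n (diff (tensor A P P) (1+n) w) :> obj P (1+n)" by(rule \<phi>_rules(1)[OF dw])
 have dP2: "diff P (1 + (1+n)) (\<phi> (1+n) w) :> obj P (1+n)" by(rule bhom_cl[OF dP \<phi>_rules(1)[OF w(1)]])
 \<comment> \<open>The homotopy identity of \<phi> at w yields the counit difference of w. In the
   trace this becomes cr (h x) - cl (h x), which is exactly the correction term of \<psi>.\<close>
 have "diff P (1 + (1+n)) (\<phi> (1+n) w) +[obj P (1+n)] \<phi> n (diff (tensor A P P) (1+n) w) = cl (1+n) w -[obj P (1+n)] cr (1+n) w"
 using \<phi>_diff[OF w(1)] by simp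
 hence "trp (1+n) (diff P (1 + (1+n)) (\<phi> (1+n) w)) +[TP (1+n)] trp (1+n) (\<phi> n (diff (tensor A P P) (1+n) w))
 = trp (1+n) (cr (1+n) (h n x)) -[TP (1+n)] trp (1+n) (cl (1+n) (h n x))"
 unfolding trp_rules(2)[OF dP2 wt, symmetric] using cl_rules[OF w(1)] by(simp add: trp_rules(5) W(2,3))
 hence \<phi>w: "trp (1+n) (\<phi> n (diff (tensor A P P) (1+n) w))
 = -[TP (1+n)] trp (1+n) (diff P (1 + (1+n)) (\<phi> (1+n) w)) +[TP (1+n)]
 (trp (1+n) (cr (1+n) (h n x)) -[TP (1+n)] trp (1+n) (cl (1+n) (h n x)))"
 using T.r_neg1[OF trp_rules(1)[OF dP2] trp_rules(1)[OF wt]] by simp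
 have q: "\<phi> n (Th n t0) :> obj P (1+n)" by(rule \<phi>_rules(1)[OF Tt0])
 have p1: "bar_phi n t0 :> Bar (1+n)" using B.\<phi>_rules(1)[OF t0(1)] by simp
 note tp = th_rules(1)[OF p1]
 have X: "trp (1+n) (\<phi> n (Th n t0)) = trp (1+n) (th (1+n) (bar_phi n t0)) +[TP (1+n)] trp (1+n) (\<chi> n t0)"
 unfolding \<chi>_def trp_rules(5)[OF q tp] by(rule T.add_minus_right[OF trp_rules(1)[OF q] trp_rules(1)[OF tp], symmetric])
 have Bop: "trace_hom A (obj P (1+n)) (th (1+n)) (B.op n (B.trp n x)) = trp (1+n) (th (1+n) (bar_phi n t0))"
 proof -
 interpret Bm: is_bimodule K A "Bar (1+n)" by(rule bar_bim)
 have "B.op n (B.trp n x) = tr A (Bar (1+n)) (bar_phi n t0)"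
 unfolding B.op_rep[OF xb t0] using Bm.B.r_zero[OF p1] by simp
 thus ?thesis using trace_hom_tr(2)[OF bar_bim PP.PB th_hom p1] by simp
 qed
 define c where "c = trp (1+n) (th (1+n) (bar_phi n t0))"
 define d where "d = -[TP (1+n)] trp (1+n) (diff P (1 + (1+n)) (\<phi> (1+n) w))"
 have e: "\<epsilon> n (th n x) :> obj P (1+n)" by(rule \<epsilon>_rules(1)[OF t])
 note chx = cl_rules[OF hx]
 have \<chi>c: "\<chi> n t0 :> obj P (1+n)" and \<psi>c: "\<psi> n x :> obj P (1+n)"
 by(rule bhom_cl[OF \<chi>h t0(1)], rule bhom_cl[OF \<psi>h x])
 have cc: "c :> TP (1+n)" and dc: "d :> TP (1+n)"
 unfolding c_def d_def using trp_rules(1)[OF tp] T.a_inv_closed[OF trp_rules(1)[OF dP2]] .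
 \<comment> \<open>The counits of h, produced by \<phi>, are joined with \<epsilon> to form \<psi>;
   this regrouping is the cancellation behind the independence of the choices.\<close>
 have "op n (trp n (th n x)) = (c +[TP (1+n)] trp (1+n) (\<chi> n t0)) +[TP (1+n)]
 (d +[TP (1+n)] (trp (1+n) (cr (1+n) (h n x)) -[TP (1+n)] trp (1+n) (cl (1+n) (h n x)))) +[TP (1+n)] trp (1+n) (\<epsilon> n (th n x))"
 unfolding op_rep[OF t U.B.a_closed[OF Tt0 dw] sw]
 unfolding trp_rules(2)[OF \<phi>_rules(1)[OF U.B.a_closed[OF Tt0 dw]] e]
 unfolding \<phi>_rules(2)[OF Tt0 dw] trp_rules(2)[OF q wt] X \<phi>w c_def d_def ..
 also have "... = c +[TP (1+n)] (trp (1+n) (\<chi> n t0) +[TP (1+n)] (d +[TP (1+n)] trp (1+n) (\<psi> n x)))"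
 unfolding \<psi>_def trp_rules(5)[OF e M.B.minus_closed[OF chx]] trp_rules(5)[OF chx]
 using cc dc trp_rules(1)[OF \<chi>c] trp_rules(1)[OF e] trp_rules(1)[OF chx(1)] trp_rules(1)[OF chx(2)]
 by(simp only: T.minus_eq T.minus_add T.minus_minus T.a_ac T.a_closed T.a_inv_closed)
 finally have O: "op n (trp n (th n x)) = c +[TP (1+n)] (trp (1+n) (\<chi> n t0) +[TP (1+n)] (d +[TP (1+n)] trp (1+n) (\<psi> n x)))" .
 \<comment> \<open>The boundary of \<open>t0\<close> represents the swap of the diagonal of d x, and
   the class of d x is zero. So \<open>t0\<close> qualifies for
   \<open>trace_homotopy_boundary\<close> in the tensor square.\<close>
 have dt0: "tr A (obj BBc (n-1)) (diff BBc n t0)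
 = 0[trob A (obj BBc (n-1))]"
 proof -
 note th = trace_hom_tr[OF bar_bim B.PP.tensor_bim bar_delta_hom[of "n - 1"]]
 note TT = is_bimodule.TrG[OF B.PP.tensor_bim]
 have "tr A (B.PP.T (n-1)) (bdel (n-1) (diff Bc n x)) = trace_hom A (B.PP.T (n-1)) (bdel (n-1)) 0[trob A (Bar (n-1))]"
 using th(2)[OF bar_d_closed[OF x]] dx' by simp
 also have "... = 0[trob A (B.PP.T (n-1))]" by(rule ahom_rules(3)[OF TBG TT th(1)])
 finally have z: "tr A (B.PP.T (n-1)) (bdel (n-1) (diff Bc n x)) = 0[trob A (B.PP.T (n-1))]" .
 have "B.trt (n-1) (diff BBc n t0) = swap_tr A Bc Bc (n-1) (bdel (n-1) (diff Bc n x))"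
 using B.swap_rep_diff(1)[OF b t0] bar_delta_chain[OF x] by simp
 also have "... = 0[trob A (B.PP.T (n-1))]"
 unfolding B.PP.trace_swap_tr(2)[OF bar_delta_rules(1)[OF bar_d_closed[OF x]], symmetric] z
 by(rule ahom_rules(3)[OF TT TT B.PP.trace_swap_tr(1)])
 finally show ?thesis by simp
 qed
 have \<chi>b: "trp (1+n) (\<chi> n t0) : boundaries (Tr A P) (1+n)"
 proof -
 have t0': "t0 :> obj BBc n" using t0(1) by simp
 show ?thesis unfolding k0[THEN conjunct2, THEN conjunct2, rule_format, OF t0']
 by(rule trace_homotopy_boundary[OF B.PP.tensor_is_cpx P k0[THEN conjunct1, rule_format] k0[THEN conjunct2, THEN conjunct1, rule_format] t0' dt0])
 qed
 have \<psi>b: "trp (1+n) (\<psi> n x) : boundaries (Tr A P) (1+n)"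
 unfolding g0[THEN conjunct2, THEN conjunct2, rule_format, OF xb]
 by(rule trace_homotopy_boundary[OF bar_is_cpx P g0[THEN conjunct1, rule_format] g0[THEN conjunct2, THEN conjunct1, rule_format] xb dx])
 have db: "d : boundaries (Tr A P) (1+n)"
 proof -
 have "trp (1 + (1+n)) (\<phi> (1+n) w) :> obj (Tr A P) (1 + n + 1)"
 using trp_rules(1)[OF \<phi>_rules(1)[OF w(1)]] by(simp add: add.commute)
 from G.boundariesI[OF this] have "trp (1+n) (diff P (1 + (1+n)) (\<phi> (1+n) w)) : boundaries (Tr A P) (1+n)"
 using diff_Tr_tr[OF P \<phi>_rules(1)[OF w(1)]] by(simp add: add.commute)
 from G.boundaries_subgroup(3)[OF this] show ?thesis by(simp add: d_def)
 qed
 have "op n (trp n (th n x)) -[TP (1+n)] c = trp (1+n) (\<chi> n t0) +[TP (1+n)] (d +[TP (1+n)] trp (1+n) (\<psi> n x))"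
 unfolding O using T.add_minus_cancel[of c _ "0[TP (1+n)]"] cc dc trp_rules(1)[OF \<chi>c] trp_rules(1)[OF \<psi>c] by simp
 moreover have "... : boundaries (Tr A P) (1+n)"
 using G.boundaries_subgroup(2)[of _ "1 + n"] \<chi>b \<psi>b db by simp
 ultimately show ?thesis unfolding Bop c_def by simp
qed

end

context resolution_comparison
begin

lemma Tr_th_boundary:
 assumes b: "b : boundaries (Tr A Bc) n"
 shows "Tr_map A P th n b : boundaries (Tr A P) n"
proof -
 interpret G: group_cpx "Tr A Bc" by(rule trace_group_cpx[OF bar_is_cpx])
 interpret H: group_cpx "Tr A P" by(rule trace_group_cpx[OF P])
 obtain y where y: "y :> obj (Tr A Bc) (n+1)" "b = diff (Tr A Bc) (n+1) y" by(rule G.boundariesE[OF b])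
 have y': "y :> trob A (obj Bc (n+1))" using y(1) by simp
 have "Tr_map A P th n b = diff (Tr A P) (n+1) (Tr_map A P th (n+1) y)"
 using Tr_th_diff[OF y'] y(2) by simp
 also have "... : boundaries (Tr A P) n" using ahom_closed[OF Tr_th(1) y'] by(intro H.boundariesI) simp
 finally show ?thesis .
qed

lemma bar_op: assumes z: "z :> TB (int n)"
 shows "B.op (int n) z = connes_trace n z"
proof -
 obtain x where x: "x :> Bi n" "z = tr A (Bi n) x" by(rule is_bimodule.tr_surj[OF bar_bim z])
 have i: "1 + int n = int (n+1)" by simp
 have x': "x :> obj Bc (int n)" using x(1) by simp
 have o: "B.op (int n) z = trace_hom A (Bi (n+1)) (bar_phi (int n)) (swap_tr A Bc Bc (int n) (bdel (int n) x))
 +[TB (int (n+1))] tr A (Bi (n+1)) 0[Bi (n+1)]"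
 using B.op_tr[OF x'] unfolding obj_bar i x(2) .
 have c: "connes_trace n z :> TB (int (n+1))" by(rule ahom_closed[OF connes_trace(1) z])
 show ?thesis unfolding o phi_swap_delta[OF x(1)] x(2)[symmetric] is_bimodule.tr_rules(3)[OF bar_bim]
 by(rule abelian_monoid.r_zero[OF abelian_group.axioms(1)[OF TBG] c])
qed

text \<open>Evaluated on a representative cycle, the operator of P agrees with the image of the
  first half by \<open>op_comparison\<close> and \<open>bar_op\<close>, while the second half is a
  boundary by \<open>connes_trace'_boundary\<close> and \<open>th\<close> preserves
  boundaries.\<close>

lemma connes_comparison:
 assumes z: "z :> HH K A (int n)"
 shows "homology_map (Tr A (shift P 1)) (int n) (op (int n)) (homology_map (Tr A P) (int n) (Tr_map A P th (int n)) z)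
 = homology_map (Tr A P) (int (n+1)) (Tr_map A P th (int (n+1))) (connes K A n z)"
proof -
 let ?CB = "Tr A Bc" and ?CP = "Tr A P" and ?CS = "Tr A (shift P 1)"
 have GB: "group_cpx ?CB" and GP: "group_cpx ?CP" and GS: "group_cpx ?CS"
 using trace_group_cpx bar_is_cpx P shift_is_cpx[OF P] by blast+
 interpret B': group_cpx ?CB by(rule GB)
 interpret P': group_cpx ?CP by(rule GP)
 have i: "int (n+1) = 1 + int n" by simp
 obtain z0 where z0: "z0 : cycles ?CB (int n)" and zz: "z = boundaries ?CB (int n) +>\<^bsub>obj ?CB (int n)\<^esub> z0"
 using z by(auto simp: HH_def B'.carrier_homology)
 have zc: "z0 :> TB (int n)" and dz: "diff ?CB (int n) z0 = 0[TB (int n - 1)]" using z0 by(simp_all add: cycles_def)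
 have zo: "z0 :> (obj ?CB (int n))" using zc by simp
 obtain x where x: "x :> Bi n" "z0 = tr A (Bi n) x" by(rule is_bimodule.tr_surj[OF bar_bim zc])
 have xb: "x :> obj Bc (int n)" using x(1) by simp
 have dx: "B.trp (int n - 1) (diff Bc (int n) x) = 0[B.TP (int n - 1)]"
 using dz diff_Tr_tr[OF bar_is_cpx xb] by(simp add: x(2))
 let ?conn = "%z. tpow_to_trace_bar K A (n+1) (connes_tpow K A n (trace_bar_to_tpow K A n z))"
 let ?c = "%z. connes_trace n z +[TB (int (n+1))] connes_trace' n z"
 have ch: "?c : ahom (TB (int n)) (TB (int (n+1)))" by(rule ahom_plus[OF TBG connes_trace(1) connes_trace'(1)])
 have add_closed: "u +[TB (int n)] v :> TB (int n)" if "u :> TB (int n)" "v :> TB (int n)" for u v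
 using that by simp
 have thz: "Tr_map A P th (int n) z0 = trp (int n) (th (int n) x)" using Tr_th(2)[OF xb] by(simp add: x(2))
 note t = th_rules(1)[OF x(1)]
 have 1: "homology_map ?CP (int n) (Tr_map A P th (int n)) z = boundaries ?CP (int n) +>\<^bsub>obj ?CP (int n)\<^esub> trp (int n) (th (int n) x)"
 unfolding zz thz[symmetric]
 by(rule homology_map_hcls[OF GB GP])
 (use ahom_add[OF Tr_th(1)[of "int n"]] ahom_closed[OF Tr_th(1)[of "int n"]] Tr_th_boundary zc in simp_all)
 have 2: "homology_map ?CS (int n) (op (int n)) (boundaries ?CP (int n) +>\<^bsub>obj ?CP (int n)\<^esub> trp (int n) (th (int n) x))
 = boundaries ?CS (int n) +>\<^bsub>obj ?CS (int n)\<^esub> op (int n) (trp (int n) (th (int n) x))"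
 by(rule homology_map_hcls[OF GP GS])
 (use ahom_add[OF op_ahom[of "int n"]] ahom_closed[OF op_ahom[of "int n"]] op_boundary boundaries_Tr_shift[OF P] trp_rules(1)[OF t] in simp_all)
 have cb: "?c b : boundaries ?CB (int (n+1))" if b: "b : boundaries ?CB (int n)" for b
 proof -
 have bc: "b :> TB (int n)" and db: "diff ?CB (int n) b = 0[TB (int n - 1)]"
 using B'.boundaries_cycles[OF b] by(simp_all add: cycles_def)
 have "connes_trace n b : boundaries ?CB (int (n+1))" using B.op_boundary[OF b] unfolding bar_op[OF bc] i .
 thus ?thesis using B'.boundaries_subgroup(2)[OF _ connes_trace'_boundary[OF bc db]] by simp
 qed
 have 3: "connes K A n z = boundaries ?CB (int (n+1)) +>\<^bsub>obj ?CB (int (n+1))\<^esub> ?conn z0"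
 unfolding connes_def zz
 proof (rule homology_map_hcls[OF GB GB _ _ zo])
 fix u v assume "u :> (obj ?CB (int n))" "v :> (obj ?CB (int n))"
 hence u: "u :> TB (int n)" and v: "v :> TB (int n)" by simp_all
 show "?conn (u +[obj ?CB (int n)] v) = ?conn u +[obj ?CB (int (n+1))] ?conn v"
 unfolding obj_Tr obj_bar connes_chain[OF u] connes_chain[OF v] connes_chain[OF add_closed[OF u v]]
 by(rule ahom_add[OF ch u v])
 next
 fix b assume b: "b : boundaries ?CB (int n)"
 have bc: "b :> TB (int n)" using B'.boundaries_closed[OF b] by simp
 show "?conn b : boundaries ?CB (int (n+1))" unfolding connes_chain[OF bc] by(rule cb[OF b])
 next
 show "?conn z0 :> (obj ?CB (int (n+1)))" unfolding obj_Tr obj_bar connes_chain[OF zc] by(rule ahom_closed[OF ch zc])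
 qed
 have cz: "?conn z0 :> trob A (obj Bc (int (n+1)))"
 unfolding obj_bar connes_chain[OF zc] by(rule ahom_closed[OF ch zc])
 have 4: "homology_map ?CP (int (n+1)) (Tr_map A P th (int (n+1))) (connes K A n z)
 = boundaries ?CP (int (n+1)) +>\<^bsub>obj ?CP (int (n+1))\<^esub> Tr_map A P th (int (n+1)) (?conn z0)"
 unfolding 3
 proof (rule homology_map_hcls[OF GB GP])
 show "Tr_map A P th (int (n+1)) (u +[obj ?CB (int (n+1))] v) = Tr_map A P th (int (n+1)) u +[obj ?CP (int (n+1))] Tr_map A P th (int (n+1)) v"
 if "u :> (obj ?CB (int (n+1)))" "v :> (obj ?CB (int (n+1)))" for u v
 using ahom_add[OF Tr_th(1)] that unfolding obj_Tr .
 show "Tr_map A P th (int (n+1)) b : boundaries ?CP (int (n+1))" if "b : boundaries ?CB (int (n+1))" for b by(rule Tr_th_boundary[OF that])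
 show "?conn z0 :> (obj ?CB (int (n+1)))" using cz unfolding obj_Tr .
 show "Tr_map A P th (int (n+1)) (?conn z0) :> (obj ?CP (int (n+1)))" using ahom_closed[OF Tr_th(1) cz] unfolding obj_Tr .
 qed
 interpret T: abelian_group "TP (1 + int n)" by(rule TPG)
 have Tm: "Tr_map A P th (1 + int n) = trace_hom A (obj P (1 + int n)) (th (1 + int n))" by(simp add: Tr_map_def)
 have th1: "Tr_map A P th (1 + int n) : ahom (TB (int (n+1))) (TP (1 + int n))" using Tr_th(1)[of "1 + int n"] unfolding obj_bar i .
 have ct: "connes_trace n z0 :> TB (int (n+1))" and ct': "connes_trace' n z0 :> TB (int (n+1))"
 using ahom_closed[OF connes_trace(1) zc] ahom_closed[OF connes_trace'(1) zc] .
 have a: "op (int n) (trp (int n) (th (int n) x)) :> TP (1 + int n)" by(rule ahom_closed[OF op_ahom trp_rules(1)[OF t]])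
 let ?u = "Tr_map A P th (1 + int n) (connes_trace n z0)" and ?v = "Tr_map A P th (1 + int n) (connes_trace' n z0)"
 have u: "?u :> TP (1 + int n)" and v: "?v :> TP (1 + int n)"
 using ahom_closed[OF th1 ct] ahom_closed[OF th1 ct'] .
 have conn: "Tr_map A P th (1 + int n) (?conn z0) = ?u +[TP (1 + int n)] ?v"
 unfolding connes_chain[OF zc] by(rule ahom_add[OF th1 ct ct'])
 have "op (int n) (trp (int n) (th (int n) x)) -[TP (1 + int n)] ?u : boundaries ?CP (1 + int n)"
 using op_comparison[OF x(1) dx] unfolding Tm[symmetric] obj_bar x(2)[symmetric] bar_op[OF zc] .
 moreover have "?v : boundaries ?CP (1 + int n)"
 by(rule Tr_th_boundary) (use connes_trace'_boundary[OF zc dz] in \<open>simp only: i\<close>)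
 ultimately have "(op (int n) (trp (int n) (th (int n) x)) -[TP (1 + int n)] ?u) +[TP (1 + int n)] -[TP (1 + int n)] ?v : boundaries ?CP (1 + int n)"
 using P'.boundaries_subgroup(2,3)[of _ "1 + int n"] by simp
 moreover have "(op (int n) (trp (int n) (th (int n) x)) -[TP (1 + int n)] ?u) +[TP (1 + int n)] -[TP (1 + int n)] ?v
 = op (int n) (trp (int n) (th (int n) x)) -[TP (1 + int n)] (?u +[TP (1 + int n)] ?v)"
 using a u v by(simp only: T.minus_eq T.minus_add T.a_assoc T.a_closed T.a_inv_closed)
 ultimately have d: "op (int n) (trp (int n) (th (int n) x)) -[obj ?CP (1 + int n)] Tr_map A P th (1 + int n) (?conn z0) : boundaries ?CP (1 + int n)"
 unfolding conn obj_Tr by simp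
 have "boundaries ?CP (1 + int n) +>\<^bsub>obj ?CP (1 + int n)\<^esub> op (int n) (trp (int n) (th (int n) x))
 = boundaries ?CP (1 + int n) +>\<^bsub>obj ?CP (1 + int n)\<^esub> Tr_map A P th (1 + int n) (?conn z0)"
 by(rule P'.hcls_eqI[OF _ _ d]) (use a T.a_closed[OF u v] conn in \<open>simp_all only: obj_Tr\<close>)
 thus ?thesis unfolding 1 2 4 unfolding i by(simp add: boundaries_Tr_shift[OF P])
qed

end

section \<open>The signs of the shift and the assembly of the result\<close>

lemma (in assoc_algebra) bd_shift:
 assumes C: "is_bimodule_cpx K A C" and P: "is_bimodule_cpx K A P"
 and f: "f : bimodule_cpx_maps A C (shift P 1)" and x: "x :> obj C n"
 shows "bd C (shift P 1) f n x = diff P (1+n) (f n x) +[obj P n] f (n-1) (diff C n x)"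
proof -
 interpret N: is_bimodule K A "obj P n" by(rule cpx_bim[OF P])
 have fh: "f n : bhom A (obj C n) (obj P (1+n))" for n using cpx_maps_hom[OF f, of n] by simp
 have a: "f (n-1) (diff C n x) :> obj P n"
 using bhom_cl[OF fh bhom_cl[OF cpx_diff[OF C] x]] by simp
 have b: "diff P (1+n) (f n x) :> obj P n"
 using bhom_cl[OF cpx_diff[OF P] bhom_cl[OF fh x]] by simp
 have "bd C (shift P 1) f n x = f (n-1) (diff C n x) -[obj P n] (-[obj P n] diff P (1+n) (f n x))"
 by(simp add: bd_def shift_def signed_def)
 thus ?thesis using a b by(simp add: N.B.minus_eq N.B.minus_minus N.B.a_comm)
qed

lemma (in assoc_algebra) diff_Tr_shift:
 assumes P: "is_bimodule_cpx K A P" and u: "u :> trob A (obj P (1+n))"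
 shows "diff (Tr A (shift P 1)) n u = -[trob A (obj P n)] diff (Tr A P) (1+n) u"
proof -
 obtain p where p: "p :> obj P (1+n)" "u = tr A (obj P (1+n)) p"
 by(rule is_bimodule.tr_surj[OF cpx_bim[OF P] u])
 have dp: "diff P (1+n) p :> obj P n" using bhom_cl[OF cpx_diff[OF P] p(1)] by simp
 have ps: "p :> obj (shift P 1) n" using p(1) by simp
 have "diff (Tr A (shift P 1)) n u = tr A (obj P n) (-[obj P n] diff P (1+n) p)"
 using diff_Tr_tr[OF shift_is_cpx[OF P] ps] by(simp add: p(2) shift_def signed_def)
 also have "... = -[trob A (obj P n)] tr A (obj P n) (diff P (1+n) p)"
 by(rule is_bimodule.tr_rules(4)[OF cpx_bim[OF P] dp])
 finally show ?thesis using diff_Tr_tr[OF P p(1)] by(simp add: p(2))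
qed

theorem corollary14:
  fixes K :: "'k ring" and A :: "('k, 'a) module"
    and P :: "('a, 'p) bimodule_cpx" and \<mu> :: "'p \<Rightarrow> 'a"
    and \<Delta> :: "int \<Rightarrow> 'p \<Rightarrow> (('p, 'p) tensor_gen \<Rightarrow>\<^sub>0 int) set"
    and \<phi> :: "int \<Rightarrow> (('p, 'p) tensor_gen \<Rightarrow>\<^sub>0 int) set \<Rightarrow> 'p"
    and \<epsilon> :: "int \<Rightarrow> 'p \<Rightarrow> 'p"
  assumes "assoc_algebra K A"
    and "projective_resolution K A P \<mu>"
    and "diagonal_2_approximation A P \<mu> \<Delta>"
    and "\<phi> \<in> bimodule_cpx_maps A (tensor A P P) (shift P 1)"
    and "\<And>n t. t \<in> carrier (obj (tensor A P P) n) \<Longrightarrow>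
           bd (tensor A P P) (shift P 1) \<phi> n t = counit_difference A P \<mu> n t"
    and "\<epsilon> \<in> bimodule_cpx_maps A P (shift P 1)"
    and "\<And>n x. x \<in> carrier (obj P n) \<Longrightarrow>
           bd P (shift P 1) \<epsilon> n x = counit_difference A P \<mu> n (\<Delta> n x)"
  shows "induces_on_HH K A P \<mu>
    (\<lambda>n z. Tr_map A (shift P 1) \<phi> n (trace_swap A P P n (Tr_map A (tensor A P P) \<Delta> n z))
           \<oplus>\<^bsub>obj (Tr A (shift P 1)) n\<^esub> Tr_map A (shift P 1) \<epsilon> n z)
    (connes K A)"
proof -
 interpret assoc_algebra K A by(rule assms(1))
 note R = projective_resolution_resolution[OF assms(2)]
 interpret aug: augmented_cpx K A P \<mu> by(rule resolution_augmented[OF R])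
 note Pc = aug.P
 have D: "\<Delta> : bimodule_cpx_maps A P (tensor A P P)" "commutes_with_diff P (tensor A P P) \<Delta>"
 and Du: "!!n x. x :> obj P n ==> left_unit A (stalk A) n (tensor_map A (stalk A) (stalk A)
 (extend_by_zero A \<mu>) (extend_by_zero A \<mu>) n (\<Delta> n x)) = extend_by_zero A \<mu> n x"
 using assms(3) by(simp_all add: diagonal_2_approximation_def)
 have Dh: "\<Delta> n : bhom A (obj P n) (aug.PP.T n)" for n using cpx_maps_hom[OF D(1), of n] by simp
 interpret O: trace_operator K A P \<mu> \<Delta> \<phi> \<epsilon>
 proof
 show "\<Delta> n : bhom A (obj P n) (aug.PP.T n)" for n by(rule Dh)
 show "diff (tensor A P P) n (\<Delta> n x) = \<Delta> (n-1) (diff P n x)" if "x :> obj P n" for n x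
 by(rule chain_mapD[OF Pc aug.PP.tensor_is_cpx D that])
 show "\<phi> n : bhom A (aug.PP.T n) (obj P (1+n))" for n using cpx_maps_hom[OF assms(4), of n] by simp
 show "\<epsilon> n : bhom A (obj P n) (obj P (1+n))" for n using cpx_maps_hom[OF assms(6), of n] by simp
 show "diff P (1+n) (\<phi> n t) +[obj P n] \<phi> (n-1) (diff (tensor A P P) n t) = aug.cl n t -[obj P n] aug.cr n t"
 if "t :> aug.PP.T n" for n t
 using bd_shift[OF aug.PP.tensor_is_cpx Pc assms(4), of t n] assms(5)[of t n] that by(simp add: aug.counit_difference_eq)
 show "diff P (1+n) (\<epsilon> n x) +[obj P n] \<epsilon> (n-1) (diff P n x) = aug.cl n (\<Delta> n x) -[obj P n] aug.cr n (\<Delta> n x)"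
 if "x :> obj P n" for n x
 using bd_shift[OF Pc Pc assms(6) that] assms(7)[OF that] by(simp add: aug.counit_difference_eq)
 qed
 have F: "(%n z. Tr_map A (shift P 1) \<phi> n (trace_swap A P P n (Tr_map A (tensor A P P) \<Delta> n z))
 +[obj (Tr A (shift P 1)) n] Tr_map A (shift P 1) \<epsilon> n z) = O.op"
 by(simp add: fun_eq_iff Tr_map_def O.op_def)
 \<comment> \<open>The bar modules lift against any homomorphism with large enough image, so a
   comparison map exists and the quantification over comparison maps is not vacuous.\<close>
 have ne: "comparison_maps K A P \<mu> ~= {}"
 proof (rule comparison_exists[OF bar_is_cpx R, where \<nu> = "Ba A"])
 show "Ba A : bhom A (obj (bar K A) 0) (reg_bim A)" using Ba(1) by simp
 show "Ba A (diff (bar K A) 1 x) = 0[A]" if "x :> obj (bar K A) 1" for x using bar_augmentation_diff that by simp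
 show "carrier (obj (bar K A) n) = {0[obj (bar K A) n]}" if "n < 0" for n using bar_neg[OF that] by simp
 show "lifts A (obj (bar K A) 0) (obj P 0) (reg_bim A)" using bar_lifts[OF aug.PP.PB reg_bim] by simp
 show "lifts A (obj (bar K A) n) (obj P n) (obj P (n-1))" for n using bar_lifts[OF aug.PP.PB aug.PP.PB] by simp
 show "comparison_maps K A P \<mu> ~= {}" if "th : bimodule_cpx_maps A (bar K A) P" "commutes_with_diff (bar K A) P th"
 "!!x. x :> obj (bar K A) 0 ==> \<mu> (th 0 x) = Ba A x" for th
 using that by(auto simp: comparison_maps_def)
 qed
 have G1: "O.op : module_cpx_maps K (Tr A P) (Tr A (shift P 1))"
 using O.op_ahom O.op_scal by(simp add: module_cpx_maps_def module_hom_def)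
 have G2: "commutes_with_diff (Tr A P) (Tr A (shift P 1)) O.op"
 unfolding commutes_with_diff_def
 proof (intro allI ballI)
 fix n z assume "z :> obj (Tr A P) n"
 hence z: "z :> O.TP n" by simp
 interpret T: abelian_group "O.TP n" by(rule O.TPG)
 interpret G: group_cpx "Tr A P" by(rule trace_group_cpx[OF Pc])
 have oz: "O.op n z :> O.TP (1+n)" by(rule ahom_closed[OF O.op_ahom z])
 have a: "diff (Tr A P) (1+n) (O.op n z) :> O.TP n" using G.d_rules(1)[of "O.op n z" "1 + n"] oz by simp
 have dz: "diff (Tr A P) n z :> O.TP (n-1)" using G.d_rules(1)[of z n] z by simp
 have b: "O.op (n-1) (diff (Tr A P) n z) :> O.TP n" using ahom_closed[OF O.op_ahom dz] by simp
 have "bd (Tr A P) (Tr A (shift P 1)) O.op n z = O.op (n-1) (diff (Tr A P) n z) -[O.TP n] (-[O.TP n] diff (Tr A P) (1+n) (O.op n z))"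
 unfolding bd_def diff_Tr_shift[OF Pc oz] by simp
 also have "... = 0[O.TP n]"
 using O.op_diff[OF z] a b by(simp add: T.minus_eq T.minus_minus T.a_comm)
 finally show "bd (Tr A P) (Tr A (shift P 1)) O.op n z = 0[obj (Tr A (shift P 1)) (n-1)]" by simp
 qed
 have G3: "(\<forall>n. bij_betw (homology_map (Tr A P) n (Tr_map A P th n)) (carrier (HH K A n)) (carrier (homology (Tr A P) n))) &
 (\<forall>n. ALL z:carrier (HH K A (int n)).
 homology_map (Tr A (shift P 1)) (int n) (O.op (int n)) (homology_map (Tr A P) (int n) (Tr_map A P th (int n)) z)
 = homology_map (Tr A P) (int (n+1)) (Tr_map A P th (int (n+1))) (connes K A n z))"
 if th: "th : comparison_maps K A P \<mu>" for th
 proof -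
 interpret C: resolution_comparison K A P \<mu> \<Delta> \<phi> \<epsilon> th
 proof
 show "projective_resolution K A P \<mu>" "th : comparison_maps K A P \<mu>" by(rule assms(2), rule th)
 \<comment> \<open>The normalisation of \<Delta> enters here, rewritten as a condition on the left
   counit.\<close>
 show "\<mu> (aug.cl 0 (\<Delta> 0 x)) = \<mu> x" if "x :> obj P 0" for x
 using Du[OF that] aug.augmentation_tensor[OF O.\<Delta>_rules(1)[OF that]] by(simp add: extend_by_zero_def)
 qed
 show ?thesis using C.th_isomorphism C.connes_comparison by(simp only: HH_def) blast
 qed
 show ?thesis unfolding F induces_on_HH_def using G1 G2 ne G3 by blast
qed

end
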